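(* Let $X$ be a compact connected abelian group of finite dimension $d\geqslant 1$ and let $\theta:X\to X$ be an ergodic (continuous group) automorphism. Let $\mathbb{K}_1,\dots,\mathbb{K}_k$ be the algebraic number fields, $\xi_j\in\mathbb{K}_j$ the elements, and $T_j$ the sets of finite places of $\mathbb{K}_j$ attached to $(X,\theta)$ as described in the context. Let $P_j^\infty$ be the set of infinite places of $\mathbb{K}_j$ and let $S_j$ be the set of finite places of $\mathbb{K}_j$ not in $T_j$, so that \[ \mathsf{F}_\theta(n)=\prod_{j=1}^{k}|\xi_j^n-1|_{P_j^\infty\cup S_j}\qquad(n\geqslant 1). \] If the dimension $d$ of $X$ is at most $3$ and this product comprises only finitely many places (that is, every $S_j$ is finite), then $\zeta_\theta$ is rational or has a natural boundary at its circle of convergence.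
   Context: For an automorphism $\theta$ of $X$, $\mathsf{F}_\theta(n)=|\{x\in X:\theta^n x=x\}|$ and $\zeta_\theta(z)=\exp\sum_{n\geqslant 1}\frac{\mathsf{F}_\theta(n)}{n}z^n$. A compact connected abelian group has dimension $d$ if its Pontryagin dual $\widehat X$ is isomorphic to a subgroup of $\mathbb{Q}^d$ of rank $d$. For a number field $\mathbb{K}$ the absolute values $|\cdot|_v$ are normalized so that the Artin product formula holds: $|x|_v=(\text{size of the residue field})^{-\mathrm{ord}_v(x)}$ for finite $v$, the usual absolute value for real $v$, and the square of the usual absolute value for complex $v$. For a set $S$ of places, $|x|_S=\prod_{v\in S}|x|_v$. Attached data. Regard $\widehat X$ as a module over $\mathbb{Z}[t^{\pm1}]$, with $t$ acting as the dual automorphism $\widehat\theta$. Then $\mathbb{Q}\otimes_{\mathbb{Z}}\widehat X$ is a $\mathbb{Q}[t^{\pm1}]$-module of $\mathbb{Q}$-dimension $d$; the fields $\mathbb{K}_1,\dots,\mathbb{K}_k$ are its composition factors $\mathbb{Q}[t^{\pm 1}]/(f_j)$ (listed with multiplicity), and $\xi_j\in\mathbb{K}_j$ is the image of $t$, so $\mathbb{K}_j=\mathbb{Q}(\xi_j)$. By a known theorem (R. Miles), for ergodic $\theta$ no $\xi_j$ is a root of unity, and there are sets $T_j$ of finite places of $\mathbb{K}_j$ with $|\xi_j|_v=1$ for all $v\in T_j$ such that $\mathsf{F}_\theta(n)=\prod_{j=1}^k|\xi_j^n-1|_{T_j}^{-1}$ for all $n\geqslant1$ (in particular these numbers are finite);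 the formula in the claim follows from the Artin product formula. A power series has a natural boundary at its circle of convergence if it has no analytic continuation to any connected open set properly containing its open disc of convergence (equivalently, every point of the circle of convergence is a singularity). *)

theory Defs
  imports
    "HOL-Complex_Analysis.Complex_Analysis"
    "HOL-Algebra.Algebra"
    "HOL-Algebra.Algebraic_Closure_Type"
begin

section \<open>Compact abelian groups and their automorphisms\<close>

definition dual_group :: "('x::topological_ab_group_add \<Rightarrow> complex) monoid" where
  "dual_group =
     \<lparr>carrier = {\<phi>. continuous_on UNIV \<phi> \<and> (\<forall>x. cmod (\<phi> x) = 1) \<and>
                    (\<forall>x y. \<phi> (x + y) = \<phi> x * \<phi> y)},
      monoid.mult = (\<lambda>\<phi> \<psi> x. \<phi> x * \<psi> x), one = (\<lambda>_. 1)\<rparr>"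

definition topological_automorphism :: "('x::topological_ab_group_add \<Rightarrow> 'x) \<Rightarrow> bool" where
  "topological_automorphism \<theta> \<longleftrightarrow>
     homeomorphism UNIV UNIV \<theta> (inv_into UNIV \<theta>) \<and> (\<forall>x y. \<theta> (x + y) = \<theta> x + \<theta> y)"

text \<open>The Haar measure of a compact group, normalized to total mass 1.\<close>

definition haar_measure :: "'x::topological_ab_group_add measure \<Rightarrow> bool" where
  "haar_measure \<mu> \<longleftrightarrow>
     sets \<mu> = sets borel \<and> emeasure \<mu> UNIV = 1 \<and>
     (\<forall>x. \<forall>A\<in>sets borel. emeasure \<mu> ((+) x ` A) = emeasure \<mu> A) \<and>
     (\<forall>A\<in>sets borel. emeasure \<mu> A = (SUP C\<in>{C. compact C \<and> C \<subseteq> A}. emeasure \<mu> C))"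

text \<open>A topological automorphism of a compact group preserves Haar measure, so that
  invariance of the measure is not repeated here.\<close>

definition ergodic :: "'x measure \<Rightarrow> ('x \<Rightarrow> 'x) \<Rightarrow> bool" where
  "ergodic \<mu> \<theta> \<longleftrightarrow>
     (\<forall>A\<in>sets \<mu>. \<theta> -` A = A \<longrightarrow> emeasure \<mu> A = 0 \<or> emeasure \<mu> A = 1)"

definition periodic_points :: "('x \<Rightarrow> 'x) \<Rightarrow> nat \<Rightarrow> 'x set" where
  "periodic_points \<theta> n = {x. (\<theta> ^^ n) x = x}"

definition num_periodic :: "('x \<Rightarrow> 'x) \<Rightarrow> nat \<Rightarrow> nat" where
  "num_periodic \<theta> n = card (periodic_points \<theta> n)"

definition dynamical_zeta :: "('x \<Rightarrow> 'x) \<Rightarrow> complex fps" where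
  "dynamical_zeta \<theta> =
     fps_exp 1 oo
       Abs_fps (\<lambda>n. if n = 0 then 0 else of_nat (num_periodic \<theta> n) / of_nat n)"


section \<open>Rank and dimension\<close>

definition int_independent :: "('a, 'm) monoid_scheme \<Rightarrow> 'a set \<Rightarrow> bool" where
  "int_independent G B \<longleftrightarrow>
     finite B \<and> B \<subseteq> carrier G \<and>
     (\<forall>c :: 'a \<Rightarrow> int. finprod G (\<lambda>b. b [^]\<^bsub>G\<^esub> c b) B = \<one>\<^bsub>G\<^esub> \<longrightarrow> (\<forall>b\<in>B. c b = 0))"

definition has_rank :: "('a, 'm) monoid_scheme \<Rightarrow> nat \<Rightarrow> bool" where
  "has_rank G r \<longleftrightarrow>
     (\<exists>B. int_independent G B \<and> card B = r) \<and>
     (\<forall>B. int_independent G B \<longrightarrow> card B \<le> r)"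

definition rat_group :: "rat monoid" where
  "rat_group = \<lparr>carrier = UNIV, monoid.mult = (+), one = 0\<rparr>"

abbreviation rat_power :: "nat \<Rightarrow> (nat \<Rightarrow> rat) monoid" where
  "rat_power d \<equiv> product_group {..<d} (\<lambda>_. rat_group)"

definition has_dimension :: "'x::topological_ab_group_add itself \<Rightarrow> nat \<Rightarrow> bool" where
  "has_dimension ty d \<longleftrightarrow>
     (\<exists>H. subgroup H (rat_power d) \<and> has_rank (rat_power d\<lparr>carrier := H\<rparr>) d \<and>
          (dual_group :: ('x \<Rightarrow> complex) monoid) \<cong> rat_power d\<lparr>carrier := H\<rparr>)"


section \<open>Modules and composition factors\<close>

text \<open>For modules, the ring fields \<^const>\<open>monoid.mult\<close> and \<^const>\<open>one\<close> of the record
  are irrelevant.\<close>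

definition quot_module :: "('r, 'a, 'm) module_scheme \<Rightarrow> 'a set \<Rightarrow> ('r, 'a set) module" where
  "quot_module M H =
     \<lparr>carrier = a_rcosets\<^bsub>M\<^esub> H, monoid.mult = undefined, one = undefined,
      ring.zero = H, add = set_add M,
      smult = (\<lambda>r C. \<Union>x\<in>C. H +>\<^bsub>M\<^esub> (r \<odot>\<^bsub>M\<^esub> x))\<rparr>"

definition module_isomorphic ::
  "('r, 'c) ring_scheme \<Rightarrow> ('r, 'a, 'm) module_scheme \<Rightarrow> ('r, 'b, 'n) module_scheme \<Rightarrow> bool" where
  "module_isomorphic R M N \<longleftrightarrow>
     (\<exists>h. bij_betw h (carrier M) (carrier N) \<and>
          (\<forall>x\<in>carrier M. \<forall>y\<in>carrier M. h (x \<oplus>\<^bsub>M\<^esub> y) = h x \<oplus>\<^bsub>N\<^esub> h y) \<and>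
          (\<forall>r\<in>carrier R. \<forall>x\<in>carrier M. h (r \<odot>\<^bsub>M\<^esub> x) = r \<odot>\<^bsub>N\<^esub> h x))"

definition composition_series ::
  "('r, 'c) ring_scheme \<Rightarrow> ('r, 'a, 'm) module_scheme \<Rightarrow> nat \<Rightarrow> (nat \<Rightarrow> 'a set) \<Rightarrow> bool" where
  "composition_series R M k W \<longleftrightarrow>
     W 0 = {\<zero>\<^bsub>M\<^esub>} \<and> W k = carrier M \<and>
     (\<forall>i\<le>k. submodule (W i) R M) \<and>
     (\<forall>i<k. W i \<subset> W (Suc i) \<and>
        (\<forall>N. submodule N R M \<and> W i \<subseteq> N \<and> N \<subseteq> W (Suc i) \<longrightarrow> N = W i \<or> N = W (Suc i)))"

definition regular_module :: "('a, 'm) ring_scheme \<Rightarrow> ('a, 'a) module" where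
  "regular_module R =
     \<lparr>carrier = carrier R, monoid.mult = (\<otimes>\<^bsub>R\<^esub>), one = \<one>\<^bsub>R\<^esub>,
      ring.zero = \<zero>\<^bsub>R\<^esub>, add = (\<oplus>\<^bsub>R\<^esub>), smult = (\<otimes>\<^bsub>R\<^esub>)\<rparr>"

text \<open>The composition factors of \<open>M\<close>, with multiplicity and in an arbitrary order, are the
  cyclic modules \<open>R/(f 1), \<dots>, R/(f k)\<close>.\<close>

definition cyclic_composition_factors ::
  "('r, 'c) ring_scheme \<Rightarrow> ('r, 'a, 'm) module_scheme \<Rightarrow> nat \<Rightarrow> (nat \<Rightarrow> 'r) \<Rightarrow> bool" where
  "cyclic_composition_factors R M k f \<longleftrightarrow>
     (\<forall>j\<in>{1..k}. f j \<in> carrier R) \<and>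
     (\<exists>W \<pi>. composition_series R M k W \<and> \<pi> permutes {1..k} \<and>
        (\<forall>i\<in>{1..k}. module_isomorphic R
           (quot_module (M\<lparr>carrier := W i\<rparr>) (W (i - 1)))
           (quot_module (regular_module R) (PIdl\<^bsub>R\<^esub> (f (\<pi> i))))))"


section \<open>The rationalized dual as a module over the Laurent polynomials\<close>

text \<open>The tensor product over the integers of two abelian groups, as the quotient of the free
  abelian group on the pairs by the biadditivity relations.\<close>

definition tensor_relators ::
  "('a, 'm) monoid_scheme \<Rightarrow> ('b, 'n) monoid_scheme \<Rightarrow> (('a \<times> 'b) \<Rightarrow>\<^sub>0 int) set" where
  "tensor_relators A B =
     {frag_of (a \<otimes>\<^bsub>A\<^esub> a', b) - frag_of (a, b) - frag_of (a', b) | a a' b.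
        a \<in> carrier A \<and> a' \<in> carrier A \<and> b \<in> carrier B} \<union>
     {frag_of (a, b \<otimes>\<^bsub>B\<^esub> b') - frag_of (a, b) - frag_of (a, b') | a b b'.
        a \<in> carrier A \<and> b \<in> carrier B \<and> b' \<in> carrier B}"

definition tensor_kernel ::
  "('a, 'm) monoid_scheme \<Rightarrow> ('b, 'n) monoid_scheme \<Rightarrow> (('a \<times> 'b) \<Rightarrow>\<^sub>0 int) set" where
  "tensor_kernel A B =
     generate (free_Abelian_group (carrier A \<times> carrier B)) (tensor_relators A B)"

definition int_tensor ::
  "('a, 'm) monoid_scheme \<Rightarrow> ('b, 'n) monoid_scheme \<Rightarrow> (('a \<times> 'b) \<Rightarrow>\<^sub>0 int) set monoid" where
  "int_tensor A B = free_Abelian_group (carrier A \<times> carrier B) Mod tensor_kernel A B"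

text \<open>Finitely supported functions from the integers to the rationals, with convolution as
  multiplication: the ring of Laurent polynomials in \<open>t\<close>.\<close>

type_synonym laurent = "int \<Rightarrow>\<^sub>0 rat"

abbreviation laurent_ring :: "laurent ring" where
  "laurent_ring \<equiv> ring_of_type_algebra"

definition laurent_t :: laurent where
  "laurent_t = Poly_Mapping.single 1 1"

definition int_iterate :: "('x \<Rightarrow> 'x) \<Rightarrow> int \<Rightarrow> 'x \<Rightarrow> 'x" where
  "int_iterate \<theta> m = (if 0 \<le> m then \<theta> ^^ nat m else inv_into UNIV \<theta> ^^ nat (- m))"

text \<open>The action of \<open>p = \<Sum>\<^sub>m p\<^sub>m t\<^sup>m\<close> on representatives: the pair \<open>(q, \<phi>)\<close> is sent to the sum
  of the \<open>(p\<^sub>m q, \<phi> \<circ> \<theta>\<^sup>m)\<close>.\<close>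

definition laurent_action ::
  "('x \<Rightarrow> 'x) \<Rightarrow> laurent \<Rightarrow> ((rat \<times> ('x \<Rightarrow> complex)) \<Rightarrow>\<^sub>0 int) \<Rightarrow>
     ((rat \<times> ('x \<Rightarrow> complex)) \<Rightarrow>\<^sub>0 int)" where
  "laurent_action \<theta> p =
     frag_extend (\<lambda>(q, \<phi>). \<Sum>m\<in>Poly_Mapping.keys p.
       frag_of (Poly_Mapping.lookup p m * q, \<phi> \<circ> int_iterate \<theta> m))"

definition rational_dual_module ::
  "('x::topological_ab_group_add \<Rightarrow> 'x) \<Rightarrow>
     (laurent, ((rat \<times> ('x \<Rightarrow> complex)) \<Rightarrow>\<^sub>0 int) set) module" where
  "rational_dual_module \<theta> =
     (let F = free_Abelian_group (carrier rat_group \<times> carrier dual_group);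
          V = int_tensor rat_group (dual_group :: ('x \<Rightarrow> complex) monoid);
          N = tensor_kernel rat_group dual_group
      in \<lparr>carrier = carrier V, monoid.mult = undefined, one = undefined,
          ring.zero = \<one>\<^bsub>V\<^esub>, add = (\<otimes>\<^bsub>V\<^esub>),
          smult = (\<lambda>p C. \<Union>u\<in>C. N #>\<^bsub>F\<^esub> laurent_action \<theta> p u)\<rparr>)"

definition factor_field :: "laurent \<Rightarrow> laurent set ring" where
  "factor_field f = laurent_ring Quot (PIdl\<^bsub>laurent_ring\<^esub> f)"

definition factor_elt :: "laurent \<Rightarrow> laurent set" where
  "factor_elt f = PIdl\<^bsub>laurent_ring\<^esub> f +>\<^bsub>laurent_ring\<^esub> laurent_t"


section \<open>Places of a number field\<close>

text \<open>A place is represented by its normalized absolute value, extended by 0 outside the field.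
  The finite places are those of the discrete valuations \<open>ord\<^sub>v\<close> with value group \<open>\<int>\<close>; their
  residue fields are finite since \<open>K\<close> is a number field.\<close>

definition discrete_valuation :: "('a, 'm) ring_scheme \<Rightarrow> ('a \<Rightarrow> int) \<Rightarrow> bool" where
  "discrete_valuation K w \<longleftrightarrow>
     (let U = carrier K - {\<zero>\<^bsub>K\<^esub>} in
        w ` U = UNIV \<and>
        (\<forall>x\<in>U. \<forall>y\<in>U. w (x \<otimes>\<^bsub>K\<^esub> y) = w x + w y) \<and>
        (\<forall>x\<in>U. \<forall>y\<in>U. x \<oplus>\<^bsub>K\<^esub> y \<noteq> \<zero>\<^bsub>K\<^esub> \<longrightarrow> min (w x) (w y) \<le> w (x \<oplus>\<^bsub>K\<^esub> y)))"

definition residue_field :: "('a, 'm) ring_scheme \<Rightarrow> ('a \<Rightarrow> int) \<Rightarrow> 'a set ring" where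
  "residue_field K w =
     K\<lparr>carrier := {x \<in> carrier K. x = \<zero>\<^bsub>K\<^esub> \<or> 0 \<le> w x}\<rparr> Quot
       {x \<in> carrier K. x = \<zero>\<^bsub>K\<^esub> \<or> 0 < w x}"

definition finite_abs :: "('a, 'm) ring_scheme \<Rightarrow> ('a \<Rightarrow> int) \<Rightarrow> 'a \<Rightarrow> real" where
  "finite_abs K w x =
     (if x \<in> carrier K - {\<zero>\<^bsub>K\<^esub>}
      then real (card (carrier (residue_field K w))) powi (- w x) else 0)"

definition finite_places :: "('a, 'm) ring_scheme \<Rightarrow> ('a \<Rightarrow> real) set" where
  "finite_places K = {finite_abs K w | w. discrete_valuation K w}"

definition infinite_abs :: "('a, 'm) ring_scheme \<Rightarrow> ('a \<Rightarrow> complex) \<Rightarrow> 'a \<Rightarrow> real" where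
  "infinite_abs K \<sigma> x =
     (if x \<in> carrier K
      then (if \<sigma> ` carrier K \<subseteq> \<real> then cmod (\<sigma> x) else (cmod (\<sigma> x))\<^sup>2) else 0)"

definition infinite_places :: "('a, 'm) ring_scheme \<Rightarrow> ('a \<Rightarrow> real) set" where
  "infinite_places K =
     {infinite_abs K \<sigma> | \<sigma>. \<sigma> \<in> ring_hom K (ring_of_type_algebra :: complex ring)}"

text \<open>\<open>S\<close> may be infinite; for \<open>x \<noteq> 0\<close> all but finitely many factors are 1.\<close>

definition abs_prod :: "('a \<Rightarrow> real) set \<Rightarrow> 'a \<Rightarrow> real" where
  "abs_prod S x = (\<Prod>v | v \<in> S \<and> v x \<noteq> 1. v x)"

text \<open>The element \<open>\<xi>\<^sub>j\<^sup>n - 1\<close> of \<open>\<bbbK>\<^sub>j\<close>.\<close>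

definition factor_elt_pow_minus_1 :: "laurent \<Rightarrow> nat \<Rightarrow> laurent set" where
  "factor_elt_pow_minus_1 f n =
     (factor_elt f [^]\<^bsub>factor_field f\<^esub> n) \<ominus>\<^bsub>factor_field f\<^esub> \<one>\<^bsub>factor_field f\<^esub>"


section \<open>Rationality and natural boundaries\<close>

definition rational_fps :: "complex fps \<Rightarrow> bool" where
  "rational_fps F \<longleftrightarrow> (\<exists>p q. q \<noteq> 0 \<and> F * fps_of_poly q = fps_of_poly p)"

definition has_natural_boundary :: "complex fps \<Rightarrow> bool" where
  "has_natural_boundary F \<longleftrightarrow>
     0 < fps_conv_radius F \<and> fps_conv_radius F < \<infinity> \<and>
     \<not> (\<exists>U g. open U \<and> connected U \<and> eball 0 (fps_conv_radius F) \<subset> U \<and> g holomorphic_on U \<and>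
           (\<forall>z\<in>eball 0 (fps_conv_radius F). g z = eval_fps F z))"

end

(* Each composition factor is realised inside the complex numbers as Q(xi), and the product formula
   turns the T-part of |xi^n - 1| into the product over the remaining places.  Ergodicity says that a
   character fixed by a power of theta is trivial; since finitely many characters generate everything
   up to torsion, every element of the rationalized dual is killed by some Q(t^n) with Q(1) nonzero.
   Hence xi is not a root of unity.

   If all S_j are finite, then F(n) = L^n D(n) g(n) E(n).  Here D >= 0 is a trigonometric polynomial
   collecting the conjugates on the unit circle, E tends to 1, and g is the product over the finite
   places at which xi is a unit.  Such a place contributes 1 unless n is divisible by some a, and then a
   strictly decreasing function of the exponent of its residue characteristic p in n.  Without such
   places F is an integral combination of exponentials and zeta is rational.  Otherwise there is a
   prime q such that the Abel means of D(n) g(n) w^n do not tend to 0 for primitive q^i-th roots of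
   unity w with i large.  These w/L are dense in the circle of convergence, and zeta'/zeta blows up
   at them at the rate of a simple pole, so a continuation of zeta past the circle would have a
   non-isolated set of zeros. *)
theory Submission
  imports Defs "Jordan_Normal_Form.Char_Poly"
begin

hide_const (open) Polynomials.degree Polynomials.lead_coeff up_ring.coeff up_ring.monom Divisibility.prime

section \<open>Conjugates and norms\<close>

text \<open>A finite place is given only as a function built from some normalized discrete valuation
  on an abstract quotient field. Using the product formula therefore requires a classification of
  these valuations. It comes from the maximal order: index equals norm, nonzero primes are maximal
  and locally invertible, and each valuation belongs to exactly one prime.

  Abel means enter because \<open>(1 - r) * (\<Sum>n. F(n) x^n r^n)\<close> is \<open>1 - r\<close>
  times \<open>z \<zeta>'(z) / \<zeta>(z)\<close> at \<open>z = r x\<close>, hence tends to 0 if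
  \<zeta> continues to \<open>x\<close> with a nonzero value. The obstacle is to exclude that limit:
  a Fourier coefficient of \<open>D(n) g(n)\<close> is a sum over several frequencies of
  \<open>D\<close> and over several places with the same residue characteristic, and its terms might
  cancel. So no coefficient is computed. Instead \<open>g\<close> is compared with its truncation at
  level \<open>i - 1\<close> above \<open>q\<close>. Against \<open>w^n\<close> the truncated
  product has mean 0, while the difference lives on multiples of \<open>q^i\<close>, where
  \<open>w^n = 1\<close>, and has constant sign. Positivity of \<open>D\<close> then bounds its mean
  away from 0.\<close>

abbreviation rpoly :: "rat poly \<Rightarrow> complex \<Rightarrow> complex" where
  "rpoly p x \<equiv> poly (map_poly of_rat p) x"

abbreviation ipoly :: "int poly \<Rightarrow> complex \<Rightarrow> complex" where
  "ipoly p x \<equiv> poly (map_poly of_int p) x"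

interpretation of_rat_poly_hom: map_poly_comm_semiring_hom "of_rat :: rat \<Rightarrow> complex" ..
interpretation of_rat_poly_hom: map_poly_comm_ring_hom "of_rat :: rat \<Rightarrow> complex" ..
interpretation of_rat_poly_hom: map_poly_idom_hom "of_rat :: rat \<Rightarrow> complex" ..

lemma poly_eq_sum_lessThan:
  fixes x :: "'a::comm_semiring_1"
  assumes "degree p < n"
  shows "poly p x = (\<Sum>k<n. coeff p k * x ^ k)"
proof -
  have "(\<Sum>k\<le>degree p. coeff p k * x ^ k) = (\<Sum>k<n. coeff p k * x ^ k)"
    using assms by (intro sum.mono_neutral_left) (auto simp: coeff_eq_0)
  then show ?thesis by (simp add: Polynomial.poly_altdef)
qed

lemma rpoly_of_int [simp]: "rpoly (map_poly of_int p) x = ipoly p x"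
proof -
  have "map_poly of_rat (map_poly of_int p :: rat poly) = (map_poly of_int p :: complex poly)"
    by (intro poly_eqI) (simp add: coeff_map_poly)
  then show ?thesis by simp
qed

text \<open>A kernel vector would list the coefficients of a nonzero polynomial of degree below
  \<open>n\<close> with \<open>n\<close> distinct roots.\<close>

lemma Vandermonde_det_nonzero:
  fixes b :: "nat \<Rightarrow> complex"
  assumes "inj_on b {..<n}"
  shows "Determinant.det (Matrix.mat n n (\<lambda>(i, j). b i ^ j)) \<noteq> 0"
proof
  let ?V = "Matrix.mat n n (\<lambda>(i, j). b i ^ j)"
  assume "Determinant.det ?V = 0"
  then obtain v where v: "v \<in> carrier_vec n" "v \<noteq> 0\<^sub>v n" "?V *\<^sub>v v = 0\<^sub>v n"
    using det_0_iff_vec_prod_zero[of ?V n] by auto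
  define p where "p = (\<Sum>k<n. monom (vec_index v k) k)"
  have co: "coeff p k = (if k < n then vec_index v k else 0)" for k
    by (simp add: p_def coeff_sum)
  have root: "poly p (b i) = 0" if i: "i < n" for i
  proof -
    have "poly p (b i) = (\<Sum>k<n. vec_index v k * b i ^ k)"
      by (simp add: p_def poly_sum poly_monom)
    also have "\<dots> = vec_index (?V *\<^sub>v v) i"
      using i v(1) by (simp add: scalar_prod_def lessThan_atLeast0 mult.commute)
    finally show ?thesis using v(3) i by simp
  qed
  have "n > 0" using v by (cases n) auto
  have "p \<noteq> 0"
  proof
    assume "p = 0"
    then have "vec_index v k = 0" if "k < n" for k
      using co[of k] that by simp
    then show False using v(1,2) by auto
  qed
  have "degree p < n"
    using co \<open>n > 0\<close> by (intro degree_lessI) auto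
  moreover have "n \<le> card {x. poly p x = 0}"
  proof -
    have "b ` {..<n} \<subseteq> {x. poly p x = 0}" using root by auto
    then have "card (b ` {..<n}) \<le> card {x. poly p x = 0}"
      by (intro card_mono poly_roots_finite \<open>p \<noteq> 0\<close>)
    then show ?thesis using assms by (simp add: card_image)
  qed
  moreover have "card {x. poly p x = 0} \<le> degree p"
    using \<open>p \<noteq> 0\<close> by (rule card_poly_roots_bound)
  ultimately show False by simp
qed

text \<open>The field lives inside the complex numbers and is generated by an algebraic integer, so
  that \<open>A\<close> below is an order in it. Minimality is tested against rational polynomials;
  with monicity this makes \<open>f\<close> the minimal polynomial of \<alpha> over the rationals,
  its integrality being part of the data.\<close>

locale number_field =
  fixes f :: "int poly" and \<alpha> :: complex
  assumes monic: "lead_coeff f = 1"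
    and root: "ipoly f \<alpha> = 0"
    and minimal: "\<And>p. rpoly p \<alpha> = 0 \<Longrightarrow> p \<noteq> 0 \<Longrightarrow> degree f \<le> degree p"
begin

abbreviation deg :: nat where "deg \<equiv> degree f"

definition conj :: "complex set" where "conj = {b. ipoly f b = 0}"

definition K :: "complex set" where "K = range (\<lambda>p. rpoly p \<alpha>)"

definition A :: "complex set" where "A = range (\<lambda>p. ipoly p \<alpha>)"

text \<open>The embedding that sends \<alpha> to \<open>b\<close>. For a conjugate \<open>b\<close>
  the polynomial picked for \<open>x\<close> does not matter, by
  \<open>vanishing_conj\<close>.\<close>

definition \<sigma> :: "complex \<Rightarrow> complex \<Rightarrow> complex" where
  "\<sigma> b x = rpoly (SOME p. rpoly p \<alpha> = x) b"

definition nrm :: "complex \<Rightarrow> complex" where "nrm x = (\<Prod>b\<in>conj. \<sigma> b x)"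

lemma f_nonzero: "f \<noteq> 0" using monic by auto

lemma deg_pos: "0 < deg"
proof (rule ccontr)
  assume "\<not> 0 < deg"
  then obtain c where "f = [:c:]" by (auto elim: degree_eq_zeroE)
  then show False using monic root by simp
qed

abbreviation fq :: "rat poly" where "fq \<equiv> map_poly of_int f"

lemma vanishing_dvd:
  assumes "rpoly p \<alpha> = 0" shows "fq dvd p"
proof -
  have "p mod fq = 0"
  proof (rule ccontr)
    assume ne: "p mod fq \<noteq> 0"
    have "rpoly (p div fq * fq + p mod fq) \<alpha> = 0" using assms by (simp only: div_mult_mod_eq)
    then have "rpoly (p mod fq) \<alpha> = 0"
      unfolding of_rat_poly_hom.hom_add of_rat_poly_hom.hom_mult by (simp add: root)
    then have "deg \<le> degree (p mod fq)" using minimal ne by blast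
    moreover have "degree (p mod fq) < degree fq"
      using ne f_nonzero by (intro degree_mod_less') auto
    ultimately show False by simp
  qed
  then show ?thesis by auto
qed

lemma \<alpha>_in_conj: "\<alpha> \<in> conj" by (simp add: conj_def root)

lemma vanishing_conj:
  assumes "rpoly p \<alpha> = 0" "b \<in> conj" shows "rpoly p b = 0"
proof -
  obtain q where "p = fq * q" using vanishing_dvd[OF assms(1)] by auto
  then show ?thesis using assms(2) by (simp add: of_rat_poly_hom.hom_mult conj_def)
qed

lemma \<sigma>_rpoly: "b \<in> conj \<Longrightarrow> \<sigma> b (rpoly p \<alpha>) = rpoly p b"
proof -
  assume b: "b \<in> conj"
  define q where "q = (SOME q. rpoly q \<alpha> = rpoly p \<alpha>)"
  have "rpoly q \<alpha> = rpoly p \<alpha>" unfolding q_def by (rule someI) simp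
  then have "rpoly (q - p) \<alpha> = 0" by (simp add: of_rat_poly_hom.hom_minus)
  then have "rpoly (q - p) b = 0" using b vanishing_conj by blast
  then show ?thesis by (simp add: of_rat_poly_hom.hom_minus \<sigma>_def q_def)
qed

lemma \<sigma>_ipoly: "b \<in> conj \<Longrightarrow> \<sigma> b (ipoly p \<alpha>) = ipoly p b"
  using \<sigma>_rpoly[of b "map_poly of_int p"] by simp

lemma K_E: assumes "x \<in> K" obtains p where "x = rpoly p \<alpha>"
  using assms by (auto simp: K_def)

lemma K_rpoly [simp]: "rpoly p \<alpha> \<in> K" by (auto simp: K_def)

lemma K_add [simp]: "x \<in> K \<Longrightarrow> y \<in> K \<Longrightarrow> x + y \<in> K"
  by (auto elim!: K_E simp flip: poly_add of_rat_poly_hom.hom_add)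
lemma K_mult [simp]: "x \<in> K \<Longrightarrow> y \<in> K \<Longrightarrow> x * y \<in> K"
  by (auto elim!: K_E simp flip: poly_mult of_rat_poly_hom.hom_mult)
lemma K_uminus [simp]: "x \<in> K \<Longrightarrow> - x \<in> K"
  by (auto elim!: K_E simp flip: poly_minus of_rat_poly_hom.hom_uminus)
lemma K_diff [simp]: "x \<in> K \<Longrightarrow> y \<in> K \<Longrightarrow> x - y \<in> K"
  by (auto elim!: K_E simp flip: poly_diff of_rat_poly_hom.hom_minus)
lemma K_of_rat [simp]: "of_rat q \<in> K"
  using K_rpoly[of "[:q:]"] by (simp add: of_rat_hom.map_poly_pCons_hom)
lemma K_0 [simp]: "0 \<in> K" and K_1 [simp]: "1 \<in> K" and K_of_int [simp]: "of_int k \<in> K"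
  and K_of_nat [simp]: "of_nat m \<in> K"
  using K_of_rat[of 0] K_of_rat[of 1] K_of_rat[of "of_int k"] K_of_rat[of "of_nat m"] by simp_all
lemma K_power [simp]: "x \<in> K \<Longrightarrow> x ^ m \<in> K" by (induction m) auto

lemma \<alpha>_in_K [simp]: "\<alpha> \<in> K"
  using K_rpoly[of "[:0, 1:]"] by simp

lemma K_sum [simp]: "(\<And>i. i \<in> I \<Longrightarrow> g i \<in> K) \<Longrightarrow> sum g I \<in> K"
  by (induction I rule: infinite_finite_induct) auto

lemma \<sigma>_add: "b \<in> conj \<Longrightarrow> x \<in> K \<Longrightarrow> y \<in> K \<Longrightarrow> \<sigma> b (x + y) = \<sigma> b x + \<sigma> b y"
  by (auto elim!: K_E simp: \<sigma>_rpoly simp flip: poly_add of_rat_poly_hom.hom_add)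
lemma \<sigma>_mult: "b \<in> conj \<Longrightarrow> x \<in> K \<Longrightarrow> y \<in> K \<Longrightarrow> \<sigma> b (x * y) = \<sigma> b x * \<sigma> b y"
  by (auto elim!: K_E simp: \<sigma>_rpoly simp flip: poly_mult of_rat_poly_hom.hom_mult)
lemma \<sigma>_diff: "b \<in> conj \<Longrightarrow> x \<in> K \<Longrightarrow> y \<in> K \<Longrightarrow> \<sigma> b (x - y) = \<sigma> b x - \<sigma> b y"
  by (auto elim!: K_E simp: \<sigma>_rpoly simp flip: poly_diff of_rat_poly_hom.hom_minus)
lemma \<sigma>_of_rat: "b \<in> conj \<Longrightarrow> \<sigma> b (of_rat q) = of_rat q"
  using \<sigma>_rpoly[of b "[:q:]"] by (simp add: of_rat_hom.map_poly_pCons_hom)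
lemma \<sigma>_0: "b \<in> conj \<Longrightarrow> \<sigma> b 0 = 0" and \<sigma>_1: "b \<in> conj \<Longrightarrow> \<sigma> b 1 = 1"
  and \<sigma>_of_int: "b \<in> conj \<Longrightarrow> \<sigma> b (of_int k) = of_int k"
  and \<sigma>_of_nat: "b \<in> conj \<Longrightarrow> \<sigma> b (of_nat m) = of_nat m"
  using \<sigma>_of_rat[of b 0] \<sigma>_of_rat[of b 1] \<sigma>_of_rat[of b "of_int k"] \<sigma>_of_rat[of b "of_nat m"]
  by simp_all
lemma \<sigma>_\<alpha>: "b \<in> conj \<Longrightarrow> \<sigma> b \<alpha> = b"
  using \<sigma>_rpoly[of b "[:0, 1:]"] by simp
lemma \<sigma>_power: "b \<in> conj \<Longrightarrow> x \<in> K \<Longrightarrow> \<sigma> b (x ^ m) = \<sigma> b x ^ m"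
  by (induction m) (auto simp: \<sigma>_1 \<sigma>_mult)

text \<open>This is irreducibility of \<open>fq\<close>: of two complementary factors one vanishes
  at \<alpha>, and minimality then gives it the full degree.\<close>

lemma coprime_if_not_dvd:
  assumes "\<not> fq dvd p" shows "coprime fq p"
proof (rule coprimeI)
  fix d assume d: "d dvd fq" "d dvd p"
  then obtain e where e: "fq = d * e" by auto
  have nz: "d \<noteq> 0" "e \<noteq> 0" using e f_nonzero by auto
  have dege: "degree d + degree e = deg" using nz degree_mult_eq[of d e] by (simp flip: e)
  have "rpoly (d * e) \<alpha> = 0" by (simp add: root flip: e)
  then have "rpoly d \<alpha> = 0 \<or> rpoly e \<alpha> = 0"
    by (simp add: of_rat_poly_hom.hom_mult)
  then show "is_unit d"
  proof
    assume "rpoly e \<alpha> = 0"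
    then have "deg \<le> degree e" using minimal nz by blast
    then show ?thesis using dege nz by (simp add: is_unit_iff_degree)
  next
    assume "rpoly d \<alpha> = 0"
    then have "fq dvd d" by (rule vanishing_dvd)
    then show ?thesis using d(2) assms dvd_trans by blast
  qed
qed

lemma K_inverse [simp]: assumes "x \<in> K" shows "inverse x \<in> K"
proof (cases "x = 0")
  case False
  obtain p where p: "x = rpoly p \<alpha>" using assms by (rule K_E)
  have "\<not> fq dvd p"
  proof
    assume "fq dvd p"
    then obtain q where "p = fq * q" by auto
    then show False using False p by (simp add: of_rat_poly_hom.hom_mult root)
  qed
  then have "coprime fq p" by (rule coprime_if_not_dvd)
  then obtain u v where "u * fq + v * p = 1"
    by (metis bezout_coefficients_fst_snd coprime_imp_gcd_eq_1)
  then have "rpoly (u * fq + v * p) \<alpha> = 1" by simp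
  then have "rpoly v \<alpha> * x = 1"
    by (simp add: of_rat_poly_hom.hom_mult of_rat_poly_hom.hom_add root p)
  then have "inverse x = rpoly v \<alpha>" using False by (simp add: field_simps)
  then show ?thesis by simp
qed auto

lemma K_divide [simp]: "x \<in> K \<Longrightarrow> y \<in> K \<Longrightarrow> x / y \<in> K"
  by (simp add: divide_inverse)

lemma K_powi [simp]: "x \<in> K \<Longrightarrow> x powi m \<in> K"
  by (simp add: power_int_def)

lemma \<sigma>_nonzero: assumes "b \<in> conj" "x \<in> K" "x \<noteq> 0" shows "\<sigma> b x \<noteq> 0"
proof -
  have "\<sigma> b x * \<sigma> b (inverse x) = \<sigma> b (x * inverse x)"
    using assms by (subst \<sigma>_mult) auto
  then show ?thesis using assms by (auto simp: \<sigma>_1)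
qed

lemma finite_conj: "finite conj"
  unfolding conj_def using f_nonzero by (intro poly_roots_finite) auto

text \<open>Characteristic 0 makes the derivative nonzero, and its lower degree makes it prime to
  \<open>fq\<close>; so no conjugate is a double root.\<close>

lemma card_conj: "card conj = deg"
proof -
  let ?F = "map_poly of_int f :: complex poly"
  have der: "map_poly of_rat (pderiv fq) = pderiv ?F"
    by (intro poly_eqI) (simp add: coeff_pderiv coeff_map_poly of_rat_mult of_rat_add)
  have "rsquarefree ?F"
    unfolding rsquarefree_roots
  proof (intro allI notI)
    fix b assume b: "poly ?F b = 0 \<and> poly (pderiv ?F) b = 0"
    have "pderiv fq \<noteq> 0" using deg_pos by (simp add: pderiv_eq_0_iff)
    then have "\<not> fq dvd pderiv fq"
      using deg_pos by (auto dest: dvd_imp_degree_le simp: degree_pderiv)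
    then have "coprime fq (pderiv fq)" by (rule coprime_if_not_dvd)
    then obtain u v where "u * fq + v * pderiv fq = 1"
      by (metis bezout_coefficients_fst_snd coprime_imp_gcd_eq_1)
    then have "rpoly (u * fq + v * pderiv fq) b = 1" by simp
    then show False
      using b by (simp add: of_rat_poly_hom.hom_mult of_rat_poly_hom.hom_add der)
  qed
  then show ?thesis
    using rsquarefree_card_degree[of ?F] f_nonzero by (simp add: conj_def)
qed

lemma nrm_mult: "x \<in> K \<Longrightarrow> y \<in> K \<Longrightarrow> nrm (x * y) = nrm x * nrm y"
  by (simp add: nrm_def \<sigma>_mult prod.distrib)
lemma nrm_of_nat: "nrm (of_nat m) = of_nat m ^ deg"
  by (simp add: nrm_def \<sigma>_of_nat card_conj)
lemma nrm_1: "nrm 1 = 1" using nrm_of_nat[of 1] by simp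
lemma nrm_nonzero: "x \<in> K \<Longrightarrow> x \<noteq> 0 \<Longrightarrow> nrm x \<noteq> 0"
  using finite_conj by (simp add: nrm_def \<sigma>_nonzero)
lemma nrm_power: "x \<in> K \<Longrightarrow> nrm (x ^ m) = nrm x ^ m"
  by (induction m) (auto simp: nrm_1 nrm_mult)

lemma coordinates:
  assumes "x \<in> K"
  obtains c where "x = (\<Sum>i<deg. of_rat (c i) * \<alpha> ^ i)"
proof -
  obtain p where p: "x = rpoly p \<alpha>" using assms by (rule K_E)
  have "rpoly (p div fq * fq + p mod fq) \<alpha> = x" using p by (simp only: div_mult_mod_eq)
  then have x: "x = rpoly (p mod fq) \<alpha>"
    unfolding of_rat_poly_hom.hom_add of_rat_poly_hom.hom_mult by (simp add: root)
  have "degree (p mod fq) < deg"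
    using degree_mod_less[of fq p] f_nonzero deg_pos by auto
  then have "x = (\<Sum>i<deg. of_rat (coeff (p mod fq) i) * \<alpha> ^ i)"
    unfolding x by (subst poly_eq_sum_lessThan[where n = deg]) auto
  then show ?thesis by (rule that)
qed

lemma independent:
  assumes "(\<Sum>i<deg. of_rat (c i) * \<alpha> ^ i) = 0" "i < deg"
  shows "c i = 0"
proof -
  define p where "p = (\<Sum>i<deg. monom (c i) i)"
  have co: "coeff p k = (if k < deg then c k else 0)" for k
    by (simp add: p_def coeff_sum)
  have dp: "degree p < deg" using co deg_pos by (intro degree_lessI) auto
  then have "rpoly p \<alpha> = 0"
    using assms by (subst poly_eq_sum_lessThan[where n = deg]) (auto simp: co)
  then have "p = 0" using minimal dp by fastforce
  then show ?thesis using co[of i] assms(2) by simp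
qed

lemma A_sub_K: "A \<subseteq> K" using rpoly_of_int unfolding A_def K_def by (metis image_subsetI rangeI)
lemma A_ipoly [simp]: "ipoly p \<alpha> \<in> A" by (auto simp: A_def)
lemma A_E: assumes "x \<in> A" obtains p where "x = ipoly p \<alpha>"
  using assms by (auto simp: A_def)
lemma A_add [simp]: "x \<in> A \<Longrightarrow> y \<in> A \<Longrightarrow> x + y \<in> A"
  by (auto elim!: A_E simp flip: poly_add of_int_poly_hom.hom_add)
lemma A_mult [simp]: "x \<in> A \<Longrightarrow> y \<in> A \<Longrightarrow> x * y \<in> A"
  by (auto elim!: A_E simp flip: poly_mult of_int_poly_hom.hom_mult)
lemma A_uminus [simp]: "x \<in> A \<Longrightarrow> - x \<in> A"
  by (auto elim!: A_E simp flip: poly_minus of_int_poly_hom.hom_uminus)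
lemma A_diff [simp]: "x \<in> A \<Longrightarrow> y \<in> A \<Longrightarrow> x - y \<in> A"
  by (auto elim!: A_E simp flip: poly_diff of_int_poly_hom.hom_minus)
lemma A_of_int [simp]: "of_int k \<in> A"
  using A_ipoly[of "[:k:]"] by (simp add: of_int_hom.map_poly_pCons_hom)
lemma A_0 [simp]: "0 \<in> A" and A_1 [simp]: "1 \<in> A" and A_of_nat [simp]: "of_nat m \<in> A"
  using A_of_int[of 0] A_of_int[of 1] A_of_int[of "of_nat m"] by simp_all
lemma A_power [simp]: "x \<in> A \<Longrightarrow> x ^ m \<in> A" by (induction m) auto
lemma A_\<alpha> [simp]: "\<alpha> \<in> A" using A_ipoly[of "[:0, 1:]"] by simp
lemma A_sum [simp]: "(\<And>i. i \<in> I \<Longrightarrow> g i \<in> A) \<Longrightarrow> sum g I \<in> A"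
  by (induction I rule: infinite_finite_induct) auto

text \<open>Pseudo-division scales the dividend by a power of the leading coefficient, which is 1
  here, so the division stays integral. Agreement at all conjugates at once is what the matrix
  argument for norms consumes.\<close>

lemma int_poly_reduce:
  obtains r where "degree r < deg" "\<And>b. b \<in> conj \<Longrightarrow> ipoly r b = ipoly p b"
proof -
  obtain q r where qr: "pseudo_divmod p f = (q, r)" by force
  from pseudo_divmod[OF f_nonzero qr] monic
  have eq: "p = f * q + r" and "r = 0 \<or> degree r < deg" by auto
  then have "degree r < deg" using deg_pos by auto
  moreover have "ipoly r b = ipoly p b" if "b \<in> conj" for b
    using that by (simp add: eq of_int_poly_hom.hom_add of_int_poly_hom.hom_mult conj_def)
  ultimately show ?thesis by (rule that)
qed

lemma A_coordinates:
  assumes "x \<in> A"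
  obtains c :: "nat \<Rightarrow> int" where "x = (\<Sum>i<deg. of_int (c i) * \<alpha> ^ i)"
proof -
  obtain p where p: "x = ipoly p \<alpha>" using assms by (rule A_E)
  obtain r where r: "degree r < deg" "\<And>b. b \<in> conj \<Longrightarrow> ipoly r b = ipoly p b"
    using int_poly_reduce[of p] by blast
  have "x = ipoly r \<alpha>" using r(2) \<alpha>_in_conj p by simp
  then have "x = (\<Sum>i<deg. of_int (coeff r i) * \<alpha> ^ i)"
    using r(1) by (subst (asm) poly_eq_sum_lessThan[where n = deg]) auto
  then show ?thesis by (rule that)
qed

text \<open>Multiplication by \<open>x\<close> has an integral matrix \<open>M\<close> in the power basis, and the Vandermonde
  matrix of the conjugates diagonalizes it.\<close>

lemma nrm_A_int:
  assumes "x \<in> A" shows "\<exists>m::int. nrm x = of_int m"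
proof -
  obtain p where p: "x = ipoly p \<alpha>" using assms by (rule A_E)
  have "\<forall>j. \<exists>r. degree r < deg \<and> (\<forall>b\<in>conj. ipoly r b = ipoly (p * monom 1 j) b)"
    using int_poly_reduce by metis
  then obtain R where R: "\<And>j. degree (R j) < deg"
      "\<And>j b. b \<in> conj \<Longrightarrow> ipoly (R j) b = ipoly (p * monom 1 j) b" by metis
  obtain b where b: "bij_betw b {..<deg} conj"
    using ex_bij_betw_nat_finite[OF finite_conj] card_conj by (auto simp: lessThan_atLeast0)
  define V where "V = Matrix.mat deg deg (\<lambda>(i, j). b i ^ j)"
  define M where "M = Matrix.mat deg deg (\<lambda>(i, j). coeff (R j) i)"
  define M' where "M' = map_mat complex_of_int M"
  define D where "D = Matrix.mat deg deg (\<lambda>(i, j). if i = j then ipoly p (b i) else 0)"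
  have carr: "V \<in> carrier_mat deg deg" "M' \<in> carrier_mat deg deg" "D \<in> carrier_mat deg deg"
    by (auto simp: V_def M_def M'_def D_def)
  \<comment> \<open>Entry \<open>(i, j)\<close> of either product is the value of
    \<open>p * X^j\<close> at \<open>b i\<close>; on the left this polynomial has first been reduced
    below degree \<open>deg\<close>.\<close>
  have "V * M' = D * V"
  proof (rule eq_matI)
    fix i j assume "i < dim_row (D * V)" "j < dim_col (D * V)"
    then have ij: "i < deg" "j < deg" using carr by auto
    then have bi: "b i \<in> conj" using b by (auto simp: bij_betw_def)
    have "index_mat (V * M') (i, j) = (\<Sum>k<deg. b i ^ k * of_int (coeff (R j) k))"
      using ij by (simp add: V_def M_def M'_def scalar_prod_def lessThan_atLeast0)
    also have "\<dots> = ipoly (R j) (b i)"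
      using R(1)[of j] by (subst poly_eq_sum_lessThan[where n = deg]) (auto simp: mult.commute)
    also have "\<dots> = ipoly p (b i) * b i ^ j"
      using R(2)[OF bi] by (simp add: of_int_poly_hom.hom_mult poly_monom)
    also have "\<dots> = (\<Sum>k<deg. if k = i then ipoly p (b i) * b k ^ j else 0)"
      using ij by (subst sum.delta) auto
    also have "\<dots> = (\<Sum>k<deg. (if i = k then ipoly p (b i) else 0) * b k ^ j)"
      by (intro sum.cong) auto
    also have "\<dots> = index_mat (D * V) (i, j)"
      using ij by (simp add: V_def D_def scalar_prod_def lessThan_atLeast0)
    finally show "index_mat (V * M') (i, j) = index_mat (D * V) (i, j)" .
  qed (use carr in auto)
  then have "Determinant.det V * Determinant.det M' = Determinant.det D * Determinant.det V"
    using det_mult[OF carr(1,2)] det_mult[OF carr(3,1)] by metis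
  moreover have "Determinant.det V \<noteq> 0"
    unfolding V_def using b by (intro Vandermonde_det_nonzero) (auto simp: bij_betw_def)
  ultimately have "Determinant.det D = Determinant.det M'"
    by (simp add: mult.commute)
  also have "\<dots> = of_int (Determinant.det M)" unfolding M'_def by simp
  finally have int: "Determinant.det D = of_int (Determinant.det M)" .
  have "Determinant.det D = prod_list (diag_mat D)"
    using carr by (intro det_upper_triangular) (auto simp: D_def)
  also have "\<dots> = (\<Prod>i<deg. ipoly p (b i))"
    by (simp add: prod_list_diag_prod D_def lessThan_atLeast0)
  also have "\<dots> = (\<Prod>z\<in>conj. ipoly p z)"
    by (rule prod.reindex_bij_betw[OF b])
  also have "\<dots> = nrm x"
    by (simp add: nrm_def p \<sigma>_ipoly)
  finally show ?thesis using int by metis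
qed

lemma nrm_A_ge_1: assumes "x \<in> A" "x \<noteq> 0" shows "cmod (nrm x) \<ge> 1"
proof -
  obtain m where m: "nrm x = of_int m" using nrm_A_int assms by blast
  moreover have "m \<noteq> 0" using nrm_nonzero assms A_sub_K m by fastforce
  ultimately show ?thesis by simp
qed

end

section \<open>Index and norm\<close>

definition add_subgroup :: "'a::ab_group_add set \<Rightarrow> bool" where
  "add_subgroup H \<longleftrightarrow> 0 \<in> H \<and> (\<forall>x\<in>H. \<forall>y\<in>H. x - y \<in> H)"

text \<open>Plain subsets stand for groups because the same subgroup is viewed inside several larger
  ones: orders, fractional ideals, valuation rings.\<close>

definition cosets :: "'a::ab_group_add set \<Rightarrow> 'a set \<Rightarrow> 'a set set" where
  "cosets G H = (\<lambda>x. (+) x ` H) ` G"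

lemma add_subgroupI: "0 \<in> H \<Longrightarrow> (\<And>x y. x \<in> H \<Longrightarrow> y \<in> H \<Longrightarrow> x - y \<in> H) \<Longrightarrow> add_subgroup H"
  by (simp add: add_subgroup_def)

lemma add_subgroup_closed:
  assumes "add_subgroup H"
  shows "0 \<in> H" "x \<in> H \<Longrightarrow> y \<in> H \<Longrightarrow> x - y \<in> H" "x \<in> H \<Longrightarrow> - x \<in> H"
    "x \<in> H \<Longrightarrow> y \<in> H \<Longrightarrow> x + y \<in> H"
proof -
  show 0: "0 \<in> H" and d: "x \<in> H \<Longrightarrow> y \<in> H \<Longrightarrow> x - y \<in> H" for x y
    using assms by (auto simp: add_subgroup_def)
  show m: "x \<in> H \<Longrightarrow> - x \<in> H" for x using d[of 0 x] 0 by simp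
  show "x \<in> H \<Longrightarrow> y \<in> H \<Longrightarrow> x + y \<in> H" using d[of x "- y"] m by simp
qed

lemma coset_eq_iff:
  assumes "add_subgroup H"
  shows "(+) x ` H = (+) y ` H \<longleftrightarrow> x - y \<in> H"
proof
  assume "(+) x ` H = (+) y ` H"
  moreover have "x \<in> (+) x ` H" using add_subgroup_closed(1)[OF assms] by (auto intro: image_eqI[of _ _ 0])
  ultimately show "x - y \<in> H" by auto
next
  assume h: "x - y \<in> H"
  have "(+) x ` H \<subseteq> (+) y ` H" if "x - y \<in> H" for x y
  proof
    fix z assume "z \<in> (+) x ` H"
    then obtain u where u: "u \<in> H" "z = x + u" by auto
    then have "z = y + ((x - y) + u)" "(x - y) + u \<in> H"
      using that add_subgroup_closed[OF assms] by auto
    then show "z \<in> (+) y ` H" by blast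
  qed
  moreover have "y - x \<in> H" using add_subgroup_closed(3)[OF assms h] by simp
  ultimately show "(+) x ` H = (+) y ` H" using h by blast
qed

text \<open>Finiteness and the bound come together from finite sets of pairwise incongruent
  elements, so that a pigeonhole argument on representatives suffices.\<close>

lemma card_cosets_bound:
  assumes H: "add_subgroup H"
    and bd: "\<And>B. finite B \<Longrightarrow> B \<subseteq> G \<Longrightarrow> (\<And>x y. x \<in> B \<Longrightarrow> y \<in> B \<Longrightarrow> x - y \<in> H \<Longrightarrow> x = y) \<Longrightarrow> card B \<le> m"
  shows "finite (cosets G H) \<and> card (cosets G H) \<le> m"
proof (rule finite_if_finite_subsets_card_bdd)
  fix F assume F: "F \<subseteq> cosets G H" "finite F"
  then obtain B where B: "B \<subseteq> G" "inj_on (\<lambda>x. (+) x ` H) B" "F = (\<lambda>x. (+) x ` H) ` B"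
    unfolding cosets_def using subset_image_inj by metis
  have "finite B" using B F finite_imageD by blast
  moreover have "x = y" if "x \<in> B" "y \<in> B" "x - y \<in> H" for x y
    using that B(2) coset_eq_iff[OF H] by (metis inj_onD)
  ultimately have "card B \<le> m" using bd B(1) by blast
  then show "card F \<le> m" using B by (simp add: card_image)
qed

text \<open>Among the multiples \<open>0 x, ..., N x\<close> two are congruent, so some
  \<open>j x\<close> with \<open>1 \<le> j \<le> N\<close> lies in \<open>H\<close>; the factorial
  of \<open>N\<close> is a multiple of every such \<open>j\<close> and serves all \<open>x\<close>
  at once.\<close>

lemma cosets_torsion:
  fixes G H :: "complex set"
  assumes H: "add_subgroup H" and G: "add_subgroup G" and fin: "finite (cosets G H)"
  shows "\<exists>m\<ge>1. \<forall>x\<in>G. of_nat m * x \<in> H"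
proof -
  define N where "N = card (cosets G H)"
  have nG: "of_nat j * x \<in> G" if "x \<in> G" for j x
    by (induction j) (use add_subgroup_closed[OF G] that in \<open>auto simp: algebra_simps\<close>)
  have nH: "of_nat j * x \<in> H" if "x \<in> H" for j x
    by (induction j) (use add_subgroup_closed[OF H] that in \<open>auto simp: algebra_simps\<close>)
  have "of_nat (fact N) * x \<in> H" if x: "x \<in> G" for x
  proof -
    let ?g = "\<lambda>j::nat. (+) (of_nat j * x) ` H"
    have "?g ` {0..N} \<subseteq> cosets G H" using nG[OF x] by (auto simp: cosets_def)
    then have "card (?g ` {0..N}) \<le> N" unfolding N_def using fin by (rule card_mono[rotated])
    then have "\<not> inj_on ?g {0..N}" by (intro pigeonhole) simp
    then obtain i j where ij: "i \<le> N" "j \<le> N" "i \<noteq> j" "?g i = ?g j"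
      by (auto simp: inj_on_def)
    have *: "of_nat (fact N) * x \<in> H" if "i < j" "j \<le> N" "?g i = ?g j" for i j :: nat
    proof -
      have "of_nat j * x - of_nat i * x \<in> H" using that(3) coset_eq_iff[OF H] by metis
      then have h: "of_nat (j - i) * x \<in> H" using that(1) by (simp add: of_nat_diff algebra_simps)
      have "(j - i) dvd fact N" using that by (intro dvd_fact) auto
      then obtain q where "fact N = (j - i) * q" by (rule dvdE)
      then have "of_nat (fact N) * x = of_nat q * (of_nat (j - i) * x)"
        by (metis mult.assoc mult.commute of_nat_mult)
      then show ?thesis using nH[OF h] by (simp only:)
    qed
    show ?thesis
      using *[of i j] *[of j i] ij by (metis linorder_neqE_nat)
  qed
  then show ?thesis using fact_ge_1[of N] by blast
qed

text \<open>Sums of elements of a transversal of \<open>H\<close> in \<open>G\<close> and of one of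
  \<open>L\<close> in \<open>H\<close> form a transversal of \<open>L\<close> in
  \<open>G\<close>.\<close>

lemma card_cosets_mult:
  assumes L: "add_subgroup L" and H: "add_subgroup H" and G: "add_subgroup G"
    and sub: "L \<subseteq> H" "H \<subseteq> G" and fin: "finite (cosets G L)"
  shows "finite (cosets G H)" "finite (cosets H L)"
    "card (cosets G L) = card (cosets G H) * card (cosets H L)"
proof -
  show fHL: "finite (cosets H L)"
    by (rule finite_subset[OF _ fin]) (use sub in \<open>auto simp: cosets_def\<close>)
  obtain B where B: "B \<subseteq> G" "inj_on (\<lambda>x. (+) x ` H) B" "(\<lambda>x. (+) x ` H) ` G = (\<lambda>x. (+) x ` H) ` B"
    using subset_image_inj[of "(\<lambda>x. (+) x ` H) ` G" "\<lambda>x. (+) x ` H" G] by auto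
  obtain C where C: "C \<subseteq> H" "inj_on (\<lambda>x. (+) x ` L) C" "(\<lambda>x. (+) x ` L) ` H = (\<lambda>x. (+) x ` L) ` C"
    using subset_image_inj[of "(\<lambda>x. (+) x ` L) ` H" "\<lambda>x. (+) x ` L" H] by auto
  have "bij_betw (\<lambda>(b, c). (+) (b + c) ` L) (B \<times> C) (cosets G L)"
  proof (rule bij_betwI')
    fix p q assume pq: "p \<in> B \<times> C" "q \<in> B \<times> C"
    obtain b c b' c' where [simp]: "p = (b, c)" "q = (b', c')" by (cases p, cases q)
    show "((case p of (b, c) \<Rightarrow> (+) (b + c) ` L) = (case q of (b, c) \<Rightarrow> (+) (b + c) ` L)) = (p = q)"
    proof
      assume "(case p of (b, c) \<Rightarrow> (+) (b + c) ` L) = (case q of (b, c) \<Rightarrow> (+) (b + c) ` L)"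
      then have l: "b + c - (b' + c') \<in> L" using coset_eq_iff[OF L] by simp
      have "c' - c \<in> H" using pq C(1) add_subgroup_closed(2)[OF H] by auto
      moreover have "b - b' = (b + c - (b' + c')) + (c' - c)" by simp
      ultimately have "b - b' \<in> H" using l sub(1) add_subgroup_closed(4)[OF H] by (metis subsetD)
      then have b: "b = b'" using pq B(2) coset_eq_iff[OF H] by (auto simp: inj_on_def)
      then have "c - c' \<in> L" using l by simp
      then have "c = c'" using pq C(2) coset_eq_iff[OF L] by (auto simp: inj_on_def)
      then show "p = q" using b by simp
    qed auto
  next
    fix p assume "p \<in> B \<times> C"
    then show "(case p of (b, c) \<Rightarrow> (+) (b + c) ` L) \<in> cosets G L"
      using B(1) C(1) sub add_subgroup_closed(4)[OF G] unfolding cosets_def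
      by (cases p) (auto intro!: imageI dest!: subsetD[OF B(1)] subsetD[OF C(1)] subsetD[OF sub(2)])
  next
    fix Y assume "Y \<in> cosets G L"
    then obtain x where x: "x \<in> G" "Y = (+) x ` L" by (auto simp: cosets_def)
    from imageI[OF x(1), of "\<lambda>x. (+) x ` H"]
    obtain b where b: "b \<in> B" "(+) x ` H = (+) b ` H" unfolding B(3) by (elim imageE)
    have "x - b \<in> H" using b(2) coset_eq_iff[OF H] by metis
    from imageI[OF this, of "\<lambda>x. (+) x ` L"]
    obtain c where c: "c \<in> C" "(+) (x - b) ` L = (+) c ` L" unfolding C(3) by (elim imageE)
    have "x - b - c \<in> L" using c(2) coset_eq_iff[OF L] by metis
    then have "x - (b + c) \<in> L" by (simp add: diff_diff_add)
    then have "(+) x ` L = (+) (b + c) ` L" using coset_eq_iff[OF L] by metis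
    then show "\<exists>p\<in>B \<times> C. Y = (case p of (b, c) \<Rightarrow> (+) (b + c) ` L)"
      using x b c by (intro bexI[of _ "(b, c)"]) auto
  qed
  then have bij: "card (B \<times> C) = card (cosets G L)" "finite (B \<times> C)"
    using fin by (auto simp: bij_betw_same_card bij_betw_finite)
  have cB: "card B = card (cosets G H)" and cC: "card C = card (cosets H L)"
    using B C by (simp_all add: cosets_def card_image)
  show "card (cosets G L) = card (cosets G H) * card (cosets H L)"
    using bij by (simp add: card_cartesian_product cB cC)
  have "C \<noteq> {}" using C(3) add_subgroup_closed(1)[OF H] by auto
  then have "finite B" using bij(2) finite_cartesian_productD1 by blast
  then show "finite (cosets G H)" unfolding cosets_def using B(3) by simp
qed

lemma cosets_scale:
  fixes x :: complex assumes x: "x \<noteq> 0"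
  shows "finite (cosets ((*) x ` G) ((*) x ` H)) = finite (cosets G H)"
    "card (cosets ((*) x ` G) ((*) x ` H)) = card (cosets G H)"
proof -
  have eq: "cosets ((*) x ` G) ((*) x ` H) = (`) ((*) x) ` cosets G H"
    unfolding cosets_def image_image by (intro image_cong refl) (simp add: image_image algebra_simps)
  have "inj_on ((`) ((*) x)) (cosets G H)"
    using x by (intro inj_on_image) (auto simp: inj_on_def)
  then show "finite (cosets ((*) x ` G) ((*) x ` H)) = finite (cosets G H)"
    "card (cosets ((*) x ` G) ((*) x ` H)) = card (cosets G H)"
    unfolding eq by (auto simp: card_image finite_image_iff)
qed

text \<open>Otherwise the powers of \<open>a / b\<close> would outgrow \<open>c\<close>. Index and
  norm are both multiplicative, so the constants lost in rough comparisons of the two disappear on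
  passing to powers.\<close>

lemma le_if_powers_le:
  fixes a b c :: real
  assumes "\<And>k::nat. a ^ k \<le> c * b ^ k" "0 < b"
  shows "a \<le> b"
proof (rule ccontr)
  assume "\<not> a \<le> b"
  then have "1 < a / b" using assms(2) by simp
  then obtain k where "c < (a / b) ^ k" using real_arch_pow by blast
  then have "c * b ^ k < a ^ k" using assms(2) by (simp add: power_divide field_simps)
  then show False using assms(1)[of k] by simp
qed

section \<open>The maximal order, and the index of a principal ideal as a norm\<close>

context number_field
begin

lemma \<sigma>_sum: "b \<in> conj \<Longrightarrow> (\<And>i. i \<in> I \<Longrightarrow> g i \<in> K) \<Longrightarrow> \<sigma> b (sum g I) = (\<Sum>i\<in>I. \<sigma> b (g i))"
  by (induction I rule: infinite_finite_induct) (auto simp: \<sigma>_0 \<sigma>_add)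

text \<open>If all coordinates in the power basis are at most \<eta> in absolute value, every
  conjugate is at most \<open>Cb * \<eta>\<close>. The sum over all conjugates is a convenient upper
  bound for the maximum.\<close>

definition Cb :: real where "Cb = (\<Sum>b\<in>conj. \<Sum>i<deg. cmod b ^ i)"

lemma Cb_nonneg: "Cb \<ge> 0" unfolding Cb_def by (intro sum_nonneg) auto

lemma nrm_small:
  assumes "\<And>i. i < deg \<Longrightarrow> \<bar>real_of_rat (e i)\<bar> \<le> \<eta>" "\<eta> \<ge> 0"
  shows "cmod (nrm (\<Sum>i<deg. of_rat (e i) * \<alpha> ^ i)) \<le> (Cb * \<eta>) ^ deg"
proof -
  have "cmod (\<sigma> b (\<Sum>i<deg. of_rat (e i) * \<alpha> ^ i)) \<le> Cb * \<eta>" if b: "b \<in> conj" for b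
  proof -
    have "\<sigma> b (\<Sum>i<deg. of_rat (e i) * \<alpha> ^ i) = (\<Sum>i<deg. of_rat (e i) * b ^ i)"
      using b by (simp add: \<sigma>_sum \<sigma>_mult \<sigma>_of_rat \<sigma>_power \<sigma>_\<alpha>)
    moreover have "cmod (of_rat q) = \<bar>real_of_rat q\<bar>" for q
      by (cases q) (simp add: of_rat_rat norm_divide)
    ultimately have "cmod (\<sigma> b (\<Sum>i<deg. of_rat (e i) * \<alpha> ^ i)) \<le> (\<Sum>i<deg. \<bar>real_of_rat (e i)\<bar> * cmod b ^ i)"
      by (metis (no_types, lifting) norm_mult norm_power norm_sum sum.cong)
    also have "\<dots> \<le> (\<Sum>i<deg. \<eta> * cmod b ^ i)"
      using assms by (intro sum_mono mult_right_mono) auto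
    also have "\<dots> = \<eta> * (\<Sum>i<deg. cmod b ^ i)" by (simp add: sum_distrib_left)
    also have "\<dots> \<le> \<eta> * Cb"
      unfolding Cb_def using assms b finite_conj
      by (intro mult_left_mono member_le_sum[where f = "\<lambda>b. \<Sum>i<deg. cmod b ^ i"]) (auto intro: sum_nonneg)
    finally show ?thesis by (simp add: mult.commute)
  qed
  then have "(\<Prod>b\<in>conj. cmod (\<sigma> b (\<Sum>i<deg. of_rat (e i) * \<alpha> ^ i))) \<le> (\<Prod>b\<in>conj. Cb * \<eta>)"
    by (intro prod_mono) auto
  then show ?thesis by (simp add: nrm_def prod_norm card_conj)
qed

text \<open>Two elements whose coordinates have nearly equal fractional parts differ, up to an element
  of \<open>A\<close>, by an element of small norm.\<close>

lemma finite_index_A: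
  assumes \<Lambda>: "add_subgroup \<Lambda>" "A \<subseteq> \<Lambda>" "\<Lambda> \<subseteq> K"
    and big: "\<And>z. z \<in> \<Lambda> \<Longrightarrow> z \<noteq> 0 \<Longrightarrow> \<eta> \<le> cmod (nrm z)"
    and m: "m > 0" "(Cb / real m) ^ deg < \<eta>"
  shows "finite (cosets \<Lambda> A) \<and> card (cosets \<Lambda> A) \<le> m ^ deg"
proof (rule card_cosets_bound)
  show "add_subgroup A" by (intro add_subgroupI) auto
  fix B assume B: "finite B" "B \<subseteq> \<Lambda>" "\<And>x y. x \<in> B \<Longrightarrow> y \<in> B \<Longrightarrow> x - y \<in> A \<Longrightarrow> x = y"
  have "\<forall>x. \<exists>c. x \<in> K \<longrightarrow> x = (\<Sum>i<deg. of_rat (c i) * \<alpha> ^ i)"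
    using coordinates by metis
  then obtain c where c: "\<And>x. x \<in> K \<Longrightarrow> x = (\<Sum>i<deg. of_rat (c x i) * \<alpha> ^ i)" by metis
  \<comment> \<open>\<open>g\<close> tells which of the \<open>m ^ deg\<close> boxes of side
    \<open>1 / m\<close> contains the vector of fractional parts of the coordinates.\<close>
  define g where "g x = (\<lambda>i\<in>{..<deg}. nat \<lfloor>of_nat m * frac (c x i)\<rfloor>)" for x
  have "g ` B \<subseteq> {..<deg} \<rightarrow>\<^sub>E {..<m}"
  proof -
    have "nat \<lfloor>of_nat m * frac q\<rfloor> < m" for q :: rat
    proof -
      have "of_nat m * frac q < of_nat m * 1" using m frac_lt_1[of q] by (intro mult_strict_left_mono) auto
      then have "\<lfloor>of_nat m * frac q\<rfloor> < int m" by (simp add: floor_less_iff)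
      then show ?thesis using m by linarith
    qed
    then show ?thesis by (auto simp: g_def PiE_def Pi_def extensional_def)
  qed
  moreover have "inj_on g B"
  proof (rule inj_onI)
    fix x y assume xy: "x \<in> B" "y \<in> B" "g x = g y"
    define e where "e i = frac (c x i) - frac (c y i)" for i
    have e: "\<bar>real_of_rat (e i)\<bar> \<le> 1 / real m" if "i < deg" for i
    proof -
      have "nat \<lfloor>of_nat m * frac (c x i)\<rfloor> = nat \<lfloor>of_nat m * frac (c y i)\<rfloor>"
        using fun_cong[OF xy(3), of i] that by (simp add: g_def)
      then have "\<lfloor>of_nat m * frac (c x i)\<rfloor> = \<lfloor>of_nat m * frac (c y i)\<rfloor>"
        by (subst (asm) eq_nat_nat_iff) auto
      then have "\<bar>of_nat m * frac (c x i) - of_nat m * frac (c y i)\<bar> < 1" by linarith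
      then have "of_nat m * \<bar>e i\<bar> < 1"
        unfolding e_def by (simp flip: right_diff_distrib add: abs_mult)
      then have "real_of_rat (of_nat m * \<bar>e i\<bar>) < 1" by (subst of_rat_less_1_iff) auto
      then show ?thesis using m by (simp add: of_rat_mult field_simps)
    qed
    define d where "d = (\<Sum>i<deg. of_rat (e i) * \<alpha> ^ i)"
    define a where "a = (\<Sum>i<deg. of_int (\<lfloor>c x i\<rfloor> - \<lfloor>c y i\<rfloor>) * \<alpha> ^ i)"
    have xK: "x \<in> K" "y \<in> K" using xy B \<Lambda> by auto
    have "x - y = (\<Sum>i<deg. of_rat (c x i - c y i) * \<alpha> ^ i)"
      by (subst c[OF xK(1)], subst c[OF xK(2)])
        (simp add: of_rat_diff algebra_simps sum_subtractf)
    also have "\<dots> = (\<Sum>i<deg. of_rat (e i) * \<alpha> ^ i + of_int (\<lfloor>c x i\<rfloor> - \<lfloor>c y i\<rfloor>) * \<alpha> ^ i)"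
      by (intro sum.cong refl) (simp add: e_def frac_def of_rat_diff algebra_simps of_rat_add)
    also have "\<dots> = d + a" by (simp add: d_def a_def sum.distrib)
    finally have split: "x - y = d + a" .
    have aA: "a \<in> A" by (auto simp: a_def)
    have "x \<in> \<Lambda>" "y \<in> \<Lambda>" using xy B(2) by auto
    then have "x - y \<in> \<Lambda>" by (rule add_subgroup_closed(2)[OF \<Lambda>(1)])
    then have dL: "d \<in> \<Lambda>"
      using aA \<Lambda>(2) add_subgroup_closed(2)[OF \<Lambda>(1), of "x - y" a] split by auto
    have "cmod (nrm d) \<le> (Cb * (1 / real m)) ^ deg"
      unfolding d_def by (intro nrm_small e) auto
    then have "cmod (nrm d) < \<eta>" using m by simp
    then have "d = 0" using big[OF dL] by linarith
    then show "x = y" using B(3)[OF xy(1,2)] split aA by simp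
  qed
  ultimately have "card B \<le> card ({..<deg} \<rightarrow>\<^sub>E {..<m})"
    by (intro card_inj_on_le) (auto intro: finite_PiE)
  then show "card B \<le> m ^ deg" by (simp add: card_PiE)
qed

text \<open>The maximal order, described by almost integrality.\<close>

definition Oint :: "complex set" where
  "Oint = {x\<in>K. \<exists>D::nat. D \<ge> 1 \<and> (\<forall>k. of_nat D * x ^ k \<in> A)}"

lemma Oint_K: "x \<in> Oint \<Longrightarrow> x \<in> K" by (simp add: Oint_def)

lemma OintE:
  assumes "x \<in> Oint" obtains D :: nat where "D \<ge> 1" "\<And>k. of_nat D * x ^ k \<in> A"
  using assms by (auto simp: Oint_def)

lemma OintI: "x \<in> K \<Longrightarrow> D \<ge> 1 \<Longrightarrow> (\<And>k. of_nat D * x ^ k \<in> A) \<Longrightarrow> x \<in> Oint"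
  by (auto simp: Oint_def)

lemma A_sub_Oint: "x \<in> A \<Longrightarrow> x \<in> Oint"
  by (rule OintI[of x 1]) (use A_sub_K in auto)

lemma Oint_uminus: assumes "x \<in> Oint" shows "- x \<in> Oint"
proof -
  obtain D :: nat where D: "D \<ge> 1" "\<And>k. of_nat D * x ^ k \<in> A" using assms by (rule OintE) blast
  have "of_nat D * (- x) ^ k = (-1) ^ k * (of_nat D * x ^ k)" for k
    by (simp add: power_minus[of x] mult.left_commute)
  moreover have "(-1) ^ k * (of_nat D * x ^ k) \<in> A" for k
    using A_of_int[of "-1"] by (intro A_mult[OF A_power D(2)]) simp
  ultimately have "of_nat D * (- x) ^ k \<in> A" for k by metis
  then show "- x \<in> Oint" using assms D(1) by (intro OintI[of _ D]) (auto simp: Oint_K)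
qed

lemma Oint_add: assumes "x \<in> Oint" "y \<in> Oint" shows "x + y \<in> Oint"
proof -
  obtain D E :: nat where D: "D \<ge> 1" "\<And>k. of_nat D * x ^ k \<in> A" and E: "E \<ge> 1" "\<And>k. of_nat E * y ^ k \<in> A"
    using assms by (auto elim!: OintE)
  have "of_nat (D * E) * (x + y) ^ k = (\<Sum>j\<le>k. of_nat (k choose j) * (of_nat D * x ^ j) * (of_nat E * y ^ (k - j)))" for k
    by (simp add: binomial_ring sum_distrib_left mult_ac)
  moreover have "\<dots> k \<in> A" for k by (intro A_sum A_mult[OF A_mult[OF A_of_nat D(2)] E(2)])
  ultimately show ?thesis using assms D(1) E(1)
    by (intro OintI[of _ "D * E"]) (auto simp: Oint_K simp del: of_nat_mult)
qed

lemma Oint_mult: assumes "x \<in> Oint" "y \<in> Oint" shows "x * y \<in> Oint"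
proof -
  obtain D E :: nat where D: "D \<ge> 1" "\<And>k. of_nat D * x ^ k \<in> A" and E: "E \<ge> 1" "\<And>k. of_nat E * y ^ k \<in> A"
    using assms by (auto elim!: OintE)
  have "of_nat (D * E) * (x * y) ^ k = (of_nat D * x ^ k) * (of_nat E * y ^ k)" for k
    by (simp add: power_mult_distrib)
  moreover have "(of_nat D * x ^ k) * (of_nat E * y ^ k) \<in> A" for k by (rule A_mult[OF D(2) E(2)])
  ultimately show ?thesis using assms D(1) E(1)
    by (intro OintI[of _ "D * E"]) (auto simp: Oint_K simp del: of_nat_mult)
qed

lemma Oint_diff: "x \<in> Oint \<Longrightarrow> y \<in> Oint \<Longrightarrow> x - y \<in> Oint"
  using Oint_add[of x "- y"] Oint_uminus by simp
lemma Oint_of_nat: "of_nat k \<in> Oint" by (rule A_sub_Oint) simp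
lemma Oint_0: "0 \<in> Oint" and Oint_1: "1 \<in> Oint" by (auto intro: A_sub_Oint)
lemma Oint_power: "x \<in> Oint \<Longrightarrow> x ^ k \<in> Oint"
  by (induction k) (auto simp: Oint_1 Oint_mult)
lemma Oint_subgroup: "add_subgroup Oint"
  by (intro add_subgroupI Oint_0 Oint_diff)

text \<open>All \<open>D * x ^ k\<close> have nonzero integral norm, hence of absolute value at
  least 1, while a norm of \<open>x\<close> below 1 would make these norms tend to 0.\<close>

lemma nrm_Oint_ge_1: assumes "x \<in> Oint" "x \<noteq> 0" shows "cmod (nrm x) \<ge> 1"
proof (rule ccontr)
  assume lt: "\<not> cmod (nrm x) \<ge> 1"
  obtain D :: nat where D: "D \<ge> 1" "\<And>k. of_nat D * x ^ k \<in> A" using assms(1) by (rule OintE) blast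
  obtain k where k: "cmod (nrm x) ^ k < 1 / real D ^ deg"
    using real_arch_pow_inv[of "1 / real D ^ deg" "cmod (nrm x)"] D(1) lt by auto
  have "nrm (of_nat D * x ^ k) = of_nat D ^ deg * nrm x ^ k"
    using assms by (simp add: nrm_mult nrm_of_nat nrm_power Oint_K)
  then have "1 \<le> real D ^ deg * cmod (nrm x) ^ k"
    using nrm_A_ge_1[OF D(2)[of k]] assms D(1) by (simp add: norm_mult norm_power)
  then show False using k D(1) by (simp add: field_simps)
qed

text \<open>Nonzero elements of \<open>Oint\<close> have norm at least 1, so
  \<open>finite_index_A\<close> applies with \<eta> equal to 1 and makes \<open>A\<close> of finite
  index; torsion of the quotient gives the multiplier.\<close>

lemma ex_conductor: "\<exists>D\<ge>1. \<forall>x\<in>Oint. of_nat D * x \<in> A"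
proof (rule cosets_torsion)
  show "add_subgroup A" by (intro add_subgroupI) auto
  show "add_subgroup Oint" by (rule Oint_subgroup)
  define m where "m = nat \<lceil>Cb\<rceil> + 1"
  have "Cb < real m" unfolding m_def using Cb_nonneg by linarith
  then have "Cb / real m < 1" "m > 0" using Cb_nonneg by (auto simp: m_def)
  then have "(Cb / real m) ^ deg < 1" using deg_pos Cb_nonneg by (intro power_less_one_iff[THEN iffD2]) auto
  then show "finite (cosets Oint A)"
    using finite_index_A[of Oint 1 m] Oint_subgroup A_sub_Oint Oint_K nrm_Oint_ge_1 \<open>m > 0\<close>
    by (metis subsetI)
qed

text \<open>The multiplier of \<open>ex_conductor\<close> moves the powers from \<open>Oint\<close>
  into \<open>A\<close>, where the definition applies. Thus \<open>Oint\<close> is completely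
  integrally closed, the property that later makes primes invertible.\<close>

lemma almost_integral:
  assumes "y \<in> K" "D \<ge> (1::nat)" "\<And>k. of_nat D * y ^ k \<in> Oint"
  shows "y \<in> Oint"
proof -
  obtain E :: nat where E: "E \<ge> 1" "\<And>x. x \<in> Oint \<Longrightarrow> of_nat E * x \<in> A" using ex_conductor by blast
  then have "of_nat (E * D) * y ^ k \<in> A" for k using E(2)[OF assms(3)[of k]] by (simp add: mult.assoc)
  then show ?thesis using assms E by (intro OintI[of _ "E * D"]) auto
qed

lemma ex_denominator:
  assumes "x \<in> K" shows "\<exists>D::nat. D \<ge> 1 \<and> of_nat D * x \<in> Oint"
proof -
  obtain c where x: "x = (\<Sum>i<deg. of_rat (c i) * \<alpha> ^ i)" using assms by (rule coordinates)
  define d where "d i = snd (quotient_of (c i))" for i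
  have d: "d i > 0" "c i = of_int (fst (quotient_of (c i))) / of_int (d i)" for i
    unfolding d_def by (rule quotient_of_denom_pos') (use quotient_of_div[of "c i"] in \<open>simp add: prod.expand\<close>)
  define D where "D = (\<Prod>i<deg. d i)"
  have Dpos: "D > 0" using d(1) by (auto simp: D_def intro: prod_pos)
  have "\<exists>z. of_int D * complex_of_rat (c i) = of_int z" if "i < deg" for i
  proof -
    have "D = d i * (\<Prod>i\<in>{..<deg} - {i}. d i)" unfolding D_def using that by (subst prod.remove[of _ i]) auto
    then have "complex_of_int D = of_int (d i) * of_int (\<Prod>i\<in>{..<deg} - {i}. d i)" by simp
    moreover have "complex_of_rat (c i) = of_int (fst (quotient_of (c i))) / of_int (d i)"
      by (subst d(2)) (simp add: of_rat_divide)
    ultimately have "of_int D * complex_of_rat (c i) = of_int ((\<Prod>i\<in>{..<deg} - {i}. d i) * fst (quotient_of (c i)))"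
      using d(1)[of i] by simp
    then show ?thesis by blast
  qed
  then obtain z where z: "\<And>i. i < deg \<Longrightarrow> of_int D * complex_of_rat (c i) = of_int (z i)" by metis
  have "of_int D * x = (\<Sum>i<deg. of_int (z i) * \<alpha> ^ i)"
    unfolding x sum_distrib_left by (intro sum.cong refl) (simp flip: z mult.assoc)
  then have "of_int D * x \<in> A" by simp
  moreover have "of_int D = (of_nat (nat D) :: complex)" using Dpos by simp
  ultimately have "of_nat (nat D) * x \<in> Oint" using A_sub_Oint by metis
  moreover have "nat D \<ge> 1" using Dpos by linarith
  ultimately show ?thesis by blast
qed

text \<open>The absolute norm of the principal ideal of \<open>x\<close>; \<open>nu_eq_nrm\<close>
  identifies it with the absolute value of \<open>nrm x\<close>.\<close>

definition nu :: "complex \<Rightarrow> nat" where "nu x = card (cosets Oint ((*) x ` Oint))"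

lemma mult_Oint_subgroup: "add_subgroup ((*) x ` Oint)"
proof (rule add_subgroupI)
  show "0 \<in> (*) x ` Oint" using Oint_0 by (auto intro: image_eqI[of _ _ 0])
  fix u v assume "u \<in> (*) x ` Oint" "v \<in> (*) x ` Oint"
  then show "u - v \<in> (*) x ` Oint" using Oint_diff by (auto simp flip: right_diff_distrib)
qed

text \<open>Scaling by \<open>inverse x\<close> turns the index of \<open>x Oint\<close> in
  \<open>Oint\<close> into that of \<open>Oint\<close> in the fractional ideal of
  \<open>inverse x\<close>. Nonzero elements of the latter have norm at least
  \<open>1 / cmod (nrm x)\<close>, so \<open>finite_index_A\<close> bounds even its index over
  \<open>A\<close>.\<close>

lemma nu_bound:
  assumes x: "x \<in> Oint" "x \<noteq> 0" and m: "m > 0" "(Cb / real m) ^ deg < 1 / cmod (nrm x)"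
  shows "finite (cosets Oint ((*) x ` Oint))" "nu x \<le> m ^ deg"
proof -
  let ?L = "(*) (inverse x) ` Oint"
  have OL: "Oint \<subseteq> ?L"
  proof
    fix z assume "z \<in> Oint"
    then have "x * z \<in> Oint" using x Oint_mult by blast
    then show "z \<in> ?L" using x by (intro image_eqI[of _ _ "x * z"]) auto
  qed
  have LK: "?L \<subseteq> K" using x by (auto intro!: K_mult K_inverse intro: Oint_K)
  have AO: "A \<subseteq> Oint" using A_sub_Oint by auto
  have As: "add_subgroup A" by (intro add_subgroupI) auto
  have xK: "x \<in> K" using x Oint_K by blast
  have "1 / cmod (nrm x) \<le> cmod (nrm z)" if "z \<in> ?L" "z \<noteq> 0" for z
  proof -
    from that(1) obtain w where w: "w \<in> Oint" "z = inverse x * w" by blast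
    then have "nrm w = nrm x * nrm z" using x xK by (subst nrm_mult[symmetric]) (auto simp: Oint_K simp flip: mult.assoc)
    moreover have "cmod (nrm w) \<ge> 1" using w that by (intro nrm_Oint_ge_1) auto
    ultimately show ?thesis using nrm_nonzero[OF xK x(2)] by (simp add: norm_mult field_simps)
  qed
  then have fin: "finite (cosets ?L A)" and le: "card (cosets ?L A) \<le> m ^ deg"
    using finite_index_A[OF mult_Oint_subgroup _ LK, of "1 / cmod (nrm x)" m] m AO OL by blast+
  note ch = card_cosets_mult[OF As Oint_subgroup mult_Oint_subgroup AO OL fin]
  have "card (cosets Oint A) > 0"
    using ch(2) Oint_0 by (auto simp: card_gt_0_iff cosets_def)
  then have "card (cosets ?L Oint) \<le> card (cosets ?L A)" by (simp add: ch(3))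
  moreover have "(*) x ` ?L = Oint" using x by (simp add: image_image flip: mult.assoc)
  ultimately show "finite (cosets Oint ((*) x ` Oint))" "nu x \<le> m ^ deg"
    using cosets_scale[OF x(2), of ?L Oint] ch(1) le by (auto simp: nu_def)
qed

lemma nu_estimate:
  assumes x: "x \<in> Oint" "x \<noteq> 0"
  shows "finite (cosets Oint ((*) x ` Oint))" "real (nu x) \<le> (Cb + 2) ^ deg * cmod (nrm x)"
proof -
  define t where "t = root deg (cmod (nrm x))"
  have N: "cmod (nrm x) \<ge> 1" using x by (rule nrm_Oint_ge_1)
  have t: "t ^ deg = cmod (nrm x)" "t \<ge> 1" using N deg_pos by (auto simp: t_def)
  \<comment> \<open>Chosen so that \<open>Cb / m < 1 / t\<close>. Since \<open>m\<close> is at most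
    \<open>Cb * t + 2\<close> and \<open>t \<ge> 1\<close>, the loss is only the factor
    \<open>(Cb + 2) ^ deg\<close>.\<close>
  define m where "m = nat \<lceil>Cb * t\<rceil> + 1"
  have "Cb * t \<ge> 0" using Cb_nonneg t by simp
  then have m: "Cb * t < real m" "real m \<le> Cb * t + 2" "m > 0" unfolding m_def by linarith+
  have "Cb / real m < 1 / t" using m t by (simp add: field_simps)
  then have "(Cb / real m) ^ deg < (1 / t) ^ deg"
    using deg_pos Cb_nonneg by (intro power_strict_mono) auto
  then have lt: "(Cb / real m) ^ deg < 1 / cmod (nrm x)" using t by (simp add: power_divide)
  show "finite (cosets Oint ((*) x ` Oint))" using nu_bound(1)[OF x m(3) lt] .
  have "nu x \<le> m ^ deg" using nu_bound(2)[OF x m(3) lt] .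
  then have "real (nu x) \<le> real m ^ deg" by (metis of_nat_le_iff of_nat_power)
  also have "\<dots> \<le> ((Cb + 2) * t) ^ deg"
    using m t by (intro power_mono) (auto simp: algebra_simps)
  finally show "real (nu x) \<le> (Cb + 2) ^ deg * cmod (nrm x)" using t by (simp add: power_mult_distrib)
qed

lemma nu_mult:
  assumes "x \<in> Oint" "x \<noteq> 0" "y \<in> Oint" "y \<noteq> 0" shows "nu (x * y) = nu x * nu y"
proof -
  have sub: "(*) (x * y) ` Oint \<subseteq> (*) x ` Oint" "(*) x ` Oint \<subseteq> Oint"
    using assms Oint_mult by (auto simp: mult.assoc)
  have fin: "finite (cosets Oint ((*) (x * y) ` Oint))"
    using assms by (intro nu_estimate Oint_mult) auto
  have "(*) (x * y) ` Oint = (*) x ` ((*) y ` Oint)" by (simp add: image_image mult.assoc)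
  then have "card (cosets ((*) x ` Oint) ((*) (x * y) ` Oint)) = nu y"
    using cosets_scale(2)[OF assms(2)] by (simp add: nu_def)
  then show ?thesis
    using card_cosets_mult(3)[OF mult_Oint_subgroup mult_Oint_subgroup Oint_subgroup sub fin]
    by (simp add: nu_def)
qed

lemma nu_pos: assumes "x \<in> Oint" "x \<noteq> 0" shows "nu x > 0"
  using nu_estimate(1)[OF assms] Oint_0 unfolding nu_def by (auto simp: card_gt_0_iff cosets_def)

lemma nu_1: "nu 1 = 1"
proof -
  have "nu 1 * nu 1 = nu 1 * 1"
    using nu_mult[OF Oint_1 one_neq_zero Oint_1 one_neq_zero] unfolding mult_1_right by (rule sym)
  moreover have "0 < nu 1" using nu_pos[OF Oint_1] by simp
  ultimately show ?thesis using nat_mult_eq_cancel1 by blast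
qed

lemma nu_power: "x \<in> Oint \<Longrightarrow> x \<noteq> 0 \<Longrightarrow> nu (x ^ k) = nu x ^ k"
  by (induction k) (auto simp: nu_mult nu_1 Oint_power)

text \<open>The constant in \<open>nu_estimate\<close> does not depend on \<open>x\<close>, so
  applying the estimate to powers of \<open>x\<close> removes it.\<close>

lemma nu_le_nrm: assumes "x \<in> Oint" "x \<noteq> 0" shows "real (nu x) \<le> cmod (nrm x)"
proof (rule le_if_powers_le)
  show "0 < cmod (nrm x)" using nrm_Oint_ge_1[OF assms] by linarith
  show "real (nu x) ^ k \<le> (Cb + 2) ^ deg * cmod (nrm x) ^ k" for k
    using nu_estimate(2)[of "x ^ k"] assms
    by (simp add: Oint_power nu_power nrm_power Oint_K norm_power)
qed

text \<open>With \<open>D\<close> a conductor, the elements with coordinates in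
  \<open>{0..<m div D}\<close> are incongruent modulo \<open>m\<close>: a difference of two,
  multiplied by \<open>D\<close>, has coordinates divisible by \<open>m\<close> but smaller than
  \<open>m\<close>. Taking \<open>m = M ^ k\<close> and letting \<open>k\<close> grow removes the
  loss of \<open>D\<close>.\<close>

lemma nu_of_nat_ge: assumes "M \<ge> 1" shows "M ^ deg \<le> nu (of_nat M)"
proof -
  obtain D :: nat where D: "D \<ge> 1" "\<And>x. x \<in> Oint \<Longrightarrow> of_nat D * x \<in> A" using ex_conductor by blast
  have lower: "(m div D) ^ deg \<le> nu (of_nat m)" if m: "m \<ge> 1" for m
  proof -
    define s where "s c = (\<Sum>i<deg. of_nat (c i) * \<alpha> ^ i)" for c :: "nat \<Rightarrow> nat"
    let ?P = "{..<deg} \<rightarrow>\<^sub>E {..<m div D}"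
    let ?g = "\<lambda>c. (+) (s c) ` ((*) (of_nat m) ` Oint)"
    have sO: "s c \<in> Oint" for c unfolding s_def by (rule A_sub_Oint) simp
    have "inj_on ?g ?P"
    proof (rule inj_onI)
      fix c c' assume cc: "c \<in> ?P" "c' \<in> ?P" "?g c = ?g c'"
      from iffD1[OF coset_eq_iff[OF mult_Oint_subgroup] cc(3)]
      obtain w where w: "w \<in> Oint" "s c - s c' = of_nat m * w" by (elim imageE)
      obtain z :: "nat \<Rightarrow> int" where z: "of_nat D * w = (\<Sum>i<deg. of_int (z i) * \<alpha> ^ i)"
        using D(2)[OF w(1)] by (rule A_coordinates)
      have "of_nat D * (s c - s c') - of_nat m * (of_nat D * w) = 0" by (simp add: w)
      moreover have "of_nat D * (s c - s c') - of_nat m * (of_nat D * w) =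
          (\<Sum>i<deg. of_rat (of_int (int D * (int (c i) - int (c' i)) - int m * z i)) * \<alpha> ^ i)"
        unfolding z s_def of_rat_of_int_eq
        by (simp add: sum_distrib_left algebra_simps sum_subtractf sum.distrib)
      ultimately have zero: "(of_int (int D * (int (c i) - int (c' i)) - int m * z i) :: rat) = 0" if "i < deg" for i
        using that by (intro independent[where i = i]) simp_all
      have "c i = c' i" if i: "i < deg" for i
      proof -
        have eq: "int D * (int (c i) - int (c' i)) = int m * z i" using zero[OF i]
          by (simp only: of_int_eq_0_iff)
        have "c i < m div D" "c' i < m div D" using cc i by auto
        then have "\<bar>int (c i) - int (c' i)\<bar> < int (m div D)" by linarith
        then have "int D * \<bar>int (c i) - int (c' i)\<bar> < int D * int (m div D)"
          using D(1) by (intro mult_strict_left_mono) auto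
        also have "\<dots> \<le> int m" by (metis of_nat_le_iff of_nat_mult times_div_less_eq_dividend)
        finally have "int m * \<bar>z i\<bar> < int m" using arg_cong[OF eq, of abs] by (simp add: abs_mult)
        then have "z i = 0" using m by (cases "z i = 0") (auto simp: mult_less_cancel_left2)
        then show ?thesis using eq D(1) by simp
      qed
      then show "c = c'" using cc by (intro PiE_ext[of c _ _ c']) auto
    qed
    moreover have "?g ` ?P \<subseteq> cosets Oint ((*) (of_nat m) ` Oint)"
      unfolding cosets_def by (rule image_subsetI) (rule imageI, rule sO)
    moreover have "finite (cosets Oint ((*) (of_nat m) ` Oint))"
      using m by (intro nu_estimate Oint_of_nat) auto
    ultimately have "card ?P \<le> nu (of_nat m)" unfolding nu_def by (intro card_inj_on_le)
    then show ?thesis by (simp add: card_PiE)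
  qed
  have "real (M ^ deg) \<le> real (nu (of_nat M))"
  proof (rule le_if_powers_le)
    show nupos: "0 < real (nu (of_nat M))" using nu_pos[of "of_nat M"] assms Oint_of_nat by simp
    fix k
    let ?q = "M ^ k div D"
    have nk: "nu (of_nat (M ^ k)) = nu (of_nat M) ^ k" using assms Oint_of_nat by (simp add: nu_power)
    show "real (M ^ deg) ^ k \<le> (2 * real D) ^ deg * real (nu (of_nat M)) ^ k"
    \<comment> \<open>When \<open>M ^ k\<close> is smaller than \<open>D\<close> the count says
      nothing; the constant \<open>2 * D\<close> covers this case, and also the rounding in the
      other one.\<close>
    proof (cases "?q = 0")
      case True
      then have "M ^ k \<le> 2 * D" using D(1) by (simp add: div_eq_0_iff)
      then have "real (M ^ k) ^ deg \<le> (2 * real D) ^ deg" by (intro power_mono) linarith+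
      moreover have "1 \<le> real (nu (of_nat M)) ^ k" using nupos by (intro one_le_power) simp
      ultimately have "real (M ^ k) ^ deg * 1 \<le> (2 * real D) ^ deg * real (nu (of_nat M)) ^ k"
        by (intro mult_mono) auto
      then show ?thesis by (simp add: power_mult[symmetric] mult.commute)
    next
      case False
      have "M ^ k < D * (?q + 1)" using dividend_less_times_div[of D "M ^ k"] D(1) by simp
      also have "\<dots> \<le> 2 * D * ?q" using False by (simp add: algebra_simps)
      finally have "real (M ^ k) \<le> real (2 * D * ?q)" by (simp only: of_nat_le_iff)
      then have "real (M ^ k) ^ deg \<le> (2 * real D * real ?q) ^ deg"
        by (intro power_mono) simp_all
      then have "real (M ^ k) ^ deg \<le> (2 * real D) ^ deg * real ?q ^ deg"
        by (simp only: power_mult_distrib)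
      also have "\<dots> \<le> (2 * real D) ^ deg * real (nu (of_nat M)) ^ k"
        using lower[of "M ^ k"] assms nk by (intro mult_left_mono) (auto simp flip: of_nat_power)
      finally show ?thesis by (simp add: power_mult[symmetric] mult.commute)
    qed
  qed
  then show ?thesis by simp
qed

lemma ex_cofactor:
  assumes x: "x \<in> Oint" "x \<noteq> 0"
  shows "\<exists>m\<ge>1. \<exists>y\<in>Oint. x * y = of_nat m"
proof -
  obtain m where m: "m \<ge> 1" "\<And>z. z \<in> Oint \<Longrightarrow> of_nat m * z \<in> (*) x ` Oint"
    using cosets_torsion[OF mult_Oint_subgroup Oint_subgroup nu_estimate(1)[OF x]] by blast
  then show ?thesis using m(2)[OF Oint_1] by force
qed

text \<open>Complete \<open>x\<close> to a product \<open>x * y = m\<close>. For both factors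
  \<open>nu\<close> is at most the norm, but for the product it is at least the norm; a strict
  inequality at \<open>x\<close> could not be made up by \<open>y\<close>.\<close>

lemma nu_eq_nrm: assumes x: "x \<in> Oint" "x \<noteq> 0" shows "real (nu x) = cmod (nrm x)"
proof -
  obtain m y where m: "m \<ge> 1" "y \<in> Oint" "x * y = of_nat m" using ex_cofactor[OF x] by auto
  then have y: "y \<noteq> 0" by auto
  have "cmod (nrm x) * cmod (nrm y) = real (m ^ deg)"
    using x m by (simp flip: norm_mult nrm_mult add: Oint_K nrm_of_nat norm_power)
  also have "\<dots> \<le> real (nu (x * y))" using nu_of_nat_ge[OF m(1)] m(3) by simp
  also have "\<dots> = real (nu x) * real (nu y)" using nu_mult x m(2) y by simp
  finally have le: "cmod (nrm x) * cmod (nrm y) \<le> real (nu x) * real (nu y)" .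
  show ?thesis
  proof (rule ccontr)
    assume "real (nu x) \<noteq> cmod (nrm x)"
    then have "real (nu x) < cmod (nrm x)" using nu_le_nrm[OF x] by simp
    then have "real (nu x) * real (nu y) < cmod (nrm x) * cmod (nrm y)"
      using nu_le_nrm[OF m(2) y] nu_pos[OF m(2) y] by (intro mult_less_le_imp_less) auto
    then show False using le by simp
  qed
qed

end

section \<open>Prime ideals and valuations\<close>

text \<open>Quotients are compared through their congruences on representatives, which spares the
  construction of an isomorphism.\<close>

lemma card_image_eq_if_same_kernel:
  assumes "\<And>x y. x \<in> G \<Longrightarrow> y \<in> G \<Longrightarrow> g x = g y \<longleftrightarrow> h x = h y"
  shows "card (g ` G) = card (h ` G)"
proof -
  obtain B where B: "B \<subseteq> G" "inj_on g B" "g ` G = g ` B"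
    using subset_image_inj[of "g ` G" g G] by auto
  have "inj_on h B" using B(1,2) assms by (auto simp: inj_on_def subset_iff)
  moreover have "h ` G \<subseteq> h ` B"
  proof
    fix z assume "z \<in> h ` G"
    then obtain x where x: "x \<in> G" "z = h x" by auto
    then have "g x \<in> g ` B" using B(3) by auto
    then obtain b where b: "b \<in> B" "g x = g b" by auto
    then have "h x = h b" using assms x B(1) by auto
    then show "z \<in> h ` B" using x b by simp
  qed
  moreover have "h ` B \<subseteq> h ` G" using B(1) by auto
  ultimately show ?thesis using B(2,3) by (metis card_image subset_antisym)
qed

lemma card_cosets_eq_1:
  assumes "add_subgroup L" "add_subgroup H" "card (cosets H L) = 1" "x \<in> H"
  shows "x \<in> L"
proof -
  obtain Y where Y: "cosets H L = {Y}" using assms(3) by (rule card_1_singletonE)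
  have "(+) x ` L \<in> cosets H L" "(+) 0 ` L \<in> cosets H L"
    unfolding cosets_def by (rule imageI, fact, rule imageI, rule add_subgroup_closed(1)[OF assms(2)])
  then have "(+) x ` L = (+) 0 ` L" using Y by simp
  then have "x - 0 \<in> L" by (rule iffD1[OF coset_eq_iff[OF assms(1)]])
  then show ?thesis by simp
qed

section \<open>Primes of the maximal order\<close>

context number_field
begin

definition intideal :: "complex set \<Rightarrow> bool" where
  "intideal I \<longleftrightarrow> I \<subseteq> Oint \<and> add_subgroup I \<and> (\<forall>x\<in>Oint. \<forall>y\<in>I. x * y \<in> I) \<and> (\<exists>x\<in>I. x \<noteq> 0)"

definition prim :: "complex set \<Rightarrow> bool" where
  "prim P \<longleftrightarrow> intideal P \<and> 1 \<notin> P \<and> (\<forall>x\<in>Oint. \<forall>y\<in>Oint. x * y \<in> P \<longrightarrow> x \<in> P \<or> y \<in> P)"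

lemma intidealD:
  assumes "intideal I"
  shows "x \<in> I \<Longrightarrow> x \<in> Oint" "add_subgroup I" "x \<in> Oint \<Longrightarrow> y \<in> I \<Longrightarrow> x * y \<in> I"
    "y \<in> Oint \<Longrightarrow> x \<in> I \<Longrightarrow> x * y \<in> I" "\<exists>x\<in>I. x \<noteq> 0" "0 \<in> I"
  using assms add_subgroup_closed(1) unfolding intideal_def by (auto simp: mult.commute)

lemma primD:
  assumes "prim P"
  shows "intideal P" "1 \<notin> P"
    "x \<in> Oint \<Longrightarrow> y \<in> Oint \<Longrightarrow> x \<notin> P \<Longrightarrow> y \<notin> P \<Longrightarrow> x * y \<notin> P"
    "x \<in> P \<Longrightarrow> x \<in> Oint"
  using assms intidealD(1) unfolding prim_def by blast+

lemma finite_cosets_ideal: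
  assumes "intideal I" shows "finite (cosets Oint I)"
proof -
  obtain x where x: "x \<in> I" "x \<noteq> 0" using intidealD(5)[OF assms] by blast
  then have xO: "x \<in> Oint" using intidealD(1)[OF assms] by blast
  have "(*) x ` Oint \<subseteq> I" using intidealD(4)[OF assms] x by auto
  moreover have "I \<subseteq> Oint" using assms by (auto simp: intideal_def)
  ultimately show ?thesis
    using card_cosets_mult(1)[OF mult_Oint_subgroup intidealD(2)[OF assms] Oint_subgroup _ _ nu_estimate(1)[OF xO x(2)]]
    by blast
qed

lemma prim_power: "prim P \<Longrightarrow> x \<in> Oint \<Longrightarrow> x \<notin> P \<Longrightarrow> x ^ k \<notin> P"
  by (induction k) (auto simp: primD Oint_power)

text \<open>A finite integral domain is a field: two powers of \<open>b\<close> coincide modulo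
  \<open>P\<close>, and cancelling the smaller one leaves a power congruent to 1.\<close>

lemma prim_inverse:
  assumes P: "prim P" and b: "b \<in> Oint" "b \<notin> P"
  shows "\<exists>b'\<in>Oint. b * b' - 1 \<in> P"
proof -
  let ?g = "\<lambda>k::nat. (+) (b ^ k) ` P"
  have S: "add_subgroup P" using intidealD(2) primD(1)[OF P] by blast
  have "?g ` {0..card (cosets Oint P)} \<subseteq> cosets Oint P"
    using b Oint_power by (auto simp: cosets_def)
  then have "card (?g ` {0..card (cosets Oint P)}) \<le> card (cosets Oint P)"
    by (rule card_mono[OF finite_cosets_ideal[OF primD(1)[OF P]]])
  then have "\<not> inj_on ?g {0..card (cosets Oint P)}" by (intro pigeonhole) simp
  then obtain i j where ij: "i \<noteq> j" "?g i = ?g j" by (auto simp: inj_on_def)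
  have *: "\<exists>b'\<in>Oint. b * b' - 1 \<in> P" if "i < j" "b ^ j - b ^ i \<in> P" for i j
  proof -
    have "b ^ j - b ^ i = b ^ i * (b ^ (j - i) - 1)"
      using that(1) by (simp add: algebra_simps flip: power_add)
    then have "b ^ (j - i) - 1 \<in> P"
      using that(2) primD(3)[OF P, of "b ^ i" "b ^ (j - i) - 1"] prim_power[OF P b] b
      by (auto simp: Oint_power Oint_diff Oint_1)
    moreover have "b ^ (j - i) = b * b ^ (j - i - 1)"
      using that(1) by (metis power_minus_mult mult.commute zero_less_diff)
    ultimately show ?thesis using b by (intro bexI[of _ "b ^ (j - i - 1)"]) (auto simp: Oint_power)
  qed
  have d: "b ^ i - b ^ j \<in> P" by (rule iffD1[OF coset_eq_iff[OF S] ij(2)])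
  then have "b ^ j - b ^ i \<in> P" using add_subgroup_closed(3)[OF S d] by simp
  then show ?thesis using * d ij(1) by (metis linorder_neqE_nat)
qed

text \<open>An element of \<open>P\<close> outside \<open>Q\<close> would be invertible modulo
  \<open>Q\<close>, hence modulo \<open>P\<close>, which puts 1 into \<open>P\<close>.\<close>

lemma prim_subset_eq:
  assumes P: "prim P" and Q: "prim Q" and sub: "Q \<subseteq> P" shows "Q = P"
proof -
  have "b \<in> Q" if b: "b \<in> P" for b
  proof (rule ccontr)
    assume "b \<notin> Q"
    then obtain b' where b': "b' \<in> Oint" "b * b' - 1 \<in> Q"
      using prim_inverse[OF Q] primD(4)[OF P b] by blast
    have "b * b' \<in> P" using intidealD(4)[OF primD(1)[OF P]] b b' by blast
    moreover have "b * b' - 1 \<in> P" using b' sub by blast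
    ultimately have "b * b' - (b * b' - 1) \<in> P"
      by (rule add_subgroup_closed(2)[OF intidealD(2)[OF primD(1)[OF P]]])
    then show False using primD(2)[OF P] by simp
  qed
  then show ?thesis using sub by blast
qed

text \<open>The colon ideal \<open>(I : c)\<close>, that is, the annihilator of the class of
  \<open>c\<close> in \<open>Oint\<close> modulo \<open>I\<close>.\<close>

definition coln :: "complex set \<Rightarrow> complex \<Rightarrow> complex set" where
  "coln I c = {b\<in>Oint. b * c \<in> I}"

lemma coln_ideal:
  assumes I: "intideal I" and c: "c \<in> Oint" shows "intideal (coln I c)" "I \<subseteq> coln I c"
proof -
  show sub: "I \<subseteq> coln I c" using intidealD(1,4)[OF I] c by (auto simp: coln_def)
  have "add_subgroup (coln I c)"
    using add_subgroup_closed(1,2)[OF intidealD(2)[OF I]]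
    by (intro add_subgroupI) (auto simp: coln_def Oint_0 Oint_diff left_diff_distrib)
  moreover have "x * y \<in> coln I c" if "x \<in> Oint" "y \<in> coln I c" for x y
    using that intidealD(3)[OF I, of x "y * c"] by (auto simp: coln_def Oint_mult mult.assoc)
  ultimately show "intideal (coln I c)"
    using sub intidealD(5)[OF I] unfolding intideal_def by (auto simp: coln_def)
qed

lemma coln_mono: assumes "intideal I" "y \<in> Oint" shows "coln I c \<subseteq> coln I (y * c)"
proof
  fix b assume "b \<in> coln I c"
  then have "b \<in> Oint" "y * (b * c) \<in> I" using intidealD(3)[OF assms] by (auto simp: coln_def)
  moreover have "y * (b * c) = b * (y * c)" by (rule mult.left_commute)
  ultimately show "b \<in> coln I (y * c)" by (simp add: coln_def)
qed

lemma index_minimal_eq: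
  assumes I: "intideal I" and J: "intideal J" and sub: "I \<subseteq> J"
    and le: "card (cosets Oint I) \<le> card (cosets Oint J)"
  shows "I = J"
proof -
  have JO: "J \<subseteq> Oint" using intidealD(1)[OF J] by blast
  note ch = card_cosets_mult[OF intidealD(2)[OF I] intidealD(2)[OF J] Oint_subgroup sub JO finite_cosets_ideal[OF I]]
  have ne: "cosets J I \<noteq> {}" "cosets Oint J \<noteq> {}"
    using intidealD(6)[OF J] Oint_0 by (auto simp: cosets_def)
  have p: "card (cosets J I) > 0" "card (cosets Oint J) > 0"
    using ne ch(1,2) by (auto simp: card_gt_0_iff)
  have "card (cosets J I) = 1"
  proof (rule ccontr)
    assume "card (cosets J I) \<noteq> 1"
    then have "card (cosets Oint J) * 2 \<le> card (cosets Oint J) * card (cosets J I)"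
      using p by (intro mult_le_mono) auto
    then show False using le ch(3) p by simp
  qed
  then have "x \<in> I" if "x \<in> J" for x
    using card_cosets_eq_1[OF intidealD(2)[OF I] intidealD(2)[OF J]] that by blast
  then show ?thesis using sub by blast
qed

text \<open>An annihilator of least index is maximal among annihilators of nonzero classes, and such
  annihilators are prime: the usual existence proof for associated primes.\<close>

lemma ex_prim_annihilator:
  assumes I: "intideal I" "1 \<notin> I"
  shows "\<exists>c\<in>Oint. c \<notin> I \<and> prim (coln I c)"
proof -
  obtain c where c: "c \<in> Oint \<and> c \<notin> I"
    "\<And>d. d \<in> Oint \<and> d \<notin> I \<Longrightarrow> card (cosets Oint (coln I c)) \<le> card (cosets Oint (coln I d))"
    using ex_has_least_nat[of "\<lambda>c. c \<in> Oint \<and> c \<notin> I" 1 "\<lambda>c. card (cosets Oint (coln I c))"] I(2) Oint_1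
    by blast
  have "prim (coln I c)"
    unfolding prim_def
  proof (intro conjI ballI impI)
    show "intideal (coln I c)" using coln_ideal(1)[OF I(1)] c(1) by blast
    show "1 \<notin> coln I c" using c(1) by (simp add: coln_def)
    fix x y assume xy: "x \<in> Oint" "y \<in> Oint" "x * y \<in> coln I c"
    show "x \<in> coln I c \<or> y \<in> coln I c"
    proof (rule disjCI)
      assume "y \<notin> coln I c"
      then have yc: "y * c \<in> Oint" "y * c \<notin> I" using xy c(1) by (auto simp: coln_def Oint_mult)
      have "coln I c \<subseteq> coln I (y * c)"
        by (rule coln_mono[OF I(1) xy(2)])
      then have "coln I c = coln I (y * c)"
        using index_minimal_eq[OF coln_ideal(1)[OF I(1)] coln_ideal(1)[OF I(1)]] c yc by blast
      moreover have "x \<in> coln I (y * c)" using xy by (auto simp: coln_def mult.assoc)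
      ultimately show "x \<in> coln I c" by simp
    qed
  qed
  then show ?thesis using c(1) by blast
qed

lemma principal_ideal: "x \<in> Oint \<Longrightarrow> x \<noteq> 0 \<Longrightarrow> intideal ((*) x ` Oint)"
  unfolding intideal_def
proof (intro conjI ballI)
  assume x: "x \<in> Oint" "x \<noteq> 0"
  show "(*) x ` Oint \<subseteq> Oint" using x Oint_mult by auto
  show "add_subgroup ((*) x ` Oint)" by (rule mult_Oint_subgroup)
  show "u * v \<in> (*) x ` Oint" if uv: "u \<in> Oint" "v \<in> (*) x ` Oint" for u v
  proof -
    from uv(2) obtain z where "z \<in> Oint" "v = x * z" by (elim imageE)
    then show ?thesis using uv(1) by (intro image_eqI[of _ _ "u * z"]) (auto simp: Oint_mult)
  qed
  show "\<exists>u\<in>(*) x ` Oint. u \<noteq> 0" using x Oint_1 by (intro bexI[of _ "x * 1"]) auto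
qed

text \<open>\<open>y\<close> plays the role of a generator of the inverse of the prime ideal \<open>P\<close>, locally at \<open>P\<close>.\<close>

definition inv_unif :: "complex set \<Rightarrow> complex \<Rightarrow> bool" where
  "inv_unif P y \<longleftrightarrow> y \<in> K \<and> y \<notin> Oint \<and> (\<forall>b\<in>P. y * b \<in> Oint)"

text \<open>The quotient \<open>y = s * c / p\<close> is integral on \<open>P\<close> as soon as
  \<open>P\<close> is exactly the set of multipliers carrying \<open>s * c\<close> into
  \<open>p Oint\<close>. An associated prime of \<open>p Oint\<close> need not be \<open>P\<close>,
  so the ideal is first replaced by its part at \<open>P\<close>.\<close>

lemma ex_inv_unif:
  assumes P: "prim P" shows "\<exists>y. inv_unif P y"
proof -
  note PI = primD(1)[OF P]
  obtain p where p: "p \<in> P" "p \<noteq> 0" using intidealD(5)[OF PI] by blast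
  have pO: "p \<in> Oint" using p primD(4)[OF P] by blast
  let ?I = "(*) p ` Oint"
  have I: "intideal ?I" using principal_ideal pO p(2) by blast
  have IP: "?I \<subseteq> P" using intidealD(4)[OF PI] p by auto
  \<comment> \<open>Least index means that \<open>(?I : s)\<close> is as large as possible among
    \<open>s\<close> outside \<open>P\<close>. It then absorbs all denominators outside
    \<open>P\<close>, being the contraction of the localization of \<open>?I\<close> at
    \<open>P\<close>.\<close>
  obtain s where s: "s \<in> Oint \<and> s \<notin> P"
    "\<And>d. d \<in> Oint \<and> d \<notin> P \<Longrightarrow> card (cosets Oint (coln ?I s)) \<le> card (cosets Oint (coln ?I d))"
    using ex_has_least_nat[of "\<lambda>c. c \<in> Oint \<and> c \<notin> P" 1 "\<lambda>c. card (cosets Oint (coln ?I c))"] primD(2)[OF P] Oint_1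
    by blast
  let ?J = "coln ?I s"
  have J: "intideal ?J" using coln_ideal(1)[OF I] s(1) by blast
  have J1: "1 \<notin> ?J" using s(1) IP by (auto simp: coln_def)
  have sat: "x \<in> ?J" if x: "x \<in> Oint" and t: "t \<in> Oint" "t \<notin> P" "t * x \<in> ?J" for x t
  proof -
    have ts: "t * s \<in> Oint \<and> t * s \<notin> P" using s(1) t P primD(3) Oint_mult by blast
    have "?J \<subseteq> coln ?I (t * s)"
      by (rule coln_mono[OF I t(1)])
    then have "?J = coln ?I (t * s)"
      using index_minimal_eq[OF J coln_ideal(1)[OF I]] s(2)[OF ts] ts by blast
    moreover have "x \<in> coln ?I (t * s)" using x t(3) by (simp add: coln_def mult_ac)
    ultimately show ?thesis by simp
  qed
  obtain c where c: "c \<in> Oint" "c \<notin> ?J" "prim (coln ?J c)" using ex_prim_annihilator[OF J J1] by blast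
  \<comment> \<open>By saturation no multiplier outside \<open>P\<close> can annihilate a nonzero
    class modulo \<open>?J\<close>; so the associated prime lies in \<open>P\<close>, and equals it
    by maximality.\<close>
  have "coln ?J c \<subseteq> P"
  proof
    fix b assume "b \<in> coln ?J c"
    then have "b \<in> Oint" "b * c \<in> ?J" by (auto simp: coln_def)
    then show "b \<in> P" using sat[OF c(1)] c(2) by blast
  qed
  then have eq: "coln ?J c = P" using prim_subset_eq[OF P c(3)] by blast
  have y: "s * c / p * b \<in> Oint" if b: "b \<in> P" for b
  proof -
    have "b \<in> coln ?J c" using b eq by simp
    then have "b * c * s \<in> ?I" by (simp add: coln_def)
    then obtain z where "z \<in> Oint" "b * c * s = p * z" by (elim imageE)
    then show ?thesis using p(2) by (simp add: field_simps)
  qed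
  have "s * c / p \<notin> Oint"
  proof
    assume "s * c / p \<in> Oint"
    then have "p * (s * c / p) \<in> ?I" by (rule imageI)
    then have "c * s \<in> ?I" using p(2) by (simp add: mult.commute)
    then show False using c(1,2) by (simp add: coln_def)
  qed
  moreover have "s * c / p \<in> K" using s(1) c(1) pO Oint_K by simp
  ultimately show ?thesis using y unfolding inv_unif_def by blast
qed

section \<open>The valuation attached to a prime\<close>

context
  fixes P :: "complex set" and y :: complex
  assumes P: "prim P" and y: "inv_unif P y"
begin

lemma yK: "y \<in> K" and y_notin: "y \<notin> Oint" and yP: "b \<in> P \<Longrightarrow> y * b \<in> Oint"
  using y by (auto simp: inv_unif_def)

lemma y_nz: "y \<noteq> 0" using y_notin Oint_0 by blast

text \<open>If multiplication by \<open>y\<close> preserved \<open>P\<close>, then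
  \<open>p * y ^ k\<close> would remain in \<open>P\<close> for every \<open>k\<close>, and
  \<open>y\<close> would be almost integral, hence integral.\<close>

lemma ex_unif: "\<exists>u\<in>P. y * u \<notin> P"
proof (rule ccontr)
  assume "\<not> (\<exists>u\<in>P. y * u \<notin> P)"
  then have *: "y * u \<in> P" if "u \<in> P" for u using that by blast
  obtain p where p: "p \<in> P" "p \<noteq> 0" using intidealD(5)[OF primD(1)[OF P]] by blast
  have pO: "p \<in> Oint" using p primD(4)[OF P] by blast
  obtain m q where m: "m \<ge> 1" "q \<in> Oint" "p * q = of_nat m" using ex_cofactor[OF pO p(2)] by blast
  have pk: "p * y ^ k \<in> P" for k
  proof (induction k)
    case (Suc k) then show ?case using *[OF Suc] by (simp add: mult_ac)
  qed (use p in simp)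
  have "of_nat m * y ^ k \<in> Oint" for k
  proof -
    have "of_nat m * y ^ k = q * (p * y ^ k)" using m(3) by (simp add: mult_ac)
    then show ?thesis using Oint_mult[OF m(2) primD(4)[OF P pk]] by (simp only:)
  qed
  then show False using almost_integral[OF yK m(1)] y_notin by blast
qed

text \<open>Take \<open>v\<close> in \<open>P\<close> with \<open>y * v\<close> outside
  \<open>P\<close>. Multiplication by \<open>v ^ j\<close> would produce an element lying both
  inside and outside \<open>P\<close>.\<close>

lemma unit_mult_y_power_notin:
  assumes u: "u \<in> Oint" "u \<notin> P" and j: "j \<ge> 1" shows "u * y ^ j \<notin> Oint"
proof
  assume uy: "u * y ^ j \<in> Oint"
  obtain v where v: "v \<in> P" "y * v \<notin> P" using ex_unif by blast
  have "v ^ j \<in> P" using j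
  proof (induction j rule: dec_induct)
    case (step k) then show ?case
      using intidealD(3)[OF primD(1)[OF P] primD(4)[OF P v(1)]] by simp
  qed (use v in simp)
  then have "(u * y ^ j) * v ^ j \<in> P" using intidealD(3)[OF primD(1)[OF P] uy] by blast
  moreover have "u * (y * v) ^ j \<notin> P"
    using primD(3)[OF P u(1) _ u(2)] prim_power[OF P yP[OF v(1)] v(2)] Oint_power yP v(1) by blast
  ultimately show False by (simp add: power_mult_distrib mult.assoc)
qed

text \<open>If all \<open>x * y ^ k\<close> were integral, a cofactor of \<open>x\<close> would make
  \<open>y\<close> almost integral. The last integral one is outside \<open>P\<close>, since inside
  \<open>P\<close> one further factor \<open>y\<close> would be tolerated.\<close>

lemma ex_y_power:
  assumes x: "x \<in> Oint" "x \<noteq> 0" shows "\<exists>m::nat. x * y ^ m \<in> Oint \<and> x * y ^ m \<notin> P"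
proof -
  have "\<exists>k. x * y ^ k \<notin> Oint"
  proof (rule ccontr)
    assume "\<not> (\<exists>k. x * y ^ k \<notin> Oint)"
    then have all: "x * y ^ k \<in> Oint" for k by blast
    obtain m q where m: "m \<ge> 1" "q \<in> Oint" "x * q = of_nat m" using ex_cofactor[OF x] by blast
    have "of_nat m * y ^ k \<in> Oint" for k
    proof -
      have "of_nat m * y ^ k = q * (x * y ^ k)" using m(3) by (simp add: mult_ac)
      then show ?thesis using Oint_mult[OF m(2) all] by (simp only:)
    qed
    then show False using almost_integral[OF yK m(1)] y_notin by blast
  qed
  then obtain k where k: "x * y ^ k \<notin> Oint" "\<And>j. j < k \<Longrightarrow> x * y ^ j \<in> Oint"
    using exists_least_iff[of "\<lambda>k. x * y ^ k \<notin> Oint"] by blast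
  have "k \<noteq> 0" using k(1) x by (cases k) auto
  then obtain m where m: "k = Suc m" using not0_implies_Suc by blast
  have "x * y ^ m \<notin> P"
  proof
    assume "x * y ^ m \<in> P"
    then have "y * (x * y ^ m) \<in> Oint" by (rule yP)
    then show False using k(1) m by (simp add: mult_ac)
  qed
  then show ?thesis using k(2)[of m] m by blast
qed

text \<open>The assertion that \<open>z\<close> has valuation \<open>m\<close> at \<open>P\<close>:
  up to a fraction of elements outside \<open>P\<close>, it is the \<open>m\<close>-th power of the
  uniformizer \<open>inverse y\<close>. A relation is used because existence and uniqueness of
  \<open>m\<close> are still to be shown.\<close>

definition V :: "complex \<Rightarrow> int \<Rightarrow> bool" where
  "V z m \<longleftrightarrow> (\<exists>s t. s \<in> Oint \<and> s \<notin> P \<and> t \<in> Oint \<and> t \<notin> P \<and> s * z * y powi m = t)"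

text \<open>The localization of \<open>Oint\<close> at \<open>P\<close>.\<close>

definition OP :: "complex set" where
  "OP = {z. \<exists>s. s \<in> Oint \<and> s \<notin> P \<and> s * z \<in> Oint}"

lemma notin_nz: "s \<notin> P \<Longrightarrow> s \<noteq> 0" using intidealD(6)[OF primD(1)[OF P]] by blast

lemma V_ex: assumes "z \<in> K" "z \<noteq> 0" shows "\<exists>m. V z m"
proof -
  obtain D :: nat where D: "D \<ge> 1" "of_nat D * z \<in> Oint" using ex_denominator[OF assms(1)] by blast
  obtain i where i: "of_nat D * z * y ^ i \<in> Oint" "of_nat D * z * y ^ i \<notin> P"
    using ex_y_power[OF D(2)] assms D by auto
  obtain j where j: "of_nat D * y ^ j \<in> Oint" "of_nat D * y ^ j \<notin> P"
    using ex_y_power[OF Oint_of_nat[of D]] D by auto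
  have "of_nat D * y ^ j * z * y powi (int i - int j) = of_nat D * z * y ^ i"
    using y_nz by (simp add: power_int_diff)
  then show ?thesis using i j unfolding V_def by blast
qed

lemma V_unique_aux: assumes "V z m" "V z m'" "m < m'" shows False
proof -
  obtain s t s' t' where st: "s \<in> Oint" "s \<notin> P" "t \<in> Oint" "t \<notin> P" "s * z * y powi m = t"
     "s' \<in> Oint" "s' \<notin> P" "t' \<in> Oint" "t' \<notin> P" "s' * z * y powi m' = t'"
    using assms(1,2) unfolding V_def by blast
  define j where "j = nat (m' - m)"
  have m': "m' = m + int j" and j: "j \<ge> 1" using assms(3) by (auto simp: j_def)
  have "t * s' * y ^ j = s * t'"
    using y_nz by (simp add: st(5,10)[symmetric] m' power_int_add)
  then have "t * s' * y ^ j \<in> Oint" using Oint_mult st by simp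
  moreover have "t * s' * y ^ j \<notin> Oint"
    using unit_mult_y_power_notin[OF Oint_mult[OF st(3,6)] primD(3)[OF P st(3,6,4,7)] j] .
  ultimately show False by blast
qed

lemma V_unique: "V z m \<Longrightarrow> V z m' \<Longrightarrow> m = m'"
  using V_unique_aux by (metis linorder_neqE)

lemma V_mult: assumes "V z m" "V z' m'" shows "V (z * z') (m + m')"
proof -
  obtain s t s' t' where st: "s \<in> Oint" "s \<notin> P" "t \<in> Oint" "t \<notin> P" "s * z * y powi m = t"
     "s' \<in> Oint" "s' \<notin> P" "t' \<in> Oint" "t' \<notin> P" "s' * z' * y powi m' = t'"
    using assms unfolding V_def by blast
  have "(s * s') * (z * z') * y powi (m + m') = t * t'"
    using y_nz by (simp add: st(5,10)[symmetric] power_int_add mult_ac)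
  then show ?thesis
    unfolding V_def using Oint_mult[OF st(1,6)] Oint_mult[OF st(3,8)] primD(3)[OF P st(1,6,2,7)] primD(3)[OF P st(3,8,4,9)]
    by blast
qed

lemma V_y: "V (y powi (- m)) m"
  unfolding V_def using Oint_1 primD(2)[OF P] y_nz
  by (intro exI[of _ 1]) (auto simp: power_int_minus)

lemma OP_mult: "z \<in> OP \<Longrightarrow> z' \<in> OP \<Longrightarrow> z * z' \<in> OP"
proof -
  assume "z \<in> OP" "z' \<in> OP"
  then obtain s s' where s: "s \<in> Oint" "s \<notin> P" "s * z \<in> Oint" "s' \<in> Oint" "s' \<notin> P" "s' * z' \<in> Oint"
    unfolding OP_def by blast
  have "(s * s') * (z * z') \<in> Oint" using Oint_mult[OF s(3,6)] by (simp add: mult_ac)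
  then show ?thesis unfolding OP_def using Oint_mult[OF s(1,4)] primD(3)[OF P s(1,4,2,5)] by blast
qed

lemma OP_add: "z \<in> OP \<Longrightarrow> z' \<in> OP \<Longrightarrow> z + z' \<in> OP"
proof -
  assume "z \<in> OP" "z' \<in> OP"
  then obtain s s' where s: "s \<in> Oint" "s \<notin> P" "s * z \<in> Oint" "s' \<in> Oint" "s' \<notin> P" "s' * z' \<in> Oint"
    unfolding OP_def by blast
  have "(s * s') * (z + z') = s' * (s * z) + s * (s' * z')" by (simp add: algebra_simps)
  then have "(s * s') * (z + z') \<in> Oint" using Oint_mult Oint_add s by simp
  then show ?thesis unfolding OP_def using Oint_mult[OF s(1,4)] primD(3)[OF P s(1,4,2,5)] by blast
qed

lemma OP_Oint: "z \<in> Oint \<Longrightarrow> z \<in> OP"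
  unfolding OP_def using Oint_1 primD(2)[OF P] by (intro CollectI exI[of _ 1]) auto

lemma OP_inverse_y: "inverse y \<in> OP"
proof -
  obtain v where v: "v \<in> P" "y * v \<notin> P" using ex_unif by blast
  have "y * v * inverse y = v" using y_nz by simp
  then have "y * v * inverse y \<in> Oint" using primD(4)[OF P v(1)] by (simp only:)
  then show ?thesis unfolding OP_def using v(2) yP[OF v(1)] by (intro CollectI exI[of _ "y * v"] conjI)
qed

text \<open>One direction holds because \<open>inverse y\<close> itself is in the local ring; in the
  other, a negative \<open>m\<close> would make a positive power of \<open>y\<close> integral up to
  factors outside \<open>P\<close>.\<close>

lemma OP_iff: assumes "V z m" shows "z \<in> OP \<longleftrightarrow> 0 \<le> m"
proof -
  obtain s t where st: "s \<in> Oint" "s \<notin> P" "t \<in> Oint" "t \<notin> P" "s * z * y powi m = t"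
    using assms unfolding V_def by blast
  show ?thesis
  proof
    assume m: "0 \<le> m"
    have pw: "inverse y ^ k \<in> OP" for k
      by (induction k) (auto intro: OP_mult OP_inverse_y OP_Oint[OF Oint_1])
    have "s * (t / s) = t" using notin_nz[OF st(2)] by simp
    then have "t / s \<in> OP" unfolding OP_def using st by (intro CollectI exI[of _ s]) auto
    then have "t / s * inverse y ^ nat m \<in> OP" using OP_mult pw by blast
    moreover have "t / s * inverse y ^ nat m = z"
    proof -
      have "y powi m = y ^ nat m" using m by (simp add: power_int_def)
      then have "t = s * z * y ^ nat m" using st(5) by simp
      then show ?thesis using y_nz notin_nz[OF st(2)] by (simp add: field_simps power_inverse)
    qed
    ultimately show "z \<in> OP" by simp
  next
    assume "z \<in> OP"
    then obtain s' where s': "s' \<in> Oint" "s' \<notin> P" "s' * z \<in> Oint" unfolding OP_def by blast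
    show "0 \<le> m"
    proof (rule ccontr)
      assume "\<not> 0 \<le> m"
      define j where "j = nat (- m)"
      have m: "m = - int j" and j: "j \<ge> 1" using \<open>\<not> 0 \<le> m\<close> by (auto simp: j_def)
      have "t * s' * y ^ j = s * (s' * z)"
        using y_nz by (simp add: st(5)[symmetric] m power_int_minus field_simps)
      then have "t * s' * y ^ j \<in> Oint" using Oint_mult[OF st(1) s'(3)] by (simp only:)
      then show False
        using unit_mult_y_power_notin[OF Oint_mult[OF st(3) s'(1)] primD(3)[OF P st(3) s'(1) st(4) s'(2)] j] by blast
    qed
  qed
qed

text \<open>Scaling by \<open>y powi min m m'\<close> makes both valuations nonnegative, and the
  ultrametric inequality becomes closure of the local ring under addition.\<close>

lemma V_min:
  assumes "V z m" "V z' m'" "V (z + z') n" shows "min m m' \<le> n"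
proof -
  define k where "k = min m m'"
  have Vk: "V (y powi k) (- k)" using V_y[of "- k"] by simp
  note V' = V_mult[OF assms(1) Vk] V_mult[OF assms(2) Vk] V_mult[OF assms(3) Vk]
  have "z * y powi k \<in> OP" "z' * y powi k \<in> OP"
    using OP_iff[OF V'(1)] OP_iff[OF V'(2)] by (auto simp: k_def)
  then have "z * y powi k + z' * y powi k \<in> OP" by (rule OP_add)
  then have "(z + z') * y powi k \<in> OP" by (simp only: distrib_right)
  then have "0 \<le> n + (- k)" using OP_iff[OF V'(3)] by blast
  then show ?thesis by (simp add: k_def)
qed

lemma V_pos_iff: assumes "x \<in> Oint" "V x m" shows "0 < m \<longleftrightarrow> x \<in> P"
proof -
  have m0: "0 \<le> m" using OP_iff[OF assms(2)] OP_Oint[OF assms(1)] by blast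
  obtain s t where st: "s \<in> Oint" "s \<notin> P" "t \<in> Oint" "t \<notin> P" "s * x * y powi m = t"
    using assms unfolding V_def by blast
  show ?thesis
  proof
    assume m: "0 < m"
    show "x \<in> P"
    proof (rule ccontr)
      assume "x \<notin> P"
      then have "V x 0" using assms(1) Oint_1 primD(2)[OF P] unfolding V_def by (intro exI[of _ 1] exI[of _ x]) auto
      then show False using V_unique[OF assms(2)] m by simp
    qed
  next
    assume x: "x \<in> P"
    show "0 < m"
    proof (rule ccontr)
      assume "\<not> 0 < m"
      then have "s * x = t" using m0 st(5) by simp
      then show False using intidealD(3)[OF primD(1)[OF P] st(1) x] st(4) by simp
    qed
  qed
qed
end

text \<open>With \<open>b\<close> an inverse of \<open>s\<close> modulo \<open>P\<close>, the
  integral element \<open>b * (s * z)\<close> has the same residue as \<open>z\<close>. This carries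
  residues of the local ring back to \<open>Oint\<close>.\<close>

lemma V_coset_reduce:
  assumes P: "prim P" and s: "s \<in> Oint" "s \<notin> P" "s * z \<in> Oint"
  shows "\<exists>a\<in>Oint. \<exists>q\<in>P. z - a = z * q"
proof -
  obtain b where b: "b \<in> Oint" "s * b - 1 \<in> P" using prim_inverse[OF P s(1,2)] by blast
  have "- (s * b - 1) \<in> P" using add_subgroup_closed(3)[OF intidealD(2)[OF primD(1)[OF P]] b(2)] .
  moreover have "z - b * (s * z) = z * (- (s * b - 1))" by (simp add: algebra_simps)
  ultimately show ?thesis using Oint_mult[OF b(1) s(3)] by blast
qed

section \<open>Arbitrary discrete valuations of the field\<close>

definition dval :: "(complex \<Rightarrow> int) \<Rightarrow> bool" where
  "dval w \<longleftrightarrow> w ` (K - {0}) = UNIV \<and>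
     (\<forall>x\<in>K - {0}. \<forall>y\<in>K - {0}. w (x * y) = w x + w y) \<and>
     (\<forall>x\<in>K - {0}. \<forall>y\<in>K - {0}. x + y \<noteq> 0 \<longrightarrow> min (w x) (w y) \<le> w (x + y))"

definition Pw :: "(complex \<Rightarrow> int) \<Rightarrow> complex set" where
  "Pw w = {x\<in>Oint. x = 0 \<or> 0 < w x}"

lemma ex_dval: assumes P: "prim P" shows "\<exists>w. dval w \<and> Pw w = P"
proof -
  obtain y where y: "inv_unif P y" using ex_inv_unif[OF P] by blast
  note U = V_unique[OF P y]
  have "\<forall>z\<in>K - {0}. \<exists>m. V P y z m" using V_ex[OF P y] by blast
  then obtain w where w: "\<And>z. z \<in> K \<Longrightarrow> z \<noteq> 0 \<Longrightarrow> V P y z (w z)" by (metis Diff_iff singletonD)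
  have "dval w"
    unfolding dval_def
  proof (intro conjI ballI impI)
    show "w ` (K - {0}) = UNIV"
    proof (rule UNIV_eq_I[symmetric])
      fix m
      have yk: "y powi (- m) \<in> K - {0}" using yK[OF P y] y_nz[OF P y] by simp
      then have "w (y powi (- m)) = m" using U[OF w V_y[OF P y]] by simp
      then show "m \<in> w ` (K - {0})" using yk by (metis imageI)
    qed
    fix x z assume xz: "x \<in> K - {0}" "z \<in> K - {0}"
    show "w (x * z) = w x + w z"
      using U[OF w V_mult[OF P y w w]] xz by simp
    assume "x + z \<noteq> 0"
    then show "min (w x) (w z) \<le> w (x + z)"
      using V_min[OF P y w w w] xz by simp
  qed
  moreover have "Pw w = P"
  proof -
    have "x \<in> P \<longleftrightarrow> x \<in> Pw w" for x
    proof (cases "x \<in> Oint \<and> x \<noteq> 0")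
      case True
      then show ?thesis using V_pos_iff[OF P y _ w] Oint_K unfolding Pw_def by auto
    next
      case False
      then show ?thesis
        using primD(4)[OF P] intidealD(6)[OF primD(1)[OF P]] Oint_0 unfolding Pw_def by auto
    qed
    then show ?thesis by blast
  qed
  ultimately show ?thesis by blast
qed

context
  fixes w assumes w: "dval w"
begin

lemma dval_mult: "x \<in> K \<Longrightarrow> x \<noteq> 0 \<Longrightarrow> y \<in> K \<Longrightarrow> y \<noteq> 0 \<Longrightarrow> w (x * y) = w x + w y"
  using w unfolding dval_def by auto
lemma dval_add:
  "x \<in> K \<Longrightarrow> x \<noteq> 0 \<Longrightarrow> y \<in> K \<Longrightarrow> y \<noteq> 0 \<Longrightarrow> x + y \<noteq> 0 \<Longrightarrow> min (w x) (w y) \<le> w (x + y)"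
  using w unfolding dval_def by auto
lemma dval_surj: "\<exists>x\<in>K. x \<noteq> 0 \<and> w x = m"
proof -
  have "m \<in> w ` (K - {0})" using w unfolding dval_def by blast
  then show ?thesis by (elim imageE) auto
qed
lemma dval_1: "w 1 = 0" using dval_mult[of 1 1] by simp
lemma dval_uminus: assumes "x \<in> K" "x \<noteq> 0" shows "w (- x) = w x"
proof -
  have "w (-1) + w (-1) = 0" using dval_mult[of "-1" "-1"] dval_1 by simp
  then show ?thesis using dval_mult[of "-1" x] assms by simp
qed
lemma dval_power: assumes "x \<in> K" "x \<noteq> 0" shows "w (x ^ k) = int k * w x"
  by (induction k) (use assms dval_1 dval_mult in \<open>auto simp: algebra_simps\<close>)

lemma dval_sum:
  assumes "\<And>i. i \<in> I \<Longrightarrow> g i \<in> K" "\<And>i. i \<in> I \<Longrightarrow> g i \<noteq> 0 \<Longrightarrow> b \<le> w (g i)" "sum g I \<noteq> 0"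
  shows "b \<le> w (sum g I)"
  using assms
proof (induction I rule: infinite_finite_induct)
  case (insert i I)
  have K: "g i \<in> K" "sum g I \<in> K" using insert by auto
  show ?case
  proof (cases "g i = 0 \<or> sum g I = 0")
    case True then show ?thesis using insert by auto
  next
    case False
    then have "min (w (g i)) (w (sum g I)) \<le> w (g i + sum g I)"
      using insert K by (intro dval_add) auto
    moreover have "b \<le> w (g i)" "b \<le> w (sum g I)" using insert False by auto
    ultimately show ?thesis using insert by simp
  qed
qed auto

lemma dval_of_nat: assumes "m \<ge> 1" shows "0 \<le> w (of_nat m)"
proof -
  have "(\<Sum>i<m. 1) = (of_nat m :: complex)" by simp
  then show ?thesis using dval_sum[of "{..<m}" "\<lambda>_. 1" 0] dval_1 assms by simp
qed

lemma dval_of_int: assumes "m \<noteq> 0" shows "0 \<le> w (of_int m)"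
proof (cases "m > 0")
  case True then show ?thesis using dval_of_nat[of "nat m"] by simp
next
  case False
  then show ?thesis using dval_of_nat[of "nat (- m)"] dval_uminus[of "of_int m"] assms by simp
qed

text \<open>On \<open>A\<close> the valuation is bounded below, since only finitely many powers of
  \<alpha> serve as a basis and integers have nonnegative valuation. As \<open>D * x ^ k\<close>
  lies in \<open>A\<close> for all \<open>k\<close>, a negative \<open>w x\<close> is
  impossible.\<close>

lemma dval_Oint: assumes x: "x \<in> Oint" "x \<noteq> 0" shows "0 \<le> w x"
proof -
  define B where "B = (\<Sum>i<deg. \<bar>int i * w \<alpha>\<bar>)"
  have low: "- B \<le> w a" if a: "a \<in> A" "a \<noteq> 0" for a
  proof -
    obtain c :: "nat \<Rightarrow> int" where c: "a = (\<Sum>i<deg. of_int (c i) * \<alpha> ^ i)" using a(1) by (rule A_coordinates)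
    have "- B \<le> w (of_int (c i) * \<alpha> ^ i)" if i: "i < deg" "of_int (c i) * \<alpha> ^ i \<noteq> 0" for i
    proof -
      have nz: "c i \<noteq> 0" "\<alpha> ^ i \<noteq> 0" using i(2) by auto
      have "w (\<alpha> ^ i) = int i * w \<alpha>"
        using nz(2) dval_1 by (cases "i = 0") (auto intro: dval_power)
      then have "w (of_int (c i) * \<alpha> ^ i) = w (of_int (c i)) + int i * w \<alpha>"
        using nz by (subst dval_mult) auto
      moreover have "0 \<le> w (of_int (c i))" using dval_of_int nz by blast
      moreover have "\<bar>int i * w \<alpha>\<bar> \<le> B"
        unfolding B_def using i(1) by (intro member_le_sum[where f = "\<lambda>i. \<bar>int i * w \<alpha>\<bar>"]) auto
      ultimately show ?thesis by linarith
    qed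
    then show ?thesis unfolding c using a(2) c by (intro dval_sum) auto
  qed
  obtain D :: nat where D: "D \<ge> 1" "\<And>k. of_nat D * x ^ k \<in> A" using x(1) by (rule OintE) blast
  have *: "- B \<le> w (of_nat D) + int k * w x" for k
    using low[OF D(2)[of k]] x D(1) Oint_K by (simp add: dval_mult dval_power)
  show ?thesis
  proof (rule ccontr)
    assume "\<not> 0 \<le> w x"
    then have "int (nat (B + w (of_nat D) + 1)) * w x \<le> int (nat (B + w (of_nat D) + 1)) * (-1)"
      by (intro mult_left_mono) auto
    then show False using *[of "nat (B + w (of_nat D) + 1)"] by linarith
  qed
qed

lemma prim_Pw: "prim (Pw w)"
  unfolding prim_def intideal_def
proof (intro conjI ballI impI)
  show "Pw w \<subseteq> Oint" by (auto simp: Pw_def)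
  show "1 \<notin> Pw w" by (simp add: Pw_def dval_1)
  show "add_subgroup (Pw w)"
  proof (rule add_subgroupI)
    show "0 \<in> Pw w" by (simp add: Pw_def Oint_0)
    fix x z assume xz: "x \<in> Pw w" "z \<in> Pw w"
    then have O: "x \<in> Oint" "z \<in> Oint" "x - z \<in> Oint" by (auto simp: Pw_def Oint_diff)
    have "0 < w (x - z)" if ne: "x - z \<noteq> 0" "x \<noteq> 0" "z \<noteq> 0"
    proof -
      have "min (w x) (w (- z)) \<le> w (x + (- z))"
        using O ne by (intro dval_add) (auto simp: Oint_K)
      moreover have "0 < w x" "0 < w z" using xz ne by (auto simp: Pw_def)
      moreover have "w (- z) = w z" using O ne Oint_K by (intro dval_uminus) auto
      ultimately show ?thesis by simp
    qed
    moreover have "0 < w (x - z)" if "x - z \<noteq> 0" "x = 0 \<or> z = 0"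
      using xz that O Oint_K dval_uminus by (auto simp: Pw_def)
    ultimately show "x - z \<in> Pw w" using O unfolding Pw_def by blast
  qed
  show "x * z \<in> Pw w" if "x \<in> Oint" "z \<in> Pw w" for x z
  proof (cases "x = 0 \<or> z = 0")
    case True then show ?thesis using that by (auto simp: Pw_def Oint_0)
  next
    case False
    then have "w (x * z) = w x + w z" "0 \<le> w x" "0 < w z"
      using that Oint_K by (auto simp: Pw_def intro!: dval_mult dval_Oint)
    then show ?thesis using that by (auto simp: Pw_def Oint_mult)
  qed
  show "x \<in> Pw w \<or> z \<in> Pw w" if "x \<in> Oint" "z \<in> Oint" "x * z \<in> Pw w" for x z
  proof (cases "x = 0 \<or> z = 0")
    case True then show ?thesis using that by (auto simp: Pw_def)
  next
    case False
    then have "w (x * z) = w x + w z" "0 \<le> w x" "0 \<le> w z"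
      using that Oint_K by (auto intro!: dval_mult dval_Oint)
    then show ?thesis using that False by (auto simp: Pw_def)
  qed
  show "\<exists>x\<in>Pw w. x \<noteq> 0"
  proof -
    obtain x where x: "x \<in> K" "x \<noteq> 0" "w x = 1" using dval_surj by blast
    obtain D :: nat where D: "D \<ge> 1" "of_nat D * x \<in> Oint" using ex_denominator[OF x(1)] by blast
    have "w (of_nat D * x) = w (of_nat D) + 1" using x D(1) by (subst dval_mult) auto
    then have "0 < w (of_nat D * x)" using dval_of_nat[OF D(1)] by linarith
    then have "of_nat D * x \<in> Pw w" using D(2) by (simp add: Pw_def)
    moreover have "of_nat D * x \<noteq> 0" using D(1) x(2) by simp
    ultimately show ?thesis by blast
  qed
qed

lemma dval_unit: assumes "s \<in> Oint" "s \<notin> Pw w" shows "s \<noteq> 0" "w s = 0" "s \<in> K"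
proof -
  show "s \<noteq> 0" "s \<in> K" using assms Oint_0 Oint_K by (auto simp: Pw_def)
  then show "w s = 0" using assms dval_Oint[of s] by (auto simp: Pw_def)
qed

text \<open>Integral elements outside \<open>Pw w\<close> have valuation 0, so exponent
  \<open>m\<close> in \<open>V\<close> forces \<open>w x = - m * w y\<close>. Applied to an element
  with \<open>w x = 1\<close> this makes \<open>w y\<close> a unit of the integers, negative because
  \<open>y * v\<close> is a unit for some \<open>v\<close> in the prime; so \<open>w y = -1\<close>.
  Hence a normalized valuation is determined by its prime.\<close>

lemma dval_eq_V:
  assumes y: "inv_unif (Pw w) y" and z: "z \<in> K" "z \<noteq> 0"
  shows "V (Pw w) y z (w z)"
proof -
  note P = prim_Pw
  have y': "y \<in> K" "y \<noteq> 0" using yK[OF P y] y_nz[OF P y] by auto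
  have powi: "w (y powi m) = m * w y" for m
  proof (cases "m \<ge> 0")
    case True then show ?thesis using dval_power[OF y', of "nat m"] by (simp add: power_int_def)
  next
    case False
    have "w (inverse y) = - w y" using dval_mult[of y "inverse y"] y' dval_1 by simp
    then show ?thesis using False dval_power[of "inverse y" "nat (- m)"] y' by (simp add: power_int_def)
  qed
  have rel: "w x + m * w y = 0" if "V (Pw w) y x m" "x \<in> K" "x \<noteq> 0" for x m
  proof -
    from that(1)[unfolded V_def[OF P y]] obtain s t where st: "s \<in> Oint" "s \<notin> Pw w" "t \<in> Oint" "t \<notin> Pw w" "s * x * y powi m = t"
      by blast
    have "w (s * x * y powi m) = w s + w x + w (y powi m)"
      using dval_unit[OF st(1,2)] that y' by (simp add: dval_mult)
    then show ?thesis using st(5) dval_unit(2)[OF st(1,2)] dval_unit(2)[OF st(3,4)] powi by simp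
  qed
  obtain v where v: "v \<in> Pw w" "y * v \<notin> Pw w" using ex_unif[OF P y] by blast
  have yv: "y * v \<in> Oint" using yP[OF P y v(1)] .
  have v': "v \<in> K" "v \<noteq> 0" "0 < w v" using v yv dval_unit(1)[OF yv v(2)] by (auto simp: Pw_def Oint_K)
  have neg: "w y < 0" using dval_unit(2)[OF yv v(2)] dval_mult[of y v] y' v' by simp
  obtain x where x: "x \<in> K" "x \<noteq> 0" "w x = 1" using dval_surj by blast
  obtain m where "V (Pw w) y x m" using V_ex[OF P y x(1,2)] by blast
  then have "m * w y = - 1" using rel x by fastforce
  then have wy: "w y = -1" using neg by (metis minus_mult_minus minus_minus mult.commute zmult_eq_1_iff mult_minus_left not_less zero_le_one)
  obtain k where k: "V (Pw w) y z k" using V_ex[OF P y z] by blast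
  then have "k = w z" using rel[OF k z] wy by simp
  then show ?thesis using k by simp
qed

lemma max_ideal_subgroup: "add_subgroup {x\<in>K. x = 0 \<or> 0 < w x}"
proof (rule add_subgroupI)
  fix x z assume xz: "x \<in> {x\<in>K. x = 0 \<or> 0 < w x}" "z \<in> {x\<in>K. x = 0 \<or> 0 < w x}"
  show "x - z \<in> {x\<in>K. x = 0 \<or> 0 < w x}"
  proof (cases "x - z = 0 \<or> x = 0 \<or> z = 0")
    case True
    then consider "x - z = 0" | "z = 0" | "x = 0" "z \<noteq> 0" by blast
    then show ?thesis using xz dval_uminus[of z] by cases auto
  next
    case False
    then have "min (w x) (w (- z)) \<le> w (x + (- z))" using xz by (intro dval_add) auto
    then show ?thesis using xz False dval_uminus[of z] by auto
  qed
qed simp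

text \<open>Each residue class of the valuation ring contains an integral element by
  \<open>V_coset_reduce\<close>, and for integral elements both congruences are the same. The norm
  of the prime is thus the size of the residue field.\<close>

lemma residue_card:
  "card (cosets {x\<in>K. x = 0 \<or> 0 \<le> w x} {x\<in>K. x = 0 \<or> 0 < w x}) = card (cosets Oint (Pw w))"
proof -
  let ?R = "{x\<in>K. x = 0 \<or> 0 \<le> w x}" and ?M = "{x\<in>K. x = 0 \<or> 0 < w x}"
  note P = prim_Pw
  obtain y where y: "inv_unif (Pw w) y" using ex_inv_unif[OF P] by blast
  note S = max_ideal_subgroup
  have OR: "Oint \<subseteq> ?R" using Oint_K dval_Oint by blast
  have red: "\<exists>a\<in>Oint. x - a \<in> ?M" if x: "x \<in> ?R" for x
  proof (cases "x = 0")
    case True then show ?thesis using Oint_0 by (intro bexI[of _ 0]) auto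
  next
    case False
    then have xK: "x \<in> K" "0 \<le> w x" using x by auto
    have "x \<in> OP (Pw w)" using OP_iff[OF P y dval_eq_V[OF y xK(1) False]] xK(2) by blast
    from this[unfolded OP_def[OF P y]] obtain s where s: "s \<in> Oint" "s \<notin> Pw w" "s * x \<in> Oint" by blast
    obtain a q where a: "a \<in> Oint" "q \<in> Pw w" "x - a = x * q" using V_coset_reduce[OF P s] by blast
    have "x * q \<in> ?M"
    proof (cases "q = 0")
      case qnz: False
      have "q \<in> K" "0 < w q" using a(2) qnz Oint_K by (auto simp: Pw_def)
      then show ?thesis using dval_mult[OF xK(1) False _ qnz] xK by simp
    qed simp
    then have "x - a \<in> ?M" by (simp only: a(3))
    then show ?thesis using a(1) by blast
  qed
  have img: "cosets ?R ?M = (\<lambda>x. (+) x ` ?M) ` Oint"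
  proof
    show "cosets ?R ?M \<subseteq> (\<lambda>x. (+) x ` ?M) ` Oint"
    proof
      fix Y assume "Y \<in> cosets ?R ?M"
      then obtain x where x: "x \<in> ?R" "Y = (+) x ` ?M" unfolding cosets_def by (elim imageE)
      obtain a where a: "a \<in> Oint" "x - a \<in> ?M" using red[OF x(1)] by blast
      have "(+) x ` ?M = (+) a ` ?M" by (rule iffD2[OF coset_eq_iff[OF S] a(2)])
      then show "Y \<in> (\<lambda>x. (+) x ` ?M) ` Oint"
        unfolding x(2) by (simp only:) (rule imageI[OF a(1)])
    qed
    show "(\<lambda>x. (+) x ` ?M) ` Oint \<subseteq> cosets ?R ?M"
      unfolding cosets_def by (rule image_mono[OF OR])
  qed
  have "((+) x ` ?M = (+) z ` ?M) = ((+) x ` Pw w = (+) z ` Pw w)" if "x \<in> Oint" "z \<in> Oint" for x z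
  proof -
    have "x - z \<in> ?M \<longleftrightarrow> x - z \<in> Pw w"
      using Oint_diff[OF that] Oint_K by (auto simp: Pw_def)
    then show ?thesis
      using coset_eq_iff[OF S, of x z] coset_eq_iff[OF intidealD(2)[OF primD(1)[OF P]], of x z] by simp
  qed
  then have "card ((\<lambda>x. (+) x ` ?M) ` Oint) = card ((\<lambda>x. (+) x ` Pw w) ` Oint)"
    by (rule card_image_eq_if_same_kernel)
  then show ?thesis unfolding img by (simp add: cosets_def)
qed

end

lemma dval_unique:
  assumes "dval w" "dval w'" "Pw w = Pw w'" "z \<in> K" "z \<noteq> 0" shows "w z = w' z"
proof -
  obtain y where y: "inv_unif (Pw w) y" using ex_inv_unif[OF prim_Pw[OF assms(1)]] by blast
  have "V (Pw w) y z (w z)" "V (Pw w) y z (w' z)"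
    using dval_eq_V[OF assms(1) y assms(4,5)] dval_eq_V[OF assms(2), of y z] y assms by auto
  then show ?thesis by (rule V_unique[OF prim_Pw[OF assms(1)] y])
qed

end

section \<open>The product formula\<close>

context number_field
begin

text \<open>Only the values at nonzero elements of \<open>K\<close> are determined, by
  \<open>dval_unique\<close>.\<close>

definition vv :: "complex set \<Rightarrow> complex \<Rightarrow> int" where
  "vv P = (SOME w. dval w \<and> Pw w = P)"

lemma vv: assumes "prim P" shows "dval (vv P)" "Pw (vv P) = P"
  using someI_ex[OF ex_dval[OF assms]] by (auto simp: vv_def)

lemma vv_nonneg: "prim P \<Longrightarrow> x \<in> Oint \<Longrightarrow> x \<noteq> 0 \<Longrightarrow> 0 \<le> vv P x"
  using dval_Oint vv by blast

lemma vv_mult: "prim P \<Longrightarrow> x \<in> K \<Longrightarrow> x \<noteq> 0 \<Longrightarrow> y \<in> K \<Longrightarrow> y \<noteq> 0 \<Longrightarrow> vv P (x * y) = vv P x + vv P y"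
  using dval_mult vv by blast

lemma vv_pos_iff: "prim P \<Longrightarrow> x \<in> Oint \<Longrightarrow> x \<noteq> 0 \<Longrightarrow> 0 < vv P x \<longleftrightarrow> x \<in> P"
  using vv(2)[of P] by (auto simp: Pw_def)

text \<open>The exponent of \<open>P\<close> in the factorization of \<open>I\<close>, read off as
  the least valuation on \<open>I\<close> so that products of ideals never have to be
  formed.\<close>

definition ordI :: "complex set \<Rightarrow> complex set \<Rightarrow> nat" where
  "ordI P I = (LEAST m. \<exists>x\<in>I. x \<noteq> 0 \<and> vv P x = int m)"

lemma ordI_attained:
  assumes "prim P" "intideal I" shows "\<exists>x\<in>I. x \<noteq> 0 \<and> vv P x = int (ordI P I)"
proof -
  obtain x where x: "x \<in> I" "x \<noteq> 0" using intidealD(5)[OF assms(2)] by blast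
  then have "0 \<le> vv P x" using vv_nonneg[OF assms(1)] intidealD(1)[OF assms(2)] by blast
  then have "\<exists>m. \<exists>x\<in>I. x \<noteq> 0 \<and> vv P x = int m" using x by (intro exI[of _ "nat (vv P x)"]) auto
  then show ?thesis unfolding ordI_def by (rule LeastI_ex)
qed

lemma ordI_le:
  assumes "prim P" "intideal I" "x \<in> I" "x \<noteq> 0" shows "int (ordI P I) \<le> vv P x"
proof -
  have n: "0 \<le> vv P x" using vv_nonneg[OF assms(1)] intidealD(1)[OF assms(2)] assms by blast
  have "ordI P I \<le> nat (vv P x)" unfolding ordI_def using n assms by (intro Least_le bexI[of _ x]) auto
  then show ?thesis using n by linarith
qed

lemma ordI_eqI:
  assumes "prim P" "intideal I" "x \<in> I" "x \<noteq> 0" "vv P x = int m"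
    "\<And>z. z \<in> I \<Longrightarrow> z \<noteq> 0 \<Longrightarrow> int m \<le> vv P z"
  shows "ordI P I = m"
  using ordI_attained[OF assms(1,2)] ordI_le[OF assms(1-4)] assms(5,6) by fastforce

lemma ordI_mono:
  assumes "prim P" "intideal I" "intideal J" "I \<subseteq> J" shows "ordI P J \<le> ordI P I"
proof -
  obtain x where "x \<in> I" "x \<noteq> 0" "vv P x = int (ordI P I)" using ordI_attained[OF assms(1,2)] by blast
  then show ?thesis using ordI_le[OF assms(1,3), of x] assms(4) by auto
qed

abbreviation NP :: "complex set \<Rightarrow> nat" where "NP P \<equiv> card (cosets Oint P)"

lemma NP_ge_2: assumes P: "prim P" shows "NP P \<ge> 2"
proof (rule ccontr)
  assume "\<not> NP P \<ge> 2"
  moreover have "NP P \<noteq> 0"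
    using finite_cosets_ideal[OF primD(1)[OF P]] Oint_0 by (auto simp: cosets_def)
  ultimately have "NP P = 1" by simp
  then have "1 \<in> P"
    by (rule card_cosets_eq_1[OF intidealD(2)[OF primD(1)[OF P]] Oint_subgroup _ Oint_1])
  then show False using primD(2)[OF P] by blast
qed

text \<open>\<open>J\<close> is the ideal generated by \<open>I\<close> and \<open>c\<close>. The
  map sending \<open>b\<close> to \<open>b * c\<close> identifies \<open>Oint\<close> modulo
  \<open>(I : c)\<close> with \<open>J\<close> modulo \<open>I\<close>, so this is one simple step
  in a filtration of \<open>Oint\<close> modulo \<open>I\<close>.\<close>

lemma enlarge_ideal:
  assumes I: "intideal I" and c: "c \<in> Oint" "c \<notin> I" "prim (coln I c)"
  defines "J \<equiv> {u + b * c |u b. u \<in> I \<and> b \<in> Oint}"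
  shows "intideal J" "I \<subseteq> J" "c \<in> J" "card (cosets J I) = NP (coln I c)"
    "\<And>q x. q \<in> coln I c \<Longrightarrow> x \<in> J \<Longrightarrow> q * x \<in> I"
proof -
  note S = intidealD(2)[OF I]
  show IJ: "I \<subseteq> J"
  proof
    fix u assume "u \<in> I"
    then have "u + 0 * c \<in> J" unfolding J_def using Oint_0 by blast
    then show "u \<in> J" by simp
  qed
  have "0 + 1 * c \<in> J" unfolding J_def using Oint_1 intidealD(6)[OF I] by blast
  then show cJ: "c \<in> J" by simp
  have JO: "J \<subseteq> Oint" using intidealD(1)[OF I] c(1) by (auto simp: J_def Oint_add Oint_mult)
  have SJ: "add_subgroup J"
  proof (rule add_subgroupI)
    show "0 \<in> J" using IJ intidealD(6)[OF I] by blast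
    fix x z assume "x \<in> J" "z \<in> J"
    then obtain u b u' b' where ub: "x = u + b * c" "u \<in> I" "b \<in> Oint" "z = u' + b' * c" "u' \<in> I" "b' \<in> Oint"
      unfolding J_def by blast
    have "x - z = (u - u') + (b - b') * c" using ub by (simp add: algebra_simps)
    moreover have "u - u' \<in> I" using add_subgroup_closed(2)[OF S] ub by blast
    ultimately show "x - z \<in> J" unfolding J_def using Oint_diff ub by blast
  qed
  have mult: "x * z \<in> J" if x: "x \<in> Oint" and z: "z \<in> J" for x z
  proof -
    obtain u b where ub: "z = u + b * c" "u \<in> I" "b \<in> Oint" using z unfolding J_def by blast
    have "x * z = x * u + (x * b) * c" using ub by (simp add: algebra_simps)
    then show ?thesis unfolding J_def using intidealD(3)[OF I x ub(2)] Oint_mult[OF x ub(3)] by blast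
  qed
  show "intideal J"
    unfolding intideal_def using JO SJ mult IJ intidealD(5)[OF I] by blast
  show "q * x \<in> I" if q: "q \<in> coln I c" and x: "x \<in> J" for q x
  proof -
    obtain u b where ub: "x = u + b * c" "u \<in> I" "b \<in> Oint" using x unfolding J_def by blast
    have qq: "q \<in> Oint" "q * c \<in> I" using q by (auto simp: coln_def)
    have "q * x = q * u + b * (q * c)" using ub by (simp add: algebra_simps)
    then show ?thesis
      using add_subgroup_closed(4)[OF S intidealD(3)[OF I qq(1) ub(2)] intidealD(3)[OF I ub(3) qq(2)]] by simp
  qed
  let ?Q = "coln I c"
  have SQ: "add_subgroup ?Q" using intidealD(2)[OF primD(1)[OF c(3)]] .
  have img: "cosets J I = (\<lambda>b. (+) (b * c) ` I) ` Oint"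
  proof
    show "cosets J I \<subseteq> (\<lambda>b. (+) (b * c) ` I) ` Oint"
    proof
      fix Y assume "Y \<in> cosets J I"
      then obtain x where x: "x \<in> J" "Y = (+) x ` I" unfolding cosets_def by (elim imageE)
      obtain u b where ub: "x = u + b * c" "u \<in> I" "b \<in> Oint" using x(1) unfolding J_def by blast
      then have "x - b * c \<in> I" by simp
      then have "(+) x ` I = (+) (b * c) ` I" by (rule iffD2[OF coset_eq_iff[OF S]])
      then show "Y \<in> (\<lambda>b. (+) (b * c) ` I) ` Oint"
        unfolding x(2) by (simp only:) (rule imageI[OF ub(3)])
    qed
    show "(\<lambda>b. (+) (b * c) ` I) ` Oint \<subseteq> cosets J I"
    proof (rule image_subsetI)
      fix b assume "b \<in> Oint"
      then have "b * c \<in> J" using mult cJ by blast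
      then show "(+) (b * c) ` I \<in> cosets J I" unfolding cosets_def by (rule imageI)
    qed
  qed
  have "((+) (b * c) ` I = (+) (b' * c) ` I) = ((+) b ` ?Q = (+) b' ` ?Q)" if "b \<in> Oint" "b' \<in> Oint" for b b'
  proof -
    have "b * c - b' * c \<in> I \<longleftrightarrow> b - b' \<in> ?Q"
      using Oint_diff[OF that] by (simp add: coln_def left_diff_distrib)
    then show ?thesis using coset_eq_iff[OF S, of "b * c" "b' * c"] coset_eq_iff[OF SQ, of b b'] by simp
  qed
  then have "card ((\<lambda>b. (+) (b * c) ` I) ` Oint) = card ((\<lambda>b. (+) b ` ?Q) ` Oint)"
    by (rule card_image_eq_if_same_kernel)
  then show "card (cosets J I) = NP ?Q" unfolding img by (simp add: cosets_def)
qed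

text \<open>The element \<open>y\<close> inverting \<open>P\<close> locally has valuation -1, and it
  becomes a unit when multiplied by a suitable element of \<open>P\<close>.\<close>

lemma ex_vv_eq_1: assumes P: "prim P" shows "\<exists>q\<in>P. q \<noteq> 0 \<and> vv P q = 1"
proof -
  obtain z where z: "z \<in> K" "z \<noteq> 0" "vv P z = 1" using dval_surj[OF vv(1)[OF P]] by blast
  obtain y where y: "inv_unif P y" using ex_inv_unif[OF P] by blast
  obtain u where u: "u \<in> P" "y * u \<notin> P" using ex_unif[OF P y] by blast
  have yu: "y * u \<in> Oint" using yP[OF P y u(1)] .
  have nz: "y \<noteq> 0" "u \<noteq> 0" "y \<in> K" "u \<in> K"
    using y_nz[OF P y] yK[OF P y] u intidealD(6)[OF primD(1)[OF P]] primD(4)[OF P u(1)] Oint_K by auto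
  have "V P y (y powi (- (- 1))) (- 1)" by (rule V_y[OF P y])
  then have Vy: "V P y y (-1)" by simp
  have "V P y y (vv P y)" using dval_eq_V[OF vv(1)[OF P], of y y] y nz vv(2)[OF P] by simp
  then have "vv P y = - 1" using V_unique[OF P y _ Vy] by blast
  moreover have "vv P (y * u) = 0" using dval_unit(2)[OF vv(1)[OF P] yu] u(2) vv(2)[OF P] by simp
  ultimately have "vv P u = 1" using vv_mult[OF P nz(3,1,4,2)] by simp
  then show ?thesis using u nz by blast
qed

text \<open>Multiplying \<open>J\<close> by an element of the prime \<open>(I : c)\<close> lands in
  \<open>I\<close>. Taking this element outside \<open>P\<close>, or with valuation 1 when
  \<open>P\<close> is that prime, bounds the growth of the exponent by 0 or 1.\<close>

lemma index_step:
  assumes I: "intideal I" and J: "intideal J" "I \<subseteq> J" and c: "c \<in> J" "c \<notin> I"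
    and Q: "prim (coln I c)" and ann: "\<forall>q\<in>coln I c. \<forall>x\<in>J. q * x \<in> I" and P: "prim P"
  shows "ordI P I = (if P = coln I c then ordI P J + 1 else ordI P J)"
proof -
  let ?Q = "coln I c"
  have low: "ordI P J \<le> ordI P I" using ordI_mono[OF P I J] .
  have up: "int (ordI P I) \<le> vv P q + int (ordI P J)" if q: "q \<in> ?Q" "q \<noteq> 0" for q
  proof -
    obtain x where x: "x \<in> J" "x \<noteq> 0" "vv P x = int (ordI P J)" using ordI_attained[OF P J(1)] by blast
    have "q \<in> K" "x \<in> K" using q x primD(4)[OF Q] intidealD(1)[OF J(1)] Oint_K by auto
    then have "vv P (q * x) = vv P q + int (ordI P J)" using vv_mult[OF P] q x by simp
    then show ?thesis using ordI_le[OF P I bspec[OF bspec[OF ann q(1)] x(1)]] q x by simp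
  qed
  show ?thesis
  proof (cases "P = ?Q")
    case False
    then have "\<not> ?Q \<subseteq> P" using prim_subset_eq[OF P Q] by blast
    then obtain q where q: "q \<in> ?Q" "q \<notin> P" by blast
    have qO: "q \<in> Oint" using q primD(4)[OF Q] by blast
    have "q \<noteq> 0" using q intidealD(6)[OF primD(1)[OF P]] by blast
    moreover have "vv P q = 0" using dval_unit(2)[OF vv(1)[OF P] qO] q vv(2)[OF P] by simp
    ultimately show ?thesis using up[OF q(1)] low False by simp
  next
    case True
    obtain q where q: "q \<in> P" "q \<noteq> 0" "vv P q = 1" using ex_vv_eq_1[OF P] by blast
    then have le: "ordI P I \<le> ordI P J + 1" using up[of q] True by simp
    \<comment> \<open>If the exponents agreed, \<open>c\<close> would be an element of
      \<open>I\<close> times one of the local ring. Clearing denominators then gives an element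
      outside \<open>P\<close> that carries \<open>c\<close> into \<open>I\<close>, against
      \<open>P = (I : c)\<close>.\<close>
    have "ordI P I \<noteq> ordI P J"
    proof
      assume eq: "ordI P I = ordI P J"
      obtain x where x: "x \<in> I" "x \<noteq> 0" "vv P x = int (ordI P J)" using ordI_attained[OF P I] eq by auto
      have xK: "x \<in> K" using x intidealD(1)[OF I] Oint_K by blast
      have c': "c \<noteq> 0" "c \<in> K" using c intidealD(6)[OF I] intidealD(1)[OF J(1)] Oint_K by auto
      obtain y where y: "inv_unif P y" using ex_inv_unif[OF P] by blast
      have V: "V P y z (vv P z)" if "z \<in> K" "z \<noteq> 0" for z
        using dval_eq_V[OF vv(1)[OF P], of y z] y that vv(2)[OF P] by simp
      define m where "m = int (ordI P J)"
      have "V P y x m" using V[OF xK x(2)] x(3) by (simp add: m_def)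
      then obtain s t where st: "s \<in> Oint" "s \<notin> P" "t \<in> Oint" "t \<notin> P" "s * x * y powi m = t"
        unfolding V_def[OF P y] by blast
      have "V P y (y powi m) (- m)" using V_y[OF P y, of "- m"] by (simp only: minus_minus)
      from V_mult[OF P y V[OF c'(2,1)] this] have "V P y (c * y powi m) (vv P c + (- m))" .
      moreover have "0 \<le> vv P c + (- m)" using ordI_le[OF P J(1) c(1) c'(1)] by (simp add: m_def)
      ultimately have "c * y powi m \<in> OP P" using OP_iff[OF P y] by blast
      then obtain s' where s': "s' \<in> Oint" "s' \<notin> P" "s' * (c * y powi m) \<in> Oint" unfolding OP_def[OF P y] by blast
      have "s' * t * c = s * (s' * (c * y powi m)) * x" using st(5) by (simp add: mult_ac)
      then have "s' * t * c \<in> I" using intidealD(3)[OF I Oint_mult[OF st(1) s'(3)] x(1)] by (simp only:)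
      then have "s' * t \<in> P" unfolding True coln_def using Oint_mult[OF s'(1) st(3)] by simp
      then show False using primD(3)[OF P s'(1) st(3) s'(2) st(4)] by blast
    qed
    then show ?thesis using le low True by simp
  qed
qed

text \<open>Induction on the index: one step of \<open>enlarge_ideal\<close> divides the index by
  the norm of a single prime, and by \<open>index_step\<close> it lowers exactly the exponent of
  that prime by 1.\<close>

lemma index_eq_prod:
  assumes "intideal I"
  shows "\<exists>F. finite F \<and> (\<forall>P\<in>F. prim P) \<and> (\<forall>P. prim P \<longrightarrow> P \<notin> F \<longrightarrow> ordI P I = 0) \<and>
     card (cosets Oint I) = (\<Prod>P\<in>F. NP P ^ ordI P I)"
  using assms
proof (induction "card (cosets Oint I)" arbitrary: I rule: less_induct)
  case less
  note I = less.prems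
  show ?case
  proof (cases "1 \<in> I")
    case True
    then have "x \<in> I" if "x \<in> Oint" for x using intidealD(3)[OF I that True] by simp
    then have eq: "I = Oint" using intidealD(1)[OF I] by blast
    have "finite (cosets Oint Oint) \<and> card (cosets Oint Oint) \<le> 1"
    proof (rule card_cosets_bound[OF Oint_subgroup])
      fix B assume B: "finite B" "B \<subseteq> Oint" "\<And>x y. x \<in> B \<Longrightarrow> y \<in> B \<Longrightarrow> x - y \<in> Oint \<Longrightarrow> x = y"
      have "x = y" if "x \<in> B" "y \<in> B" for x y
        using B(3)[OF that] Oint_diff B(2) that by (simp add: subset_iff)
      then show "card B \<le> 1" using card_le_Suc0_iff_eq[OF B(1)] by simp
    qed
    moreover have "cosets Oint Oint \<noteq> {}" using Oint_0 by (auto simp: cosets_def)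
    ultimately have "card (cosets Oint Oint) = 1" by (metis card_0_eq le_antisym less_one not_less)
    then have "card (cosets Oint I) = 1" using eq by simp
    moreover have "ordI P I = 0" if P: "prim P" for P
      using ordI_le[OF P I True] dval_1[OF vv(1)[OF P]] by simp
    ultimately show ?thesis by (intro exI[of _ "{}"]) auto
  next
    case False
    obtain c where c: "c \<in> Oint" "c \<notin> I" "prim (coln I c)" using ex_prim_annihilator[OF I False] by blast
    define J where "J = {u + b * c |u b. u \<in> I \<and> b \<in> Oint}"
    note J = enlarge_ideal[OF I c, folded J_def]
    let ?Q = "coln I c"
    have JO: "J \<subseteq> Oint" using intidealD(1)[OF J(1)] by blast
    note ch = card_cosets_mult[OF intidealD(2)[OF I] intidealD(2)[OF J(1)] Oint_subgroup J(2) JO finite_cosets_ideal[OF I]]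
    have "card (cosets Oint J) > 0"
      using ch(1) Oint_0 by (auto simp: card_gt_0_iff cosets_def)
    then have "card (cosets Oint J) * 1 < card (cosets Oint J) * card (cosets J I)"
      using NP_ge_2[OF c(3)] J(4) by (intro mult_strict_left_mono) auto
    then have "card (cosets Oint J) < card (cosets Oint I)" using ch(3) by simp
    from less.hyps[OF this J(1)] obtain F where F: "finite F" "\<And>P. P \<in> F \<Longrightarrow> prim P"
      "\<And>P. prim P \<Longrightarrow> P \<notin> F \<Longrightarrow> ordI P J = 0" "card (cosets Oint J) = (\<Prod>P\<in>F. NP P ^ ordI P J)" by blast
    have "\<forall>q\<in>coln I c. \<forall>x\<in>J. q * x \<in> I" using J(5) by blast
    note step = index_step[OF I J(1,2,3) c(2,3) this]
    have "(\<Prod>P\<in>insert ?Q F. NP P ^ ordI P I) = NP ?Q ^ ordI ?Q I * (\<Prod>P\<in>F - {?Q}. NP P ^ ordI P I)"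
      using F(1) by (simp add: prod.insert_remove)
    also have "(\<Prod>P\<in>F - {?Q}. NP P ^ ordI P I) = (\<Prod>P\<in>F - {?Q}. NP P ^ ordI P J)"
      using step F(2) by (intro prod.cong) auto
    also have "NP ?Q ^ ordI ?Q I = NP ?Q * NP ?Q ^ ordI ?Q J" using step[OF c(3)] by simp
    also have "NP ?Q * NP ?Q ^ ordI ?Q J * (\<Prod>P\<in>F - {?Q}. NP P ^ ordI P J) = NP ?Q * (\<Prod>P\<in>insert ?Q F. NP P ^ ordI P J)"
      using F(1) by (simp add: prod.insert_remove)
    also have "(\<Prod>P\<in>insert ?Q F. NP P ^ ordI P J) = (\<Prod>P\<in>F. NP P ^ ordI P J)"
      using F(1,3) c(3) by (cases "?Q \<in> F") (auto simp: insert_absorb)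
    finally have "card (cosets Oint I) = (\<Prod>P\<in>insert ?Q F. NP P ^ ordI P I)"
      using ch(3) J(4) F(4) by (simp add: mult.commute)
    moreover have "ordI P I = 0" if "prim P" "P \<notin> insert ?Q F" for P
      using step[OF that(1)] F(3)[OF that(1)] that(2) by auto
    ultimately show ?thesis using F(1,2) c(3) by (intro exI[of _ "insert ?Q F"]) auto
  qed
qed

lemma product_formula_Oint:
  assumes x: "x \<in> Oint" "x \<noteq> 0"
  shows "\<exists>F. finite F \<and> (\<forall>P\<in>F. prim P) \<and> (\<forall>P. prim P \<longrightarrow> P \<notin> F \<longrightarrow> vv P x = 0) \<and>
     cmod (nrm x) = (\<Prod>P\<in>F. real (NP P) powi vv P x)"
proof -
  let ?I = "(*) x ` Oint"
  have I: "intideal ?I" using principal_ideal x by blast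
  have ord: "int (ordI P ?I) = vv P x" if P: "prim P" for P
  proof -
    have n: "0 \<le> vv P x" using vv_nonneg[OF P x] .
    have "ordI P ?I = nat (vv P x)"
    proof (rule ordI_eqI[OF P I])
      have "x * 1 \<in> ?I" by (rule imageI[OF Oint_1])
      then show "x \<in> ?I" by simp
      show "vv P x = int (nat (vv P x))" using n by simp
      fix z assume z: "z \<in> ?I" "z \<noteq> 0"
      then obtain o' where o: "o' \<in> Oint" "z = x * o'" by (elim imageE)
      then have "vv P z = vv P x + vv P o'" using z x vv_mult[OF P] Oint_K by auto
      moreover have "0 \<le> vv P o'" using vv_nonneg[OF P o(1)] o z by auto
      ultimately show "int (nat (vv P x)) \<le> vv P z" using n by simp
    qed (use x in auto)
    then show ?thesis using n by simp
  qed
  obtain F where F: "finite F" "\<And>P. P \<in> F \<Longrightarrow> prim P"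
    "\<And>P. prim P \<Longrightarrow> P \<notin> F \<Longrightarrow> ordI P ?I = 0" "nu x = (\<Prod>P\<in>F. NP P ^ ordI P ?I)"
    using index_eq_prod[OF I] unfolding nu_def by blast
  have "cmod (nrm x) = (\<Prod>P\<in>F. real (NP P) powi vv P x)"
    unfolding nu_eq_nrm[OF x, symmetric] F(4) of_nat_prod of_nat_power
    using F(2) ord by (intro prod.cong refl) (metis power_int_of_nat)
  moreover have "vv P x = 0" if "prim P" "P \<notin> F" for P using ord[OF that(1)] F(3)[OF that] by simp
  ultimately show ?thesis using F(1,2) by blast
qed

text \<open>A denominator \<open>D\<close> reduces the claim to the integral elements
  \<open>D\<close> and \<open>D * x\<close>, whose formulas are spread over a common finite set of
  primes before dividing.\<close>

theorem product_formula:
  assumes x: "x \<in> K" "x \<noteq> 0"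
  shows "finite {P. prim P \<and> vv P x \<noteq> 0}"
    "cmod (nrm x) = (\<Prod>P | prim P \<and> vv P x \<noteq> 0. real (NP P) powi vv P x)"
proof -
  obtain D :: nat where D: "D \<ge> 1" "of_nat D * x \<in> Oint" using ex_denominator[OF x(1)] by blast
  have nz: "(of_nat D :: complex) \<noteq> 0" "of_nat D * x \<noteq> 0" using D(1) x by auto
  obtain F where F: "finite F" "\<And>P. P \<in> F \<Longrightarrow> prim P" "\<And>P. prim P \<Longrightarrow> P \<notin> F \<Longrightarrow> vv P (of_nat D * x) = 0"
     "cmod (nrm (of_nat D * x)) = (\<Prod>P\<in>F. real (NP P) powi vv P (of_nat D * x))"
    using product_formula_Oint[OF D(2) nz(2)] by blast
  obtain G where G: "finite G" "\<And>P. P \<in> G \<Longrightarrow> prim P" "\<And>P. prim P \<Longrightarrow> P \<notin> G \<Longrightarrow> vv P (of_nat D) = 0"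
     "cmod (nrm (of_nat D)) = (\<Prod>P\<in>G. real (NP P) powi vv P (of_nat D))"
    using product_formula_Oint[OF Oint_of_nat nz(1)] by blast
  have vm: "vv P (of_nat D * x) = vv P (of_nat D) + vv P x" if "prim P" for P
    using vv_mult[OF that] nz x by auto
  have sub: "{P. prim P \<and> vv P x \<noteq> 0} \<subseteq> F \<union> G" 
  proof (rule subsetI, rule ccontr)
    fix P assume P: "P \<in> {P. prim P \<and> vv P x \<noteq> 0}" "P \<notin> F \<union> G"
    then show False using vm[of P] F(3)[of P] G(3)[of P] by simp
  qed
  show fin: "finite {P. prim P \<and> vv P x \<noteq> 0}" using finite_subset[OF sub] F(1) G(1) by blast
  have NPpos: "real (NP P) > 0" if "prim P" for P using NP_ge_2[OF that] by simp
  have e1: "cmod (nrm (of_nat D * x)) = (\<Prod>P\<in>F \<union> G. real (NP P) powi vv P (of_nat D * x))"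
    unfolding F(4) using F G by (intro prod.mono_neutral_left) auto
  have e2: "cmod (nrm (of_nat D)) = (\<Prod>P\<in>F \<union> G. real (NP P) powi vv P (of_nat D))"
    unfolding G(4) using F G by (intro prod.mono_neutral_left) auto
  have "cmod (nrm (of_nat D)) * cmod (nrm x) = cmod (nrm (of_nat D * x))"
    using x by (simp add: nrm_mult norm_mult)
  also have "\<dots> = (\<Prod>P\<in>F \<union> G. real (NP P) powi vv P (of_nat D) * real (NP P) powi vv P x)"
    unfolding e1 using vm F(2) G(2) NPpos
    by (intro prod.cong refl) (metis Un_iff less_irrefl power_int_add)
  also have "\<dots> = cmod (nrm (of_nat D)) * (\<Prod>P\<in>F \<union> G. real (NP P) powi vv P x)"
    unfolding e2 by (rule prod.distrib)
  finally have "cmod (nrm x) = (\<Prod>P\<in>F \<union> G. real (NP P) powi vv P x)"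
    using nrm_nonzero[OF K_of_nat nz(1)] by simp
  also have "\<dots> = (\<Prod>P | prim P \<and> vv P x \<noteq> 0. real (NP P) powi vv P x)"
    using F G sub by (intro prod.mono_neutral_right) auto
  finally show "cmod (nrm x) = (\<Prod>P | prim P \<and> vv P x \<noteq> 0. real (NP P) powi vv P x)" .
qed

end

section \<open>Places of number fields\<close>

context number_field
begin

section \<open>Growth of valuations along powers of a unit\<close>

context
  fixes w assumes w: "dval w"
begin

abbreviation Mw :: "complex set" where "Mw \<equiv> {x\<in>K. x = 0 \<or> 0 < w x}"

lemma Mw_closed:
  "0 \<in> Mw" "x \<in> Mw \<Longrightarrow> y \<in> Mw \<Longrightarrow> x + y \<in> Mw" "x \<in> Mw \<Longrightarrow> y \<in> Mw \<Longrightarrow> x - y \<in> Mw"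
  using add_subgroup_closed[OF max_ideal_subgroup[OF w]] by blast+

lemma Mw_mult: assumes "y \<in> K" "y = 0 \<or> 0 \<le> w y" "x \<in> Mw" shows "x * y \<in> Mw"
proof (cases "x = 0 \<or> y = 0")
  case False
  then show ?thesis using assms dval_mult[OF w, of x y] by auto
qed auto

lemma Mw_sum: "(\<And>i. i \<in> I \<Longrightarrow> g i \<in> Mw) \<Longrightarrow> sum g I \<in> Mw"
proof (induction I rule: infinite_finite_induct)
  case (insert i I)
  have "g i + sum g I \<in> Mw" using insert by (intro Mw_closed(2)) blast+
  moreover have "sum g (insert i I) = g i + sum g I" using insert.hyps by simp
  ultimately show ?case by (rule ssubst[rotated])
qed simp_all

lemma w_unit_add: assumes "x \<in> K" "x \<noteq> 0" "w x = 0" "y \<in> Mw" shows "x + y \<noteq> 0" "w (x + y) = 0"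
proof -
  show nz: "x + y \<noteq> 0"
  proof
    assume "x + y = 0"
    then have "y = - x" by (simp add: add_eq_0_iff)
    then show False using assms dval_uminus[OF w, of x] by auto
  qed
  have ge: "0 \<le> w (x + y)"
  proof (cases "y = 0")
    case False
    then show ?thesis using dval_add[OF w assms(1,2), of y] assms(3,4) nz by auto
  qed (use assms in auto)
  moreover have "\<not> 0 < w (x + y)"
  proof
    assume "0 < w (x + y)"
    then have "x + y \<in> Mw" using assms by auto
    then have "(x + y) - y \<in> Mw" using assms(4) by (rule Mw_closed(3))
    then show False using assms(2,3) by simp
  qed
  ultimately show "w (x + y) = 0" by simp
qed

text \<open>The prime ideal contains a positive integer by \<open>ex_cofactor\<close>, hence also
  one of its prime factors.\<close>

lemma ex_residue_char: "\<exists>p. prime p \<and> 0 < w (of_nat p)"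
proof -
  have P: "prim (Pw w)" using prim_Pw[OF w] .
  obtain x where x: "x \<in> Pw w" "x \<noteq> 0" using intidealD(5)[OF primD(1)[OF P]] by blast
  obtain m y where m: "m \<ge> 1" "y \<in> Oint" "x * y = of_nat m"
    using ex_cofactor[OF primD(4)[OF P x(1)] x(2)] by blast
  have "x * y \<in> Pw w" using intidealD(4)[OF primD(1)[OF P] m(2) x(1)] .
  then have "0 < w (of_nat m)" using m by (auto simp: Pw_def)
  then show ?thesis using m(1)
  proof (induction m rule: less_induct)
    case (less m)
    have "m \<noteq> 1" using less.prems(1) dval_1[OF w] by auto
    then obtain p where p: "prime p" "p dvd m" using prime_factor_nat by blast
    then obtain k where k: "m = p * k" by blast
    have kp: "k \<ge> 1" "p > 1" using less.prems(2) k prime_gt_1_nat[OF p(1)] by (auto simp: Suc_le_eq intro: Nat.gr0I)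
    then have "k < m" using k by simp
    have "w (of_nat m) = w (of_nat p) + w (of_nat k)"
      unfolding k of_nat_mult using kp by (intro dval_mult[OF w]) auto
    then show ?case using less.IH[OF \<open>k < m\<close>] less.prems(1) kp p(1) by (cases "0 < w (of_nat p)") auto
  qed
qed

lemma w_coprime: assumes "prime p" "0 < w (of_nat p)" "\<not> p dvd k" shows "w (of_nat k) = 0"
proof (rule ccontr)
  assume ne: "w (of_nat k) \<noteq> 0"
  have k0: "k \<noteq> 0" using assms(3) by (intro notI) simp
  then have "k \<ge> 1" by simp
  then have "0 < w (of_nat k)" using ne dval_of_nat[OF w, of k] by simp
  then have kM: "of_nat k \<in> Mw" "of_nat p \<in> Mw" using assms by auto
  have "coprime k p" using prime_imp_coprime[OF assms(1,3)] by (rule coprime_commute[THEN iffD1])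
  then have "coprime (int k) (int p)" by simp
  then obtain u v where uv: "u * int k + v * int p = 1"
    by (metis bezout_int coprime_iff_gcd_eq_1)
  have int: "of_int z \<in> K \<and> ((of_int z :: complex) = 0 \<or> 0 \<le> w (of_int z))" for z
    using dval_of_int[OF w, of z] by auto
  have "of_nat k * of_int u + of_nat p * of_int v \<in> Mw"
    using int by (intro Mw_closed(2) Mw_mult kM) blast+
  moreover have "of_nat k * of_int u + of_nat p * of_int v = (1::complex)"
    using arg_cong[OF uv, of "of_int :: int \<Rightarrow> complex"] by (simp add: mult.commute)
  ultimately show False using dval_1[OF w] by simp
qed

text \<open>When \<open>x\<close> is congruent to 1 modulo the maximal ideal, the second factor is
  congruent to \<open>k\<close>. So its valuation is governed by divisibility of \<open>k\<close> by
  the residue characteristic.\<close>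

lemma geometric_factor:
  fixes x :: complex
  shows "x ^ k - 1 = (x - 1) * (of_nat k + (\<Sum>i<k. x ^ i - 1))"
  unfolding sum_subtractf by (subst power_diff_1_eq) simp

lemma power_sub_1_Mw:
  assumes x: "x \<in> K" "x - 1 \<in> Mw" shows "x ^ i - 1 \<in> Mw"
proof (cases "x = 0")
  case True
  then show ?thesis using x dval_uminus[OF w, of 1] dval_1[OF w] by simp
next
  case False
  have "1 + (x - 1) = x" by simp
  then have w0: "w x = 0" using w_unit_add(2)[of 1 "x - 1"] x dval_1[OF w] by simp
  show ?thesis
  proof (induction i)
    case (Suc i)
    have "(x ^ i - 1) * x + (x - 1) \<in> Mw"
      using Suc x w0 by (intro Mw_closed(2) Mw_mult) auto
    then show ?case by (simp add: algebra_simps)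
  qed simp
qed

lemma w_power_sub_1_coprime:
  assumes x: "x \<in> K" "x - 1 \<in> Mw" "x \<noteq> 1" and p: "prime p" "0 < w (of_nat p)" "\<not> p dvd k"
  shows "w (x ^ k - 1) = w (x - 1)"
proof -
  have "k \<noteq> 0" using p(3) by (intro notI) simp
  then have k: "of_nat k \<noteq> (0::complex)" by simp
  have S: "(\<Sum>i<k. x ^ i - 1) \<in> Mw" by (intro Mw_sum power_sub_1_Mw x)
  note u = w_unit_add[OF _ k w_coprime[OF p] S]
  have "w (x ^ k - 1) = w (x - 1) + w (of_nat k + (\<Sum>i<k. x ^ i - 1))"
    by (subst geometric_factor, intro dval_mult[OF w]) (use x u(1) in auto)
  then show ?thesis using u(2) by simp
qed

text \<open>The second factor in \<open>geometric_factor\<close> lies in the maximal ideal. Only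
  strict growth is asserted, because ramification spoils an exact increment when \<open>x\<close> is
  not close enough to 1.\<close>

lemma w_power_sub_1_prime:
  assumes x: "x \<in> K" "x - 1 \<in> Mw" and p: "0 < w (of_nat p)" and ne: "x ^ p \<noteq> 1" "x \<noteq> 1"
  shows "w (x - 1) < w (x ^ p - 1)"
proof -
  have "(\<Sum>i<p. x ^ i - 1) \<in> Mw" by (intro Mw_sum power_sub_1_Mw x)
  moreover have "of_nat p \<in> Mw" using p by auto
  ultimately have S: "of_nat p + (\<Sum>i<p. x ^ i - 1) \<in> Mw" by (rule Mw_closed(2)[rotated])
  have nz: "of_nat p + (\<Sum>i<p. x ^ i - 1) \<noteq> 0" using geometric_factor[of x p] ne(1) by auto
  have "w (x ^ p - 1) = w (x - 1) + w (of_nat p + (\<Sum>i<p. x ^ i - 1))"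
    by (subst geometric_factor, intro dval_mult[OF w]) (use x ne nz in auto)
  then show ?thesis using S nz by simp
qed

text \<open>\<open>a\<close> is the order of \<xi> in the residue field and \<open>p\<close> the
  residue characteristic. For \<open>n = a * m\<close> the part of \<open>m\<close> prime to
  \<open>p\<close> leaves the valuation unchanged, and every further factor \<open>p\<close> raises
  it strictly, whence a decreasing absolute value.\<close>

lemma unit_place_structure:
  fixes N :: real
  assumes x: "\<xi> \<in> K" "\<xi> \<noteq> 0" "w \<xi> = 0" and nr: "\<And>n. n \<ge> 1 \<Longrightarrow> \<xi> ^ n \<noteq> 1" and N: "N > 1"
  shows "\<exists>a p h. a \<ge> 1 \<and> prime p \<and> (\<forall>t. 0 < h t) \<and> (\<forall>t. h (Suc t) < h t) \<and>
     (\<forall>n\<ge>1. N powi (- w (\<xi> ^ n - 1)) = (if a dvd n then h (multiplicity p n) else 1))"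
proof -
  let ?R = "{x\<in>K. x = 0 \<or> 0 \<le> w x}"
  have pw: "w (\<xi> ^ i) = 0" for i using dval_power[OF w x(1,2)] x(3) by simp
  have ex: "\<exists>b\<ge>1. \<xi> ^ b - 1 \<in> Mw"
  proof -
    have "card (cosets ?R Mw) \<noteq> 0"
      using residue_card[OF w] NP_ge_2[OF prim_Pw[OF w]] by simp
    then have fin: "finite (cosets ?R Mw)" by (metis card.infinite)
    let ?g = "\<lambda>i::nat. (+) (\<xi> ^ i) ` Mw"
    have "?g ` {0..card (cosets ?R Mw)} \<subseteq> cosets ?R Mw"
      unfolding cosets_def using x pw by (intro image_subsetI) (rule imageI, simp)
    then have "card (?g ` {0..card (cosets ?R Mw)}) \<le> card (cosets ?R Mw)" by (rule card_mono[OF fin])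
    then have "\<not> inj_on ?g {0..card (cosets ?R Mw)}" by (intro pigeonhole) simp
    then obtain i j where ij: "i \<noteq> j" "?g i = ?g j" by (auto simp: inj_on_def)
    have *: "\<exists>b\<ge>1. \<xi> ^ b - 1 \<in> Mw" if "i < j" "\<xi> ^ j - \<xi> ^ i \<in> Mw" for i j
    proof -
      have "\<xi> ^ j - \<xi> ^ i = \<xi> ^ i * (\<xi> ^ (j - i) - 1)"
        using that(1) by (simp add: algebra_simps flip: power_add)
      moreover have nz: "\<xi> ^ (j - i) - 1 \<noteq> 0" using nr[of "j - i"] that(1) by simp
      ultimately have "0 < w (\<xi> ^ i) + w (\<xi> ^ (j - i) - 1)"
        using that(2) x dval_mult[OF w, of "\<xi> ^ i" "\<xi> ^ (j - i) - 1"] by auto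
      then have "\<xi> ^ (j - i) - 1 \<in> Mw" using pw x by simp
      then show ?thesis using that(1) by (intro exI[of _ "j - i"]) simp
    qed
    have d: "\<xi> ^ i - \<xi> ^ j \<in> Mw" by (rule iffD1[OF coset_eq_iff[OF max_ideal_subgroup[OF w]] ij(2)])
    have d': "\<xi> ^ j - \<xi> ^ i \<in> Mw" using Mw_closed(3)[OF Mw_closed(1) d] by simp
    show ?thesis
    proof (cases "i < j")
      case True then show ?thesis using *[OF _ d'] by blast
    next
      case False then show ?thesis using *[OF _ d] ij(1) by auto
    qed
  qed
  define a where "a = (LEAST b::nat. 1 \<le> b \<and> \<xi> ^ b - 1 \<in> Mw)"
  have a: "a \<ge> 1" "\<xi> ^ a - 1 \<in> Mw" using LeastI_ex[of "\<lambda>b. b \<ge> 1 \<and> \<xi> ^ b - 1 \<in> Mw"] ex by (auto simp: a_def)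
  have least: "a \<le> b" if "b \<ge> 1" "\<xi> ^ b - 1 \<in> Mw" for b using that unfolding a_def by (intro Least_le) simp
  obtain p where p: "prime p" "0 < w (of_nat p)" using ex_residue_char by blast
  define u0 where "u0 = \<xi> ^ a"
  have u0K: "u0 \<in> K" "u0 - 1 \<in> Mw" using x a by (auto simp: u0_def)
  have u0ne: "u0 ^ k \<noteq> 1" if "k \<ge> 1" for k using nr[of "a * k"] a(1) that by (simp add: u0_def power_mult)
  define H where "H t = N powi (- w (u0 ^ (p ^ t) - 1))" for t
  have Hpos: "0 < H t" for t using N by (simp add: H_def)
  have Hdec: "H (Suc t) < H t" for t
  proof -
    have "w (u0 ^ (p ^ t) - 1) < w ((u0 ^ (p ^ t)) ^ p - 1)"
      using u0ne[of "p ^ t"] u0ne[of "p ^ t * p"] u0K p prime_gt_0_nat[OF p(1)] power_sub_1_Mw[OF u0K]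
      by (intro w_power_sub_1_prime) (auto simp: power_mult)
    then show ?thesis using N unfolding H_def
      by (intro power_int_strict_increasing) (simp_all add: mult.commute flip: power_mult)
  qed
  define e where "e = multiplicity p a"
  \<comment> \<open>The function is indexed by the multiplicity in \<open>n\<close>, not in
    \<open>n / a\<close>, hence the shift by \<open>e\<close>. Below \<open>e\<close> no multiple of
    \<open>a\<close> occurs, and a linear extension keeps \<open>h\<close> positive and strictly
    decreasing.\<close>
  define h where "h t = (if t \<ge> e then H (t - e) else H 0 + real (e - t))" for t
  have "h (Suc t) < h t" for t
  proof -
    consider "Suc t \<le> e" "Suc t \<noteq> e" | "Suc t = e" | "t \<ge> e" by linarith
    then show ?thesis
    proof cases
      case 1 then show ?thesis by (auto simp: h_def)
    next
      case 2 then show ?thesis by (auto simp: h_def)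
    next
      case 3 then show ?thesis using Hdec[of "t - e"] by (simp add: h_def Suc_diff_le)
    qed
  qed
  moreover have "0 < h t" for t using Hpos by (auto simp: h_def add_pos_nonneg)
  moreover have "N powi (- w (\<xi> ^ n - 1)) = (if a dvd n then h (multiplicity p n) else 1)" if n: "n \<ge> 1" for n
  proof (cases "a dvd n")
    case False
    have "\<xi> ^ n - 1 \<notin> Mw"
    proof
      assume nM: "\<xi> ^ n - 1 \<in> Mw"
      have r: "n mod a \<ge> 1" using False by (simp add: Suc_le_eq mod_greater_zero_iff_not_dvd)
      have "u0 ^ (n div a) - 1 \<in> Mw" by (rule power_sub_1_Mw[OF u0K])
      then have "(u0 ^ (n div a) - 1) * \<xi> ^ (n mod a) \<in> Mw" using x pw by (intro Mw_mult) auto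
      then have "(\<xi> ^ n - 1) - (u0 ^ (n div a) - 1) * \<xi> ^ (n mod a) \<in> Mw" by (rule Mw_closed(3)[OF nM])
      moreover have "\<xi> ^ n = u0 ^ (n div a) * \<xi> ^ (n mod a)"
        by (simp add: u0_def flip: power_mult power_add)
      ultimately have "\<xi> ^ (n mod a) - 1 \<in> Mw" by (simp add: algebra_simps)
      then have "a \<le> n mod a" using least r by blast
      then show False using mod_less_divisor[of a n] a(1) by linarith
    qed
    moreover have "0 \<le> w (\<xi> ^ n - 1)"
      using dval_add[OF w, of "\<xi> ^ n" "-1"] x pw nr[OF n] dval_uminus[OF w, of 1] dval_1[OF w] by simp
    ultimately have "w (\<xi> ^ n - 1) = 0" using x nr[OF n] by auto
    then show ?thesis using False by simp
  next
    case True
    then obtain m where m: "n = a * m" by blast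
    have m1: "m \<noteq> 0" using n m by auto
    obtain k where k: "m = p ^ multiplicity p m * k" "\<not> p dvd k"
      using multiplicity_decompose'[of m p] m1 p(1) by (metis not_prime_unit)
    define t where "t = multiplicity p m"
    have mult: "multiplicity p n = e + t"
      unfolding m e_def t_def using p(1) a(1) m1 by (intro prime_elem_multiplicity_mult_distrib) auto
    have "\<xi> ^ n = (u0 ^ (p ^ t)) ^ k" by (subst m, subst k(1)) (simp add: u0_def t_def power_mult)
    then have "w (\<xi> ^ n - 1) = w (u0 ^ (p ^ t) - 1)"
      using w_power_sub_1_coprime[OF _ power_sub_1_Mw[OF u0K] _ p k(2), of "p ^ t"] u0K u0ne[of "p ^ t"] prime_gt_0_nat[OF p(1)]
      by simp
    then show ?thesis using True mult by (simp add: h_def H_def)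
  qed
  ultimately show ?thesis using a(1) p(1) by blast
qed

end
end

section \<open>Places of an abstract number field\<close>

lemma prod_pairs_cnj:
  fixes g :: "complex \<Rightarrow> real"
  assumes fin: "finite B" and cl: "\<And>b. b \<in> B \<Longrightarrow> cnj b \<in> B" and g: "\<And>b. b \<in> B \<Longrightarrow> g (cnj b) = g b"
  shows "(\<Prod>b\<in>B. g b) = (\<Prod>b\<in>{b\<in>B. Im b \<ge> 0}. if b \<in> \<real> then g b else (g b)\<^sup>2)"
proof -
  let ?P = "{b\<in>B. Im b > 0}" and ?Z = "{b\<in>B. Im b = 0}" and ?N = "{b\<in>B. Im b < 0}"
  have B: "B = ?P \<union> ?Z \<union> ?N" by auto
  have f: "finite ?P" "finite ?Z" "finite ?N" using fin by simp_all
  have d: "?P \<inter> ?Z = {}" "(?P \<union> ?Z) \<inter> ?N = {}" by auto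
  have u: "prod h (?P \<union> ?Z) = prod h ?P * prod h ?Z" for h :: "complex \<Rightarrow> real"
    by (rule prod.union_disjoint[OF f(1,2) d(1)])
  have "prod g B = prod g ((?P \<union> ?Z) \<union> ?N)" by (rule arg_cong[OF B])
  also have "\<dots> = prod g (?P \<union> ?Z) * prod g ?N"
    by (rule prod.union_disjoint[OF finite_UnI[OF f(1,2)] f(3) d(2)])
  also have "prod g ?N = prod g ?P"
    by (rule prod.reindex_bij_witness[where i = cnj and j = cnj]) (auto simp: cl g)
  also have "prod g (?P \<union> ?Z) = prod g ?P * prod g ?Z" by (rule u)
  finally have 1: "(\<Prod>b\<in>B. g b) = (\<Prod>b\<in>?P. (g b)\<^sup>2) * (\<Prod>b\<in>?Z. g b)"
    by (simp add: power2_eq_square prod.distrib)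
  have U: "{b\<in>B. Im b \<ge> 0} = ?P \<union> ?Z" by auto
  have "(\<Prod>b\<in>?P \<union> ?Z. if b \<in> \<real> then g b else (g b)\<^sup>2) =
      (\<Prod>b\<in>?P. if b \<in> \<real> then g b else (g b)\<^sup>2) * (\<Prod>b\<in>?Z. if b \<in> \<real> then g b else (g b)\<^sup>2)"
    by (rule u)
  also have "\<dots> = (\<Prod>b\<in>?P. (g b)\<^sup>2) * (\<Prod>b\<in>?Z. g b)"
    by (intro arg_cong2[where f = "(*)"] prod.cong refl) (auto simp: complex_is_Real_iff)
  finally show ?thesis unfolding 1 U by simp
qed

text \<open>Places are functions on the carrier of the abstract field \<open>F\<close>, so sets of
  places have to be compared there; \<phi> moves the arithmetic of \<open>K\<close> to it.\<close>

locale number_field_iso = number_field f \<alpha> for f \<alpha> +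
  fixes F :: "('a, 'b) ring_scheme" and \<phi> :: "'a \<Rightarrow> complex"
  assumes fieldF: "Ring.field F"
    and inj: "inj_on \<phi> (carrier F)"
    and img: "\<phi> ` carrier F = K"
    and \<phi>_add: "\<And>x y. x \<in> carrier F \<Longrightarrow> y \<in> carrier F \<Longrightarrow> \<phi> (x \<oplus>\<^bsub>F\<^esub> y) = \<phi> x + \<phi> y"
    and \<phi>_mult: "\<And>x y. x \<in> carrier F \<Longrightarrow> y \<in> carrier F \<Longrightarrow> \<phi> (x \<otimes>\<^bsub>F\<^esub> y) = \<phi> x * \<phi> y"
    and \<phi>_one: "\<phi> \<one>\<^bsub>F\<^esub> = 1"
begin

lemma ringF: "Ring.ring F" using fieldF by (simp add: Ring.field_def domain_def cring_def)

lemma cl: "x \<in> carrier F \<Longrightarrow> y \<in> carrier F \<Longrightarrow> x \<oplus>\<^bsub>F\<^esub> y \<in> carrier F"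
  "x \<in> carrier F \<Longrightarrow> y \<in> carrier F \<Longrightarrow> x \<otimes>\<^bsub>F\<^esub> y \<in> carrier F"
  "\<zero>\<^bsub>F\<^esub> \<in> carrier F" "\<one>\<^bsub>F\<^esub> \<in> carrier F"
  using ringF by (auto intro: ring.ring_simprules)

lemma \<phi>_K: "x \<in> carrier F \<Longrightarrow> \<phi> x \<in> K" using img by blast

lemma \<phi>_zero: "\<phi> \<zero>\<^bsub>F\<^esub> = 0"
proof -
  have "\<zero>\<^bsub>F\<^esub> \<oplus>\<^bsub>F\<^esub> \<zero>\<^bsub>F\<^esub> = \<zero>\<^bsub>F\<^esub>" using ringF cl by (intro ring.ring_simprules) auto
  then have "\<phi> \<zero>\<^bsub>F\<^esub> + \<phi> \<zero>\<^bsub>F\<^esub> = \<phi> \<zero>\<^bsub>F\<^esub>" using \<phi>_add cl by metis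
  then show ?thesis by simp
qed

lemma \<phi>_eq_0_iff: "x \<in> carrier F \<Longrightarrow> \<phi> x = 0 \<longleftrightarrow> x = \<zero>\<^bsub>F\<^esub>"
  using inj \<phi>_zero cl(3) by (metis inj_onD)

lemma \<phi>_pow: "x \<in> carrier F \<Longrightarrow> \<phi> (x [^]\<^bsub>F\<^esub> (n::nat)) = \<phi> x ^ n \<and> x [^]\<^bsub>F\<^esub> n \<in> carrier F"
  by (induction n) (auto simp: \<phi>_one \<phi>_mult cl)

lemma \<phi>_minus:
  assumes "x \<in> carrier F" "y \<in> carrier F"
  shows "x \<ominus>\<^bsub>F\<^esub> y \<in> carrier F" "\<phi> (x \<ominus>\<^bsub>F\<^esub> y) = \<phi> x - \<phi> y"
proof -
  show c: "x \<ominus>\<^bsub>F\<^esub> y \<in> carrier F" using ringF assms by (simp add: ring.ring_simprules)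
  have "(x \<ominus>\<^bsub>F\<^esub> y) \<oplus>\<^bsub>F\<^esub> y = x"
    using ringF assms by (simp add: ring.ring_simprules a_minus_def)
  then have "\<phi> (x \<ominus>\<^bsub>F\<^esub> y) + \<phi> y = \<phi> x" using \<phi>_add[OF c assms(2)] by simp
  then show "\<phi> (x \<ominus>\<^bsub>F\<^esub> y) = \<phi> x - \<phi> y" by (metis add_diff_cancel_right')
qed

definition \<psi> :: "complex \<Rightarrow> 'a" where "\<psi> = inv_into (carrier F) \<phi>"

lemma \<psi>: "z \<in> K \<Longrightarrow> \<psi> z \<in> carrier F" "z \<in> K \<Longrightarrow> \<phi> (\<psi> z) = z" "x \<in> carrier F \<Longrightarrow> \<psi> (\<phi> x) = x"
  unfolding \<psi>_def using img inj by (auto simp: inv_into_into f_inv_into_f)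

lemma \<psi>_add: "x \<in> K \<Longrightarrow> y \<in> K \<Longrightarrow> \<psi> (x + y) = \<psi> x \<oplus>\<^bsub>F\<^esub> \<psi> y"
  using \<psi> \<phi>_add cl(1) by (metis)
lemma \<psi>_mult: "x \<in> K \<Longrightarrow> y \<in> K \<Longrightarrow> \<psi> (x * y) = \<psi> x \<otimes>\<^bsub>F\<^esub> \<psi> y"
  using \<psi> \<phi>_mult cl(2) by (metis)
lemma \<psi>_one: "\<psi> 1 = \<one>\<^bsub>F\<^esub>" using \<psi>(3)[OF cl(4)] \<phi>_one by simp
lemma \<psi>_zero: "\<psi> 0 = \<zero>\<^bsub>F\<^esub>" using \<psi>(3)[OF cl(3)] \<phi>_zero by simp
lemma \<psi>_nonzero: "z \<in> K \<Longrightarrow> z \<noteq> 0 \<Longrightarrow> \<psi> z \<noteq> \<zero>\<^bsub>F\<^esub>" using \<psi>(2) \<phi>_zero by metis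

lemma discrete_valuation_dval:
  assumes "discrete_valuation F w" shows "dval (\<lambda>z. w (\<psi> z))"
proof -
  have s: "w ` (carrier F - {\<zero>\<^bsub>F\<^esub>}) = UNIV"
    and m: "\<And>x y. x \<in> carrier F - {\<zero>\<^bsub>F\<^esub>} \<Longrightarrow> y \<in> carrier F - {\<zero>\<^bsub>F\<^esub>} \<Longrightarrow> w (x \<otimes>\<^bsub>F\<^esub> y) = w x + w y"
    and a: "\<And>x y. x \<in> carrier F - {\<zero>\<^bsub>F\<^esub>} \<Longrightarrow> y \<in> carrier F - {\<zero>\<^bsub>F\<^esub>} \<Longrightarrow> x \<oplus>\<^bsub>F\<^esub> y \<noteq> \<zero>\<^bsub>F\<^esub> \<Longrightarrow> min (w x) (w y) \<le> w (x \<oplus>\<^bsub>F\<^esub> y)"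
    using assms unfolding discrete_valuation_def Let_def by blast+
  have in_U: "\<psi> z \<in> carrier F - {\<zero>\<^bsub>F\<^esub>}" if "z \<in> K - {0}" for z using that \<psi>(1) \<psi>_nonzero by auto
  show ?thesis
    unfolding dval_def
  proof (intro conjI ballI impI)
    show "(\<lambda>z. w (\<psi> z)) ` (K - {0}) = UNIV"
    proof (rule UNIV_eq_I[symmetric])
      fix m
      have "m \<in> w ` (carrier F - {\<zero>\<^bsub>F\<^esub>})" using s by simp
      then obtain x where x: "x \<in> carrier F" "x \<noteq> \<zero>\<^bsub>F\<^esub>" "m = w x" by auto
      then show "m \<in> (\<lambda>z. w (\<psi> z)) ` (K - {0})"
        using \<phi>_K \<phi>_eq_0_iff \<psi>(3) by (intro image_eqI[of _ _ "\<phi> x"]) auto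
    qed
    fix x y assume xy: "x \<in> K - {0}" "y \<in> K - {0}"
    show "w (\<psi> (x * y)) = w (\<psi> x) + w (\<psi> y)"
      using m[OF in_U in_U] xy \<psi>_mult by auto
    assume "x + y \<noteq> 0"
    then have "\<psi> x \<oplus>\<^bsub>F\<^esub> \<psi> y \<noteq> \<zero>\<^bsub>F\<^esub>" using xy \<psi>_add \<psi>_nonzero by (metis DiffD1 K_add)
    then show "min (w (\<psi> x)) (w (\<psi> y)) \<le> w (\<psi> (x + y))"
      using a[OF in_U in_U] xy \<psi>_add by auto
  qed
qed

lemma dval_discrete_valuation:
  assumes w: "dval w" shows "discrete_valuation F (\<lambda>x. w (\<phi> x))"
  unfolding discrete_valuation_def Let_def
proof (intro conjI ballI impI)
  show "(\<lambda>x. w (\<phi> x)) ` (carrier F - {\<zero>\<^bsub>F\<^esub>}) = UNIV"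
  proof (rule UNIV_eq_I[symmetric])
    fix m
    obtain z where z: "z \<in> K" "z \<noteq> 0" "w z = m" using dval_surj[OF w] by blast
    then show "m \<in> (\<lambda>x. w (\<phi> x)) ` (carrier F - {\<zero>\<^bsub>F\<^esub>})"
      using \<psi>(1,2) \<psi>_nonzero by (intro image_eqI[of _ _ "\<psi> z"]) auto
  qed
  fix x y assume xy: "x \<in> carrier F - {\<zero>\<^bsub>F\<^esub>}" "y \<in> carrier F - {\<zero>\<^bsub>F\<^esub>}"
  then have nz: "\<phi> x \<in> K" "\<phi> x \<noteq> 0" "\<phi> y \<in> K" "\<phi> y \<noteq> 0" using \<phi>_K \<phi>_eq_0_iff by auto
  show "w (\<phi> (x \<otimes>\<^bsub>F\<^esub> y)) = w (\<phi> x) + w (\<phi> y)"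
    using dval_mult[OF w nz] xy \<phi>_mult by simp
  assume "x \<oplus>\<^bsub>F\<^esub> y \<noteq> \<zero>\<^bsub>F\<^esub>"
  then have "\<phi> x + \<phi> y \<noteq> 0" using xy \<phi>_add \<phi>_eq_0_iff cl(1) by (metis DiffD1)
  then show "min (w (\<phi> x)) (w (\<phi> y)) \<le> w (\<phi> (x \<oplus>\<^bsub>F\<^esub> y))"
    using dval_add[OF w nz] xy \<phi>_add by simp
qed

lemma card_residue_field:
  assumes w: "discrete_valuation F w"
  shows "card (carrier (residue_field F w)) = NP (Pw (\<lambda>z. w (\<psi> z)))"
proof -
  let ?w = "\<lambda>z. w (\<psi> z)"
  note d = discrete_valuation_dval[OF w]
  let ?R = "{x \<in> carrier F. x = \<zero>\<^bsub>F\<^esub> \<or> 0 \<le> w x}" and ?M = "{x \<in> carrier F. x = \<zero>\<^bsub>F\<^esub> \<or> 0 < w x}"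
  let ?R' = "{x\<in>K. x = 0 \<or> 0 \<le> ?w x}" and ?M' = "{x\<in>K. x = 0 \<or> 0 < ?w x}"
  let ?S = "F\<lparr>carrier := ?R\<rparr>"
  have car: "carrier (residue_field F w) = (\<lambda>a. (\<lambda>h. h \<oplus>\<^bsub>F\<^esub> a) ` ?M) ` ?R"
    by (auto simp: residue_field_def FactRing_def A_RCOSETS_def' a_r_coset_def')
  have M: "\<phi> ` ?M = ?M'"
  proof (intro equalityI subsetI)
    fix z assume "z \<in> \<phi> ` ?M" then show "z \<in> ?M'" using \<phi>_K \<psi>(3) \<phi>_zero by auto
  next
    fix z assume "z \<in> ?M'" then show "z \<in> \<phi> ` ?M" using \<psi> \<psi>_zero by (intro image_eqI[of _ _ "\<psi> z"]) auto
  qed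
  have R: "\<phi> ` ?R = ?R'"
  proof (intro equalityI subsetI)
    fix z assume "z \<in> \<phi> ` ?R" then show "z \<in> ?R'" using \<phi>_K \<psi>(3) \<phi>_zero by auto
  next
    fix z assume "z \<in> ?R'" then show "z \<in> \<phi> ` ?R" using \<psi> \<psi>_zero by (intro image_eqI[of _ _ "\<psi> z"]) auto
  qed
  have co: "\<phi> ` ((\<lambda>h. h \<oplus>\<^bsub>F\<^esub> a) ` ?M) = (+) (\<phi> a) ` ?M'" if "a \<in> ?R" for a
    unfolding M[symmetric] image_image using that by (intro image_cong refl) (auto simp: \<phi>_add add.commute)
  have sub: "Y \<subseteq> carrier F" if "Y \<in> carrier (residue_field F w)" for Y
    using that unfolding car by (auto intro: cl(1))
  have "inj_on ((`) \<phi>) (carrier (residue_field F w))"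
  proof (rule inj_onI)
    fix Y Z assume YZ: "Y \<in> carrier (residue_field F w)" "Z \<in> carrier (residue_field F w)" "\<phi> ` Y = \<phi> ` Z"
    show "Y = Z" using inj_on_image_eq_iff[OF inj sub[OF YZ(1)] sub[OF YZ(2)]] YZ(3) by simp
  qed
  then have "card (carrier (residue_field F w)) = card ((`) \<phi> ` carrier (residue_field F w))"
    by (simp add: card_image)
  also have "(`) \<phi> ` carrier (residue_field F w) = (\<lambda>a. (+) (\<phi> a) ` ?M') ` ?R"
    unfolding car image_image[of "(`) \<phi>"] by (rule image_cong[OF refl co])
  also have "\<dots> = (\<lambda>z. (+) z ` ?M') ` (\<phi> ` ?R)" by (simp only: image_image)
  also have "\<dots> = cosets ?R' ?M'" unfolding R cosets_def ..
  also have "card \<dots> = NP (Pw ?w)" by (rule residue_card[OF d])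
  finally show ?thesis .
qed

definition place :: "complex set \<Rightarrow> 'a \<Rightarrow> real" where
  "place P x = (if x \<in> carrier F - {\<zero>\<^bsub>F\<^esub>} then real (NP P) powi (- vv P (\<phi> x)) else 0)"

text \<open>Transport along \<phi> turns a valuation of \<open>F\<close> into one of
  \<open>K\<close>, which \<open>dval_unique\<close> identifies with that of its prime; the residue
  fields match by \<open>card_residue_field\<close>.\<close>

lemma finite_places_eq: "finite_places F = place ` {P. prim P}"
proof (intro equalityI subsetI)
  fix v assume "v \<in> finite_places F"
  then obtain w where w: "discrete_valuation F w" "v = finite_abs F w" by (auto simp: finite_places_def)
  let ?w = "\<lambda>z. w (\<psi> z)"
  note d = discrete_valuation_dval[OF w(1)]
  have P: "prim (Pw ?w)" using prim_Pw[OF d] .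
  have "w x = vv (Pw ?w) (\<phi> x)" if "x \<in> carrier F" "x \<noteq> \<zero>\<^bsub>F\<^esub>" for x
    using dval_unique[OF d vv(1)[OF P], of "\<phi> x"] vv(2)[OF P] that \<phi>_K \<phi>_eq_0_iff \<psi>(3) by simp
  then have "v = place (Pw ?w)"
    unfolding w(2) by (intro ext) (simp add: finite_abs_def place_def card_residue_field[OF w(1)])
  then show "v \<in> place ` {P. prim P}" using P by blast
next
  fix v assume "v \<in> place ` {P. prim P}"
  then obtain P where P: "prim P" "v = place P" by blast
  let ?w = "\<lambda>x. vv P (\<phi> x)"
  have w: "discrete_valuation F ?w" using dval_discrete_valuation[OF vv(1)[OF P(1)]] .
  have "Pw (\<lambda>z. ?w (\<psi> z)) = Pw (vv P)" using Oint_K \<psi>(2) by (auto simp: Pw_def)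
  then have "card (carrier (residue_field F ?w)) = NP P" using card_residue_field[OF w] vv(2)[OF P(1)] by simp
  then have "finite_abs F ?w = v" unfolding P(2) by (intro ext) (simp add: finite_abs_def place_def)
  then show "v \<in> finite_places F" using w by (auto simp: finite_places_def)
qed

lemma place_eq_1_iff:
  assumes "prim P" "x \<in> carrier F" "x \<noteq> \<zero>\<^bsub>F\<^esub>" shows "place P x = 1 \<longleftrightarrow> vv P (\<phi> x) = 0"
proof
  assume "place P x = 1"
  then have 1: "real (NP P) powi (- vv P (\<phi> x)) = 1" using assms by (simp add: place_def)
  have N: "1 < real (NP P)" using NP_ge_2[OF assms(1)] by simp
  show "vv P (\<phi> x) = 0"
    using power_int_strict_increasing[OF _ N, of 0 "- vv P (\<phi> x)"]
      power_int_strict_increasing[OF _ N, of "- vv P (\<phi> x)" 0] 1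
    by (cases "vv P (\<phi> x)" "0 :: int" rule: linorder_cases) auto
qed (use assms in \<open>simp add: place_def\<close>)

text \<open>A prime is recovered from its place as the set of integral elements whose value differs
  from 1, together with 0. Without injectivity, factors of distinct primes could merge in a product
  over the set of places.\<close>

lemma inj_place: "inj_on place {P. prim P}"
proof (rule inj_onI)
  fix P Q assume PQ: "P \<in> {P. prim P}" "Q \<in> {P. prim P}" "place P = place Q"
  have "x \<in> P \<longleftrightarrow> x \<in> Q" if x: "x \<in> Oint" "x \<noteq> 0" for x
  proof -
    have c: "\<psi> x \<in> carrier F" "\<psi> x \<noteq> \<zero>\<^bsub>F\<^esub>" "\<phi> (\<psi> x) = x" using x Oint_K \<psi> \<psi>_nonzero by auto
    have "vv P x = 0 \<longleftrightarrow> vv Q x = 0"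
      using place_eq_1_iff[OF _ c(1,2), of P] place_eq_1_iff[OF _ c(1,2), of Q] PQ c(3) by simp
    moreover have "0 \<le> vv P x" "0 \<le> vv Q x" using PQ x vv_nonneg by auto
    ultimately show ?thesis using vv_pos_iff[of P x] vv_pos_iff[of Q x] PQ x by auto
  qed
  moreover have "0 \<in> P" "0 \<in> Q" "P \<subseteq> Oint" "Q \<subseteq> Oint"
    using PQ intidealD(6)[OF primD(1)] primD(4) by auto
  ultimately show "P = Q" by blast
qed

lemma finite_places_product:
  assumes x: "x \<in> carrier F" "x \<noteq> \<zero>\<^bsub>F\<^esub>"
  shows "finite {v \<in> finite_places F. v x \<noteq> 1}" "abs_prod (finite_places F) x = inverse (cmod (nrm (\<phi> x)))"
proof -
  have z: "\<phi> x \<in> K" "\<phi> x \<noteq> 0" using x \<phi>_K \<phi>_eq_0_iff by auto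
  let ?Q = "{P. prim P \<and> vv P (\<phi> x) \<noteq> 0}"
  have eq: "{v \<in> finite_places F. v x \<noteq> 1} = place ` ?Q"
    unfolding finite_places_eq using place_eq_1_iff[OF _ x] by auto
  show "finite {v \<in> finite_places F. v x \<noteq> 1}" unfolding eq using product_formula(1)[OF z] by simp
  have "inj_on place ?Q" using inj_place by (rule inj_on_subset) auto
  then have "abs_prod (finite_places F) x = (\<Prod>P\<in>?Q. place P x)"
    unfolding abs_prod_def eq by (simp add: prod.reindex)
  also have "\<dots> = (\<Prod>P\<in>?Q. inverse (real (NP P) powi vv P (\<phi> x)))"
    using x by (intro prod.cong refl) (simp add: place_def power_int_minus)
  also have "\<dots> = inverse (cmod (nrm (\<phi> x)))"
    unfolding product_formula(2)[OF z]
    using prod_inversef[of "\<lambda>P. real (NP P) powi vv P (\<phi> x)" ?Q] by (simp add: comp_def)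
  finally show "abs_prod (finite_places F) x = inverse (cmod (nrm (\<phi> x)))" .
qed

lemma conj_cnj: "b \<in> conj \<Longrightarrow> cnj b \<in> conj"
proof -
  assume "b \<in> conj"
  then have "cnj (ipoly f b) = 0" by (simp add: conj_def)
  moreover have "cnj (ipoly f b) = ipoly f (cnj b)" by (simp add: Polynomial.poly_altdef)
  ultimately show ?thesis by (simp add: conj_def)
qed

lemma \<sigma>_coordinates:
  assumes "b \<in> conj" shows "\<sigma> b (\<Sum>i<deg. of_rat (c i) * \<alpha> ^ i) = (\<Sum>i<deg. of_rat (c i) * b ^ i)"
  using assms by (simp add: \<sigma>_sum \<sigma>_mult \<sigma>_of_rat \<sigma>_power \<sigma>_\<alpha>)

lemma cnj_of_rat: "cnj (of_rat q) = of_rat q"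
  by (cases q) (simp add: of_rat_rat)

lemma \<sigma>_cnj: assumes "b \<in> conj" "x \<in> K" shows "\<sigma> (cnj b) x = cnj (\<sigma> b x)"
proof -
  obtain c where c: "x = (\<Sum>i<deg. of_rat (c i) * \<alpha> ^ i)" using assms(2) by (rule coordinates)
  show ?thesis unfolding c \<sigma>_coordinates[OF assms(1)] \<sigma>_coordinates[OF conj_cnj[OF assms(1)]]
    by (simp add: cnj_of_rat)
qed

text \<open>An embedding fixes the rationals, so it is determined by the image of \<alpha>, which
  must be a root of \<open>f\<close>.\<close>

lemma embedding_eq_\<sigma>:
  assumes \<tau>: "\<tau> \<in> Ring.ring_hom F (ring_of_type_algebra :: complex ring)"
  shows "\<exists>b\<in>conj. \<forall>x\<in>carrier F. \<tau> x = \<sigma> b (\<phi> x)"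
proof -
  define \<rho> where "\<rho> z = \<tau> (\<psi> z)" for z
  have \<tau>': "\<tau> (x \<oplus>\<^bsub>F\<^esub> y) = \<tau> x + \<tau> y" "\<tau> (x \<otimes>\<^bsub>F\<^esub> y) = \<tau> x * \<tau> y" "\<tau> \<one>\<^bsub>F\<^esub> = 1"
    if "x \<in> carrier F" "y \<in> carrier F" for x y
    using \<tau> that by (auto simp: Ring.ring_hom_def ring_of_type_algebra_def)
  have add: "\<rho> (x + y) = \<rho> x + \<rho> y" and mult: "\<rho> (x * y) = \<rho> x * \<rho> y" if "x \<in> K" "y \<in> K" for x y
    using that \<tau>' \<psi>(1) by (simp_all add: \<rho>_def \<psi>_add \<psi>_mult)
  have one: "\<rho> 1 = 1" using \<tau>'(3)[OF cl(4) cl(4)] by (simp add: \<rho>_def \<psi>_one)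
  have zero: "\<rho> 0 = 0" using add[of 0 0] by simp
  have nat: "\<rho> (of_nat m) = of_nat m" for m by (induction m) (auto simp: zero one add)
  have minus: "\<rho> (- x) = - \<rho> x" if "x \<in> K" for x
    using add[OF that K_uminus[OF that]] zero by (simp add: eq_neg_iff_add_eq_0 add.commute)
  have int: "\<rho> (of_int k) = of_int k" for k
    by (cases k) (auto simp: nat minus simp del: of_nat_Suc)
  have rat: "\<rho> (of_rat q) = of_rat q" for q
  proof (cases q)
    case (Fract a b)
    then have "of_rat q * of_int b = (of_int a :: complex)" by (simp add: of_rat_rat)
    then have "\<rho> (of_rat q) * of_int b = of_int a" using mult[of "of_rat q" "of_int b"] int by simp
    then have "\<rho> (of_rat q) * of_int b = of_rat q * of_int b" using \<open>of_rat q * of_int b = (of_int a :: complex)\<close> by simp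
    then show ?thesis using Fract(2) by simp
  qed
  have pow: "\<rho> (x ^ k) = \<rho> x ^ k" if "x \<in> K" for x k
    by (induction k) (auto simp: one mult that)
  have sum: "\<rho> (sum g I) = (\<Sum>i\<in>I. \<rho> (g i))" if "\<And>i. i \<in> I \<Longrightarrow> g i \<in> K" for g and I :: "nat set"
    using that by (induction I rule: infinite_finite_induct) (auto simp: zero add)
  define b where "b = \<rho> \<alpha>"
  have poly: "\<rho> (\<Sum>i\<in>I. of_rat (c i) * \<alpha> ^ i) = (\<Sum>i\<in>I. of_rat (c i) * b ^ i)" for c and I :: "nat set"
    by (simp add: sum mult rat pow b_def)
  have z: "(\<Sum>i\<le>deg. of_rat (of_int (coeff f i)) * \<alpha> ^ i) = 0"
    using root by (simp add: Polynomial.poly_altdef)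
  have "(\<Sum>i\<le>deg. of_rat (of_int (coeff f i)) * b ^ i) = 0"
    using poly[of "\<lambda>i. of_int (coeff f i)" "{..deg}"] unfolding z zero by (rule sym)
  then have b: "b \<in> conj" by (simp add: conj_def Polynomial.poly_altdef)
  have "\<tau> x = \<sigma> b (\<phi> x)" if x: "x \<in> carrier F" for x
  proof -
    obtain c where c: "\<phi> x = (\<Sum>i<deg. of_rat (c i) * \<alpha> ^ i)" using \<phi>_K[OF x] by (rule coordinates)
    have "\<tau> x = \<rho> (\<phi> x)" using \<psi>(3)[OF x] by (simp add: \<rho>_def)
    then show ?thesis unfolding c poly \<sigma>_coordinates[OF b] .
  qed
  then show ?thesis using b by blast
qed

lemma \<sigma>_embedding: "b \<in> conj \<Longrightarrow> (\<lambda>x. \<sigma> b (\<phi> x)) \<in> Ring.ring_hom F (ring_of_type_algebra :: complex ring)"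
  by (auto simp: Ring.ring_hom_def ring_of_type_algebra_def \<phi>_add \<phi>_mult \<phi>_one \<sigma>_add \<sigma>_mult \<sigma>_1 \<phi>_K)

definition ipl :: "complex \<Rightarrow> 'a \<Rightarrow> real" where
  "ipl b x = (if x \<in> carrier F then (if b \<in> \<real> then cmod (\<sigma> b (\<phi> x)) else (cmod (\<sigma> b (\<phi> x)))\<^sup>2) else 0)"

lemma \<sigma>_real_iff: assumes "b \<in> conj" shows "(\<lambda>x. \<sigma> b (\<phi> x)) ` carrier F \<subseteq> \<real> \<longleftrightarrow> b \<in> \<real>"
proof
  assume "(\<lambda>x. \<sigma> b (\<phi> x)) ` carrier F \<subseteq> \<real>"
  moreover have "\<sigma> b (\<phi> (\<psi> \<alpha>)) = b" using \<psi>(2) \<sigma>_\<alpha>[OF assms] by simp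
  ultimately show "b \<in> \<real>" using \<psi>(1)[OF \<alpha>_in_K] by (metis image_subset_iff)
next
  assume "b \<in> \<real>"
  then have "cnj b = b" by (simp add: Reals_cnj_iff)
  then have "cnj (\<sigma> b (\<phi> x)) = \<sigma> b (\<phi> x)" if "x \<in> carrier F" for x
    using \<sigma>_cnj[OF assms \<phi>_K[OF that]] by simp
  then show "(\<lambda>x. \<sigma> b (\<phi> x)) ` carrier F \<subseteq> \<real>" by (auto simp: Reals_cnj_iff)
qed

lemma infinite_abs_cong:
  assumes "\<And>x. x \<in> carrier F \<Longrightarrow> \<tau> x = \<tau>' x" shows "infinite_abs F \<tau> = infinite_abs F \<tau>'"
proof -
  have "\<tau> ` carrier F = \<tau>' ` carrier F" using assms by (rule image_cong[OF refl])
  then show ?thesis using assms by (intro ext) (simp add: infinite_abs_def)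
qed

lemma infinite_places_eq: "infinite_places F = ipl ` {b \<in> conj. Im b \<ge> 0}"
proof -
  have e: "infinite_abs F (\<lambda>x. \<sigma> b (\<phi> x)) = ipl b" if "b \<in> conj" for b
    by (intro ext) (simp add: infinite_abs_def ipl_def \<sigma>_real_iff[OF that])
  have "infinite_places F = ipl ` conj"
  proof (intro equalityI subsetI)
    fix v assume "v \<in> infinite_places F"
    then obtain \<tau> where t: "v = infinite_abs F \<tau>" "\<tau> \<in> Ring.ring_hom F (ring_of_type_algebra :: complex ring)"
      by (auto simp: infinite_places_def)
    obtain b where b: "b \<in> conj" "\<forall>x\<in>carrier F. \<tau> x = \<sigma> b (\<phi> x)" using embedding_eq_\<sigma>[OF t(2)] by blast
    have "v = ipl b" unfolding t(1) e[OF b(1), symmetric] using b(2) by (intro infinite_abs_cong) simp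
    then show "v \<in> ipl ` conj" using b(1) by simp
  next
    fix v assume "v \<in> ipl ` conj"
    then obtain b where b: "b \<in> conj" "v = ipl b" by blast
    have "v = infinite_abs F (\<lambda>x. \<sigma> b (\<phi> x))" using b(2) e[OF b(1)] by simp
    then show "v \<in> infinite_places F"
      unfolding infinite_places_def using \<sigma>_embedding[OF b(1)] by blast
  qed
  moreover have "ipl ` conj \<subseteq> ipl ` {b \<in> conj. Im b \<ge> 0}"
  proof (rule image_subsetI)
    fix b assume b: "b \<in> conj"
    have "ipl (cnj b) = ipl b"
      by (intro ext) (simp add: ipl_def \<sigma>_cnj[OF b \<phi>_K] complex_is_Real_iff)
    then show "ipl b \<in> ipl ` {b \<in> conj. Im b \<ge> 0}"
      using b conj_cnj[OF b] by (cases "Im b \<ge> 0") (auto intro: image_eqI[of _ _ "cnj b"])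
  qed
  ultimately show ?thesis by blast
qed

text \<open>The value at 2 is 2 at a real place and 4 at a complex one, which decides the
  normalization. The moduli of \<open>b\<close> and \<open>b + 1\<close> then fix the real part of
  \<open>b\<close> and its imaginary part up to sign.\<close>

lemma inj_ipl: "inj_on ipl {b \<in> conj. Im b \<ge> 0}"
proof (rule inj_onI)
  fix b b' assume b: "b \<in> {b \<in> conj. Im b \<ge> 0}" "b' \<in> {b \<in> conj. Im b \<ge> 0}" "ipl b = ipl b'"
  have c: "b \<in> conj" "b' \<in> conj" "Im b \<ge> 0" "Im b' \<ge> 0" using b by auto
  have v: "ipl c (\<psi> z) = (if c \<in> \<real> then cmod (\<sigma> c z) else (cmod (\<sigma> c z))\<^sup>2)" if "z \<in> K" for c z
    using that \<psi> by (simp add: ipl_def)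
  have "b \<in> \<real> \<longleftrightarrow> b' \<in> \<real>"
    using fun_cong[OF b(3), of "\<psi> 2"] v[of 2 b] v[of 2 b'] \<sigma>_of_nat[OF c(1), of 2] \<sigma>_of_nat[OF c(2), of 2] K_of_nat[of 2]
    by (auto split: if_splits)
  then have n: "cmod (\<sigma> b z) = cmod (\<sigma> b' z)" if "z \<in> K" for z
    using fun_cong[OF b(3), of "\<psi> z"] v[OF that, of b] v[OF that, of b'] by (auto split: if_splits)
  have n0: "(cmod b)\<^sup>2 = (cmod b')\<^sup>2" using n[OF \<alpha>_in_K] \<sigma>_\<alpha>[OF c(1)] \<sigma>_\<alpha>[OF c(2)] by simp
  have "(cmod (b + 1))\<^sup>2 = (cmod (b' + 1))\<^sup>2"
    using n[of "\<alpha> + 1"] c by (simp add: \<sigma>_add \<sigma>_\<alpha> \<sigma>_1)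
  then have re: "Re b = Re b'" using n0 unfolding cmod_power2 by (simp add: power2_eq_square algebra_simps)
  then have "(Im b)\<^sup>2 = (Im b')\<^sup>2" using n0 by (simp add: cmod_power2)
  then have "Im b = Im b'" using c(3,4) by (simp add: power2_eq_iff_nonneg)
  then show "b = b'" using re by (simp add: complex_eq_iff)
qed

lemma finite_infinite_places: "finite (infinite_places F)"
  unfolding infinite_places_eq using finite_conj by simp

lemma infinite_places_product:
  assumes "x \<in> carrier F" shows "(\<Prod>v\<in>infinite_places F. v x) = cmod (nrm (\<phi> x))"
proof -
  have "(\<Prod>v\<in>infinite_places F. v x) = (\<Prod>b\<in>{b \<in> conj. Im b \<ge> 0}. ipl b x)"
    unfolding infinite_places_eq by (subst prod.reindex[OF inj_ipl]) simp
  also have "\<dots> = (\<Prod>b\<in>conj. cmod (\<sigma> b (\<phi> x)))"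
    using assms by (subst prod_pairs_cnj[OF finite_conj])
      (auto simp: conj_cnj \<sigma>_cnj \<phi>_K ipl_def intro!: prod.cong)
  finally show ?thesis by (simp add: nrm_def prod_norm)
qed

text \<open>The integer 2 has value above 1 at every infinite place and at most 1 at every finite
  one. Disjointness is what lets a product over the union of the two sets split.\<close>

lemma places_disjoint: "infinite_places F \<inter> finite_places F = {}"
proof (rule ccontr)
  assume "infinite_places F \<inter> finite_places F \<noteq> {}"
  then obtain b P where b: "b \<in> conj" and P: "prim P" and eq: "ipl b = place P"
    unfolding infinite_places_eq finite_places_eq by blast
  have two: "\<psi> 2 \<in> carrier F" "\<psi> 2 \<noteq> \<zero>\<^bsub>F\<^esub>" "\<phi> (\<psi> 2) = 2"
    using K_of_nat[of 2] \<psi> \<psi>_nonzero by auto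
  have "ipl b (\<psi> 2) > 1" using two \<sigma>_of_nat[OF b, of 2] by (auto simp: ipl_def)
  moreover have "place P (\<psi> 2) \<le> 1"
  proof -
    have "0 \<le> vv P 2" using vv_nonneg[OF P Oint_of_nat[of 2]] by simp
    then have "real (NP P) powi (- vv P 2) \<le> real (NP P) powi 0"
      using NP_ge_2[OF P] by (intro power_int_increasing) auto
    then show ?thesis using two by (simp add: place_def)
  qed
  ultimately show False using eq by simp
qed

lemma abs_prod_finite: "finite S \<Longrightarrow> abs_prod S x = (\<Prod>v\<in>S. v x)"
  unfolding abs_prod_def by (intro prod.mono_neutral_left) auto

lemma abs_prod_union:
  assumes "finite {v\<in>S. v x \<noteq> 1}" "finite {v\<in>T. v x \<noteq> 1}" "S \<inter> T = {}"
  shows "abs_prod (S \<union> T) x = abs_prod S x * abs_prod T x"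
proof -
  have e: "{v \<in> S \<union> T. v x \<noteq> 1} = {v\<in>S. v x \<noteq> 1} \<union> {v\<in>T. v x \<noteq> 1}" by auto
  have d: "{v\<in>S. v x \<noteq> 1} \<inter> {v\<in>T. v x \<noteq> 1} = {}" using assms(3) by blast
  show ?thesis unfolding abs_prod_def e by (rule prod.union_disjoint[OF assms(1,2) d])
qed

text \<open>The finite places multiply to the inverse of the norm and the infinite ones to the norm.
  Splitting the finite places into \<open>S\<close> and \<open>T\<close> moves the part at
  \<open>T\<close> to the other side.\<close>

lemma abs_prod_complement:
  assumes x: "x \<in> carrier F" "x \<noteq> \<zero>\<^bsub>F\<^esub>" and T: "T \<subseteq> finite_places F" "S = finite_places F - T"
  shows "inverse (abs_prod T x) = abs_prod (infinite_places F \<union> S) x"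
    "finite S \<Longrightarrow> abs_prod (infinite_places F \<union> S) x = cmod (nrm (\<phi> x)) * (\<Prod>v\<in>S. v x)"
proof -
  note fp = finite_places_product[OF x]
  have fT: "finite {v\<in>T. v x \<noteq> 1}" "finite {v\<in>S. v x \<noteq> 1}" "finite {v\<in>infinite_places F. v x \<noteq> 1}"
    using T finite_infinite_places by (auto intro: finite_subset[OF _ fp(1)])
  have u: "finite_places F = S \<union> T" and d: "S \<inter> T = {}" using T by auto
  have "abs_prod (finite_places F) x = abs_prod S x * abs_prod T x"
    unfolding u by (rule abs_prod_union[OF fT(2,1) d])
  then have "abs_prod S x * abs_prod T x = inverse (cmod (nrm (\<phi> x)))" using fp(2) by simp
  moreover have "cmod (nrm (\<phi> x)) \<noteq> 0" using nrm_nonzero x \<phi>_K \<phi>_eq_0_iff by simp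
  ultimately have inv: "abs_prod T x * (cmod (nrm (\<phi> x)) * abs_prod S x) = 1"
    by (simp add: field_simps)
  have U: "abs_prod (infinite_places F \<union> S) x = cmod (nrm (\<phi> x)) * abs_prod S x"
    using places_disjoint T
    by (subst abs_prod_union[OF fT(3,2)]) (auto simp: abs_prod_finite[OF finite_infinite_places] infinite_places_product[OF x(1)])
  show "inverse (abs_prod T x) = abs_prod (infinite_places F \<union> S) x"
    unfolding U by (rule inverse_unique[OF inv])
  show "finite S \<Longrightarrow> abs_prod (infinite_places F \<union> S) x = cmod (nrm (\<phi> x)) * (\<Prod>v\<in>S. v x)"
    using U abs_prod_finite by metis
qed

end

section \<open>Abel means\<close>

text \<open>The Abel mean at radius \<open>r\<close>. For \<open>u n = F n * x ^ n\<close>, with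
  value 0 at 0, the series is \<open>z\<close> times the logarithmic derivative of the zeta function
  at \<open>z = r * x\<close>, so this quantity has a nonzero limit exactly where a simple pole of
  that derivative would sit.\<close>

definition abel :: "(nat \<Rightarrow> complex) \<Rightarrow> real \<Rightarrow> complex" where
  "abel u r = of_real (1 - r) * (suminf (\<lambda>n. u n * of_real r ^ n))"

definition bdd_seq :: "(nat \<Rightarrow> complex) \<Rightarrow> bool" where
  "bdd_seq u \<longleftrightarrow> (\<exists>C. \<forall>n. cmod (u n) \<le> C)"

definition negl :: "(nat \<Rightarrow> complex) \<Rightarrow> bool" where
  "negl u \<longleftrightarrow> (abel u \<longlongrightarrow> 0) (at_left 1)"

lemma bdd_seqE: assumes "bdd_seq u" obtains C where "C \<ge> 0" "\<And>n. cmod (u n) \<le> C"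
  using assms unfolding bdd_seq_def by (metis norm_ge_zero order_trans)

lemma bdd_seqI: "(\<And>n. cmod (u n) \<le> C) \<Longrightarrow> bdd_seq u" unfolding bdd_seq_def by blast

lemma bdd_seq_add: assumes "bdd_seq u" "bdd_seq v" shows "bdd_seq (\<lambda>n. u n + v n)"
proof -
  obtain C D where "\<And>n. cmod (u n) \<le> C" "\<And>n. cmod (v n) \<le> D" using assms by (auto elim!: bdd_seqE)
  then show ?thesis by (intro bdd_seqI[of _ "C + D"]) (metis add_mono norm_triangle_ineq order_trans)
qed

lemma bdd_seq_mult: assumes "bdd_seq u" "bdd_seq v" shows "bdd_seq (\<lambda>n. u n * v n)"
proof -
  obtain C D where "C \<ge> 0" "\<And>n. cmod (u n) \<le> C" "\<And>n. cmod (v n) \<le> D" using assms by (auto elim!: bdd_seqE)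
  then show ?thesis by (intro bdd_seqI[of _ "C * D"]) (simp add: norm_mult mult_mono)
qed

lemma bdd_seq_const: "bdd_seq (\<lambda>_. c)" by (intro bdd_seqI[of _ "cmod c"]) simp
lemma bdd_seq_unit: "cmod z = 1 \<Longrightarrow> bdd_seq (\<lambda>n. z ^ n)" by (intro bdd_seqI[of _ 1]) (simp add: norm_power)
lemma bdd_seq_uminus: "bdd_seq u \<Longrightarrow> bdd_seq (\<lambda>n. - u n)" by (auto simp: bdd_seq_def)
lemma bdd_seq_diff: "bdd_seq u \<Longrightarrow> bdd_seq v \<Longrightarrow> bdd_seq (\<lambda>n. u n - v n)"
  using bdd_seq_add[OF _ bdd_seq_uminus] by simp
lemma bdd_seq_sum: "(\<And>i. i \<in> I \<Longrightarrow> bdd_seq (u i)) \<Longrightarrow> bdd_seq (\<lambda>n. \<Sum>i\<in>I. u i n)"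
  by (induction I rule: infinite_finite_induct) (auto intro: bdd_seq_const bdd_seq_add)
lemma bdd_seq_prod: "(\<And>i. i \<in> I \<Longrightarrow> bdd_seq (u i)) \<Longrightarrow> bdd_seq (\<lambda>n. \<Prod>i\<in>I. u i n)"
  by (induction I rule: infinite_finite_induct) (auto intro: bdd_seq_const bdd_seq_mult)

lemma abel_summable_norm:
  assumes "bdd_seq u" "0 \<le> r" "r < 1" shows "summable (\<lambda>n. cmod (u n * of_real r ^ n))"
proof -
  obtain C where C: "\<And>n. cmod (u n) \<le> C" using assms(1) by (auto elim!: bdd_seqE)
  show ?thesis
  proof (rule summable_comparison_test')
    show "summable (\<lambda>n. C * r ^ n)" using assms by (intro summable_mult summable_geometric) simp
    show "norm (cmod (u n * of_real r ^ n)) \<le> C * r ^ n" if "n \<ge> 0" for n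
      using C[of n] assms by (simp add: norm_mult norm_power mult_right_mono)
  qed
qed

lemma abel_summable:
  assumes "bdd_seq u" "0 \<le> r" "r < 1" shows "summable (\<lambda>n. u n * of_real r ^ n)"
  using abel_summable_norm[OF assms] by (rule summable_norm_cancel)

lemma abel_add:
  assumes "bdd_seq u" "bdd_seq v" "0 \<le> r" "r < 1"
  shows "abel (\<lambda>n. u n + v n) r = abel u r + abel v r"
  unfolding abel_def distrib_right
    suminf_add[OF abel_summable[OF assms(1,3,4)] abel_summable[OF assms(2,3,4)], symmetric]
  by (rule distrib_left)

lemma abel_cmult:
  assumes "bdd_seq u" "0 \<le> r" "r < 1" shows "abel (\<lambda>n. c * u n) r = c * abel u r"
  using suminf_mult[OF abel_summable[OF assms], of c] by (simp add: abel_def mult_ac)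

lemma abel_bound:
  assumes "\<And>n. cmod (u n) \<le> C" "0 \<le> r" "r < 1" shows "cmod (abel u r) \<le> C"
proof -
  have s: "summable (\<lambda>n. cmod (u n * of_real r ^ n))"
    by (rule abel_summable_norm[OF bdd_seqI[OF assms(1)] assms(2,3)])
  have "cmod (suminf (\<lambda>n. u n * of_real r ^ n)) \<le> (suminf (\<lambda>n. cmod (u n * of_real r ^ n)))" by (rule summable_norm[OF s])
  also have "\<dots> \<le> (suminf (\<lambda>n. C * r ^ n))"
    using assms by (intro suminf_le s summable_mult summable_geometric) (auto simp: norm_mult norm_power mult_right_mono)
  also have "\<dots> = C / (1 - r)" using assms by (subst suminf_mult) (auto simp: suminf_geometric)
  finally have "(1 - r) * cmod (suminf (\<lambda>n. u n * of_real r ^ n)) \<le> (1 - r) * (C / (1 - r))"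
    using assms by (intro mult_left_mono) auto
  moreover have "cmod (complex_of_real (1 - r)) = 1 - r" using assms by (subst norm_of_real) simp
  ultimately show ?thesis using assms by (simp add: abel_def norm_mult)
qed

lemma eventually_left_1: "(\<forall>\<^sub>F r in at_left (1::real). 0 \<le> r \<and> r < 1)"
  using eventually_at_left_real[of 0 1] by (auto elim: eventually_mono)

lemma negl_add: assumes "bdd_seq u" "bdd_seq v" "negl u" "negl v" shows "negl (\<lambda>n. u n + v n)"
proof -
  have l: "((\<lambda>r. abel u r + abel v r) \<longlongrightarrow> 0 + 0) (at_left 1)"
    using assms(3,4) unfolding negl_def by (rule tendsto_add)
  have e: "\<forall>\<^sub>F r in at_left 1. abel u r + abel v r = abel (\<lambda>n. u n + v n) r"
    using eventually_left_1 by (rule eventually_mono) (use abel_add[OF assms(1,2)] in auto)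
  show ?thesis using Lim_transform_eventually[OF l e] by (simp add: negl_def)
qed

lemma negl_cmult: assumes "bdd_seq u" "negl u" shows "negl (\<lambda>n. c * u n)"
proof -
  have l: "((\<lambda>r. c * abel u r) \<longlongrightarrow> c * 0) (at_left 1)"
    using assms(2) unfolding negl_def by (rule tendsto_mult_left)
  have e: "\<forall>\<^sub>F r in at_left 1. c * abel u r = abel (\<lambda>n. c * u n) r"
    using eventually_left_1 by (rule eventually_mono) (use abel_cmult[OF assms(1)] in auto)
  show ?thesis using Lim_transform_eventually[OF l e] by (simp add: negl_def)
qed

lemma negl_diff: assumes "bdd_seq u" "bdd_seq v" "negl u" "negl v" shows "negl (\<lambda>n. u n - v n)"
  using negl_add[OF assms(1) bdd_seq_uminus[OF assms(2)] assms(3)] negl_cmult[OF assms(2,4), of "-1"] by simp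

lemma negl_sum:
  assumes "finite I" "\<And>i. i \<in> I \<Longrightarrow> bdd_seq (u i) \<and> negl (u i)" shows "negl (\<lambda>n. \<Sum>i\<in>I. u i n)"
  using assms
proof (induction I rule: finite_induct)
  case empty
  have "abel (\<lambda>n. 0) = (\<lambda>r. 0)" by (intro ext) (simp add: abel_def)
  then show ?case by (simp add: negl_def)
next
  case (insert i I)
  then show ?case by (simp add: negl_add bdd_seq_sum)
qed

text \<open>Abel means are contractive for the supremum norm, so sequences of mean 0 are closed
  under uniform limits.\<close>

lemma negl_uniform:
  assumes "bdd_seq u"
    and appr: "\<And>e. e > 0 \<Longrightarrow> \<exists>v. bdd_seq v \<and> negl v \<and> (\<forall>n. cmod (u n - v n) \<le> e)"
  shows "negl u"
  unfolding negl_def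
proof (rule tendstoI)
  fix e :: real assume e: "e > 0"
  obtain v where v: "bdd_seq v" "negl v" "\<And>n. cmod (u n - v n) \<le> e / 2"
    using appr[of "e / 2"] e by auto
  have "\<forall>\<^sub>F r in at_left 1. dist (abel v r) 0 < e / 2"
    using v(2) e unfolding negl_def by (intro tendstoD) auto
  then show "\<forall>\<^sub>F r in at_left 1. dist (abel u r) 0 < e"
    using eventually_left_1
  proof eventually_elim
    case (elim r)
    have "abel (\<lambda>n. (u n - v n) + v n) r = abel (\<lambda>n. u n - v n) r + abel v r"
      using elim assms(1) v(1) by (intro abel_add bdd_seq_diff) auto
    moreover have "cmod (abel (\<lambda>n. u n - v n) r) \<le> e / 2"
      using elim v(3) by (intro abel_bound) auto
    ultimately show ?case
      using elim norm_triangle_ineq[of "abel (\<lambda>n. u n - v n) r" "abel v r"] by simp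
  qed
qed

lemma negl_tendsto_0:
  assumes "u \<longlonglongrightarrow> 0" shows "negl u"
proof (rule negl_uniform)
  show "bdd_seq u"
    using convergent_imp_Bseq[of u] assms by (auto simp: convergent_def Bseq_def bdd_seq_def)
  fix e :: real assume "e > 0"
  then obtain N where N: "\<And>n. n \<ge> N \<Longrightarrow> cmod (u n) < e" using assms by (auto simp: lim_sequentially dist_norm)
  define v where "v n = (if n < N then u n else 0)" for n
  have eq: "abel v = (\<lambda>r. of_real (1 - r) * (\<Sum>n<N. u n * of_real r ^ n))"
  proof
    fix r
    have "(suminf (\<lambda>n. v n * of_real r ^ n)) = (\<Sum>n<N. v n * of_real r ^ n)"
      by (rule suminf_finite) (auto simp: v_def)
    then show "abel v r = of_real (1 - r) * (\<Sum>n<N. u n * of_real r ^ n)" by (simp add: abel_def v_def)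
  qed
  have l: "((\<lambda>r. of_real (1 - r) * (\<Sum>n<N. u n * of_real r ^ n)) \<longlongrightarrow>
      of_real (1 - 1) * (\<Sum>n<N. u n * of_real 1 ^ n)) (at_left 1)"
    by (intro tendsto_intros)
  have "negl v" using l unfolding negl_def eq by simp
  moreover have "cmod (v n) \<le> (\<Sum>n<N. cmod (u n))" for n
    by (auto simp: v_def intro: member_le_sum[where f = "\<lambda>n. cmod (u n)"] sum_nonneg)
  then have "bdd_seq v" by (rule bdd_seqI)
  moreover have "cmod (u n - v n) \<le> e" for n using N[of n] \<open>e > 0\<close> by (auto simp: v_def)
  ultimately show "\<exists>v. bdd_seq v \<and> negl v \<and> (\<forall>n. cmod (u n - v n) \<le> e)" by blast
qed

text \<open>A single term contributes nothing in the limit. The index 0 needs this freedom, because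
  divisibility and multiplicity take default values there.\<close>

lemma negl_cong_pos:
  assumes "bdd_seq u" "negl u" "\<And>n. n \<ge> 1 \<Longrightarrow> v n = u n" shows "bdd_seq v" "negl v"
proof -
  define d where "d n = v n - u n" for n
  have "\<forall>\<^sub>F n in sequentially. d n = 0"
    using eventually_ge_at_top[of 1] by eventually_elim (simp add: d_def assms(3))
  then have d0: "d \<longlonglongrightarrow> 0" by (rule tendsto_eventually)
  have "cmod (d n) \<le> cmod (d 0)" for n using assms(3)[of n] by (cases n) (auto simp: d_def)
  then have bd: "bdd_seq d" by (rule bdd_seqI)
  have v: "v = (\<lambda>n. u n + d n)" by (auto simp: d_def)
  show "bdd_seq v" unfolding v by (rule bdd_seq_add[OF assms(1) bd])
  show "negl v" unfolding v by (rule negl_add[OF assms(1) bd assms(2) negl_tendsto_0[OF d0]])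
qed

text \<open>Shifting by the period multiplies the terms by \<open>z ^ t\<close>, so the power series
  is a polynomial divided by \<open>1 - z ^ t * r ^ t\<close>. This denominator does not vanish at
  \<open>r = 1\<close>, and the factor \<open>1 - r\<close> remains.\<close>

lemma negl_periodic:
  assumes per: "\<And>n. G (n + t) = G n" and t: "t \<ge> 1" and z: "cmod z = 1" "z ^ t \<noteq> 1" and bd: "bdd_seq G"
  shows "negl (\<lambda>n. z ^ n * G n)"
proof -
  define u where "u n = z ^ n * G n" for n
  have bu: "bdd_seq u" unfolding u_def by (intro bdd_seq_mult bdd_seq_unit z bd)
  have shift: "u (n + t) = z ^ t * u n" for n by (simp add: u_def per power_add mult_ac)
  define P where "P r = (\<Sum>n<t. u n * of_real r ^ n)" for r :: real
  have "abel u r = of_real (1 - r) * P r / (1 - z ^ t * of_real r ^ t)" if r: "0 \<le> r" "r < 1" for r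
  proof -
    define S where "S = (suminf (\<lambda>n. u n * of_real r ^ n))"
    note s = abel_summable[OF bu r]
    have "S = (suminf (\<lambda>n. u (n + t) * of_real r ^ (n + t))) + P r"
      unfolding S_def P_def by (rule suminf_split_initial_segment[OF s])
    also have "(suminf (\<lambda>n. u (n + t) * of_real r ^ (n + t))) = (suminf (\<lambda>n. (z ^ t * of_real r ^ t) * (u n * of_real r ^ n)))"
      by (intro suminf_cong) (simp add: shift power_add mult_ac)
    also have "\<dots> = (z ^ t * of_real r ^ t) * S" unfolding S_def by (rule suminf_mult[OF s])
    finally have eq: "S * (1 - z ^ t * of_real r ^ t) = P r" by (simp add: algebra_simps)
    have "cmod (z ^ t * of_real r ^ t) < 1"
      using r z t by (simp add: norm_mult norm_power power_less_one_iff)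
    then have "1 - z ^ t * of_real r ^ t \<noteq> 0" by auto
    then have "S = P r / (1 - z ^ t * of_real r ^ t)" using eq by (metis nonzero_eq_divide_eq)
    then show ?thesis unfolding abel_def S_def[symmetric] by (simp only: times_divide_eq_right)
  qed
  then have e: "\<forall>\<^sub>F r in at_left 1. of_real (1 - r) * P r / (1 - z ^ t * of_real r ^ t) = abel u r"
    using eventually_left_1 by (auto elim: eventually_mono)
  have l: "((\<lambda>r. of_real (1 - r) * P r / (1 - z ^ t * of_real r ^ t)) \<longlongrightarrow>
     of_real (1 - 1) * P 1 / (1 - z ^ t * of_real 1 ^ t)) (at_left 1)"
    unfolding P_def using z(2) by (intro tendsto_intros) auto
  show ?thesis using Lim_transform_eventually[OF l e] unfolding negl_def u_def[symmetric] by simp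
qed

section \<open>Trigonometric polynomials\<close>

inductive_set trig :: "(nat \<Rightarrow> complex) set" where
  trig_mono: "cmod z = 1 \<Longrightarrow> (\<lambda>n. c * z ^ n) \<in> trig"
| trig_add: "u \<in> trig \<Longrightarrow> v \<in> trig \<Longrightarrow> (\<lambda>n. u n + v n) \<in> trig"

lemma trig_const: "(\<lambda>n. c) \<in> trig" using trig_mono[of 1 c] by simp
lemma trig_power: "cmod z = 1 \<Longrightarrow> (\<lambda>n. z ^ n) \<in> trig" using trig_mono[of z 1] by simp

lemma trig_mult_mono: "v \<in> trig \<Longrightarrow> cmod z = 1 \<Longrightarrow> (\<lambda>n. (c * z ^ n) * v n) \<in> trig"
proof (induction rule: trig.induct)
  case (trig_mono w d)
  have "(\<lambda>n. (c * d) * (z * w) ^ n) \<in> trig" using trig_mono by (intro trig.trig_mono) (simp add: norm_mult)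
  then show ?case by (simp add: power_mult_distrib mult_ac)
next
  case (trig_add u v)
  then show ?case using trig.trig_add by (simp add: distrib_left)
qed

lemma trig_mult: "u \<in> trig \<Longrightarrow> v \<in> trig \<Longrightarrow> (\<lambda>n. u n * v n) \<in> trig"
proof (induction rule: trig.induct)
  case (trig_mono w d)
  then show ?case using trig_mult_mono by blast
next
  case (trig_add u v)
  then show ?case using trig.trig_add by (simp add: distrib_right)
qed

lemma trig_sum: "(\<And>i. i \<in> I \<Longrightarrow> u i \<in> trig) \<Longrightarrow> (\<lambda>n. \<Sum>i\<in>I. u i n) \<in> trig"
  by (induction I rule: infinite_finite_induct) (auto intro: trig_const trig_add)

lemma trig_rep:
  "u \<in> trig \<Longrightarrow> \<exists>Z c. finite Z \<and> (\<forall>z\<in>Z. cmod z = 1) \<and> u = (\<lambda>n. \<Sum>z\<in>Z. c z * z ^ n)"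
proof (induction rule: trig.induct)
  case (trig_mono z c)
  then show ?case by (intro exI[of _ "{z}"] exI[of _ "\<lambda>_. c"]) simp
next
  case (trig_add u v)
  then obtain Z c Y d where Z: "finite Z" "\<forall>z\<in>Z. cmod z = 1" "u = (\<lambda>n. \<Sum>z\<in>Z. c z * z ^ n)"
    and Y: "finite Y" "\<forall>z\<in>Y. cmod z = 1" "v = (\<lambda>n. \<Sum>z\<in>Y. d z * z ^ n)" by blast
  define e where "e z = (if z \<in> Z then c z else 0) + (if z \<in> Y then d z else 0)" for z
  have "u n + v n = (\<Sum>z\<in>Z \<union> Y. e z * z ^ n)" for n
  proof -
    have "u n = (\<Sum>z\<in>Z \<union> Y. (if z \<in> Z then c z else 0) * z ^ n)"
      unfolding Z(3) using Z(1) Y(1) by (intro sum.mono_neutral_cong_left) auto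
    moreover have "v n = (\<Sum>z\<in>Z \<union> Y. (if z \<in> Y then d z else 0) * z ^ n)"
      unfolding Y(3) using Z(1) Y(1) by (intro sum.mono_neutral_cong_left) auto
    ultimately show ?thesis by (simp add: e_def distrib_right sum.distrib)
  qed
  then show ?case using Z Y by (intro exI[of _ "Z \<union> Y"] exI[of _ e]) auto
qed

lemma bdd_seq_trig: "u \<in> trig \<Longrightarrow> bdd_seq u"
  by (induction rule: trig.induct) (auto intro: bdd_seq_mult bdd_seq_const bdd_seq_unit bdd_seq_add)

text \<open>After division by \<open>w ^ n\<close> every frequency other than \<open>w\<close>
  becomes a power of a number different from 1 and drops out by \<open>negl_periodic\<close> with
  period 1.\<close>

lemma abel_Fourier:
  assumes Z: "finite Z" "\<forall>z\<in>Z. cmod z = 1" and w: "cmod w = 1"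
  shows "(abel (\<lambda>n. (\<Sum>z\<in>Z. c z * z ^ n) * inverse w ^ n) \<longlongrightarrow> (if w \<in> Z then c w else 0)) (at_left 1)"
proof -
  have w0: "w \<noteq> 0" using w by auto
  define v where "v n = (\<Sum>z\<in>Z - {w}. c z * (z / w) ^ n)" for n
  define k where "k = (if w \<in> Z then c w else 0)"
  have nv: "negl v" unfolding v_def
  proof (intro negl_sum conjI)
    fix z assume z: "z \<in> Z - {w}"
    have u: "cmod (z / w) = 1" using z Z w by (simp add: norm_divide)
    show "bdd_seq (\<lambda>n. c z * (z / w) ^ n)" by (intro bdd_seq_mult bdd_seq_const bdd_seq_unit u)
    have "negl (\<lambda>n. (z / w) ^ n * 1)"
      using z w0 by (intro negl_periodic[where t = 1] u bdd_seq_const) auto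
    then show "negl (\<lambda>n. c z * (z / w) ^ n)"
      using negl_cmult[OF bdd_seq_unit[OF u]] by simp
  qed (use Z in simp)
  have bv: "bdd_seq v" unfolding v_def
    using Z w by (intro bdd_seq_sum bdd_seq_mult bdd_seq_const bdd_seq_unit) (auto simp: norm_divide)
  have eq: "(\<Sum>z\<in>Z. c z * z ^ n) * inverse w ^ n = k + v n" for n
  proof -
    have "(\<Sum>z\<in>Z. c z * z ^ n) * inverse w ^ n = (\<Sum>z\<in>Z. c z * (z / w) ^ n)"
      by (simp add: sum_distrib_right divide_inverse power_mult_distrib mult.assoc)
    also have "\<dots> = k + v n"
    proof (cases "w \<in> Z")
      case True then show ?thesis using Z(1) w0 by (simp add: sum.remove k_def v_def)
    qed (simp add: k_def v_def)
    finally show ?thesis .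
  qed
  have k: "abel (\<lambda>_. k) r = k" if "0 \<le> r" "r < 1" for r
    using that by (simp add: abel_def suminf_mult summable_geometric suminf_geometric flip: of_real_power)
      (simp add: suminf_mult summable_geometric suminf_geometric field_simps)
  have e: "\<forall>\<^sub>F r in at_left 1. k + abel v r = abel (\<lambda>n. (\<Sum>z\<in>Z. c z * z ^ n) * inverse w ^ n) r"
    using eventually_left_1 unfolding eq
    by (rule eventually_mono) (simp add: abel_add bdd_seq_const bv k)
  have l: "((\<lambda>r. k + abel v r) \<longlongrightarrow> k + 0) (at_left 1)"
    using nv unfolding negl_def by (intro tendsto_intros)
  show ?thesis using Lim_transform_eventually[OF l e] unfolding k_def[symmetric] by simp
qed

lemma abel_nonneg_mono:
  assumes u: "bdd_seq (\<lambda>n. of_real (x n))" and v: "bdd_seq v" and le: "\<And>n. cmod (v n) \<le> x n" and r: "0 \<le> r" "r < 1"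
  shows "cmod (abel v r) \<le> Re (abel (\<lambda>n. of_real (x n)) r)"
proof -
  have s: "summable (\<lambda>n. x n * r ^ n)"
    using abel_summable[OF u r] by (simp flip: of_real_power of_real_mult)
  have "cmod (suminf (\<lambda>n. v n * of_real r ^ n)) \<le> (suminf (\<lambda>n. cmod (v n * of_real r ^ n)))"
    by (rule summable_norm[OF abel_summable_norm[OF v r]])
  also have "\<dots> \<le> (suminf (\<lambda>n. x n * r ^ n))"
    using le r by (intro suminf_le s abel_summable_norm[OF v r]) (auto simp: norm_mult norm_power mult_right_mono)
  finally have a: "(1 - r) * cmod (suminf (\<lambda>n. v n * of_real r ^ n)) \<le> (1 - r) * (suminf (\<lambda>n. x n * r ^ n))"
    using r by (intro mult_left_mono) auto
  have b: "abel (\<lambda>n. of_real (x n)) r = of_real ((1 - r) * (suminf (\<lambda>n. x n * r ^ n)))"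
    using suminf_of_real[OF s, where 'a = complex] by (simp add: abel_def)
  have c: "cmod (complex_of_real (1 - r)) = 1 - r" using r by (subst norm_of_real) simp
  show ?thesis unfolding b Re_complex_of_real using a by (simp only: abel_def norm_mult c)
qed

text \<open>The mean of a nonnegative trigonometric polynomial bounds all its Fourier coefficients.\<close>

lemma trig_nonneg_mean_pos:
  assumes x: "(\<lambda>n. of_real (x n)) \<in> trig" and nn: "\<And>n. 0 \<le> x n" and ne: "x m \<noteq> 0"
  shows "\<not> negl (\<lambda>n. of_real (x n))"
proof
  assume neg: "negl (\<lambda>n. of_real (x n))"
  obtain Z c where Z: "finite Z" "\<forall>z\<in>Z. cmod z = 1" "(\<lambda>n. of_real (x n)) = (\<lambda>n. \<Sum>z\<in>Z. c z * z ^ n)"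
    using trig_rep[OF x] by blast
  note bx = bdd_seq_trig[OF x]
  have "c w = 0" if w: "w \<in> Z" for w
  proof -
    have w1: "cmod w = 1" using w Z by blast
    have iw: "cmod (inverse w) = 1" using w1 by (simp add: norm_inverse)
    have l1: "(abel (\<lambda>n. of_real (x n) * inverse w ^ n) \<longlongrightarrow> c w) (at_left 1)"
      using abel_Fourier[OF Z(1,2) w1, of c] w unfolding fun_cong[OF Z(3)] by simp
    have "((\<lambda>r. Re (abel (\<lambda>n. of_real (x n)) r)) \<longlongrightarrow> Re 0) (at_left 1)"
      using neg unfolding negl_def by (rule tendsto_Re)
    then have l2: "((\<lambda>r. Re (abel (\<lambda>n. of_real (x n)) r)) \<longlongrightarrow> 0) (at_left 1)"
      by (simp only: zero_complex.sel)
    have "\<forall>\<^sub>F r in at_left 1. cmod (abel (\<lambda>n. of_real (x n) * inverse w ^ n) r) \<le> Re (abel (\<lambda>n. of_real (x n)) r)"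
      using eventually_left_1
    proof eventually_elim
      case (elim r)
      then show ?case
        using nn iw by (intro abel_nonneg_mono bx bdd_seq_mult bdd_seq_unit) (auto simp: norm_mult norm_power norm_inverse)
    qed
    then have l0: "(abel (\<lambda>n. of_real (x n) * inverse w ^ n) \<longlongrightarrow> 0) (at_left 1)"
      by (rule Lim_null_comparison[OF _ l2])
    show "c w = 0" by (rule tendsto_unique[OF trivial_limit_at_left_real l1 l0])
  qed
  then have "complex_of_real (x m) = 0" using fun_cong[OF Z(3), of m] by simp
  then show False using ne by simp
qed

lemma trig_progression:
  assumes B: "B \<ge> (1::nat)"
  shows "(\<lambda>n. if n mod B = A mod B then 1 else 0) \<in> trig"
proof -
  define \<zeta> where "\<zeta> = exp (2 * of_real pi * \<i> / of_nat B)"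
  have pw: "\<zeta> ^ j = exp (2 * of_real pi * \<i> * of_nat j / of_nat B)" for j
    unfolding \<zeta>_def by (simp add: exp_of_nat_mult[symmetric] mult_ac)
  have one: "\<zeta> ^ j = 1 \<longleftrightarrow> B dvd j" for j
    unfolding pw using B by (intro complex_root_unity_eq_1) auto
  have z1: "cmod \<zeta> = 1" unfolding \<zeta>_def by simp
  \<comment> \<open>Orthogonality of the characters modulo \<open>B\<close>. The exponent
    \<open>A * (B - 1)\<close> is congruent to \<open>- A\<close> and stays a natural
    number.\<close>
  have "(if n mod B = A mod B then 1 else 0) = (\<Sum>l<B. (1 / of_nat B * \<zeta> ^ (A * (B - 1) * l)) * (\<zeta> ^ l) ^ n)" for n
  proof -
    define w where "w = \<zeta> ^ (n + A * (B - 1))"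
    have cg: "B dvd n + A * (B - 1) \<longleftrightarrow> n mod B = A mod B"
    proof -
      have "int (n + A * (B - 1)) = (int n - int A) + int A * int B"
        using B by (cases B) (simp_all add: algebra_simps)
      then have "B dvd n + A * (B - 1) \<longleftrightarrow> int B dvd (int n - int A) + int A * int B"
        by (metis int_dvd_int_iff)
      also have "\<dots> \<longleftrightarrow> int B dvd int n - int A" by (rule dvd_add_times_triv_right_iff)
      also have "\<dots> \<longleftrightarrow> int n mod int B = int A mod int B" by (rule mod_eq_dvd_iff[symmetric])
      also have "\<dots> \<longleftrightarrow> n mod B = A mod B" by (simp flip: zmod_int)
      finally show ?thesis .
    qed
    have wB: "w ^ B = 1" unfolding w_def power_mult[symmetric] one by simp
    have "(\<Sum>l<B. (1 / of_nat B * \<zeta> ^ (A * (B - 1) * l)) * (\<zeta> ^ l) ^ n) = (\<Sum>l<B. w ^ l) / of_nat B"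
      unfolding sum_divide_distrib w_def by (intro sum.cong refl) (simp add: power_mult[symmetric] power_add[symmetric] algebra_simps)
    also have "(\<Sum>l<B. w ^ l) = (if w = 1 then of_nat B else 0)"
      using wB by (simp add: geometric_sum)
    finally show ?thesis using one[of "n + A * (B - 1)"] cg B by (auto simp: w_def)
  qed
  moreover have "(\<lambda>n. \<Sum>l<B. (1 / of_nat B * \<zeta> ^ (A * (B - 1) * l)) * (\<zeta> ^ l) ^ n) \<in> trig"
    using z1 by (intro trig_sum trig_mono) (simp add: norm_power)
  ultimately show ?thesis by presburger
qed

section \<open>Non-vanishing of Abel means\<close>

text \<open>For \<open>n \<ge> 1\<close> this is the multiplicity cut off at \<open>t\<close>.
  Counting divisibilities gives the value \<open>t\<close> at \<open>n = 0\<close>, where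
  \<open>multiplicity\<close> is 0; that keeps the function periodic through 0.\<close>

definition ord_upto :: "nat \<Rightarrow> nat \<Rightarrow> nat \<Rightarrow> nat" where
  "ord_upto p t n = card {s\<in>{1..t}. p ^ s dvd n}"

lemma ord_upto_eq:
  assumes "prime p" "n \<ge> 1" shows "ord_upto p t n = min (multiplicity p n) t"
proof -
  have *: "p ^ s dvd n \<longleftrightarrow> s \<le> multiplicity p n" for s
    using assms(2) prime_gt_1_nat[OF assms(1)] by (intro power_dvd_iff_le_multiplicity) auto
  have "{s\<in>{1..t}. p ^ s dvd n} = {1..min (multiplicity p n) t}"
    unfolding * by (rule Set.set_eqI, unfold mem_Collect_eq atLeastAtMost_iff) arith
  then show ?thesis by (simp add: ord_upto_def)
qed

lemma ord_upto_periodic: assumes "p ^ t dvd d" shows "ord_upto p t (n + d) = ord_upto p t n"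
proof -
  have "p ^ s dvd n + d \<longleftrightarrow> p ^ s dvd n" if "s \<le> t" for s
    using dvd_trans[OF le_imp_power_dvd[OF that] assms] by (metis dvd_add_left_iff)
  then have "{s\<in>{1..t}. p ^ s dvd n + d} = {s\<in>{1..t}. p ^ s dvd n}"
    by (intro Collect_cong conj_cong refl) simp
  then show ?thesis by (simp add: ord_upto_def)
qed

text \<open>Uniform limits of periodic functions whose periods have bounded \<open>q\<close>-part.\<close>

definition lim_periodic :: "nat \<Rightarrow> nat \<Rightarrow> (nat \<Rightarrow> real) \<Rightarrow> bool" where
  "lim_periodic q k G \<longleftrightarrow> bdd_seq (\<lambda>n. of_real (G n)) \<and>
     (\<forall>e>0. \<exists>s G'. s \<ge> 1 \<and> \<not> q dvd s \<and> (\<forall>n. G' (n + q ^ k * s) = G' n) \<and>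
        bdd_seq (\<lambda>n. of_real (G' n)) \<and> (\<forall>n\<ge>1. \<bar>G n - G' n\<bar> \<le> e))"

lemma lim_periodic_mult:
  assumes q: "prime q" and G: "lim_periodic q k G" and H: "lim_periodic q k H"
  shows "lim_periodic q k (\<lambda>n. G n * H n)"
  unfolding lim_periodic_def
proof (intro conjI allI impI)
  have bG: "bdd_seq (\<lambda>n. of_real (G n))" and bH: "bdd_seq (\<lambda>n. of_real (H n))"
    using G H by (auto simp: lim_periodic_def)
  show "bdd_seq (\<lambda>n. of_real (G n * H n))" using bdd_seq_mult[OF bG bH] by simp
  obtain C where C: "C \<ge> 0" "\<And>n. \<bar>G n\<bar> \<le> C" using bG by (elim bdd_seqE) simp
  obtain D where D: "D \<ge> 0" "\<And>n. \<bar>H n\<bar> \<le> D" using bH by (elim bdd_seqE) simp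
  fix e :: real assume e: "e > 0"
  \<comment> \<open>With both errors at most \<open>d\<close>, and \<open>H'\<close> at most
    \<open>D + 1\<close> because \<open>d \<le> 1\<close>, the product is off by at most
    \<open>d * (C + D + 1)\<close>.\<close>
  define d where "d = min 1 (e / (C + D + 1))"
  have M: "C + D + 1 > 0" using C(1) D(1) by linarith
  have d: "d > 0" "d \<le> 1" using e M by (auto simp: d_def)
  have "d \<le> e / (C + D + 1)" by (simp add: d_def)
  then have de: "d * (C + D + 1) \<le> e" using M by (simp add: pos_le_divide_eq)
  obtain s G' where s: "s \<ge> 1" "\<not> q dvd s" "\<And>n. G' (n + q ^ k * s) = G' n" "bdd_seq (\<lambda>n. of_real (G' n))"
      "\<And>n. n \<ge> 1 \<Longrightarrow> \<bar>G n - G' n\<bar> \<le> d"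
    using G d(1) unfolding lim_periodic_def by blast
  obtain t H' where t: "t \<ge> 1" "\<not> q dvd t" "\<And>n. H' (n + q ^ k * t) = H' n" "bdd_seq (\<lambda>n. of_real (H' n))"
      "\<And>n. n \<ge> 1 \<Longrightarrow> \<bar>H n - H' n\<bar> \<le> d"
    using H d(1) unfolding lim_periodic_def by blast
  have pG: "G' (n + q ^ k * s * j) = G' n" for n j
  proof (induction j)
    case (Suc j)
    have "n + q ^ k * s * Suc j = (n + q ^ k * s * j) + q ^ k * s" by simp
    then show ?case using s(3) Suc by metis
  qed simp
  have pH: "H' (n + q ^ k * t * j) = H' n" for n j
  proof (induction j)
    case (Suc j)
    have "n + q ^ k * t * Suc j = (n + q ^ k * t * j) + q ^ k * t" by simp
    then show ?case using t(3) Suc by metis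
  qed simp
  show "\<exists>s G'. s \<ge> 1 \<and> \<not> q dvd s \<and> (\<forall>n. G' (n + q ^ k * s) = G' n) \<and>
        bdd_seq (\<lambda>n. of_real (G' n)) \<and> (\<forall>n\<ge>1. \<bar>G n * H n - G' n\<bar> \<le> e)"
  proof (intro exI[of _ "s * t"] exI[of _ "\<lambda>n. G' n * H' n"] conjI allI impI)
    show "1 \<le> s * t" using s t by simp
    show "\<not> q dvd s * t" using q s t prime_dvd_mult_iff by blast
    show "G' (n + q ^ k * (s * t)) * H' (n + q ^ k * (s * t)) = G' n * H' n" for n
      using pG[of n t] pH[of n s] by (simp add: mult_ac)
    show "bdd_seq (\<lambda>n. of_real (G' n * H' n))" using bdd_seq_mult[OF s(4) t(4)] by simp
    fix n :: nat assume n: "1 \<le> n"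
    have "G n * H n - G' n * H' n = G n * (H n - H' n) + H' n * (G n - G' n)" by (simp add: algebra_simps)
    then have "\<bar>G n * H n - G' n * H' n\<bar> \<le> \<bar>G n\<bar> * \<bar>H n - H' n\<bar> + \<bar>H' n\<bar> * \<bar>G n - G' n\<bar>"
      by (metis abs_mult abs_triangle_ineq)
    also have "\<dots> \<le> C * d + (D + 1) * d"
    proof (intro add_mono mult_mono)
      show "\<bar>H' n\<bar> \<le> D + 1" using t(5)[OF n] D(2)[of n] d(2) by linarith
    qed (use C D s(5)[OF n] t(5)[OF n] in auto)
    also have "\<dots> = d * (C + D + 1)" by (simp add: algebra_simps)
    finally show "\<bar>G n * H n - G' n * H' n\<bar> \<le> e" using de by linarith
  qed
qed

lemma lim_periodic_const: assumes "prime q" shows "lim_periodic q k (\<lambda>_. c)"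
  unfolding lim_periodic_def
proof (intro conjI allI impI)
  show "bdd_seq (\<lambda>n. of_real c)" by (rule bdd_seq_const)
  fix e :: real assume "e > 0"
  then show "\<exists>s G'. s \<ge> 1 \<and> \<not> q dvd s \<and> (\<forall>n. G' (n + q ^ k * s) = G' n) \<and>
        bdd_seq (\<lambda>n. of_real (G' n)) \<and> (\<forall>n\<ge>1. \<bar>c - G' n\<bar> \<le> e)"
    using prime_nat_iff[of q] assms by (intro exI[of _ 1] exI[of _ "\<lambda>_. c"]) (auto simp: bdd_seq_const)
qed

lemma lim_periodic_prod:
  "prime q \<Longrightarrow> (\<And>v. v \<in> V \<Longrightarrow> lim_periodic q k (G v)) \<Longrightarrow> lim_periodic q k (\<lambda>n. \<Prod>v\<in>V. G v n)"
  by (induction V rule: infinite_finite_induct) (auto intro: lim_periodic_const lim_periodic_mult)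

text \<open>The approximants have periods \<open>q ^ k * s\<close> with \<open>q\<close> not
  dividing \<open>s\<close>, and \<open>nr\<close> says that \<open>z\<close> is no root of unity of
  such an order; so each approximant has mean 0.\<close>

lemma negl_lim_periodic:
  assumes G: "lim_periodic q k G" and z: "cmod z = 1"
    and nr: "\<And>s. \<not> q dvd s \<Longrightarrow> z ^ (q ^ k * s) \<noteq> 1" and q: "prime q"
  shows "negl (\<lambda>n. z ^ n * of_real (G n))"
proof (rule negl_uniform)
  have bG: "bdd_seq (\<lambda>n. of_real (G n))" using G by (auto simp: lim_periodic_def)
  show "bdd_seq (\<lambda>n. z ^ n * of_real (G n))" by (intro bdd_seq_mult bdd_seq_unit z bG)
  fix e :: real assume "e > 0"
  then obtain s G' where s: "s \<ge> 1" "\<not> q dvd s" "\<And>n. G' (n + q ^ k * s) = G' n" "bdd_seq (\<lambda>n. of_real (G' n))"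
      "\<And>n. n \<ge> 1 \<Longrightarrow> \<bar>G n - G' n\<bar> \<le> e"
    using G unfolding lim_periodic_def by blast
  define v where "v n = z ^ n * (if n = 0 then of_real (G 0) else of_real (G' n))" for n
  have "negl (\<lambda>n. z ^ n * of_real (G' n))"
    using s prime_gt_0_nat[OF q] nr[OF s(2)] z by (intro negl_periodic[where t = "q ^ k * s"]) auto
  note v = negl_cong_pos[OF bdd_seq_mult[OF bdd_seq_unit[OF z] s(4)] this, of v]
  have "bdd_seq v" "negl v" using v by (simp_all add: v_def)
  moreover have "cmod (z ^ n * of_real (G n) - v n) \<le> e" for n
  proof (cases "n = 0")
    case True then show ?thesis using \<open>e > 0\<close> by (simp add: v_def)
  next
    case False
    then have "z ^ n * of_real (G n) - v n = z ^ n * of_real (G n - G' n)"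
      by (simp add: v_def algebra_simps)
    then have "cmod (z ^ n * of_real (G n) - v n) = \<bar>G n - G' n\<bar>"
      using z by (simp only: norm_mult norm_power norm_of_real) simp
    then show ?thesis using s(5)[of n] False by simp
  qed
  ultimately show "\<exists>v. bdd_seq v \<and> negl v \<and> (\<forall>n. cmod (z ^ n * of_real (G n) - v n) \<le> e)" by blast
qed

section \<open>Local factors, their truncations, and the non-vanishing theorem\<close>

definition local_factor :: "nat \<Rightarrow> nat \<Rightarrow> (nat \<Rightarrow> real) \<Rightarrow> nat \<Rightarrow> real" where
  "local_factor a p h n = (if a dvd n then h (multiplicity p n) else 1)"

text \<open>Seeing only divisibility by \<open>p, ..., p ^ t\<close>, the truncation is genuinely
  periodic; since \<open>h\<close> decreases, it lies above the full factor for
  \<open>n \<ge> 1\<close>.\<close>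

definition trunc_factor :: "nat \<Rightarrow> nat \<Rightarrow> nat \<Rightarrow> (nat \<Rightarrow> real) \<Rightarrow> nat \<Rightarrow> real" where
  "trunc_factor t a p h n = (if a dvd n then h (ord_upto p t n) else 1)"

definition local_data :: "nat \<Rightarrow> nat \<Rightarrow> (nat \<Rightarrow> real) \<Rightarrow> bool" where
  "local_data a p h \<longleftrightarrow> a \<ge> 1 \<and> prime p \<and> (\<forall>t. 0 < h t) \<and> (\<forall>t. h (Suc t) < h t)"

context
  fixes a p :: nat and h :: "nat \<Rightarrow> real"
  assumes ld: "local_data a p h"
begin

lemma a: "a \<ge> 1" and p: "prime p" and hpos: "0 < h t" and hdec: "h (Suc t) < h t"
  using ld by (auto simp: local_data_def)

lemma h_strict: "s < t \<Longrightarrow> h t < h s"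
proof (induction t)
  case (Suc t) then show ?case using hdec[of t] by (cases "s = t") auto
qed simp

lemma h_mono: "s \<le> t \<Longrightarrow> h t \<le> h s" using h_strict[of s t] by (cases "s = t") auto

lemma h_le: "h t \<le> h 0" by (rule h_mono) simp

lemma local_factor_pos: "0 < local_factor a p h n" using hpos by (simp add: local_factor_def)
lemma trunc_factor_pos: "0 < trunc_factor t a p h n" using hpos by (simp add: trunc_factor_def)

lemma bdd_local_factor: "bdd_seq (\<lambda>n. of_real (local_factor a p h n))"
  using hpos h_le by (intro bdd_seqI[of _ "max 1 (h 0)"]) (auto simp: local_factor_def abs_of_pos le_max_iff_disj)
lemma bdd_trunc_factor: "bdd_seq (\<lambda>n. of_real (trunc_factor t a p h n))"
  using hpos h_le by (intro bdd_seqI[of _ "max 1 (h 0)"]) (auto simp: trunc_factor_def abs_of_pos le_max_iff_disj)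

lemma trunc_factor_periodic:
  assumes "a dvd d" "p ^ t dvd d" shows "trunc_factor t a p h (n + d) = trunc_factor t a p h n"
  using assms by (simp add: trunc_factor_def ord_upto_periodic dvd_add_left_iff)

lemma lim_periodic_trunc:
  assumes q: "prime q" and e: "multiplicity q a \<le> k" and pk: "p = q \<longrightarrow> t \<le> k"
  shows "lim_periodic q k (trunc_factor t a p h)"
proof -
  obtain a' e0 where a': "a = q ^ e0 * a'" "\<not> q dvd a'" "e0 \<le> k"
    using multiplicity_decompose'[of a q] a q e by (metis not_one_le_zero not_prime_unit)
  \<comment> \<open>The \<open>q\<close>-part of the period is absorbed by \<open>q ^ k\<close>, so
    \<open>s\<close> collects the rest: the part of \<open>a\<close> prime to \<open>q\<close>, and
    the levels of \<open>p\<close> when \<open>p\<close> differs from \<open>q\<close>.\<close>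
  define s where "s = a' * (if p = q then 1 else p ^ t)"
  have qs: "\<not> q dvd s"
  proof (cases "p = q")
    case False
    then have "\<not> q dvd p ^ t" using prime_dvd_power[OF q] primes_dvd_imp_eq[OF q p] by blast
    then show ?thesis using a'(2) False q by (simp add: s_def prime_dvd_mult_iff)
  qed (use a'(2) in \<open>simp add: s_def\<close>)
  then have s1: "s \<ge> 1" by (cases s) auto
  have "a dvd q ^ k * s"
    unfolding a'(1) s_def by (intro mult_dvd_mono le_imp_power_dvd a'(3) dvd_triv_left)
  moreover have "p ^ t dvd q ^ k * s" using pk by (auto simp: s_def le_imp_power_dvd)
  ultimately have per: "trunc_factor t a p h (n + q ^ k * s) = trunc_factor t a p h n" for n
    by (rule trunc_factor_periodic)
  show ?thesis
    unfolding lim_periodic_def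
    using bdd_trunc_factor per qs s1 by (intro conjI allI impI exI[of _ s] exI[of _ "trunc_factor t a p h"]) auto
qed

text \<open>A decreasing positive \<open>h\<close> is Cauchy, so truncation at a high level is
  uniformly close. For \<open>p\<close> different from \<open>q\<close> the level of truncation does
  not affect the \<open>q\<close>-part of the period.\<close>

lemma lim_periodic_local:
  assumes q: "prime q" and e: "multiplicity q a \<le> k" and pq: "p \<noteq> q"
  shows "lim_periodic q k (local_factor a p h)"
  unfolding lim_periodic_def
proof (intro conjI allI impI)
  show "bdd_seq (\<lambda>n. of_real (local_factor a p h n))" by (rule bdd_local_factor)
  fix e' :: real assume e': "e' > 0"
  have "convergent h"
    using decseq_convergent[of h 0] h_mono hpos by (metis antimonoI convergent_def less_imp_le)
  then have "Cauchy h" by (rule convergent_Cauchy)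
  then obtain m where m: "\<And>t. t \<ge> m \<Longrightarrow> \<bar>h t - h m\<bar> < e' / 2"
    using metric_CauchyD[of h "e' / 2"] e' by (auto simp: dist_real_def)
  have "lim_periodic q k (trunc_factor m a p h)" using lim_periodic_trunc[OF q e] pq by blast
  then obtain s G' where s: "s \<ge> 1" "\<not> q dvd s" "\<And>n. G' (n + q ^ k * s) = G' n" "bdd_seq (\<lambda>n. of_real (G' n))"
      "\<And>n. n \<ge> 1 \<Longrightarrow> \<bar>trunc_factor m a p h n - G' n\<bar> \<le> e' / 2"
    using e' unfolding lim_periodic_def by (metis half_gt_zero)
  have lt: "\<bar>local_factor a p h n - trunc_factor m a p h n\<bar> \<le> e' / 2" if n: "n \<ge> 1" for n
  proof (cases "multiplicity p n \<le> m")
    case True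
    then show ?thesis using e' by (simp add: local_factor_def trunc_factor_def ord_upto_eq[OF p n])
  next
    case False
    then show ?thesis using e' m[of "multiplicity p n"] by (auto simp: local_factor_def trunc_factor_def ord_upto_eq[OF p n] min_def)
  qed
  have "\<bar>local_factor a p h n - G' n\<bar> \<le> e'" if "n \<ge> 1" for n
    using s(5)[OF that] lt[OF that] by linarith
  then show "\<exists>s G'. s \<ge> 1 \<and> \<not> q dvd s \<and> (\<forall>n. G' (n + q ^ k * s) = G' n) \<and>
        bdd_seq (\<lambda>n. of_real (G' n)) \<and> (\<forall>n\<ge>1. \<bar>local_factor a p h n - G' n\<bar> \<le> e')"
    using s by blast
qed

lemma trunc_ge_local: "n \<ge> 1 \<Longrightarrow> local_factor a p h n \<le> trunc_factor t a p h n"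
  by (auto simp: local_factor_def trunc_factor_def ord_upto_eq[OF p] intro: h_mono)

end

text \<open>The power \<open>q ^ E\<close> bounds the \<open>q\<close>-part of the orders of all
  roots of unity in a finite set. This fixes how far up the \<open>q\<close>-tower one must go to
  escape the frequencies of \<open>D\<close>.\<close>

lemma ex_prime_to_order:
  fixes z :: complex and q :: nat
  assumes "prime q" "finite Z"
  shows "\<exists>E. \<forall>z\<in>Z. \<forall>n\<ge>1. z ^ n = 1 \<longrightarrow> (\<exists>s. \<not> q dvd s \<and> z ^ (q ^ E * s) = (1::complex))"
  using assms(2)
proof (induction Z rule: finite_induct)
  case (insert z Z)
  then obtain E where E: "\<forall>z\<in>Z. \<forall>n\<ge>1. z ^ n = 1 \<longrightarrow> (\<exists>s. \<not> q dvd s \<and> z ^ (q ^ E * s) = (1::complex))" by blast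
  show ?case
  proof (cases "\<exists>n\<ge>1. z ^ n = 1")
    case False
    then show ?thesis using E by (intro exI[of _ E]) auto
  next
    case True
    then obtain n where n: "n \<ge> 1" "z ^ n = 1" by blast
    obtain s e0 where s: "n = q ^ e0 * s" "\<not> q dvd s"
      using multiplicity_decompose'[of n q] n(1) assms(1) by (metis not_one_le_zero not_prime_unit)
    define F where "F = max E e0"
    have lift: "w ^ (q ^ F * s) = 1" if "w ^ (q ^ e * s) = 1" "e \<le> F" for w :: complex and e s
    proof -
      have "q ^ F * s = (q ^ e * s) * q ^ (F - e)" using that(2) by (simp add: mult_ac flip: power_add)
      then show ?thesis using that(1) by (metis power_mult power_one)
    qed
    have "z ^ (q ^ F * s) = 1" using n(2) s(1) by (intro lift[of z e0]) (auto simp: F_def)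
    moreover have "\<exists>s. \<not> q dvd s \<and> w ^ (q ^ F * s) = 1" if "w \<in> Z" "m \<ge> 1" "w ^ m = 1" for w m
    proof -
      obtain s where "\<not> q dvd s" "w ^ (q ^ E * s) = 1" using E \<open>w \<in> Z\<close> \<open>m \<ge> 1\<close> \<open>w ^ m = 1\<close> by blast
      then show ?thesis using lift[of w E s] by (auto simp: F_def)
    qed
    ultimately show ?thesis using s(2) by (intro exI[of _ F]) blast
  qed
qed simp

text \<open>Along the \<open>q\<close>-adic tower, the part of the local factors beyond level \<open>i\<close> is invariant under
  multiplication by \<open>\<omega> ^ n\<close> and has negative mean; the rest has mean 0.\<close>

theorem not_negl:
  fixes V :: "'v set" and a p :: "'v \<Rightarrow> nat" and h :: "'v \<Rightarrow> nat \<Rightarrow> real" and x :: "nat \<Rightarrow> real"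
  assumes V: "finite V" "V \<noteq> {}"
    and loc: "\<And>v. v \<in> V \<Longrightarrow> local_data (a v) (p v) (h v)"
    and x: "(\<lambda>n. of_real (x n)) \<in> trig" "\<And>n. 0 \<le> x n" "\<And>n. n \<ge> 1 \<Longrightarrow> x n \<noteq> 0"
  shows "\<exists>q i0. prime q \<and> (\<forall>i \<omega>. i0 \<le> i \<longrightarrow> i \<ge> 1 \<longrightarrow> \<omega> ^ (q ^ i) = 1 \<longrightarrow> \<omega> ^ (q ^ (i - 1)) \<noteq> 1 \<longrightarrow>
     \<not> negl (\<lambda>n. of_real (x n * (\<Prod>v\<in>V. local_factor (a v) (p v) (h v) n)) * \<omega> ^ n))"
proof -
  obtain v0 where v0: "v0 \<in> V" using V by blast
  \<comment> \<open>Any residue characteristic that occurs will do; the factors at other primes will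
    only contribute uniform limits of periodic functions.\<close>
  define q where "q = p v0"
  have q: "prime q" using loc[OF v0] by (simp add: q_def local_data_def)
  have L: "a v \<ge> 1" "prime (p v)" "\<And>t. 0 < h v t" "\<And>t. h v (Suc t) < h v t" if "v \<in> V" for v
    using loc[OF that] by (auto simp: local_data_def)
  obtain Z c where Z: "finite Z" "\<forall>z\<in>Z. cmod z = 1" "(\<lambda>n. of_real (x n)) = (\<lambda>n. \<Sum>z\<in>Z. c z * z ^ n)"
    using trig_rep[OF x(1)] by blast
  obtain E where E: "\<forall>z\<in>Z. \<forall>n\<ge>1. z ^ n = 1 \<longrightarrow> (\<exists>s. \<not> q dvd s \<and> z ^ (q ^ E * s) = 1)"
    using ex_prime_to_order[OF q Z(1)] by blast
  \<comment> \<open>From this level on, \<open>q ^ (i - 1)\<close> exceeds the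
    \<open>q\<close>-parts of all finite orders of frequencies and of all
    \<open>a v\<close>.\<close>
  define i0 where "i0 = E + (\<Sum>v\<in>V. multiplicity q (a v)) + 1"
  let ?g = "\<lambda>n. \<Prod>v\<in>V. local_factor (a v) (p v) (h v) n"
  have main: False if i: "i0 \<le> i" and \<omega>: "\<omega> ^ (q ^ i) = 1" "\<omega> ^ (q ^ (i - 1)) \<noteq> 1"
    and neg: "negl (\<lambda>n. of_real (x n * ?g n) * \<omega> ^ n)" for i and \<omega> :: complex
  proof -
    define k where "k = i - 1"
    have ik: "i = Suc k" "E \<le> k" using i by (auto simp: k_def i0_def)
    have ak: "multiplicity q (a v) \<le> k" if "v \<in> V" for v
    proof -
      have "multiplicity q (a v) \<le> (\<Sum>v\<in>V. multiplicity q (a v))" using V that by (intro member_le_sum) auto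
      then show ?thesis using i ik by (simp add: i0_def)
    qed
    have w1: "cmod \<omega> = 1"
    proof -
      have "cmod \<omega> ^ (q ^ i) = 1 ^ (q ^ i)" using \<omega>(1) by (metis norm_one norm_power power_one)
      then show ?thesis using prime_gt_0_nat[OF q] by (subst (asm) power_eq_iff_eq_base) auto
    qed
    \<comment> \<open>Truncation at \<open>k = i - 1\<close> makes the places above \<open>q\<close>
      blind to the level at which \<omega> becomes visible.\<close>
    define gt where "gt n = (\<Prod>v\<in>V. if p v = q then trunc_factor k (a v) (p v) (h v) n else local_factor (a v) (p v) (h v) n)" for n
    have lp: "lim_periodic q k gt"
      unfolding gt_def
    proof (rule lim_periodic_prod[OF q])
      fix v assume v: "v \<in> V"
      show "lim_periodic q k (\<lambda>n. if p v = q then trunc_factor k (a v) (p v) (h v) n else local_factor (a v) (p v) (h v) n)"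
        using lim_periodic_trunc[OF loc[OF v] q ak[OF v], of k] lim_periodic_local[OF loc[OF v] q ak[OF v]]
        by (cases "p v = q") auto
    qed
    have bgt: "bdd_seq (\<lambda>n. of_real (gt n))" using lp by (simp add: lim_periodic_def)
    have bg: "bdd_seq (\<lambda>n. of_real (?g n))"
      unfolding of_real_prod using loc by (intro bdd_seq_prod bdd_local_factor) auto
    note bx = bdd_seq_trig[OF x(1)]
    \<comment> \<open>The exact order of \<omega> is \<open>q ^ i\<close>, whereas a frequency that
      is a root of unity has order with \<open>q\<close>-part at most \<open>q ^ k\<close>. So the
      product cannot have order dividing \<open>q ^ k * s\<close>.\<close>
    have no: "(z * \<omega>) ^ (q ^ k * s) \<noteq> 1" if z: "z \<in> Z" and s: "\<not> q dvd s" for z s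
    proof
      assume one: "(z * \<omega>) ^ (q ^ k * s) = 1"
      have "z ^ (q ^ i * s) = ((z * \<omega>) ^ (q ^ k * s)) ^ q"
      proof -
        have "\<omega> ^ (q ^ i * s) = 1" using \<omega>(1) by (simp add: power_mult)
        moreover have "q ^ i * s = (q ^ k * s) * q" by (simp add: ik)
        ultimately show ?thesis by (metis mult.right_neutral power_mult power_mult_distrib)
      qed
      then have "z ^ (q ^ i * s) = 1" using one by simp
      moreover have "q ^ i * s \<ge> 1"
      proof -
        have "s \<noteq> 0" using s by (intro notI) simp
        then show ?thesis using prime_gt_0_nat[OF q] by (simp add: Suc_le_eq)
      qed
      ultimately obtain s' where s': "\<not> q dvd s'" "z ^ (q ^ E * s') = 1" using E z by blast
      have "z ^ (q ^ k * s * s') = 1"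
      proof -
        have "q ^ k * s * s' = (q ^ E * s') * (q ^ (k - E) * s)" using ik(2) by (simp add: mult_ac flip: power_add)
        then show ?thesis using s'(2) by (metis power_mult power_one)
      qed
      moreover have "(z * \<omega>) ^ (q ^ k * s * s') = 1" using one by (metis power_mult power_one)
      ultimately have "\<omega> ^ (q ^ k * s * s') = 1" by (simp add: power_mult_distrib)
      define \<eta> where "\<eta> = \<omega> ^ (q ^ k)"
      have e1: "\<eta> ^ (s * s') = 1" using \<open>\<omega> ^ (q ^ k * s * s') = 1\<close> by (simp add: \<eta>_def power_mult)
      have e2: "\<eta> ^ q = 1" using \<omega>(1) by (simp add: \<eta>_def ik power_mult[symmetric] mult.commute)
      have "\<not> q dvd s * s'" using s s' q prime_dvd_mult_iff by blast
      then have "coprime (s * s') q" using prime_imp_coprime[OF q] coprime_commute by blast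
      moreover have "s * s' \<noteq> 0" using \<open>\<not> q dvd s * s'\<close> by (intro notI) simp
      ultimately obtain u v where "s * s' * u = q * v + 1"
        using bezout_nat[of "s * s'" q] by (metis coprime_imp_gcd_eq_1)
      then have "\<eta> ^ (s * s' * u) = \<eta> ^ (q * v) * \<eta>" by simp
      then have "\<eta> = 1" using e1 e2 by (simp add: power_mult)
      then show False using \<omega>(2) by (simp add: \<eta>_def k_def)
    qed
    have "negl (\<lambda>n. \<Sum>z\<in>Z. c z * ((z * \<omega>) ^ n * of_real (gt n)))"
    proof (intro negl_sum conjI)
      fix z assume z: "z \<in> Z"
      have u: "cmod (z * \<omega>) = 1" using z Z w1 by (simp add: norm_mult)
      have b: "bdd_seq (\<lambda>n. (z * \<omega>) ^ n * of_real (gt n))" by (intro bdd_seq_mult bdd_seq_unit u bgt)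
      show "bdd_seq (\<lambda>n. c z * ((z * \<omega>) ^ n * of_real (gt n)))" by (rule bdd_seq_mult[OF bdd_seq_const b])
      show "negl (\<lambda>n. c z * ((z * \<omega>) ^ n * of_real (gt n)))"
        by (rule negl_cmult[OF b negl_lim_periodic[OF lp u no[OF z] q]])
    qed (rule Z(1))
    moreover have "(\<Sum>z\<in>Z. c z * ((z * \<omega>) ^ n * of_real (gt n))) = of_real (x n * gt n) * \<omega> ^ n" for n
    proof -
      have "of_real (x n) = (\<Sum>z\<in>Z. c z * z ^ n)" using fun_cong[OF Z(3), of n] .
      then show ?thesis by (simp add: sum_distrib_right sum_distrib_left power_mult_distrib mult_ac)
    qed
    ultimately have neg': "negl (\<lambda>n. of_real (x n * gt n) * \<omega> ^ n)" by simp
    \<comment> \<open>Truncated and full product differ only at multiples of \<open>q ^ i\<close>,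
      where \<open>\<omega> ^ n = 1\<close>. Hence the difference of the two twisted sequences is
      the nonnegative \<open>W\<close>, and both having mean 0 forces \<open>W\<close> to have mean
      0.\<close>
    define W where "W n = (if n = 0 then 0 else x n * (gt n - ?g n))" for n
    have ge: "?g n \<le> gt n" if n: "n \<ge> 1" for n
      unfolding gt_def
    proof (rule prod_mono)
      fix v assume v: "v \<in> V"
      show "0 \<le> local_factor (a v) (p v) (h v) n \<and> local_factor (a v) (p v) (h v) n
          \<le> (if p v = q then trunc_factor k (a v) (p v) (h v) n else local_factor (a v) (p v) (h v) n)"
        using trunc_ge_local[OF loc[OF v] n, of k] local_factor_pos[OF loc[OF v], of n] by auto
    qed
    have W0: "W n \<ge> 0" for n using ge[of n] x(2)[of n] by (auto simp: W_def)
    have same: "gt n = ?g n" if n: "n \<ge> 1" "\<not> q ^ i dvd n" for n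
    proof -
      have "multiplicity q n \<le> k"
        using n power_dvd_iff_le_multiplicity[of n q i] q prime_gt_1_nat[OF q] by (simp add: ik not_less_eq_eq) 
      then show ?thesis
        unfolding gt_def by (intro prod.cong refl)
          (auto simp: trunc_factor_def local_factor_def ord_upto_eq[OF q n(1)] min_def)
    qed
    have Wd: "of_real (x n * gt n) * \<omega> ^ n - of_real (x n * ?g n) * \<omega> ^ n = of_real (W n)" if n: "n \<ge> 1" for n
    proof (cases "q ^ i dvd n")
      case True
      then obtain m where "n = q ^ i * m" by blast
      then have "\<omega> ^ n = 1" using \<omega>(1) by (simp add: power_mult)
      then show ?thesis using n by (simp add: W_def algebra_simps)
    next
      case False
      then show ?thesis using same[OF n] n by (simp add: W_def)
    qed
    have b1: "bdd_seq (\<lambda>n. of_real (x n * gt n) * \<omega> ^ n)"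
      using bdd_seq_mult[OF bdd_seq_mult[OF bx bgt] bdd_seq_unit[OF w1]] by simp
    have b2: "bdd_seq (\<lambda>n. of_real (x n * ?g n) * \<omega> ^ n)"
      using bdd_seq_mult[OF bdd_seq_mult[OF bx bg] bdd_seq_unit[OF w1]] by simp
    note negW = negl_cong_pos[OF bdd_seq_diff[OF b1 b2] negl_diff[OF b1 b2 neg' neg], of "\<lambda>n. of_real (W n)"]
    have bW: "bdd_seq (\<lambda>n. of_real (W n))" and nW: "negl (\<lambda>n. of_real (W n))" using negW Wd by simp_all
    \<comment> \<open>\<open>A\<close> is divisible by every \<open>a v\<close> and by
      \<open>q ^ i\<close>, so that the two products differ at \<open>A\<close>. For
      \<open>n\<close> congruent to \<open>A\<close> modulo \<open>B\<close> the cofactor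
      \<open>n / A\<close> is 1 modulo every \<open>p v\<close>; so all multiplicities, and with
      them both products, are constant on this progression.\<close>
    define A where "A = q ^ i * (\<Prod>v\<in>V. a v)"
    define B where "B = A * (\<Prod>v\<in>V. p v)"
    have A1: "A \<ge> 1" using L(1) prime_gt_0_nat[OF q] V by (auto simp: A_def Suc_le_eq intro!: prod_pos)
    have pp: "(\<Prod>v\<in>V. p v) \<ge> 2"
    proof -
      have "p v0 dvd (\<Prod>v\<in>V. p v)" using V v0 by (intro dvd_prodI)
      moreover have "(\<Prod>v\<in>V. p v) > 0" using L(2) by (auto intro!: prod_pos simp: prime_gt_0_nat)
      ultimately have "p v0 \<le> (\<Prod>v\<in>V. p v)" by (rule dvd_imp_le)
      then show ?thesis using prime_ge_2_nat[OF L(2)[OF v0]] by linarith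
    qed
    have B1: "B \<ge> 1" using A1 pp by (simp add: B_def)
    have AB: "A < B" using A1 pp by (simp add: B_def)
    have prog: "gt n = gt A \<and> ?g n = ?g A" if n: "n mod B = A mod B" for n
    proof -
      have "n mod B = A" using n AB by simp
      then have n': "n = A * (1 + (\<Prod>v\<in>V. p v) * (n div B))"
        using div_mult_mod_eq[of n B] by (simp add: B_def algebra_simps)
      define m where "m = 1 + (\<Prod>v\<in>V. p v) * (n div B)"
      have n1: "n \<ge> 1" using n' A1 by simp
      have mult: "multiplicity (p v) n = multiplicity (p v) A" if v: "v \<in> V" for v
      proof -
        have "p v dvd (\<Prod>v\<in>V. p v)" using V v by (intro dvd_prodI)
        then have "\<not> p v dvd m" using prime_gt_1_nat[OF L(2)[OF v]]
          unfolding m_def by (metis dvd_add_left_iff dvd_mult2 nat_dvd_1_iff_1 less_irrefl)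
        then have "multiplicity (p v) m = 0" by (rule not_dvd_imp_multiplicity_0)
        moreover have "m \<noteq> 0" by (simp add: m_def)
        ultimately show ?thesis
          using prime_elem_multiplicity_mult_distrib[of "p v" A m] L(2)[OF v] A1 n' by (simp add: m_def)
      qed
      have dv: "a v dvd n" "a v dvd A" if v: "v \<in> V" for v
      proof -
        show "a v dvd A" using V v by (auto simp: A_def intro: dvd_mult dvd_prodI)
        then show "a v dvd n" using n' by (metis dvd_mult2)
      qed
      show ?thesis
        unfolding gt_def using mult dv
        by (auto simp: local_factor_def trunc_factor_def ord_upto_eq[OF L(2) n1] ord_upto_eq[OF L(2) A1] intro!: prod.cong)
    qed
    have lt: "?g A < gt A"
      unfolding gt_def
    proof (rule prod_mono_strict[of v0])
      show "finite V" "v0 \<in> V" by fact+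
      have dA: "a v0 dvd A" "q ^ i dvd A" using V v0 by (auto simp: A_def intro: dvd_mult dvd_prodI)
      have "i \<le> multiplicity q A" using dA(2) A1 q prime_gt_1_nat[OF q] by (subst power_dvd_iff_le_multiplicity[symmetric]) auto
      then show "local_factor (a v0) (p v0) (h v0) A < (if p v0 = q then trunc_factor k (a v0) (p v0) (h v0) A else local_factor (a v0) (p v0) (h v0) A)"
        using dA(1) ik h_strict[OF loc[OF v0], of k "multiplicity q A"]
        by (simp add: q_def[symmetric] local_factor_def trunc_factor_def ord_upto_eq[OF q A1] min_def)
      show "0 \<le> local_factor (a v) (p v) (h v) A \<and> local_factor (a v) (p v) (h v) A \<le> (if p v = q then trunc_factor k (a v) (p v) (h v) A else local_factor (a v) (p v) (h v) A)" if "v \<in> V" for v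
        using local_factor_pos[OF loc[OF that], of A] trunc_ge_local[OF loc[OF that] A1, of k] by auto
      show "0 < (if p v = q then trunc_factor k (a v) (p v) (h v) A else local_factor (a v) (p v) (h v) A)" if "v \<in> V" for v
        using local_factor_pos[OF loc[OF that], of A] trunc_factor_pos[OF loc[OF that], of k A] by auto
    qed
    define d where "d = gt A - ?g A"
    have d: "d > 0" using lt by (simp add: d_def)
    \<comment> \<open>On the progression \<open>W\<close> is \<open>d\<close> times
      \<open>x\<close>, so this nonnegative trigonometric polynomial is dominated by
      \<open>W / d\<close>. Its mean is positive by \<open>trig_nonneg_mean_pos\<close>, which
      contradicts mean 0 of \<open>W\<close>.\<close>
    define y where "y n = x n * (if n mod B = A mod B then 1 else 0)" for n
    have ytrig: "(\<lambda>n. of_real (y n)) \<in> trig"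
      using trig_mult[OF x(1) trig_progression[OF B1, of A]] by (simp add: y_def of_real_mult if_distrib cong: if_cong)
    have yW: "y n \<le> W n / d" for n
    proof (cases "n mod B = A mod B")
      case True
      have "n \<noteq> 0"
      proof
        assume "n = 0"
        then have "A mod B = 0" using True by simp
        then show False using AB A1 by simp
      qed
      then show ?thesis using prog[OF True] d by (simp add: y_def W_def True d_def)
    qed (use W0[of n] d in \<open>simp add: y_def\<close>)
    have y0: "0 \<le> y n" for n using x(2) by (simp add: y_def)
    have "y A \<noteq> 0" using x(3)[OF A1] by (simp add: y_def)
    then have "\<not> negl (\<lambda>n. of_real (y n))" by (rule trig_nonneg_mean_pos[OF ytrig y0])
    moreover have "negl (\<lambda>n. of_real (y n))"
    proof -
      have bWd: "bdd_seq (\<lambda>n. of_real (W n / d))" using bdd_seq_mult[OF bW bdd_seq_const[of "1 / of_real d"]] by simp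
      have nWd: "negl (\<lambda>n. of_real (W n / d))" using negl_cmult[OF bW nW, of "1 / of_real d"] by simp
      have "((\<lambda>r. Re (abel (\<lambda>n. of_real (W n / d)) r)) \<longlongrightarrow> Re 0) (at_left 1)"
        using nWd unfolding negl_def by (rule tendsto_Re)
      then have t: "((\<lambda>r. Re (abel (\<lambda>n. of_real (W n / d)) r)) \<longlongrightarrow> 0) (at_left 1)"
        by (simp only: zero_complex.sel)
      have "\<forall>\<^sub>F r in at_left 1. cmod (abel (\<lambda>n. of_real (y n)) r) \<le> Re (abel (\<lambda>n. of_real (W n / d)) r)"
        using eventually_left_1
      proof eventually_elim
        case (elim r)
        then show ?case
          using yW y0 by (intro abel_nonneg_mono bWd bdd_seq_trig[OF ytrig]) auto
      qed
      then show ?thesis unfolding negl_def by (rule Lim_null_comparison[OF _ t])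
    qed
    ultimately show False by blast
  qed
  then show ?thesis using q by blast
qed

section \<open>Zeta functions of sequences\<close>

definition zlog :: "(nat \<Rightarrow> complex) \<Rightarrow> complex fps" where
  "zlog u = Abs_fps (\<lambda>n. if n = 0 then 0 else u n / of_nat n)"

definition zfps :: "(nat \<Rightarrow> complex) \<Rightarrow> complex fps" where
  "zfps u = fps_exp 1 oo zlog u"

lemma zlog_0: "fps_nth (zlog u) 0 = 0" by (simp add: zlog_def)

lemma zlog_deriv_nth: "fps_nth (fps_deriv (zlog u)) n = u (Suc n)"
  by (simp add: zlog_def del: of_nat_Suc)

lemma zfps_0: "fps_nth (zfps u) 0 = 1" by (simp add: zfps_def)

lemma zfps_deriv: "fps_deriv (zfps u) = zfps u * fps_deriv (zlog u)"
  unfolding zfps_def by (subst fps_compose_deriv[OF zlog_0]) simp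

text \<open>Comparing coefficients recursively determines the solution from its constant term.
  Identities for formal exponentials are checked through their differential equation instead of
  through composition of series.\<close>

lemma fps_ode_unique:
  fixes F G a :: "complex fps"
  assumes "fps_deriv F = F * a" "fps_deriv G = G * a" "fps_nth F 0 = fps_nth G 0"
  shows "F = G"
proof (rule fps_ext)
  fix n show "fps_nth F n = fps_nth G n"
  proof (induction n rule: less_induct)
    case (less n)
    show ?case
    proof (cases n)
      case (Suc m)
      have "fps_nth (fps_deriv F) m = fps_nth (fps_deriv G) m"
        unfolding assms(1,2) fps_mult_nth using less.IH Suc by (intro sum.cong refl) simp
      then show ?thesis using Suc by (simp del: of_nat_Suc)
    qed (use assms in simp)
  qed
qed

lemma zlog_add: "zlog (\<lambda>n. u n + v n) = zlog u + zlog v"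
  by (intro fps_ext) (simp add: zlog_def add_divide_distrib)

lemma zfps_add: "zfps (\<lambda>n. u n + v n) = zfps u * zfps v"
proof (rule fps_ode_unique)
  show "fps_deriv (zfps (\<lambda>n. u n + v n)) = zfps (\<lambda>n. u n + v n) * (fps_deriv (zlog u) + fps_deriv (zlog v))"
    by (simp add: zfps_deriv zlog_add)
  show "fps_deriv (zfps u * zfps v) = zfps u * zfps v * (fps_deriv (zlog u) + fps_deriv (zlog v))"
    by (simp add: zfps_deriv algebra_simps)
qed (simp add: zfps_0)

lemma zfps_uminus: "zfps (\<lambda>n. - u n) * zfps u = 1"
proof -
  have "zlog (\<lambda>n. 0) = 0" by (intro fps_ext) (simp add: zlog_def)
  then have "zfps (\<lambda>n. - u n + u n) = 1" by (simp add: zfps_def)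
  then show ?thesis by (simp only: zfps_add)
qed

lemma zfps_power: "zfps (\<lambda>n. l ^ n) * (1 - fps_const l * fps_X) = 1"
proof (rule fps_ode_unique[where a = 0])
  have key: "fps_deriv (zlog (\<lambda>n. l ^ n)) * (1 - fps_const l * fps_X) = fps_const l"
  proof (rule fps_ext)
    fix n
    have "fps_deriv (zlog (\<lambda>n. l ^ n)) * (1 - fps_const l * fps_X) =
        fps_deriv (zlog (\<lambda>n. l ^ n)) - fps_const l * (fps_X * fps_deriv (zlog (\<lambda>n. l ^ n)))"
      by (simp add: algebra_simps)
    then show "fps_nth (fps_deriv (zlog (\<lambda>n. l ^ n)) * (1 - fps_const l * fps_X)) n = fps_nth (fps_const l) n"
      by (cases n) (simp_all add: zlog_deriv_nth del: fps_deriv_nth)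
  qed
  show "fps_deriv (zfps (\<lambda>n. l ^ n) * (1 - fps_const l * fps_X)) = zfps (\<lambda>n. l ^ n) * (1 - fps_const l * fps_X) * 0"
    by (simp add: zfps_deriv mult.assoc key flip: distrib_left)
qed (simp_all add: zfps_0)

text \<open>Coefficients arise only from signs and repetition, hence are integers. This is
  essential: for \<open>c * l ^ n\<close> the zeta function is \<open>(1 - l X) ^ (- c)\<close>,
  rational for nonzero \<open>l\<close> only if \<open>c\<close> is an integer.\<close>

inductive_set intexp :: "(nat \<Rightarrow> complex) set" where
  intexp_power: "(\<lambda>n. l ^ n) \<in> intexp"
| intexp_uminus: "u \<in> intexp \<Longrightarrow> (\<lambda>n. - u n) \<in> intexp"
| intexp_add: "u \<in> intexp \<Longrightarrow> v \<in> intexp \<Longrightarrow> (\<lambda>n. u n + v n) \<in> intexp"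

lemma intexp_mult_power: "v \<in> intexp \<Longrightarrow> (\<lambda>n. l ^ n * v n) \<in> intexp"
proof (induction rule: intexp.induct)
  case (intexp_power m)
  have eq: "(\<lambda>n. l ^ n * m ^ n) = (\<lambda>n. (l * m) ^ n)" by (intro ext) (simp add: power_mult_distrib)
  show ?case unfolding eq by (rule intexp.intexp_power)
qed (auto simp: distrib_left intro: intexp.intros dest: intexp.intexp_uminus)

lemma intexp_mult: "u \<in> intexp \<Longrightarrow> v \<in> intexp \<Longrightarrow> (\<lambda>n. u n * v n) \<in> intexp"
proof (induction rule: intexp.induct)
  case (intexp_uminus u)
  then show ?case using intexp.intexp_uminus[of "\<lambda>n. u n * v n"] by simp
next
  case (intexp_add u u')
  then show ?case using intexp.intexp_add[of "\<lambda>n. u n * v n" "\<lambda>n. u' n * v n"] by (simp add: distrib_right)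
qed (rule intexp_mult_power)

lemma intexp_1: "(\<lambda>n. 1) \<in> intexp"
proof -
  have eq: "(\<lambda>n::nat. 1) = (\<lambda>n. (1::complex) ^ n)" by (intro ext) simp
  show ?thesis by (subst eq, rule intexp_power)
qed

lemma intexp_diff: "u \<in> intexp \<Longrightarrow> v \<in> intexp \<Longrightarrow> (\<lambda>n. u n - v n) \<in> intexp"
  using intexp_add[OF _ intexp_uminus] by simp

text \<open>Sums of sequences become products and sign changes become inverses, so everything
  reduces to a geometric sequence, whose zeta function is \<open>1 / (1 - l X)\<close>.\<close>

lemma rational_zfps: "u \<in> intexp \<Longrightarrow> rational_fps (zfps u)"
proof (induction rule: intexp.induct)
  case (intexp_power l)
  have "fps_of_poly [:1, - l:] = 1 - fps_const l * fps_X"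
    by (simp add: fps_of_poly_pCons mult.commute)
  then have "zfps (\<lambda>n. l ^ n) * fps_of_poly [:1, - l:] = fps_of_poly 1"
    using zfps_power[of l] by (simp only: fps_of_poly_1)
  then show ?case unfolding rational_fps_def by (intro exI[of _ 1] exI[of _ "[:1, - l:]"]) auto
next
  case (intexp_uminus u)
  then obtain p q where pq: "q \<noteq> 0" "zfps u * fps_of_poly q = fps_of_poly p" unfolding rational_fps_def by blast
  have "zfps (\<lambda>n. - u n) * fps_of_poly p = (zfps (\<lambda>n. - u n) * zfps u) * fps_of_poly q"
    by (simp only: pq(2)[symmetric] mult.assoc)
  then have "zfps (\<lambda>n. - u n) * fps_of_poly p = fps_of_poly q" by (simp add: zfps_uminus)
  moreover have "p \<noteq> 0"
  proof
    assume "p = 0"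
    then have "zfps u = 0" using pq by simp
    then show False using zfps_0[of u] by simp
  qed
  ultimately show ?case unfolding rational_fps_def by blast
next
  case (intexp_add u v)
  then obtain p q p' q' where pq: "q \<noteq> 0" "zfps u * fps_of_poly q = fps_of_poly p"
     "q' \<noteq> 0" "zfps v * fps_of_poly q' = fps_of_poly p'" unfolding rational_fps_def by blast
  have "zfps (\<lambda>n. u n + v n) * fps_of_poly (q * q') = fps_of_poly (p * p')"
    unfolding zfps_add fps_of_poly_mult pq(2,4)[symmetric] by (simp only: mult_ac)
  then show ?case unfolding rational_fps_def using pq by (metis mult_eq_0_iff)
qed

lemma zfps_cong: "(\<And>n. n \<ge> 1 \<Longrightarrow> u n = v n) \<Longrightarrow> zfps u = zfps v"
  unfolding zfps_def by (rule arg_cong[of _ _ "(oo) (fps_exp 1)"]) (auto simp: zlog_def intro!: fps_ext)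

section \<open>Natural boundaries from non-vanishing Abel means\<close>

lemma dense_prime_power_roots:
  fixes z :: complex
  assumes z: "cmod z = 1" and e: "e > 0" and q: "prime q"
  shows "\<exists>i \<omega>. i0 \<le> i \<and> 1 \<le> i \<and> \<omega> ^ (q ^ i) = 1 \<and> \<omega> ^ (q ^ (i - 1)) \<noteq> 1 \<and> \<omega> \<noteq> z \<and> cmod (\<omega> - z) < e"
proof -
  define t where "t = Arg2pi z"
  have t: "0 \<le> t" "is_Arg z t" using Arg2pi[of z] by (auto simp: t_def)
  note tz = t(2)[unfolded is_Arg_def z of_real_1 mult_1_left]
  define d where "d = min e 1"
  have d: "d > 0" "d \<le> e" "d \<le> 1" using e by (auto simp: d_def)
  \<comment> \<open>Neighbouring roots are an angle \<open>2 * pi / N\<close> apart and at most two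
    steps are taken, whence \<open>4 * pi\<close>. The bound 1 in \<open>d\<close> keeps the total
    below a full turn.\<close>
  obtain i1 where i1: "(1 / 2) ^ i1 < d / (4 * pi)"
    using real_arch_pow_inv[of "d / (4 * pi)" "1 / 2"] d by auto
  define i where "i = max (max i0 1) i1"
  define N where "N = q ^ i"
  have N2: "2 ^ i \<le> real N" unfolding N_def using prime_ge_2_nat[OF q] by (simp add: power_mono)
  have Npos: "real N > 0" unfolding N_def using prime_gt_0_nat[OF q] by simp
  have "(1 / 2 :: real) ^ i \<le> (1 / 2) ^ i1" unfolding i_def by (intro power_decreasing) auto
  moreover have "1 / real N \<le> (1 / 2) ^ i" using N2 Npos by (simp add: power_divide field_simps)
  ultimately have "1 / real N < d / (4 * pi)" using i1 by linarith
  then have N: "4 * pi / real N < d" using Npos pi_gt_zero by (simp add: field_simps)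
  define j0 where "j0 = nat \<lfloor>t * real N / (2 * pi)\<rfloor>"
  have j0: "real j0 \<le> t * real N / (2 * pi)" "t * real N / (2 * pi) < real j0 + 1"
    using t(1) Npos by (auto simp: j0_def) 
  \<comment> \<open>Two consecutive integers are not both divisible by \<open>q\<close>, and an
    index prime to \<open>q\<close> gives exact order \<open>q ^ i\<close>. Starting above
    \<open>j0\<close> makes the angle strictly larger than \<open>t\<close>, so that \<omega>
    differs from \<open>z\<close>.\<close>
  obtain j where j: "j = j0 + 1 \<or> j = j0 + 2" "\<not> q dvd j"
  proof -
    have "\<not> (q dvd j0 + 1 \<and> q dvd j0 + 2)"
      using prime_gt_1_nat[OF q] by (metis add.assoc dvd_add_right_iff nat_dvd_1_iff_1 one_add_one less_irrefl)
    then show ?thesis using that by blast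
  qed
  define s where "s = 2 * pi * real j / real N"
  have jb: "t * real N / (2 * pi) < real j" "real j \<le> t * real N / (2 * pi) + 2" using j0 j(1) by auto
  have "t = 2 * pi * (t * real N / (2 * pi)) / real N" using Npos by simp
  have st: "0 < s - t"
  proof -
    have "t * real N < real j * (2 * pi)" using jb(1) by (simp add: field_simps)
    then show ?thesis using Npos by (simp add: s_def field_simps)
  qed
  have st2: "s - t \<le> 4 * pi / real N"
  proof -
    have "real j * (2 * pi) \<le> t * real N + 4 * pi" using jb(2) by (simp add: field_simps)
    then show ?thesis using Npos by (simp add: s_def field_simps)
  qed
  define \<omega> where "\<omega> = exp (\<i> * of_real s)"
  have "\<omega> = exp (2 * of_real pi * \<i> * of_nat j / of_nat N)" by (simp add: \<omega>_def s_def mult_ac)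
  then have pw: "\<omega> ^ m = exp (2 * of_real pi * \<i> * of_nat (j * m) / of_nat N)" for m
    by (simp add: exp_of_nat_mult[symmetric] mult_ac)
  have N1: "1 \<le> N" using Npos by simp
  have one: "\<omega> ^ m = 1 \<longleftrightarrow> N dvd j * m" for m
    unfolding pw by (rule complex_root_unity_eq_1[OF N1])
  have i: "i = Suc (i - 1)" by (simp add: i_def)
  have "\<not> N dvd j * q ^ (i - 1)"
  proof
    assume "N dvd j * q ^ (i - 1)"
    then have "q * q ^ (i - 1) dvd j * q ^ (i - 1)" unfolding N_def by (subst (asm) i) simp
    then show False using j(2) prime_gt_0_nat[OF q] by (simp add: dvd_times_right_cancel_iff)
  qed
  then have "\<omega> ^ (q ^ (i - 1)) \<noteq> 1" using one by blast
  moreover have "\<omega> ^ (q ^ i) = 1" using one N_def by simp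
  moreover have diff: "\<omega> - z = z * (exp (\<i> * of_real (s - t)) - 1)"
    by (subst (1 2) tz) (simp add: \<omega>_def algebra_simps flip: exp_add)
  have le: "cmod (exp (\<i> * of_real (s - t)) - 1) \<le> s - t"
    using dist_exp_i_1[of "s - t"] abs_sin_x_le_abs_x[of "(s - t) / 2"] st by simp
  moreover have "cmod (\<omega> - z) < e" using diff le z st2 N d by (simp add: norm_mult)
  moreover have "\<omega> \<noteq> z"
  proof
    assume "\<omega> = z"
    then have "exp (\<i> * of_real (s - t)) = 1" using diff z by auto
    then obtain k :: int where k: "s - t = of_int (2 * k) * pi"
      by (auto simp: exp_eq_1)
    have "s - t < 2 * pi" using st2 N d(3) pi_gt3 by linarith
    then have "k < 1" using k by simp
    moreover have "0 < k" using k st by (simp add: zero_less_mult_iff)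
    ultimately show False by simp
  qed
  ultimately show ?thesis by (intro exI[of _ i] exI[of _ \<omega>]) (auto simp: i_def)
qed

lemma psubset_ball_exterior:
  assumes "ball (0::complex) R \<subset> U" "\<not> (\<exists>z0\<in>U. cmod z0 = R)"
  shows "- cball 0 R \<inter> U \<noteq> {}"
proof -
  obtain u where u: "u \<in> U - ball 0 R" using psubset_imp_ex_mem[OF assms(1)] by (elim exE)
  have "cmod u \<noteq> R" using assms(2) u by blast
  then have "u \<in> - cball 0 R \<inter> U" using u by auto
  then show ?thesis by (metis empty_iff)
qed

text \<open>A continuation \<open>g\<close> is zero-free in the disc, so its zeros near a boundary
  point are isolated, and density provides some \<open>\<omega> / L\<close> near that point with
  \<open>g\<close> nonzero there. The logarithmic derivative is bounded along the radius to it, so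
  the Abel mean tends to 0, against \<open>nn\<close>.\<close>

theorem natural_boundary_zfps:
  assumes L: "L > 0" and bd: "bdd_seq (\<lambda>n. u n / of_real L ^ n)" and q: "prime q"
    and nn: "\<And>i \<omega>. i0 \<le> i \<Longrightarrow> 1 \<le> i \<Longrightarrow> \<omega> ^ (q ^ i) = 1 \<Longrightarrow> \<omega> ^ (q ^ (i - 1)) \<noteq> 1 \<Longrightarrow>
       \<not> negl (\<lambda>n. u n / of_real L ^ n * \<omega> ^ n)"
  shows "has_natural_boundary (zfps u)"
proof -
  define R where "R = 1 / L"
  have R: "R > 0" using L by (simp add: R_def)
  define F where "F = zlog u"
  obtain C where C: "C \<ge> 0" "\<And>n. cmod (u n / of_real L ^ n) \<le> C" using bd by (elim bdd_seqE) blast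
  have Cn: "cmod (u n) \<le> C * L ^ n" for n
    using C(2)[of n] L by (simp add: norm_divide norm_power field_simps)
  have radF: "fps_conv_radius F \<ge> ereal R"
    unfolding fps_conv_radius_def
  proof (rule conv_radius_geI_ex')
    fix r :: real assume r: "0 < r" "ereal r < ereal R"
    then have lr: "L * r < 1" using L by (simp add: R_def field_simps)
    show "summable (\<lambda>n. fps_nth F n * of_real r ^ n)"
    proof (rule summable_comparison_test')
      show "summable (\<lambda>n. C * (L * r) ^ n)" using lr L r by (intro summable_mult summable_geometric) simp
      show "norm (fps_nth F n * of_real r ^ n) \<le> C * (L * r) ^ n" if "n \<ge> 1" for n
      proof -
        have "cmod (u n / of_nat n) \<le> cmod (u n)" using that by (simp add: norm_divide divide_le_eq mult_le_cancel_left1)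
        then have "cmod (fps_nth F n) \<le> C * L ^ n" using Cn[of n] that by (simp add: F_def zlog_def)
        then show ?thesis using r by (simp add: norm_mult norm_power power_mult_distrib mult_right_mono flip: mult.assoc)
      qed
    qed
  qed
  have rF: "ereal (cmod z) < fps_conv_radius F" if "cmod z < R" for z :: complex
    using less_le_trans[OF _ radF, of "ereal (cmod z)"] that by simp
  define l where "l = eval_fps F"
  have hl: "l holomorphic_on ball 0 R"
    unfolding l_def by (intro holomorphic_on_eval_fps) (use rF in \<open>auto simp: eball_def\<close>)
  define E where "E z = exp (l z)" for z
  have hE: "E holomorphic_on ball 0 R" unfolding E_def by (intro holomorphic_intros hl)
  have hE': "E holomorphic_on eball 0 (ereal R)" using hE by simp
  have dl: "deriv l z = eval_fps (fps_deriv F) z" if "cmod z < R" for z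
    unfolding l_def by (rule eval_fps_deriv[symmetric, OF rF[OF that]])
  have dE: "deriv E z = E z * deriv l z" if "cmod z < R" for z
  proof -
    have "(l has_field_derivative deriv l z) (at z)"
      using hl that by (intro holomorphic_derivI[of l "ball 0 R"]) auto
    then have "(E has_field_derivative E z * deriv l z) (at z)"
      unfolding E_def by (auto intro!: derivative_eq_intros)
    then show ?thesis by (rule DERIV_imp_deriv)
  qed
  define G where "G = fps_expansion E 0"
  have EG: "E has_fps_expansion G"
    unfolding G_def using R hE by (intro has_fps_expansion_fps_expansion[of "ball 0 R"]) auto
  have lF: "l has_fps_expansion F"
    unfolding l_def using less_le_trans[OF _ radF, of 0] R by (intro eval_fps_has_fps_expansion) simp
  have "(\<lambda>z. E z * deriv l z) has_fps_expansion G * fps_deriv F"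
    by (intro has_fps_expansion_mult EG has_fps_expansion_deriv lF)
  moreover have "\<forall>\<^sub>F z in nhds 0. deriv E z = E z * deriv l z"
  proof -
    have "\<forall>\<^sub>F z in nhds 0. z \<in> ball 0 R" using R by (intro eventually_nhds_in_open) auto
    then show ?thesis by eventually_elim (simp add: dE)
  qed
  ultimately have "deriv E has_fps_expansion G * fps_deriv F"
    using has_fps_expansion_cong[of "deriv E" "\<lambda>z. E z * deriv l z"] by blast
  \<comment> \<open>The Taylor series of the analytic exponential is identified with the formal zeta
    function by their common differential equation and constant term.\<close>
  then have ode: "fps_deriv G = G * fps_deriv F"
    using fps_expansion_unique_complex[OF has_fps_expansion_deriv[OF EG]] by blast
  have "fps_nth G 0 = E 0" using has_fps_expansion_imp_0_eq_fps_nth_0[OF EG] by simp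
  then have G0: "fps_nth G 0 = 1" by (simp add: E_def l_def eval_fps_at_0 F_def zlog_0)
  have GZ: "G = zfps u"
    using fps_ode_unique[OF ode zfps_deriv[of u, folded F_def]] G0 by (simp add: zfps_0)
  have radG: "fps_conv_radius G \<ge> ereal R" unfolding G_def by (rule conv_radius_fps_expansion[OF hE'])
  have evG: "eval_fps G z = E z" if "cmod z < R" for z
    using eval_fps_expansion'[OF hE', of z] that by (simp add: G_def)
  have core: False if U: "open U" "g holomorphic_on U" "ball 0 R \<subseteq> U"
    and g: "\<And>z. cmod z < R \<Longrightarrow> g z = E z" and z0: "z0 \<in> U" "cmod z0 = R" for U g z0
  proof -
    obtain e0 where e0: "e0 > 0" "ball z0 e0 \<subseteq> U" using U(1) z0(1) open_contains_ball by blast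
    have hg: "g holomorphic_on ball z0 e0" using holomorphic_on_subset[OF U(2) e0(2)] .
    \<comment> \<open>Moving from \<open>z0\<close> towards 0 by the fraction \<open>k\<close>
      reaches a point \<open>b\<close> inside both the disc and the neighbourhood. There
      \<open>g\<close> is an exponential, which shows that \<open>g\<close> does not vanish
      identically near \<open>z0\<close>.\<close>
    define k where "k = min (e0 / (2 * R)) (1 / 2)"
    have k: "0 < k" "k < 1" "k \<le> e0 / (2 * R)" using e0 R by (auto simp: k_def)
    define b where "b = of_real (1 - k) * z0"
    have "cmod (complex_of_real (1 - k)) = 1 - k" using k by (subst norm_of_real) simp
    then have "cmod b = (1 - k) * R" unfolding b_def norm_mult z0(2) by simp
    moreover have "0 < k * R" using k R by simp
    ultimately have bR: "cmod b < R" by (simp add: left_diff_distrib)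
    have "z0 - b = of_real k * z0" by (simp add: b_def algebra_simps)
    then have "dist z0 b = k * R" using k z0(2) by (simp add: dist_norm norm_mult)
    also have "\<dots> \<le> e0 / (2 * R) * R" using R k by (intro mult_right_mono) auto
    finally have bb: "b \<in> ball z0 e0" using e0 R by simp
    have gb: "g b \<noteq> 0" using g[OF bR] by (simp add: E_def)
    obtain e where e: "e > 0" "ball z0 e \<subseteq> ball z0 e0" "\<And>z. z \<in> ball z0 e - {z0} \<Longrightarrow> g z \<noteq> 0"
    proof (cases "g z0 = 0")
      case True
      obtain r where "0 < r" "ball z0 r \<subseteq> ball z0 e0" "\<And>z. z \<in> ball z0 r - {z0} \<Longrightarrow> g z \<noteq> 0"
        using isolated_zeros[OF hg open_ball connected_ball _ True bb gb] e0(1) by (metis centre_in_ball)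
      then show ?thesis by (rule that)
    next
      case False
      have "isCont g z0"
        using holomorphic_on_imp_continuous_on[OF hg] e0(1) by (simp add: continuous_on_eq_continuous_at)
      then obtain r where r: "r > 0" "\<And>z. dist z0 z < r \<Longrightarrow> g z \<noteq> 0"
        using continuous_at_avoid[of z0 g 0] False by blast
      show ?thesis by (rule that[of "min r e0"]) (use r e0 in auto)
    qed
    have zL: "cmod (z0 * of_real L) = 1" using z0(2) L by (simp add: norm_mult R_def)
    obtain i \<omega> where w: "i0 \<le> i" "1 \<le> i" "\<omega> ^ (q ^ i) = 1" "\<omega> ^ (q ^ (i - 1)) \<noteq> 1" "\<omega> \<noteq> z0 * of_real L"
      "cmod (\<omega> - z0 * of_real L) < e * L"
      using dense_prime_power_roots[OF zL _ q, of "e * L" i0] e(1) L by auto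
    define x where "x = \<omega> / of_real L"
    have "x - z0 = (\<omega> - z0 * of_real L) / of_real L" using L by (simp add: x_def field_simps)
    then have "cmod (x - z0) = cmod (\<omega> - z0 * of_real L) / L" using L by (simp only: norm_divide norm_of_real abs_of_pos)
    then have "cmod (x - z0) < e" using w(6) L by (simp add: pos_divide_less_eq)
    then have xb: "x \<in> ball z0 e - {z0}" using w(5) L by (auto simp: x_def dist_norm norm_minus_commute)
    have w1: "cmod \<omega> = 1"
    proof -
      have "cmod \<omega> ^ (q ^ i) = 1 ^ (q ^ i)" using w(3) by (metis norm_one norm_power power_one)
      then show ?thesis using prime_gt_0_nat[OF q] by (subst (asm) power_eq_iff_eq_base) auto
    qed
    have xR: "cmod x = R" using w1 L by (simp add: x_def norm_divide R_def)
    define v where "v n = (if n = 0 then 0 else u n / of_real L ^ n * \<omega> ^ n)" for n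
    have vn: "v n = (if n = 0 then 0 else u n * x ^ n)" for n by (simp add: v_def x_def power_divide)
    \<comment> \<open>Inside the disc \<open>g\<close> coincides with the exponential of
      \<open>l\<close>, so \<open>deriv l\<close> is \<open>deriv g / g\<close>; the latter
      expression still makes sense at the boundary point.\<close>
    have ab: "abel v r = of_real (1 - r) * (of_real r * x * deriv g (of_real r * x) / g (of_real r * x))" if r: "0 \<le> r" "r < 1" for r
    proof -
      define y where "y = of_real r * x"
      have yR: "cmod y < R" using r xR R by (simp add: y_def norm_mult)
      have "(\<lambda>n. v n * of_real r ^ n) = (\<lambda>n. fps_nth (fps_X * fps_deriv F) n * y ^ n)"
        by (intro ext) (simp add: vn F_def zlog_deriv_nth y_def power_mult_distrib mult_ac del: fps_deriv_nth split: nat.split)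
      then have "suminf (\<lambda>n. v n * of_real r ^ n) = eval_fps (fps_X * fps_deriv F) y" by (simp add: eval_fps_def)
      also have "\<dots> = y * eval_fps (fps_deriv F) y"
      proof -
        have "ereal (cmod y) < fps_conv_radius (fps_deriv F)"
          by (rule less_le_trans[OF rF[OF yR] fps_conv_radius_deriv])
        then show ?thesis by (subst eval_fps_mult) auto
      qed
      also have "eval_fps (fps_deriv F) y = deriv l y" using dl[OF yR] by simp
      also have "deriv l y = deriv E y / E y" using dE[OF yR] by (simp add: E_def)
      also have "deriv E y = deriv g y"
      proof (rule deriv_cong_ev)
        have "\<forall>\<^sub>F z in nhds y. z \<in> ball 0 R" using yR by (intro eventually_nhds_in_open) auto
        then show "\<forall>\<^sub>F z in nhds y. E z = g z" by eventually_elim (simp add: g)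
      qed simp
      finally show ?thesis using g[OF yR] by (simp add: abel_def y_def)
    qed
    have xU: "x \<in> U" using xb e(2) e0(2) by blast
    have hd: "deriv g holomorphic_on U" by (rule holomorphic_deriv[OF U(2,1)])
    have c1: "isCont g x" "isCont (deriv g) x"
      using holomorphic_on_imp_continuous_on[OF U(2)] holomorphic_on_imp_continuous_on[OF hd] U(1) xU
      by (simp_all add: continuous_on_eq_continuous_at)
    have lim: "((\<lambda>r. complex_of_real r * x) \<longlongrightarrow> of_real 1 * x) (at_left 1)" by (intro tendsto_intros)
    have g1: "((\<lambda>r. g (of_real r * x)) \<longlongrightarrow> g x) (at_left 1)"
      using isCont_tendsto_compose[OF c1(1)] lim by simp
    have g2: "((\<lambda>r. deriv g (of_real r * x)) \<longlongrightarrow> deriv g x) (at_left 1)"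
      using isCont_tendsto_compose[OF c1(2)] lim by simp
    have "((\<lambda>r. of_real (1 - r) * (of_real r * x * deriv g (of_real r * x) / g (of_real r * x))) \<longlongrightarrow>
       of_real (1 - 1) * (of_real 1 * x * deriv g x / g x)) (at_left 1)"
      using e(3)[OF xb] by (intro tendsto_intros g1 g2)
    then have l2: "((\<lambda>r. of_real (1 - r) * (of_real r * x * deriv g (of_real r * x) / g (of_real r * x))) \<longlongrightarrow> 0) (at_left 1)"
      by simp
    have ev: "\<forall>\<^sub>F r in at_left 1. of_real (1 - r) * (of_real r * x * deriv g (of_real r * x) / g (of_real r * x)) = abel v r"
      using eventually_left_1 by (rule eventually_mono) (simp add: ab)
    have nv: "negl v" unfolding negl_def by (rule Lim_transform_eventually[OF l2 ev])
    have bu: "bdd_seq (\<lambda>n. u n / of_real L ^ n * \<omega> ^ n)" by (intro bdd_seq_mult bd bdd_seq_unit w1)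
    have "cmod (v n) \<le> cmod (u n / of_real L ^ n * \<omega> ^ n)" for n by (simp add: v_def)
    then have bv: "bdd_seq v" using bu unfolding bdd_seq_def by (meson order_trans)
    have "negl (\<lambda>n. u n / of_real L ^ n * \<omega> ^ n)"
      by (rule negl_cong_pos(2)[OF bv nv]) (simp add: v_def)
    then show False using nn[OF w(1-4)] by blast
  qed
  \<comment> \<open>Were the radius larger, the sum of the series itself would be a continuation
    across the circle, which \<open>core\<close> excludes.\<close>
  have radle: "fps_conv_radius G \<le> ereal R"
  proof (rule ccontr)
    assume "\<not> fps_conv_radius G \<le> ereal R"
    then have lt: "ereal R < fps_conv_radius G" by simp
    have "ball (0::complex) R \<subseteq> eball 0 (fps_conv_radius G)"
    proof
      fix z :: complex assume "z \<in> ball 0 R"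
      then have "ereal (cmod z) < ereal R" by simp
      then have "ereal (cmod z) < fps_conv_radius G" using lt by (rule order.strict_trans)
      then show "z \<in> eball 0 (fps_conv_radius G)" by (simp add: eball_def)
    qed
    moreover have "complex_of_real R \<in> eball 0 (fps_conv_radius G)" using lt R by (simp add: eball_def)
    ultimately show False
      using core[of "eball 0 (fps_conv_radius G)" "eval_fps G" "of_real R"] evG R
      by (auto intro!: holomorphic_on_eval_fps)
  qed
  then have rad: "fps_conv_radius G = ereal R" using radG by (rule antisym)
  show ?thesis
    unfolding has_natural_boundary_def GZ[symmetric] rad
  proof (intro conjI notI)
    show "0 < ereal R" using R by simp
    show "ereal R < \<infinity>" by simp
    assume "\<exists>U g. open U \<and> connected U \<and> eball 0 (ereal R) \<subset> U \<and> g holomorphic_on U \<and> (\<forall>z\<in>eball 0 (ereal R). g z = eval_fps G z)"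
    then obtain U g where U: "open U" "connected U" "ball 0 R \<subset> U" "g holomorphic_on U" "\<forall>z\<in>ball 0 R. g z = eval_fps G z"
      by auto
    have "\<exists>z0\<in>U. cmod z0 = R"
    proof (rule ccontr)
      assume no: "\<not> (\<exists>z0\<in>U. cmod z0 = R)"
      have "U \<subseteq> ball 0 R \<union> - cball 0 R" using no by fastforce
      moreover have "ball 0 R \<inter> U \<noteq> {}" using U(3) R by (metis Int_absorb2 centre_in_ball empty_iff psubset_imp_subset)
      moreover have "- cball 0 R \<inter> U \<noteq> {}" using U(3) no by (rule psubset_ball_exterior)
      ultimately show False
        using connectedD[OF U(2), of "ball 0 R" "- cball 0 R"] by (force simp: open_Compl)
    qed
    then obtain z0 where "z0 \<in> U" "cmod z0 = R" by blast
    then show False using core[OF U(1,4) _ _ \<open>z0 \<in> U\<close>] U(3,5) evG by auto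
  qed
qed

section \<open>Ergodicity and the rationalized dual\<close>

lemma haar_open_nonzero:
  fixes \<mu> :: "'x::topological_ab_group_add measure"
  assumes cpt: "compact (UNIV :: 'x set)" and haar: "haar_measure \<mu>" and U: "open U" "U \<noteq> {}"
  shows "emeasure \<mu> U \<noteq> 0"
proof
  assume z: "emeasure \<mu> U = 0"
  have tr: "(+) x ` U = (\<lambda>y. - x + y) -` U" for x
  proof (rule Set.set_eqI, rule iffI)
    fix y assume "y \<in> (+) x ` U" then show "y \<in> (\<lambda>y. - x + y) -` U" by (elim imageE) simp
  next
    fix y assume "y \<in> (\<lambda>y. - x + y) -` U"
    then have "x + (- x + y) \<in> (+) x ` U" by (intro imageI) simp
    then show "y \<in> (+) x ` U" by simp
  qed
  have op: "open ((+) x ` U)" for x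
    unfolding tr by (rule open_vimage[OF U(1)]) (intro continuous_intros)
  obtain u where u: "u \<in> U" using U(2) by blast
  \<comment> \<open>Finitely many translates of \<open>U\<close> cover by compactness, and
    translation invariance would give the whole group measure 0.\<close>
  have cov: "UNIV \<subseteq> (\<Union>x\<in>UNIV. (+) x ` U)"
  proof
    fix y :: 'x
    have "(y - u) + u \<in> (+) (y - u) ` U" by (rule imageI) (rule u)
    then have "y \<in> (+) (y - u) ` U" by (simp only: diff_add_cancel)
    then show "y \<in> (\<Union>x\<in>UNIV. (+) x ` U)" by (rule UN_I[OF UNIV_I])
  qed
  obtain C where C: "finite C" "UNIV \<subseteq> (\<Union>x\<in>C. (+) x ` U)"
    by (rule compactE_image[OF cpt op cov]) 
  have sets: "sets \<mu> = sets borel" and one: "emeasure \<mu> UNIV = 1"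
    and inv: "A \<in> sets borel \<Longrightarrow> emeasure \<mu> ((+) x ` A) = emeasure \<mu> A" for x A
    using haar unfolding haar_measure_def by auto
  have "emeasure \<mu> (\<Union>x\<in>C. (+) x ` U) \<le> (\<Sum>x\<in>C. emeasure \<mu> ((+) x ` U))"
    by (rule emeasure_subadditive_finite[OF C(1)]) (auto simp only: sets intro!: borel_open op)
  also have "\<dots> = 0" using inv[OF borel_open[OF U(1)]] z by simp
  also have "(\<Union>x\<in>C. (+) x ` U) = UNIV" using C(2) by (simp only: top.extremum_unique)
  finally show False using one by simp
qed

lemma dual_groupD:
  assumes "\<phi> \<in> carrier (dual_group :: ('x::topological_ab_group_add \<Rightarrow> complex) monoid)"
  shows "continuous_on UNIV \<phi>" "cmod (\<phi> x) = 1" "\<phi> (x + y) = \<phi> x * \<phi> y" "\<phi> x \<noteq> 0" "\<phi> 0 = 1"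
proof -
  show c: "continuous_on UNIV \<phi>" "cmod (\<phi> x) = 1" "\<phi> (x + y) = \<phi> x * \<phi> y" for x y
    using assms by (auto simp: dual_group_def)
  show nz: "\<phi> x \<noteq> 0" for x using c(2)[of x] by force
  have "\<phi> 0 * \<phi> 0 = \<phi> 0 * 1" using c(3)[of 0 0] by simp
  then show "\<phi> 0 = 1" using nz by (metis mult_left_cancel)
qed

lemma automorphism_iterate:
  assumes "topological_automorphism \<theta>"
  shows "continuous_on UNIV (\<theta> ^^ n)" "(\<theta> ^^ n) (x + y) = (\<theta> ^^ n) x + (\<theta> ^^ n) y" "(\<theta> ^^ n) 0 = 0"
proof -
  have c: "continuous_on UNIV \<theta>" and a: "\<theta> (x + y) = \<theta> x + \<theta> y" for x y
    using assms by (auto simp: topological_automorphism_def homeomorphism_def)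
  show "continuous_on UNIV (\<theta> ^^ n)"
  proof (induction n)
    case 0 then show ?case by (simp add: id_def)
  next
    case (Suc n)
    have "continuous_on ((\<theta> ^^ n) ` UNIV) \<theta>" by (rule continuous_on_subset[OF c]) simp
    from continuous_on_compose[OF Suc this] show ?case by simp
  qed
  show ad: "(\<theta> ^^ n) (x + y) = (\<theta> ^^ n) x + (\<theta> ^^ n) y" for x y
    by (induction n arbitrary: x y) (simp_all add: a)
  show "(\<theta> ^^ n) 0 = 0" using ad[of 0 0] by simp
qed

text \<open>Summing the real part of \<phi> along the orbit gives a continuous invariant function
  that equals \<open>n\<close> at 0 and is smaller at \<open>x0\<close>. A level in between
  separates two disjoint nonempty invariant open sets; ergodicity and
  \<open>haar_open_nonzero\<close> give both of them measure 1.\<close>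

lemma ergodic_no_periodic_character:
  fixes \<theta> :: "'x::topological_ab_group_add \<Rightarrow> 'x"
  assumes cpt: "compact (UNIV :: 'x set)" and aut: "topological_automorphism \<theta>"
    and haar: "haar_measure \<mu>" and erg: "ergodic \<mu> \<theta>"
    and \<phi>: "\<phi> \<in> carrier dual_group" and n: "n \<ge> 1" and per: "\<phi> \<circ> \<theta> ^^ n = \<phi>"
  shows "\<phi> = (\<lambda>_. 1)"
proof (rule ext, rule ccontr)
  fix x0 assume ne: "\<phi> x0 \<noteq> 1"
  note it = automorphism_iterate[OF aut]
  define \<psi> where "\<psi> x = (\<Sum>i<n. Re (\<phi> ((\<theta> ^^ i) x)))" for x
  have le: "Re (\<phi> x) \<le> 1" for x using complex_Re_le_cmod[of "\<phi> x"] dual_groupD(2)[OF \<phi>] by simp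
  have inv: "\<psi> (\<theta> x) = \<psi> x" for x
  proof -
    have "\<psi> (\<theta> x) + Re (\<phi> x) = (\<Sum>i<Suc n. Re (\<phi> ((\<theta> ^^ i) x)))"
      unfolding \<psi>_def by (subst sum.lessThan_Suc_shift) (simp add: funpow_swap1)
    also have "\<dots> = \<psi> x + Re (\<phi> ((\<theta> ^^ n) x))" by (simp add: \<psi>_def)
    also have "\<phi> ((\<theta> ^^ n) x) = \<phi> x" using per by (metis comp_apply)
    finally show ?thesis by simp
  qed
  have cont: "continuous_on UNIV \<psi>"
    unfolding \<psi>_def
    by (intro continuous_intros continuous_on_compose2[OF dual_groupD(1)[OF \<phi>]] it(1)) auto
  have p0: "\<psi> 0 = real n" by (simp add: \<psi>_def it(3) dual_groupD(5)[OF \<phi>])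
  have "Re (\<phi> x0) \<noteq> 1"
  proof
    assume r: "Re (\<phi> x0) = 1"
    have "(cmod (\<phi> x0))\<^sup>2 = (Re (\<phi> x0))\<^sup>2 + (Im (\<phi> x0))\<^sup>2" by (rule cmod_power2)
    then have "Im (\<phi> x0) = 0" using r dual_groupD(2)[OF \<phi>, of x0] by simp
    then show False using ne r by (simp add: complex_eq_iff)
  qed
  then have lt: "Re (\<phi> x0) < 1" using le[of x0] by simp
  have "\<psi> x0 < (\<Sum>i<n. 1)"
    unfolding \<psi>_def by (rule sum_strict_mono_ex1) (use n lt in \<open>auto intro!: le bexI[of _ 0]\<close>)
  then have px: "\<psi> x0 < real n" by simp
  define c where "c = (\<psi> x0 + real n) / 2"
  have c: "\<psi> x0 < c" "c < real n" using px by (auto simp: c_def)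
  have opA: "open {x. c < \<psi> x}" and opB: "open {x. \<psi> x < c}"
    by (intro open_Collect_less continuous_intros cont)+
  have sets: "sets \<mu> = sets borel" and one: "emeasure \<mu> UNIV = 1"
    using haar unfolding haar_measure_def by auto
  have e1: "emeasure \<mu> A = 1" if "open A" "A \<noteq> {}" "\<theta> -` A = A" for A
  proof -
    have "A \<in> sets \<mu>" using that(1) sets by simp
    then show ?thesis
      using erg that(3) haar_open_nonzero[OF cpt haar that(1,2)] unfolding ergodic_def by blast
  qed
  have eA: "emeasure \<mu> {x. c < \<psi> x} = 1"
    by (rule e1[OF opA]) (use p0 c in \<open>auto simp: inv intro!: exI[of _ 0]\<close>)
  have eB: "emeasure \<mu> {x. \<psi> x < c} = 1"
    by (rule e1[OF opB]) (use c in \<open>auto simp: inv\<close>)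
  have "emeasure \<mu> {x. c < \<psi> x} + emeasure \<mu> {x. \<psi> x < c} = emeasure \<mu> ({x. c < \<psi> x} \<union> {x. \<psi> x < c})"
    by (rule plus_emeasure) (use opA opB sets in auto)
  also have "\<dots> \<le> emeasure \<mu> UNIV" using sets by (intro emeasure_mono) auto
  finally show False using eA eB one by simp
qed

lemma dual_group_comm_group: "comm_group (dual_group :: ('x::topological_ab_group_add \<Rightarrow> complex) monoid)"
proof (rule comm_groupI)
  let ?D = "dual_group :: ('x \<Rightarrow> complex) monoid"
  fix \<phi> assume \<phi>: "\<phi> \<in> carrier ?D"
  have "continuous_on UNIV (\<lambda>x. inverse (\<phi> x))"
    by (rule continuous_on_inverse) (use dual_groupD[OF \<phi>] in auto)
  then show "\<exists>\<psi>\<in>carrier ?D. \<psi> \<otimes>\<^bsub>?D\<^esub> \<phi> = \<one>\<^bsub>?D\<^esub>"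
    using dual_groupD[OF \<phi>]
    by (intro bexI[of _ "\<lambda>x. inverse (\<phi> x)"]) (auto simp: dual_group_def norm_inverse)
qed (auto simp: dual_group_def norm_mult mult_ac intro!: continuous_on_mult)

lemma dual_one: "\<one>\<^bsub>dual_group\<^esub> = (\<lambda>_. 1)" and dual_mult: "\<phi> \<otimes>\<^bsub>dual_group\<^esub> \<psi> = (\<lambda>x. \<phi> x * \<psi> x)"
  by (simp_all add: dual_group_def)

lemma dual_int_pow:
  fixes \<phi> :: "'x::topological_ab_group_add \<Rightarrow> complex" and c :: int
  assumes \<phi>: "\<phi> \<in> carrier dual_group"
  shows "\<phi> [^]\<^bsub>dual_group\<^esub> c = (\<lambda>x. \<phi> x powi c)"
proof -
  interpret D: comm_group "dual_group :: ('x \<Rightarrow> complex) monoid" by (rule dual_group_comm_group)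
  have np: "\<phi> [^]\<^bsub>dual_group\<^esub> n = (\<lambda>x. \<phi> x ^ n)" for n :: nat
    by (induction n) (auto simp: dual_one dual_mult D.nat_pow_Suc mult_ac)
  have inv: "inv\<^bsub>dual_group\<^esub> \<psi> = (\<lambda>x. inverse (\<psi> x))" if "\<psi> \<in> carrier dual_group" for \<psi> :: "'x \<Rightarrow> complex"
  proof
    fix x
    have "(inv\<^bsub>dual_group\<^esub> \<psi> \<otimes>\<^bsub>dual_group\<^esub> \<psi>) x = 1" using D.l_inv[OF that] by (simp only: dual_one)
    then show "(inv\<^bsub>dual_group\<^esub> \<psi>) x = inverse (\<psi> x)"
      using dual_groupD(4)[OF that, of x] by (simp add: dual_mult field_simps)
  qed
  show ?thesis
  proof (cases "c < 0")
    case False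
    then show ?thesis by (intro ext) (simp add: int_pow_def2 power_int_def np)
  next
    case True
    have cl: "\<phi> [^]\<^bsub>dual_group\<^esub> nat (- c) \<in> carrier dual_group" using \<phi> by (rule D.nat_pow_closed)
    have "\<phi> [^]\<^bsub>dual_group\<^esub> c = inv\<^bsub>dual_group\<^esub> (\<phi> [^]\<^bsub>dual_group\<^esub> nat (- c))"
      by (subst int_pow_def2) (simp only: True if_True)
    also have "\<dots> = (\<lambda>x. inverse (\<phi> x ^ nat (- c)))" by (subst inv[OF cl]) (simp only: np)
    also have "\<dots> = (\<lambda>x. \<phi> x powi c)" using True by (intro ext) (simp add: power_int_def power_inverse)
    finally show ?thesis .
  qed
qed

lemma dual_finprod:
  fixes g :: "'b \<Rightarrow> 'x::topological_ab_group_add \<Rightarrow> complex"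
  assumes "finite B" "\<And>b. b \<in> B \<Longrightarrow> g b \<in> carrier dual_group"
  shows "finprod dual_group g B = (\<lambda>x. \<Prod>b\<in>B. g b x)"
proof -
  interpret D: comm_group "dual_group :: ('x \<Rightarrow> complex) monoid" by (rule dual_group_comm_group)
  show ?thesis using assms
    by (induction B rule: finite_induct) (auto simp: dual_one dual_mult Pi_def)
qed

lemma rat_group_comm_group: "comm_group rat_group"
  by (rule comm_groupI) (auto simp: rat_group_def intro: exI[of _ "- (x :: rat)" for x])

lemma character_relation:
  fixes \<phi> :: "nat \<Rightarrow> 'x::topological_ab_group_add \<Rightarrow> complex"
  assumes dim: "has_dimension TYPE('x) d" and \<phi>: "\<And>i. \<phi> i \<in> carrier dual_group"
  obtains c :: "nat \<Rightarrow> int" where "\<exists>i\<le>d. c i \<noteq> 0" "\<And>x. (\<Prod>i\<le>d. \<phi> i x powi c i) = 1"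
\<comment> \<open>\<open>int_independent\<close> concerns sets, in which coinciding characters would
  collapse. Two equal characters yield the relation with exponents 1 and -1 directly.\<close>
proof (cases "inj_on \<phi> {..d}")
  case False
  then obtain i j where ij: "i \<le> d" "j \<le> d" "i \<noteq> j" "\<phi> i = \<phi> j" by (auto simp: inj_on_def)
  define c where "c = (\<lambda>l. if l = i then 1 else if l = j then -1 else (0::int))"
  have "(\<Prod>l\<le>d. \<phi> l x powi c l) = 1" for x
  proof -
    have "(\<Prod>l\<le>d. \<phi> l x powi c l) = (\<Prod>l\<in>{i,j}. \<phi> l x powi c l)"
      by (rule prod.mono_neutral_right) (use ij in \<open>auto simp: c_def\<close>)
    also have "\<dots> = 1" using ij dual_groupD(4)[OF \<phi>, of j x] by (simp add: c_def power_int_minus)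
    finally show ?thesis .
  qed
  moreover have "\<exists>l\<le>d. c l \<noteq> 0" using ij by (intro exI[of _ i]) (simp add: c_def)
  ultimately show ?thesis using that by blast
next
  case True
  let ?D = "dual_group :: ('x \<Rightarrow> complex) monoid"
  obtain H h where H: "subgroup H (rat_power d)" "has_rank (rat_power d\<lparr>carrier := H\<rparr>) d"
    and h: "h \<in> iso ?D (rat_power d\<lparr>carrier := H\<rparr>)"
    using dim unfolding has_dimension_def is_iso_def by blast
  define G where "G = rat_power d\<lparr>carrier := H\<rparr>"
  interpret D: comm_group ?D by (rule dual_group_comm_group)
  have gG: "group (rat_power d)"
    using rat_group_comm_group by (auto simp: comm_group_def)
  have "group G" unfolding G_def by (rule subgroup.subgroup_is_group[OF H(1) gG])
  then have mG: "monoid G" by (simp add: group_def)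
  have "?D \<cong> G" using h unfolding is_iso_def G_def by blast
  then interpret G: comm_group G by (rule D.iso_imp_comm_group[OF _ mG])
  interpret hom: group_hom ?D G h
    by (rule group_hom.intro[OF D.group_axioms G.group_axioms])
      (use h in \<open>simp add: group_hom_axioms_def iso_def G_def\<close>)
  have bij: "bij_betw h (carrier ?D) (carrier G)" using h by (simp add: iso_def G_def)
  then have injh: "inj_on h (carrier ?D)" by (simp add: bij_betw_def)
  define B where "B = (\<lambda>i. h (\<phi> i)) ` {..d}"
  have injB: "inj_on (\<lambda>i. h (\<phi> i)) {..d}"
    using True injh \<phi> by (auto simp: inj_on_def)
  have "card B = Suc d" unfolding B_def by (subst card_image[OF injB]) simp
  then have "\<not> int_independent G B" using H(2) unfolding has_rank_def G_def by fastforce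
  moreover have "finite B" "B \<subseteq> carrier G" using \<phi> by (auto simp: B_def)
  ultimately obtain c :: "(nat \<Rightarrow> rat) \<Rightarrow> int" where c: "finprod G (\<lambda>b. b [^]\<^bsub>G\<^esub> c b) B = \<one>\<^bsub>G\<^esub>" "\<exists>b\<in>B. c b \<noteq> 0"
    unfolding int_independent_def by blast
  define c' where "c' i = c (h (\<phi> i))" for i
  have fp: "finprod G (\<lambda>i. h (g i)) I = h (finprod ?D g I)" if "finite I" "\<And>i. g i \<in> carrier ?D" for g :: "nat \<Rightarrow> _" and I
    using that(1)
  proof (induction I rule: finite_induct)
    case (insert i I)
    then show ?case using that(2) by (simp add: Pi_def)
  qed simp
  have cl: "\<phi> i [^]\<^bsub>?D\<^esub> c' i \<in> carrier ?D" for i by (rule D.int_pow_closed[OF \<phi>])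
  have "h (finprod ?D (\<lambda>i. \<phi> i [^]\<^bsub>?D\<^esub> c' i) {..d}) = finprod G (\<lambda>i. h (\<phi> i [^]\<^bsub>?D\<^esub> c' i)) {..d}"
    by (rule fp[symmetric]) (use cl in auto)
  also have "\<dots> = finprod G (\<lambda>i. h (\<phi> i) [^]\<^bsub>G\<^esub> c (h (\<phi> i))) {..d}"
    by (simp add: hom.hom_int_pow[OF \<phi>] c'_def)
  also have "\<dots> = finprod G (\<lambda>b. b [^]\<^bsub>G\<^esub> c b) B"
    unfolding B_def by (rule G.finprod_reindex[symmetric, OF _ injB]) (use \<phi> in auto)
  also have "\<dots> = h \<one>\<^bsub>?D\<^esub>" using c(1) by simp
  finally have "finprod ?D (\<lambda>i. \<phi> i [^]\<^bsub>?D\<^esub> c' i) {..d} = \<one>\<^bsub>?D\<^esub>"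
    by (rule inj_onD[OF injh]) (use cl in auto)
  moreover have "finprod ?D (\<lambda>i. \<phi> i [^]\<^bsub>?D\<^esub> c' i) {..d} = (\<lambda>x. \<Prod>i\<le>d. \<phi> i x powi c' i)"
    by (subst dual_finprod) (simp_all add: cl, simp add: dual_int_pow[OF \<phi>])
  ultimately have "(\<Prod>i\<le>d. \<phi> i x powi c' i) = 1" for x by (metis dual_one)
  moreover have "\<exists>i\<le>d. c' i \<noteq> 0" using c(2) by (auto simp: B_def c'_def)
  ultimately show ?thesis using that by blast
qed

text \<open>The polynomial \<open>Q\<close> in the dual of \<open>g\<close>, applied to \<phi> and
  written multiplicatively.\<close>

definition character_poly :: "('x \<Rightarrow> complex) \<Rightarrow> ('x \<Rightarrow> 'x) \<Rightarrow> int poly \<Rightarrow> 'x \<Rightarrow> complex" where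
  "character_poly \<phi> g Q x = (\<Prod>i\<le>degree Q. \<phi> ((g ^^ i) x) powi coeff Q i)"

lemma character_poly_bound:
  assumes "degree Q \<le> N"
  shows "character_poly \<phi> g Q x = (\<Prod>i\<le>N. \<phi> ((g ^^ i) x) powi coeff Q i)"
  unfolding character_poly_def
  by (rule prod.mono_neutral_left) (use assms in \<open>auto simp: coeff_eq_0\<close>)

text \<open>The rank bound makes \<open>d + 1\<close> iterates of \<phi> dependent, so some nonzero
  \<open>Q\<close> annihilates \<phi>; take one of least degree. If it vanished at 1, dividing by
  \<open>X - 1\<close> would leave a character fixed by \<open>g\<close>, which is trivial by
  \<open>erg\<close>, against minimality.\<close>

lemma character_poly_annihilator:
  fixes g :: "'x::topological_ab_group_add \<Rightarrow> 'x"
  assumes dim: "has_dimension TYPE('x) d"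
    and g: "continuous_on UNIV g" "\<And>x y. g (x + y) = g x + g y"
    and erg: "\<And>\<psi>. \<psi> \<in> carrier dual_group \<Longrightarrow> \<psi> \<circ> g = \<psi> \<Longrightarrow> \<psi> = (\<lambda>_. 1)"
    and \<phi>: "\<phi> \<in> carrier dual_group"
  obtains Q :: "int poly" where "poly Q 1 \<noteq> 0" "character_poly \<phi> g Q = (\<lambda>_. 1)"
proof -
  let ?D = "dual_group :: ('x \<Rightarrow> complex) monoid"
  interpret D: comm_group ?D by (rule dual_group_comm_group)
  have gi: "continuous_on UNIV (g ^^ i)" for i
  proof (induction i)
    case 0 then show ?case by (simp add: id_def)
  next
    case (Suc n)
    have "continuous_on ((g ^^ n) ` UNIV) g" by (rule continuous_on_subset[OF g(1)]) simp
    from continuous_on_compose[OF Suc this] show ?case by simp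
  qed
  have ga: "(g ^^ i) (x + y) = (g ^^ i) x + (g ^^ i) y" for i x y
    by (induction i arbitrary: x y) (simp_all add: g(2))
  have \<phi>i: "(\<lambda>x. \<phi> ((g ^^ i) x)) \<in> carrier ?D" for i
    using dual_groupD[OF \<phi>] continuous_on_compose2[OF dual_groupD(1)[OF \<phi>] gi[of i]]
    by (simp add: dual_group_def ga)
  note nz = dual_groupD(4)[OF \<phi>]
  obtain c where c: "\<exists>i\<le>d. c i \<noteq> 0" "\<And>x. (\<Prod>i\<le>d. \<phi> ((g ^^ i) x) powi c i) = 1"
    by (rule character_relation[where \<phi> = "\<lambda>i x. \<phi> ((g ^^ i) x)", OF dim \<phi>i], rule that)
  define Q0 where "Q0 = (\<Sum>i\<le>d. Polynomial.monom (c i) i)"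
  have co: "coeff Q0 i = (if i \<le> d then c i else 0)" for i
    unfolding Q0_def by (simp add: coeff_sum sum.delta' cong: if_cong)
  have "Q0 \<noteq> 0" using c(1) co by (metis coeff_0)
  have "degree Q0 \<le> d" by (rule degree_le) (simp add: co)
  from character_poly_bound[OF this, of \<phi> g] have "character_poly \<phi> g Q0 = (\<lambda>_. 1)"
    using c(2) by (auto simp: co)
  moreover define Pr where "Pr Q \<longleftrightarrow> Q \<noteq> 0 \<and> character_poly \<phi> g Q = (\<lambda>_. 1)" for Q
  ultimately have "Pr Q0" using \<open>Q0 \<noteq> 0\<close> by simp
  from ex_has_least_nat[of Pr, OF this, of degree]
  obtain Q where "Pr Q" and least: "\<forall>P. Pr P \<longrightarrow> degree Q \<le> degree P" by (elim exE conjE)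
  then have Q: "Q \<noteq> 0" "character_poly \<phi> g Q = (\<lambda>_. 1)" by (simp_all only: Pr_def simp_thms)
  have min: "degree Q \<le> degree P" if "P \<noteq> 0" "character_poly \<phi> g P = (\<lambda>_. 1)" for P
    using least that by (simp only: Pr_def simp_thms)
  have "poly Q 1 \<noteq> 0"
  proof
    assume "poly Q 1 = 0"
    then obtain P where P: "Q = [:-1, 1:] * P" by (auto simp: poly_eq_0_iff_dvd elim: dvdE)
    have P0: "P \<noteq> 0" using Q(1) P by auto
    have "degree Q = degree [:-1, 1 :: int:] + degree P" unfolding P by (rule degree_mult_eq) (use P0 in auto)
    then have dQ: "degree Q = Suc (degree P)" by simp
    have cQ: "coeff Q i = coeff (pCons 0 P) i - coeff P i" for i
      by (simp add: P)
    have chi: "character_poly \<phi> g P (g x) = character_poly \<phi> g P x" for x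
    proof -
      have "1 = character_poly \<phi> g Q x" using Q(2) by simp
      also have "\<dots> = (\<Prod>i\<le>Suc (degree P). \<phi> ((g ^^ i) x) powi coeff (pCons 0 P) i) / (\<Prod>i\<le>Suc (degree P). \<phi> ((g ^^ i) x) powi coeff P i)"
        unfolding character_poly_def dQ cQ by (simp only: power_int_diff nz prod_dividef simp_thms)
      also have "(\<Prod>i\<le>Suc (degree P). \<phi> ((g ^^ i) x) powi coeff P i) = character_poly \<phi> g P x"
        by (rule character_poly_bound[symmetric]) simp
      also have "(\<Prod>i\<le>Suc (degree P). \<phi> ((g ^^ i) x) powi coeff (pCons 0 P) i) = character_poly \<phi> g P (g x)"
        by (subst prod.atMost_Suc_shift) (simp add: character_poly_def funpow_swap1)
      finally show ?thesis by (metis divide_eq_1_iff)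
    qed
    have "character_poly \<phi> g P \<in> carrier ?D"
    proof -
      have cl: "(\<lambda>x. \<phi> ((g ^^ i) x)) [^]\<^bsub>?D\<^esub> c \<in> carrier ?D" for i and c :: int
        by (rule D.int_pow_closed[OF \<phi>i])
      have "character_poly \<phi> g P = finprod ?D (\<lambda>i. (\<lambda>x. \<phi> ((g ^^ i) x)) [^]\<^bsub>?D\<^esub> coeff P i) {..degree P}"
        by (subst dual_finprod) (simp_all add: cl, simp add: dual_int_pow[OF \<phi>i] character_poly_def fun_eq_iff)
      also have "\<dots> \<in> carrier ?D" by (rule D.finprod_closed) (auto intro: D.int_pow_closed \<phi>i)
      finally show ?thesis .
    qed
    then have "character_poly \<phi> g P = (\<lambda>_. 1)" by (rule erg) (auto simp: chi)
    from min[OF P0 this] dQ show False by simp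
  qed
  then show ?thesis using that Q(2) by blast
qed

section \<open>Quotient modules and simple factors\<close>

lemma quot_module_simps:
  fixes M (structure)
  assumes M: "abelian_group M" and H: "submodule H R M" and W: "submodule W R M" and HW: "H \<subseteq> W"
    and add: "\<forall>p\<in>carrier R. \<forall>x\<in>carrier M. \<forall>y\<in>carrier M. p \<odot> (x \<oplus> y) = p \<odot> x \<oplus> p \<odot> y"
  defines "Q \<equiv> quot_module (M\<lparr>carrier := W\<rparr>) H"
  shows "carrier Q = (\<lambda>x. H +> x) ` W"
    and "x \<in> W \<Longrightarrow> y \<in> W \<Longrightarrow> (H +> x) \<oplus>\<^bsub>Q\<^esub> (H +> y) = H +> (x \<oplus> y)"
    and "p \<in> carrier R \<Longrightarrow> x \<in> W \<Longrightarrow> p \<odot>\<^bsub>Q\<^esub> (H +> x) = H +> (p \<odot> x)"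
    and "x \<in> W \<Longrightarrow> H +> x = H \<longleftrightarrow> x \<in> H"
    and "x \<in> W \<Longrightarrow> x \<in> carrier M"
proof -
  interpret M: abelian_group M by (rule M)
  have Hs: "subgroup H (add_monoid M)" and Ws: "subgroup W (add_monoid M)"
    using H W by (simp_all add: submodule_def)
  interpret abelian_subgroup H M
    by (rule abelian_subgroupI3[OF additive_subgroup.intro[OF Hs] M])
  have WM: "x \<in> W \<Longrightarrow> x \<in> carrier M" for x using subgroup.subset[OF Ws] by auto
  then show "x \<in> W \<Longrightarrow> x \<in> carrier M" .
  have co: "H +>\<^bsub>M\<lparr>carrier := W\<rparr>\<^esub> x = H +> x" for x
    by (simp add: a_r_coset_def r_coset_def)
  show "carrier Q = (\<lambda>x. H +> x) ` W"
    unfolding Q_def quot_module_def A_RCOSETS_def RCOSETS_def a_r_coset_def r_coset_def by auto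
  show "x \<in> W \<Longrightarrow> y \<in> W \<Longrightarrow> (H +> x) \<oplus>\<^bsub>Q\<^esub> (H +> y) = H +> (x \<oplus> y)"
    using a_rcos_sum[of x y] WM unfolding Q_def quot_module_def by (simp add: set_add_def set_mult_def)
  show "p \<odot>\<^bsub>Q\<^esub> (H +> x) = H +> (p \<odot> x)" if p: "p \<in> carrier R" and x: "x \<in> W"
  proof -
    have px: "p \<odot> x \<in> carrier M" using W p x WM by (simp add: submodule.smult_closed)
    have "H +> (p \<odot> y) = H +> (p \<odot> x)" if y: "y \<in> H +> x" for y
    proof -
      obtain z where z: "z \<in> H" "y = z \<oplus> x" using y unfolding a_r_coset_def r_coset_def by auto
      have "p \<odot> y = p \<odot> z \<oplus> p \<odot> x" using z p x HW WM by (auto simp: add[rule_format])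
      moreover have "p \<odot> z \<in> H" using H p z(1) by (simp add: submodule.smult_closed)
      ultimately have "p \<odot> y \<in> H +> (p \<odot> x)" unfolding a_r_coset_def r_coset_def by auto
      from M.a_repr_independence[OF this px Hs] show ?thesis by simp
    qed
    note const = this
    have "x \<in> H +> x" by (rule a_rcos_self[OF WM[OF x]])
    then have ne: "(H +> x = {}) = False" by (metis empty_iff)
    have "p \<odot>\<^bsub>Q\<^esub> (H +> x) = (\<Union>y\<in>H +> x. H +> (p \<odot> y))"
      unfolding Q_def quot_module_def by (simp add: co)
    also have "\<dots> = (\<Union>y\<in>H +> x. H +> (p \<odot> x))" by (rule SUP_cong[OF refl const])
    also have "\<dots> = H +> (p \<odot> x)" by (simp only: UN_constant ne if_False)
    finally show ?thesis .
  qed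
  show "H +> x = H \<longleftrightarrow> x \<in> H" if "x \<in> W"
    using M.a_coset_join1[OF _ WM[OF that] Hs] M.a_coset_join2[OF WM[OF that] Hs] by blast
qed

text \<open>\<open>rel x r\<close> means that the isomorphism sends the coset of \<open>x\<close> to
  the coset of \<open>r\<close>. A relation between representatives is compatible with all
  operations without any choice of representatives.\<close>

lemma quotient_correspondence:
  fixes M (structure) and R (structure)
  assumes M: "abelian_group M" and H: "submodule H R M" and W: "submodule W R M" and HW: "H \<subseteq> W"
    and add: "\<forall>p\<in>carrier R. \<forall>x\<in>carrier M. \<forall>y\<in>carrier M. p \<odot>\<^bsub>M\<^esub> (x \<oplus>\<^bsub>M\<^esub> y) = p \<odot>\<^bsub>M\<^esub> x \<oplus>\<^bsub>M\<^esub> p \<odot>\<^bsub>M\<^esub> y"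
    and R: "cring R" and I: "ideal I R"
    and iso: "module_isomorphic R (quot_module (M\<lparr>carrier := W\<rparr>) H) (quot_module (regular_module R) I)"
  obtains rel where "\<And>x r. rel x r \<Longrightarrow> x \<in> W \<and> r \<in> carrier R"
    and "\<And>x. x \<in> W \<Longrightarrow> \<exists>r. rel x r"
    and "\<And>r. r \<in> carrier R \<Longrightarrow> \<exists>x. rel x r"
    and "\<And>x y r s. rel x r \<Longrightarrow> rel y s \<Longrightarrow> rel (x \<oplus>\<^bsub>M\<^esub> y) (r \<oplus>\<^bsub>R\<^esub> s)"
    and "\<And>x r p. rel x r \<Longrightarrow> p \<in> carrier R \<Longrightarrow> rel (p \<odot>\<^bsub>M\<^esub> x) (p \<otimes>\<^bsub>R\<^esub> r)"
    and "\<And>x r. rel x r \<Longrightarrow> x \<in> H \<longleftrightarrow> r \<in> I"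
proof -
  interpret M: abelian_group M by (rule M)
  interpret R: cring R by (rule R)
  interpret I: ideal I R by (rule I)
  let ?N = "regular_module R"
  have N: "abelian_group ?N"
    by (rule abelian_groupI) (auto simp: regular_module_def R.a_ac intro: R.l_neg R.a_inv_closed)
  have sub: "subgroup J (add_monoid R) \<Longrightarrow> subgroup J (add_monoid ?N)" for J
    by (simp add: subgroup_def m_inv_def regular_module_def)
  have IN: "submodule I R ?N" "submodule (carrier R) R ?N"
    unfolding submodule_def submodule_axioms_def
    using sub[OF I.a_subgroup] sub[OF R.add.subgroup_self]
    by (auto simp: regular_module_def I.I_l_closed)
  have IR: "I \<subseteq> carrier R" by (rule I.a_subset)
  have Nadd: "\<forall>p\<in>carrier R. \<forall>x\<in>carrier ?N. \<forall>y\<in>carrier ?N. p \<odot>\<^bsub>?N\<^esub> (x \<oplus>\<^bsub>?N\<^esub> y) = p \<odot>\<^bsub>?N\<^esub> x \<oplus>\<^bsub>?N\<^esub> p \<odot>\<^bsub>?N\<^esub> y"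
    by (simp add: regular_module_def R.r_distr)
  have Nc: "?N\<lparr>carrier := carrier R\<rparr> = ?N" by (simp add: regular_module_def)
  note q = quot_module_simps[OF N IN IR Nadd, unfolded Nc]
  note c = quot_module_simps[OF M H W HW add]
  define cc where "cc x = H +>\<^bsub>M\<^esub> x" for x
  define qq where "qq r = I +>\<^bsub>?N\<^esub> r" for r
  have Na: "r \<oplus>\<^bsub>?N\<^esub> s = r \<oplus>\<^bsub>R\<^esub> s" and Ns: "p \<odot>\<^bsub>?N\<^esub> s = p \<otimes>\<^bsub>R\<^esub> s" for r s p
    by (simp_all add: regular_module_def)
  let ?QM = "quot_module (M\<lparr>carrier := W\<rparr>) H" and ?QN = "quot_module ?N I"
  obtain h where h: "bij_betw h (carrier ?QM) (carrier ?QN)"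
    "\<And>x y. x \<in> carrier ?QM \<Longrightarrow> y \<in> carrier ?QM \<Longrightarrow> h (x \<oplus>\<^bsub>?QM\<^esub> y) = h x \<oplus>\<^bsub>?QN\<^esub> h y"
    "\<And>r x. r \<in> carrier R \<Longrightarrow> x \<in> carrier ?QM \<Longrightarrow> h (r \<odot>\<^bsub>?QM\<^esub> x) = r \<odot>\<^bsub>?QN\<^esub> h x"
    using iso unfolding module_isomorphic_def by blast
  have Wa: "x \<in> W \<Longrightarrow> y \<in> W \<Longrightarrow> x \<oplus>\<^bsub>M\<^esub> y \<in> W" for x y
    using W by (simp add: submodule_def) (metis subgroup.m_closed monoid.simps(1) partial_object.select_convs(1))
  have W0: "\<zero>\<^bsub>M\<^esub> \<in> W" "\<zero>\<^bsub>M\<^esub> \<in> H"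
    using W H subgroup.one_closed[of W "add_monoid M"] subgroup.one_closed[of H "add_monoid M"]
    by (simp_all add: submodule_def)
  have Ws: "p \<in> carrier R \<Longrightarrow> x \<in> W \<Longrightarrow> p \<odot>\<^bsub>M\<^esub> x \<in> W" for p x
    using W by (simp add: submodule.smult_closed)
  have ccin: "x \<in> W \<Longrightarrow> cc x \<in> carrier ?QM" for x by (simp add: c(1) cc_def)
  define rel where "rel x r \<longleftrightarrow> x \<in> W \<and> r \<in> carrier R \<and> h (cc x) = qq r" for x r
  have r1: "rel x r \<Longrightarrow> x \<in> W \<and> r \<in> carrier R" for x r by (simp add: rel_def)
  have r2: "\<exists>r. rel x r" if x: "x \<in> W" for x
  proof -
    have "h (cc x) \<in> carrier ?QN" using bij_betwE[OF h(1)] ccin[OF x] by blast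
    then have "h (cc x) \<in> (\<lambda>r. I +>\<^bsub>?N\<^esub> r) ` carrier R" by (simp only: q(1))
    then obtain r where "h (cc x) = I +>\<^bsub>?N\<^esub> r" "r \<in> carrier R" by (elim imageE)
    then show ?thesis by (intro exI[of _ r]) (simp only: rel_def x qq_def simp_thms)
  qed
  have r3: "\<exists>x. rel x r" if r: "r \<in> carrier R" for r
  proof -
    have "qq r \<in> carrier ?QN" unfolding q(1) qq_def by (rule imageI[OF r])
    then have "qq r \<in> h ` carrier ?QM" by (simp only: bij_betw_imp_surj_on[OF h(1)])
    then obtain C where C: "qq r = h C" "C \<in> carrier ?QM" by (elim imageE)
    obtain x where "C = H +>\<^bsub>M\<^esub> x" "x \<in> W" using C(2) unfolding c(1) by (elim imageE)
    then show ?thesis using C(1) r by (intro exI[of _ x]) (simp only: rel_def cc_def simp_thms)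
  qed
  have r4: "rel (x \<oplus>\<^bsub>M\<^esub> y) (r \<oplus>\<^bsub>R\<^esub> s)" if "rel x r" "rel y s" for x y r s
    using that h(2)[OF ccin ccin, of x y] c(2)[of x y] q(2)[of r s]
    by (simp add: rel_def Wa cc_def qq_def Na)
  have r5: "rel (p \<odot>\<^bsub>M\<^esub> x) (p \<otimes>\<^bsub>R\<^esub> r)" if "rel x r" "p \<in> carrier R" for x r p
    using that h(3)[OF _ ccin, of p x] c(3)[of p x] q(3)[of p r]
    by (simp add: rel_def Ws cc_def qq_def Ns)
  \<comment> \<open>The zero coset goes to a coset that is its own double;
    \<open>s \<oplus> s\<close> congruent to \<open>s\<close> modulo \<open>I\<close> forces
    \<open>s\<close> into \<open>I\<close>.\<close>
  have z: "h H = I"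
  proof -
    have cz: "cc \<zero>\<^bsub>M\<^esub> = H" using c(4)[OF W0(1)] W0(2) by (simp add: cc_def)
    obtain s where s: "rel \<zero>\<^bsub>M\<^esub> s" using r2[OF W0(1)] by blast
    then have sR: "s \<in> carrier R" and hs: "h H = qq s" by (auto simp: rel_def cz)
    have "rel \<zero>\<^bsub>M\<^esub> (s \<oplus>\<^bsub>R\<^esub> s)" using r4[OF s s] by simp
    then have "qq (s \<oplus>\<^bsub>R\<^esub> s) = qq s" using hs by (simp add: rel_def cz)
    moreover have "s \<oplus>\<^bsub>R\<^esub> s \<in> qq (s \<oplus>\<^bsub>R\<^esub> s)"
      using I.a_rcos_self[of "s \<oplus>\<^bsub>R\<^esub> s"] sR by (simp add: qq_def a_r_coset_def r_coset_def regular_module_def)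
    ultimately have "s \<oplus>\<^bsub>R\<^esub> s \<in> I +>\<^bsub>R\<^esub> s" by (simp add: qq_def a_r_coset_def r_coset_def regular_module_def)
    then obtain i where "i \<in> I" "s \<oplus>\<^bsub>R\<^esub> s = i \<oplus>\<^bsub>R\<^esub> s" unfolding a_r_coset_def r_coset_def by auto
    then have "s \<in> I" using sR IR by (metis R.add.r_cancel subsetD)
    then show ?thesis using q(4)[of s] sR hs by (simp add: qq_def)
  qed
  have r6: "x \<in> H \<longleftrightarrow> r \<in> I" if r: "rel x r" for x r
  proof -
    have x: "x \<in> W" "r \<in> carrier R" "h (cc x) = qq r" using r by (auto simp: rel_def)
    have "cc x = H \<longleftrightarrow> h (cc x) = h H"
    proof -
      have "H \<in> carrier ?QM" using ccin[OF W0(1)] c(4)[OF W0(1)] W0(2) by (simp add: cc_def)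
      from inj_on_eq_iff[OF bij_betw_imp_inj_on[OF h(1)] ccin[OF x(1)] this] show ?thesis by (simp only:)
    qed
    then show ?thesis using c(4)[OF x(1)] q(4)[of r] x by (simp add: cc_def qq_def z)
  qed
  show ?thesis
    by (rule that[of rel]) (fact r1 r2 r3 r4 r5 r6)+
qed

text \<open>An ideal between \<open>I\<close> and the ring pulls back along \<open>rel\<close> to a
  submodule between \<open>H\<close> and \<open>W\<close>, where simplicity leaves only the two
  ends.\<close>

lemma simple_quotient_maximal:
  fixes M (structure) and R (structure)
  assumes M: "abelian_group M" and H: "submodule H R M" and W: "submodule W R M" and HW: "H \<subset> W"
    and add: "\<forall>p\<in>carrier R. \<forall>x\<in>carrier M. \<forall>y\<in>carrier M. p \<odot>\<^bsub>M\<^esub> (x \<oplus>\<^bsub>M\<^esub> y) = p \<odot>\<^bsub>M\<^esub> x \<oplus>\<^bsub>M\<^esub> p \<odot>\<^bsub>M\<^esub> y"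
    and R: "cring R" and I: "ideal I R"
    and iso: "module_isomorphic R (quot_module (M\<lparr>carrier := W\<rparr>) H) (quot_module (regular_module R) I)"
    and simple: "\<And>N. submodule N R M \<Longrightarrow> H \<subseteq> N \<Longrightarrow> N \<subseteq> W \<Longrightarrow> N = H \<or> N = W"
  shows "maximalideal I R"
proof -
  interpret M: abelian_group M by (rule M)
  interpret R: cring R by (rule R)
  interpret I: ideal I R by (rule I)
  have HW': "H \<subseteq> W" using HW by blast
  have Ws: "subgroup W (add_monoid M)" and Hs: "subgroup H (add_monoid M)" using W H by (simp_all add: submodule_def)
  have WM: "W \<subseteq> carrier M" using subgroup.subset[OF Ws] by simp
  obtain rel where r1: "\<And>x r. rel x r \<Longrightarrow> x \<in> W \<and> r \<in> carrier R"
    and r2: "\<And>x. x \<in> W \<Longrightarrow> \<exists>r. rel x r"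
    and r3: "\<And>r. r \<in> carrier R \<Longrightarrow> \<exists>x. rel x r"
    and r4: "\<And>x y r s. rel x r \<Longrightarrow> rel y s \<Longrightarrow> rel (x \<oplus>\<^bsub>M\<^esub> y) (r \<oplus>\<^bsub>R\<^esub> s)"
    and r5: "\<And>x r p. rel x r \<Longrightarrow> p \<in> carrier R \<Longrightarrow> rel (p \<odot>\<^bsub>M\<^esub> x) (p \<otimes>\<^bsub>R\<^esub> r)"
    and r6: "\<And>x r. rel x r \<Longrightarrow> x \<in> H \<longleftrightarrow> r \<in> I"
    by (rule quotient_correspondence[OF M H W HW' add R I iso], rule that)
  have neg: "rel (\<ominus>\<^bsub>M\<^esub> x) s \<Longrightarrow> rel x r \<Longrightarrow> r \<oplus>\<^bsub>R\<^esub> s \<in> I" for x r s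
  proof -
    assume a: "rel (\<ominus>\<^bsub>M\<^esub> x) s" "rel x r"
    have "x \<in> carrier M" using r1[OF a(2)] WM by auto
    then have "x \<oplus>\<^bsub>M\<^esub> \<ominus>\<^bsub>M\<^esub> x \<in> H" using subgroup.one_closed[OF Hs] by (simp add: M.r_neg)
    then show ?thesis using r6[OF r4[OF a(2,1)]] by simp
  qed
  have Wn: "x \<in> W \<Longrightarrow> \<ominus>\<^bsub>M\<^esub> x \<in> W" for x using subgroup.m_inv_closed[OF Ws] by (simp add: a_inv_def)
  have cancel: "r \<in> J" if J: "ideal J R" and s: "r \<oplus>\<^bsub>R\<^esub> s \<in> J" "s \<in> J" "r \<in> carrier R" for J r s
  proof -
    interpret J: ideal J R by (rule J)
    have sR: "s \<in> carrier R" using s(2) J.a_subset by auto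
    have "r = (r \<oplus>\<^bsub>R\<^esub> s) \<oplus>\<^bsub>R\<^esub> (\<ominus>\<^bsub>R\<^esub> s)" using s(3) sR by (simp add: R.a_assoc R.r_neg)
    moreover have "(r \<oplus>\<^bsub>R\<^esub> s) \<oplus>\<^bsub>R\<^esub> (\<ominus>\<^bsub>R\<^esub> s) \<in> J" by (rule J.a_closed[OF s(1) J.a_inv_closed[OF s(2)]])
    ultimately show ?thesis by (rule ssubst[where P = "\<lambda>u. u \<in> J"])
  qed
  show ?thesis
  proof (rule maximalidealI[OF I])
    obtain x where x: "x \<in> W" "x \<notin> H" using HW by blast
    obtain r where r: "rel x r" using r2[OF x(1)] by blast
    show "carrier R \<noteq> I" using r1[OF r] r6[OF r] x(2) by blast
  next
    fix J assume J: "ideal J R" "I \<subseteq> J" "J \<subseteq> carrier R"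
    interpret J: ideal J R by (rule J(1))
    define N where "N = {x. \<exists>r\<in>J. rel x r}"
    have NW: "N \<subseteq> W" using r1 by (auto simp: N_def)
    have "subgroup N (add_monoid M)"
    proof (rule group.subgroupI)
      show "group (add_monoid M)" by (rule M.a_group)
      show "N \<subseteq> carrier (add_monoid M)" using NW WM by simp
      obtain x where "rel x \<zero>\<^bsub>R\<^esub>" using r3[of "\<zero>\<^bsub>R\<^esub>"] by blast
      then show "N \<noteq> {}" using J.zero_closed unfolding N_def by blast
    next
      fix x y assume "x \<in> N" "y \<in> N"
      then show "x \<otimes>\<^bsub>add_monoid M\<^esub> y \<in> N" unfolding N_def using r4 J.a_closed by fastforce
    next
      fix x assume "x \<in> N"
      then obtain r where r: "r \<in> J" "rel x r" unfolding N_def by blast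
      have "x \<in> W" using r1[OF r(2)] by simp
      then obtain s where s: "rel (\<ominus>\<^bsub>M\<^esub> x) s" using r2 Wn by blast
      have "r \<oplus>\<^bsub>R\<^esub> s \<in> J" using neg[OF s r(2)] J(2) by blast
      moreover have "r \<oplus>\<^bsub>R\<^esub> s = s \<oplus>\<^bsub>R\<^esub> r" using r1[OF s] r1[OF r(2)] by (simp add: R.a_comm)
      ultimately have "s \<in> J" using cancel[OF J(1), of s r] r(1) r1[OF s] by simp
      then show "inv\<^bsub>add_monoid M\<^esub> x \<in> N" using s unfolding N_def a_inv_def by blast
    qed
    then have "submodule N R M"
      unfolding submodule_def submodule_axioms_def
    proof (intro conjI allI impI)
      fix p x assume p: "p \<in> carrier R" and "x \<in> N"
      then obtain r where "r \<in> J" "rel x r" unfolding N_def by blast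
      then have "p \<otimes>\<^bsub>R\<^esub> r \<in> J" "rel (p \<odot>\<^bsub>M\<^esub> x) (p \<otimes>\<^bsub>R\<^esub> r)" using J.I_l_closed[OF _ p] r5[OF _ p] by simp_all
      then show "p \<odot>\<^bsub>M\<^esub> x \<in> N" unfolding N_def by blast
    qed
    moreover have "H \<subseteq> N"
    proof
      fix x assume x: "x \<in> H"
      then obtain r where r: "rel x r" using r2 HW' by blast
      then show "x \<in> N" using x r6[OF r] J(2) unfolding N_def by blast
    qed
    ultimately consider "N = H" | "N = W" using simple NW by blast
    then show "J = I \<or> J = carrier R"
    proof cases
      case 1
      have "r \<in> I" if r: "r \<in> J" for r
      proof -
        obtain x where x: "rel x r" using r3[OF subsetD[OF J(3) r]] by (elim exE)
        have "x \<in> N" unfolding N_def by (rule CollectI, rule bexI, rule x, rule r)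
        then have "x \<in> H" by (simp only: 1)
        then show ?thesis by (simp only: r6[OF x])
      qed
      then show ?thesis using J(2) by blast
    next
      case 2
      have "r \<in> J" if r: "r \<in> carrier R" for r
      proof -
        obtain x where x: "rel x r" using r3[OF r] by (elim exE)
        have xW: "x \<in> W" using r1[OF x] by simp
        then have "x \<in> N" by (simp only: 2)
        then obtain s where s: "s \<in> J" "rel x s" unfolding N_def by (elim CollectE bexE)
        obtain u where u: "rel (\<ominus>\<^bsub>M\<^esub> x) u" using r2[OF Wn[OF xW]] by (elim exE)
        have "u \<oplus>\<^bsub>R\<^esub> s \<in> J"
          using subsetD[OF J(2) neg[OF u s(2)]] r1[OF u] r1[OF s(2)] by (simp add: R.a_comm)
        then have "u \<in> J" using cancel[OF J(1), of u s] s(1) r1[OF u] by blast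
        moreover have "r \<oplus>\<^bsub>R\<^esub> u \<in> J" by (rule subsetD[OF J(2) neg[OF u x]])
        ultimately show ?thesis using cancel[OF J(1), of r u] r by blast
      qed
      then show ?thesis using J(3) by blast
    qed
  qed
qed

lemma automorphism_inverse:
  assumes "topological_automorphism \<theta>"
  shows "topological_automorphism (inv_into UNIV \<theta>)"
proof -
  have h: "homeomorphism UNIV UNIV \<theta> (inv_into UNIV \<theta>)" and a: "\<theta> (x + y) = \<theta> x + \<theta> y" for x y
    using assms by (auto simp: topological_automorphism_def)
  have l: "inv_into UNIV \<theta> (\<theta> x) = x" and r: "\<theta> (inv_into UNIV \<theta> x) = x" for x
    using h by (auto simp: homeomorphism_def)
  have "bij \<theta>" by (rule o_bij[of "inv_into UNIV \<theta>"]) (auto simp: fun_eq_iff l r)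
  then have ii: "inv_into UNIV (inv_into UNIV \<theta>) = \<theta>" by (rule inv_inv_eq)
  have "inv_into UNIV \<theta> (x + y) = inv_into UNIV \<theta> x + inv_into UNIV \<theta> y" for x y
    using l[of "inv_into UNIV \<theta> x + inv_into UNIV \<theta> y"] by (simp add: a r)
  then show ?thesis
    unfolding topological_automorphism_def ii using homeomorphism_symD[OF h] by blast
qed

lemma dual_comp_int_iterate:
  assumes aut: "topological_automorphism \<theta>" and \<phi>: "\<phi> \<in> carrier dual_group"
  shows "\<phi> \<circ> int_iterate \<theta> m \<in> carrier dual_group"
proof -
  have c: "continuous_on UNIV (int_iterate \<theta> m)"
    using automorphism_iterate(1)[OF aut] automorphism_iterate(1)[OF automorphism_inverse[OF aut]]
    by (simp add: int_iterate_def)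
  have a: "int_iterate \<theta> m (x + y) = int_iterate \<theta> m x + int_iterate \<theta> m y" for x y
    using automorphism_iterate(2)[OF aut] automorphism_iterate(2)[OF automorphism_inverse[OF aut]]
    by (simp add: int_iterate_def)
  have "continuous_on UNIV (\<phi> \<circ> int_iterate \<theta> m)"
    using continuous_on_compose[OF c] continuous_on_subset[OF dual_groupD(1)[OF \<phi>] subset_UNIV] by blast
  then show ?thesis using dual_groupD[OF \<phi>] by (simp add: dual_group_def a)
qed

section \<open>The tensor product with the rationals and the Laurent action\<close>

type_synonym 'x pairs = "(rat \<times> ('x \<Rightarrow> complex)) \<Rightarrow>\<^sub>0 int"

abbreviation pair_group :: "'x::topological_ab_group_add pairs monoid" where
  "pair_group \<equiv> free_Abelian_group (carrier rat_group \<times> carrier dual_group)"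

abbreviation kern :: "'x::topological_ab_group_add pairs set" where
  "kern \<equiv> tensor_kernel rat_group dual_group"

lemma pair_group_diff: "u \<in> carrier pair_group \<Longrightarrow> v \<in> carrier pair_group \<Longrightarrow> u - v \<in> carrier pair_group"
  using keys_diff[of u v] by auto

lemma frag_of_pair: "\<phi> \<in> carrier dual_group \<Longrightarrow> frag_of (r, \<phi>) \<in> carrier pair_group"
  by (simp add: rat_group_def)

lemma dual_mult_closed:
  "\<phi> \<in> carrier dual_group \<Longrightarrow> \<psi> \<in> carrier dual_group \<Longrightarrow> \<phi> \<otimes>\<^bsub>dual_group\<^esub> \<psi> \<in> carrier dual_group"
  by (rule Group.monoid.m_closed[OF group.is_monoid[OF comm_group.axioms(2)[OF dual_group_comm_group]]])

lemma relators_pair_group: "tensor_relators rat_group dual_group \<subseteq> carrier pair_group"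
proof
  fix h :: "'a pairs" assume "h \<in> tensor_relators rat_group dual_group"
  then show "h \<in> carrier pair_group"
    unfolding tensor_relators_def
    by (elim UnE CollectE exE conjE) (simp_all only:, (intro pair_group_diff frag_of_pair dual_mult_closed; assumption)+)
qed

lemma kern_subgroup: "subgroup kern pair_group"
  unfolding tensor_kernel_def by (rule group.generate_is_subgroup[OF group_free_Abelian_group relators_pair_group])

lemma kern_0: "0 \<in> kern"
  using subgroup.one_closed[OF kern_subgroup] by simp

lemma kern_add: "u \<in> kern \<Longrightarrow> v \<in> kern \<Longrightarrow> u + v \<in> kern"
  using subgroup.m_closed[OF kern_subgroup] by simp

lemma kern_uminus:
  assumes "u \<in> kern"
  shows "- u \<in> kern"
proof -
  have "u \<in> carrier pair_group" using subgroup.subset[OF kern_subgroup] assms by (rule subsetD)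
  then have "inv\<^bsub>pair_group\<^esub> u = - u" by (simp only: carrier_free_Abelian_group_iff inv_free_Abelian_group)
  then show ?thesis using subgroup.m_inv_closed[OF kern_subgroup assms] by (simp only:)
qed

lemma kern_diff: "u \<in> kern \<Longrightarrow> v \<in> kern \<Longrightarrow> u - v \<in> kern"
  using kern_add[OF _ kern_uminus, of u v] by simp

lemma kern_sum: "(\<And>i. i \<in> I \<Longrightarrow> u i \<in> kern) \<Longrightarrow> sum u I \<in> kern"
  by (induction I rule: infinite_finite_induct) (auto intro: kern_0 kern_add)

lemma kern_bi1:
  assumes "b \<in> carrier dual_group"
  shows "frag_of (a + a', b) - frag_of (a, b) - frag_of (a', b) \<in> kern"
  unfolding tensor_kernel_def tensor_relators_def
  by (rule generate.incl, rule UnI1, rule CollectI, rule exI[of _ a], rule exI[of _ a'], rule exI[of _ b])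
    (simp add: rat_group_def assms)

lemma kern_bi2:
  assumes "b \<in> carrier dual_group" "b' \<in> carrier dual_group"
  shows "frag_of (a, b \<otimes>\<^bsub>dual_group\<^esub> b') - frag_of (a, b) - frag_of (a, b') \<in> kern"
  unfolding tensor_kernel_def tensor_relators_def
  by (rule generate.incl, rule UnI2, rule CollectI, rule exI[of _ a], rule exI[of _ b], rule exI[of _ b'])
    (simp add: rat_group_def assms)

text \<open>A family additive modulo \<open>kern\<close> is determined by its value at 1. Used in
  each of the two slots, it lets integers pass across the tensor sign in
  \<open>kern_scale_pow\<close>.\<close>

lemma kern_int:
  fixes g :: "int \<Rightarrow> 'x::topological_ab_group_add pairs"
  assumes g: "\<And>a b. g (a + b) - g a - g b \<in> kern"
  shows "g c - frag_cmul c (g 1) \<in> kern"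
proof (induction c rule: int_induct[where k = 0])
  case base
  show ?case using kern_uminus[OF g[of 0 0]] by simp
next
  case (step1 i)
  have "g (i + 1) - frag_cmul (i + 1) (g 1) = (g (i + 1) - g i - g 1) + (g i - frag_cmul i (g 1))"
    by (simp add: frag_cmul_distrib)
  also have "\<dots> \<in> kern" by (rule kern_add[OF g[of i 1] step1(2)])
  finally show ?case .
next
  case (step2 i)
  have "g (i - 1) - frag_cmul (i - 1) (g 1) = (g i - frag_cmul i (g 1)) - (g ((i - 1) + 1) - g (i - 1) - g 1)"
    by (simp add: frag_cmul_diff_distrib)
  also have "\<dots> \<in> kern" by (rule kern_diff[OF step2(2) g[of "i - 1" 1]])
  finally show ?case .
qed

lemma kern_scale_pow:
  fixes \<phi> :: "'x::topological_ab_group_add \<Rightarrow> complex" and c :: int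
  assumes \<phi>: "\<phi> \<in> carrier dual_group"
  shows "frag_of (of_int c * r, \<phi>) - frag_of (r, \<phi> [^]\<^bsub>dual_group\<^esub> c) \<in> kern"
proof -
  interpret D: comm_group "dual_group :: ('x \<Rightarrow> complex) monoid" by (rule dual_group_comm_group)
  have "frag_of (of_int c * r, \<phi>) - frag_cmul c (frag_of (of_int 1 * r, \<phi>)) \<in> kern"
    by (rule kern_int[where g = "\<lambda>c. frag_of (of_int c * r, \<phi>)"]) (simp add: distrib_right kern_bi1[OF \<phi>])
  moreover have "frag_of (r, \<phi> [^]\<^bsub>dual_group\<^esub> c) - frag_cmul c (frag_of (r, \<phi> [^]\<^bsub>dual_group\<^esub> (1::int))) \<in> kern"
    by (rule kern_int[where g = "\<lambda>c. frag_of (r, \<phi> [^]\<^bsub>dual_group\<^esub> c)"])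
      (simp add: D.int_pow_mult[OF \<phi>] kern_bi2 D.int_pow_closed[OF \<phi>])
  ultimately show ?thesis
    using kern_diff[of "frag_of (of_int c * r, \<phi>) - frag_cmul c (frag_of (r, \<phi>))"
        "frag_of (r, \<phi> [^]\<^bsub>dual_group\<^esub> c) - frag_cmul c (frag_of (r, \<phi>))"]
    by (simp add: D.int_pow_1[OF \<phi>])
qed

lemma kern_zero_left: "\<phi> \<in> carrier dual_group \<Longrightarrow> frag_of (0, \<phi>) \<in> kern"
  using kern_uminus[OF kern_bi1[of \<phi> 0 0]] by simp

lemma kern_one_right: "frag_of (r, \<lambda>_. 1) \<in> (kern :: 'x::topological_ab_group_add pairs set)"
proof -
  have "(\<lambda>_. 1) \<in> carrier (dual_group :: ('x \<Rightarrow> complex) monoid)" by (simp add: dual_group_def)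
  from kern_uminus[OF kern_bi2[OF this this, of r]] show ?thesis by (simp add: dual_mult)
qed

text \<open>A common denominator turns every element of the tensor product into a pure tensor.\<close>

lemma pure_tensor:
  fixes u :: "'x::topological_ab_group_add pairs"
  assumes u: "u \<in> carrier pair_group"
  obtains r \<phi> where "\<phi> \<in> carrier dual_group" "u - frag_of (r, \<phi>) \<in> kern"
proof -
  interpret D: comm_group "dual_group :: ('x \<Rightarrow> complex) monoid" by (rule dual_group_comm_group)
  let ?P = "\<lambda>u. \<exists>(d::int) \<phi>. d > 0 \<and> \<phi> \<in> carrier dual_group \<and> u - frag_of (1 / of_int d, \<phi>) \<in> kern"
  have "Poly_Mapping.keys u \<subseteq> carrier rat_group \<times> carrier dual_group" using u by simp
  then have "?P u"
  proof (induction u rule: frag_induction)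
    case zero
    have "0 - frag_of (1 / of_int 1, \<lambda>_. 1) \<in> (kern :: 'x pairs set)"
      by (rule kern_diff[OF kern_0 kern_one_right])
    moreover have "(\<lambda>_. 1) \<in> carrier (dual_group :: ('x \<Rightarrow> complex) monoid)" by (simp add: dual_group_def)
    ultimately show ?case by (intro exI[of _ 1] exI[of _ "\<lambda>_. 1"]) simp
  next
    case (one x)
    obtain r \<phi> where x: "x = (r, \<phi>)" "\<phi> \<in> carrier dual_group" using one by auto
    obtain a d where q: "quotient_of r = (a, d)" by (cases "quotient_of r") 
    have d: "d > 0" "r = of_int a * (1 / of_int d)" using quotient_of_denom_pos[OF q] quotient_of_div[OF q] by auto
    have "frag_of x - frag_of (1 / of_int d, \<phi> [^]\<^bsub>dual_group\<^esub> a) \<in> kern"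
      unfolding x(1) d(2) by (rule kern_scale_pow[OF x(2)])
    then show ?case using d(1) D.int_pow_closed[OF x(2)] by blast
  next
    case (diff u v)
    obtain d \<phi> where d: "d > 0" "\<phi> \<in> carrier dual_group" "u - frag_of (1 / of_int d, \<phi>) \<in> kern"
      using diff(1) by blast
    obtain e \<psi> where e: "e > 0" "\<psi> \<in> carrier dual_group" "v - frag_of (1 / of_int e, \<psi>) \<in> kern"
      using diff(2) by blast
    \<comment> \<open>The common denominator lets both pure tensors be rewritten with the same first
      entry, so that their difference is again pure.\<close>
    define r :: rat where "r = 1 / of_int (d * e)"
    define \<phi>' where "\<phi>' = \<phi> [^]\<^bsub>dual_group\<^esub> e"
    define \<psi>' where "\<psi>' = \<psi> [^]\<^bsub>dual_group\<^esub> d"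
    define \<eta> where "\<eta> = \<phi>' \<otimes>\<^bsub>dual_group\<^esub> (inv\<^bsub>dual_group\<^esub> \<psi>')"
    have cl: "\<phi>' \<in> carrier dual_group" "\<psi>' \<in> carrier dual_group" "\<eta> \<in> carrier dual_group"
      unfolding \<phi>'_def \<psi>'_def \<eta>_def using d(2) e(2) by simp_all
    have r: "of_int e * r = 1 / of_int d" "of_int d * r = 1 / of_int e" using d(1) e(1) by (simp_all add: r_def)
    have k1: "frag_of (1 / of_int d, \<phi>) - frag_of (r, \<phi>') \<in> kern"
      using kern_scale_pow[OF d(2), of e r] unfolding r \<phi>'_def .
    have k2: "frag_of (1 / of_int e, \<psi>) - frag_of (r, \<psi>') \<in> kern"
      using kern_scale_pow[OF e(2), of d r] unfolding r \<psi>'_def .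
    have "\<eta> \<otimes>\<^bsub>dual_group\<^esub> \<psi>' = \<phi>'" using cl by (simp add: \<eta>_def D.m_assoc)
    then have k3: "frag_of (r, \<phi>') - frag_of (r, \<eta>) - frag_of (r, \<psi>') \<in> kern"
      using kern_bi2[OF cl(3,2), of r] by simp
    have "u - v - frag_of (r, \<eta>) = ((u - frag_of (1 / of_int d, \<phi>)) - (v - frag_of (1 / of_int e, \<psi>))) +
      (((frag_of (1 / of_int d, \<phi>) - frag_of (r, \<phi>')) - (frag_of (1 / of_int e, \<psi>) - frag_of (r, \<psi>'))) +
       (frag_of (r, \<phi>') - frag_of (r, \<eta>) - frag_of (r, \<psi>')))" by simp
    also have "\<dots> \<in> kern" by (intro kern_add kern_diff d(3) e(3) k1 k2 k3)
    finally show ?case using cl(3) d(1) e(1) unfolding r_def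
      by (intro exI[of _ "d * e"] exI[of _ \<eta>]) simp
  qed
  then show ?thesis using that by blast
qed

text \<open>The Laurent polynomial \<open>Q(t ^ n)\<close>.\<close>

definition laurent_poly :: "nat \<Rightarrow> int poly \<Rightarrow> laurent" where
  "laurent_poly n Q = (\<Sum>i\<le>degree Q. Poly_Mapping.single (int (n * i)) (of_int (coeff Q i)))"

definition rcos :: "'x::topological_ab_group_add pairs \<Rightarrow> 'x pairs set" where
  "rcos u = kern #>\<^bsub>pair_group\<^esub> u"

lemma in_rcos: "w \<in> rcos u \<longleftrightarrow> w - u \<in> kern"
proof -
  have "w \<in> rcos u \<longleftrightarrow> (\<exists>h\<in>kern. w = h + u)" unfolding rcos_def r_coset_def by auto
  also have "\<dots> \<longleftrightarrow> w - u \<in> kern"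
  proof
    assume "\<exists>h\<in>kern. w = h + u" then show "w - u \<in> kern" by (elim bexE) simp
  next
    assume "w - u \<in> kern" then show "\<exists>h\<in>kern. w = h + u" by (intro bexI[of _ "w - u"]) simp
  qed
  finally show ?thesis .
qed

lemma rcos_cong: "u - v \<in> kern \<Longrightarrow> rcos u = rcos v"
proof (rule Set.set_eqI)
  fix w assume k: "u - v \<in> kern"
  show "w \<in> rcos u \<longleftrightarrow> w \<in> rcos v"
    using kern_add[OF _ k, of "w - u"] kern_diff[OF _ k, of "w - v"] by (auto simp: in_rcos)
qed

context
  fixes \<theta> :: "'x::topological_ab_group_add \<Rightarrow> 'x"
  assumes aut: "topological_automorphism \<theta>"
begin

lemma action_frag_of:
  "laurent_action \<theta> p (frag_of (r, \<phi>)) = (\<Sum>m\<in>Poly_Mapping.keys p. frag_of (Poly_Mapping.lookup p m * r, \<phi> \<circ> int_iterate \<theta> m))"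
  by (simp add: laurent_action_def)

lemma action_diff: "laurent_action \<theta> p (u - v) = laurent_action \<theta> p u - laurent_action \<theta> p v"
  by (simp add: laurent_action_def frag_extend_diff)

lemma action_add: "laurent_action \<theta> p (u + v) = laurent_action \<theta> p u + laurent_action \<theta> p v"
  by (simp add: laurent_action_def frag_extend_add)

text \<open>Each monomial of \<open>p\<close> maps a biadditivity relation to another one. This
  makes all cosets in the union defining the scalar multiplication coincide.\<close>

lemma action_kern:
  assumes "u \<in> kern"
  shows "laurent_action \<theta> p u \<in> kern"
proof -
  have rel: "laurent_action \<theta> p h \<in> kern" if h: "h \<in> tensor_relators rat_group dual_group" for h
    using h unfolding tensor_relators_def
  proof (elim UnE CollectE exE conjE)
    fix a a' :: rat and b :: "'x \<Rightarrow> complex"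
    assume e: "h = frag_of (a \<otimes>\<^bsub>rat_group\<^esub> a', b) - frag_of (a, b) - frag_of (a', b)" and b: "b \<in> carrier dual_group"
    have "laurent_action \<theta> p h = (\<Sum>m\<in>Poly_Mapping.keys p.
        frag_of (Poly_Mapping.lookup p m * a + Poly_Mapping.lookup p m * a', b \<circ> int_iterate \<theta> m)
        - frag_of (Poly_Mapping.lookup p m * a, b \<circ> int_iterate \<theta> m) - frag_of (Poly_Mapping.lookup p m * a', b \<circ> int_iterate \<theta> m))"
      unfolding e action_diff action_frag_of by (simp add: rat_group_def distrib_left sum_subtractf)
    also have "\<dots> \<in> kern" by (rule kern_sum, rule kern_bi1, rule dual_comp_int_iterate[OF aut b])
    finally show ?thesis .
  next
    fix a :: rat and b b' :: "'x \<Rightarrow> complex"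
    assume e: "h = frag_of (a, b \<otimes>\<^bsub>dual_group\<^esub> b') - frag_of (a, b) - frag_of (a, b')"
      and b: "b \<in> carrier dual_group" "b' \<in> carrier dual_group"
    have "laurent_action \<theta> p h = (\<Sum>m\<in>Poly_Mapping.keys p.
        frag_of (Poly_Mapping.lookup p m * a, (b \<circ> int_iterate \<theta> m) \<otimes>\<^bsub>dual_group\<^esub> (b' \<circ> int_iterate \<theta> m))
        - frag_of (Poly_Mapping.lookup p m * a, b \<circ> int_iterate \<theta> m) - frag_of (Poly_Mapping.lookup p m * a, b' \<circ> int_iterate \<theta> m))"
      unfolding e action_diff action_frag_of by (simp add: dual_mult comp_def sum_subtractf)
    also have "\<dots> \<in> kern"
      by (rule kern_sum, rule kern_bi2) (rule dual_comp_int_iterate[OF aut b(1)], rule dual_comp_int_iterate[OF aut b(2)])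
    finally show ?thesis .
  qed
  have "u \<in> generate pair_group (tensor_relators rat_group dual_group)"
    using assms by (simp only: tensor_kernel_def)
  then show ?thesis
  proof (induction rule: generate.induct)
    case one then show ?case by (simp add: laurent_action_def kern_0)
  next
    case (incl h) then show ?case by (rule rel)
  next
    case (inv h)
    have "h \<in> carrier pair_group" using inv relators_pair_group by blast
    then have "inv\<^bsub>pair_group\<^esub> h = - h" by (simp only: carrier_free_Abelian_group_iff inv_free_Abelian_group)
    then show ?case using kern_uminus[OF rel[OF inv]] by (simp add: laurent_action_def frag_extend_minus)
  next
    case (eng h1 h2)
    show ?case unfolding mult_free_Abelian_group action_add by (rule kern_add[OF eng(3,4)])
  qed
qed

text \<open>A generator with first entry 0 is not 0 in the free group but lies in
  \<open>kern\<close>; so extra exponents with coefficient 0 may be added modulo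
  \<open>kern\<close>.\<close>

lemma action_superset:
  assumes "finite A" "Poly_Mapping.keys p \<subseteq> A" and \<phi>: "\<phi> \<in> carrier dual_group"
  shows "(\<Sum>m\<in>A. frag_of (Poly_Mapping.lookup p m * r, \<phi> \<circ> int_iterate \<theta> m)) - laurent_action \<theta> p (frag_of (r, \<phi>)) \<in> kern"
proof -
  have "(\<Sum>m\<in>A - Poly_Mapping.keys p. frag_of (Poly_Mapping.lookup p m * r, \<phi> \<circ> int_iterate \<theta> m)) \<in> kern"
  proof (rule kern_sum)
    fix m assume "m \<in> A - Poly_Mapping.keys p"
    then have "Poly_Mapping.lookup p m * r = 0" by (simp add: in_keys_iff)
    then show "frag_of (Poly_Mapping.lookup p m * r, \<phi> \<circ> int_iterate \<theta> m) \<in> kern"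
      using kern_zero_left[OF dual_comp_int_iterate[OF aut \<phi>]] by (simp only:)
  qed
  then show ?thesis by (simp add: action_frag_of sum.subset_diff[OF assms(2,1)])
qed

text \<open>Moving the integer coefficients across the tensor sign and then multiplying the
  characters turns the action into the tensor of \<open>r\<close> with
  \<open>character_poly\<close>, here the trivial character.\<close>

lemma action_annihilates:
  assumes \<phi>: "\<phi> \<in> carrier dual_group" and n: "n \<ge> 1" and Q: "character_poly \<phi> (\<theta> ^^ n) Q = (\<lambda>_. 1)"
  shows "laurent_action \<theta> (laurent_poly n Q) (frag_of (r, \<phi>)) \<in> kern"
proof -
  interpret D: comm_group "dual_group :: ('x \<Rightarrow> complex) monoid" by (rule dual_group_comm_group)
  define \<phi>i where "\<phi>i i = \<phi> \<circ> int_iterate \<theta> (int (n * i))" for i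
  have \<phi>i: "\<phi>i i \<in> carrier dual_group" for i unfolding \<phi>i_def by (rule dual_comp_int_iterate[OF aut \<phi>])
  have cl: "\<phi>i i [^]\<^bsub>dual_group\<^esub> c \<in> carrier dual_group" for i and c :: int by (rule D.int_pow_closed[OF \<phi>i])
  let ?A = "(\<lambda>i. int (n * i)) ` {..degree Q}" and ?p = "laurent_poly n Q"
  have lk: "Poly_Mapping.lookup ?p (int (n * i)) = of_int (coeff Q i)" if "i \<le> degree Q" for i
  proof -
    have "Poly_Mapping.lookup ?p (int (n * i)) = (\<Sum>l\<le>degree Q. if l = i then of_int (coeff Q l) else 0)"
      unfolding laurent_poly_def lookup_sum using n by (intro sum.cong) (auto simp: lookup_single when_def)
    then show ?thesis using that by simp
  qed
  have "Poly_Mapping.keys ?p \<subseteq> (\<Union>i\<le>degree Q. Poly_Mapping.keys (Poly_Mapping.single (int (n * i)) (of_int (coeff Q i) :: rat)))"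
    unfolding laurent_poly_def by (rule keys_sum)
  also have "\<dots> \<subseteq> ?A" by (auto split: if_splits)
  finally have kA: "Poly_Mapping.keys ?p \<subseteq> ?A" .
  have "(\<Sum>m\<in>?A. frag_of (Poly_Mapping.lookup ?p m * r, \<phi> \<circ> int_iterate \<theta> m)) = (\<Sum>i\<le>degree Q. frag_of (of_int (coeff Q i) * r, \<phi>i i))"
    by (subst sum.reindex) (use n lk in \<open>auto simp: inj_on_def \<phi>i_def\<close>)
  then have k1: "(\<Sum>i\<le>degree Q. frag_of (of_int (coeff Q i) * r, \<phi>i i)) - laurent_action \<theta> ?p (frag_of (r, \<phi>)) \<in> kern"
    using action_superset[OF _ kA \<phi>, of r] by simp
  have "(\<Sum>i\<le>degree Q. frag_of (of_int (coeff Q i) * r, \<phi>i i) - frag_of (r, \<phi>i i [^]\<^bsub>dual_group\<^esub> coeff Q i)) \<in> kern"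
    by (intro kern_sum kern_scale_pow \<phi>i)
  then have k2: "(\<Sum>i\<le>degree Q. frag_of (of_int (coeff Q i) * r, \<phi>i i)) - (\<Sum>i\<le>degree Q. frag_of (r, \<phi>i i [^]\<^bsub>dual_group\<^esub> coeff Q i)) \<in> kern"
    by (simp only: sum_subtractf)
  have fp: "(\<Sum>i\<in>I. frag_of (r, g i)) - frag_of (r, finprod dual_group g I) \<in> kern"
    if "finite I" "\<And>i. g i \<in> carrier dual_group" for I :: "nat set" and g :: "nat \<Rightarrow> 'x \<Rightarrow> complex"
    using that(1)
  proof (induction I rule: finite_induct)
    case empty
    then show ?case using kern_uminus[OF kern_one_right[of r]] by (simp add: dual_one)
  next
    case (insert i I)
    have c: "finprod dual_group g I \<in> carrier dual_group" by (rule D.finprod_closed) (use that(2) in auto)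
    have "(\<Sum>i\<in>insert i I. frag_of (r, g i)) - frag_of (r, finprod dual_group g (insert i I)) =
      ((\<Sum>i\<in>I. frag_of (r, g i)) - frag_of (r, finprod dual_group g I)) -
      (frag_of (r, g i \<otimes>\<^bsub>dual_group\<^esub> finprod dual_group g I) - frag_of (r, g i) - frag_of (r, finprod dual_group g I))"
      using insert(1,2) that(2) by (simp add: Pi_def)
    also have "\<dots> \<in> kern" by (rule kern_diff[OF insert(3) kern_bi2[OF that(2) c]])
    finally show ?case .
  qed
  have "finprod dual_group (\<lambda>i. \<phi>i i [^]\<^bsub>dual_group\<^esub> coeff Q i) {..degree Q} = (\<lambda>x. \<Prod>i\<le>degree Q. \<phi>i i x powi coeff Q i)"
    by (subst dual_finprod) (simp_all add: cl, simp add: dual_int_pow[OF \<phi>i])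
  also have "\<dots> = character_poly \<phi> (\<theta> ^^ n) Q"
    by (simp add: fun_eq_iff character_poly_def \<phi>i_def int_iterate_def funpow_mult del: of_nat_mult)
  finally have fin: "finprod dual_group (\<lambda>i. \<phi>i i [^]\<^bsub>dual_group\<^esub> coeff Q i) {..degree Q} = (\<lambda>_. 1)" using Q by simp
  have k3: "(\<Sum>i\<le>degree Q. frag_of (r, \<phi>i i [^]\<^bsub>dual_group\<^esub> coeff Q i)) \<in> kern"
    using kern_add[OF fp[of "{..degree Q}" "\<lambda>i. \<phi>i i [^]\<^bsub>dual_group\<^esub> coeff Q i", OF _ cl] kern_one_right[of r]]
    unfolding fin by simp
  have eq: "b = (a - c) - (a - b) + c" for a b c :: "'x pairs" by simp
  show ?thesis
    by (subst eq[of _ "\<Sum>i\<le>degree Q. frag_of (of_int (coeff Q i) * r, \<phi>i i)"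
        "\<Sum>i\<le>degree Q. frag_of (r, \<phi>i i [^]\<^bsub>dual_group\<^esub> coeff Q i)"])
      (intro kern_add kern_diff k1 k2 k3)
qed

lemma rational_dual_module_simps:
  shows "carrier (rational_dual_module \<theta>) = rcos ` carrier pair_group"
    and "\<zero>\<^bsub>rational_dual_module \<theta>\<^esub> = rcos 0"
    and "rcos u \<oplus>\<^bsub>rational_dual_module \<theta>\<^esub> rcos v = rcos (u + v)"
    and "p \<odot>\<^bsub>rational_dual_module \<theta>\<^esub> rcos u = rcos (laurent_action \<theta> p u)"
proof -
  show "carrier (rational_dual_module \<theta>) = rcos ` carrier pair_group"
    unfolding rational_dual_module_def Let_def int_tensor_def FactGroup_def RCOSETS_def rcos_def by auto
  have "rcos 0 = (kern :: 'x pairs set)" by (rule Set.set_eqI) (simp add: in_rcos)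
  then show "\<zero>\<^bsub>rational_dual_module \<theta>\<^esub> = rcos 0"
    by (simp add: rational_dual_module_def Let_def int_tensor_def FactGroup_def)
  have "w \<in> rcos u <#>\<^bsub>pair_group\<^esub> rcos v \<longleftrightarrow> w \<in> rcos (u + v)" for w
  proof -
    have "w \<in> rcos u <#>\<^bsub>pair_group\<^esub> rcos v \<longleftrightarrow> (\<exists>h\<in>rcos u. \<exists>k\<in>rcos v. w = h + k)"
      unfolding set_mult_def by auto
    also have "\<dots> \<longleftrightarrow> w \<in> rcos (u + v)"
    proof
      assume "\<exists>h\<in>rcos u. \<exists>k\<in>rcos v. w = h + k"
      then obtain h k where hk: "h - u \<in> kern" "k - v \<in> kern" "w = h + k" by (auto simp: in_rcos)
      show "w \<in> rcos (u + v)" using kern_add[OF hk(1,2)] by (simp add: in_rcos hk(3) algebra_simps)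
    next
      assume "w \<in> rcos (u + v)"
      then have "w - v \<in> rcos u" by (simp add: in_rcos algebra_simps)
      moreover have "v \<in> rcos v" by (simp add: in_rcos kern_0)
      ultimately show "\<exists>h\<in>rcos u. \<exists>k\<in>rcos v. w = h + k" by (intro bexI[of _ "w - v"] bexI[of _ v]) simp
    qed
    finally show ?thesis .
  qed
  then have "rcos u <#>\<^bsub>pair_group\<^esub> rcos v = rcos (u + v)" by (rule Set.set_eqI)
  then show "rcos u \<oplus>\<^bsub>rational_dual_module \<theta>\<^esub> rcos v = rcos (u + v)"
    by (simp add: rational_dual_module_def Let_def int_tensor_def FactGroup_def)
  have "rcos (laurent_action \<theta> p w) = rcos (laurent_action \<theta> p u)" if "w \<in> rcos u" for w
    by (rule rcos_cong) (use that action_kern[of "w - u" p] in \<open>simp add: in_rcos action_diff\<close>)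
  moreover have "u \<in> rcos u" by (simp add: in_rcos kern_0)
  ultimately have "(\<Union>w\<in>rcos u. rcos (laurent_action \<theta> p w)) = rcos (laurent_action \<theta> p u)" by blast
  then show "p \<odot>\<^bsub>rational_dual_module \<theta>\<^esub> rcos u = rcos (laurent_action \<theta> p u)"
    by (simp add: rational_dual_module_def Let_def rcos_def)
qed

lemma rational_dual_module_abelian_group: "abelian_group (rational_dual_module \<theta>)"
proof (rule abelian_groupI)
  note s = rational_dual_module_simps
  have add: "u + v \<in> carrier pair_group" if "u \<in> carrier pair_group" "v \<in> carrier pair_group" for u v :: "'x pairs"
    using Group.monoid.m_closed[OF group.is_monoid[OF group_free_Abelian_group] that] by (simp only: mult_free_Abelian_group)
  have zero: "0 \<in> carrier (pair_group :: 'x pairs monoid)" by simp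
  fix x assume "x \<in> carrier (rational_dual_module \<theta>)"
  then obtain u where u: "x = rcos u" "u \<in> carrier pair_group" by (auto simp only: s)
  show "\<zero>\<^bsub>rational_dual_module \<theta>\<^esub> \<oplus>\<^bsub>rational_dual_module \<theta>\<^esub> x = x" by (simp add: s u)
  have "rcos (0 - u) \<in> carrier (rational_dual_module \<theta>)" unfolding s by (rule imageI[OF pair_group_diff[OF zero u(2)]])
  then show "\<exists>y\<in>carrier (rational_dual_module \<theta>). y \<oplus>\<^bsub>rational_dual_module \<theta>\<^esub> x = \<zero>\<^bsub>rational_dual_module \<theta>\<^esub>"
    by (rule bexI[rotated]) (simp add: s u)
  fix y assume "y \<in> carrier (rational_dual_module \<theta>)"
  then obtain v where v: "y = rcos v" "v \<in> carrier pair_group" by (auto simp only: s)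
  show "x \<oplus>\<^bsub>rational_dual_module \<theta>\<^esub> y \<in> carrier (rational_dual_module \<theta>)"
    unfolding u v s by (rule imageI[OF add[OF u(2) v(2)]])
  show "x \<oplus>\<^bsub>rational_dual_module \<theta>\<^esub> y = y \<oplus>\<^bsub>rational_dual_module \<theta>\<^esub> x"
    by (simp add: u v s add.commute)
  fix z assume "z \<in> carrier (rational_dual_module \<theta>)"
  then obtain w where w: "z = rcos w" by (auto simp only: s)
  show "x \<oplus>\<^bsub>rational_dual_module \<theta>\<^esub> y \<oplus>\<^bsub>rational_dual_module \<theta>\<^esub> z = x \<oplus>\<^bsub>rational_dual_module \<theta>\<^esub> (y \<oplus>\<^bsub>rational_dual_module \<theta>\<^esub> z)"
    by (simp add: u v w s add.assoc)
next
  show "\<zero>\<^bsub>rational_dual_module \<theta>\<^esub> \<in> carrier (rational_dual_module \<theta>)"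
    unfolding rational_dual_module_simps by (rule imageI) simp
qed

lemma rational_dual_module_smult_add:
  assumes "x \<in> carrier (rational_dual_module \<theta>)" "y \<in> carrier (rational_dual_module \<theta>)"
  shows "p \<odot>\<^bsub>rational_dual_module \<theta>\<^esub> (x \<oplus>\<^bsub>rational_dual_module \<theta>\<^esub> y) =
    p \<odot>\<^bsub>rational_dual_module \<theta>\<^esub> x \<oplus>\<^bsub>rational_dual_module \<theta>\<^esub> p \<odot>\<^bsub>rational_dual_module \<theta>\<^esub> y"
  using assms by (auto simp only: rational_dual_module_simps action_add)

end

lemma rational_dual_module_annihilator:
  fixes \<theta> :: "'x::topological_ab_group_add \<Rightarrow> 'x"
  assumes cpt: "compact (UNIV :: 'x set)" and dim: "has_dimension TYPE('x) d"
    and aut: "topological_automorphism \<theta>" and haar: "haar_measure \<mu>" and erg: "ergodic \<mu> \<theta>"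
    and w: "w \<in> carrier (rational_dual_module \<theta>)" and n: "n \<ge> 1"
  obtains Q where "poly Q 1 \<noteq> 0" "laurent_poly n Q \<odot>\<^bsub>rational_dual_module \<theta>\<^esub> w = \<zero>\<^bsub>rational_dual_module \<theta>\<^esub>"
proof -
  note s = rational_dual_module_simps[OF aut]
  obtain u where u: "w = rcos u" "u \<in> carrier pair_group" using w unfolding s(1) by (elim imageE)
  obtain r \<phi> where \<phi>: "\<phi> \<in> carrier dual_group" and k: "u - frag_of (r, \<phi>) \<in> kern" by (rule pure_tensor[OF u(2)])
  obtain Q where Q: "poly Q 1 \<noteq> 0" "character_poly \<phi> (\<theta> ^^ n) Q = (\<lambda>_. 1)"
  proof (rule character_poly_annihilator[OF dim automorphism_iterate(1)[OF aut, of n] automorphism_iterate(2)[OF aut, of n] _ \<phi>])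
    fix \<psi> :: "'x \<Rightarrow> complex" assume "\<psi> \<in> carrier dual_group" "\<psi> \<circ> \<theta> ^^ n = \<psi>"
    then show "\<psi> = (\<lambda>_. 1)" by (rule ergodic_no_periodic_character[OF cpt aut haar erg _ n])
  qed (rule that)
  let ?a = "laurent_action \<theta> (laurent_poly n Q)"
  have "?a u = ?a (u - frag_of (r, \<phi>)) + ?a (frag_of (r, \<phi>))" by (simp add: action_diff[OF aut])
  also have "\<dots> \<in> kern" by (rule kern_add[OF action_kern[OF aut k] action_annihilates[OF aut \<phi> n Q(2)]])
  finally have "rcos (?a u) = rcos 0" by (intro rcos_cong) simp
  then have "laurent_poly n Q \<odot>\<^bsub>rational_dual_module \<theta>\<^esub> w = \<zero>\<^bsub>rational_dual_module \<theta>\<^esub>" by (simp only: u(1) s)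
  then show ?thesis using that Q(1) by blast
qed

section \<open>The ideals of the composition factors\<close>

lemma laurent_ring_simps [simp]:
  "carrier laurent_ring = UNIV" "x \<otimes>\<^bsub>laurent_ring\<^esub> y = x * y" "x \<oplus>\<^bsub>laurent_ring\<^esub> y = x + y"
  "\<one>\<^bsub>laurent_ring\<^esub> = 1" "\<zero>\<^bsub>laurent_ring\<^esub> = 0"
  by (simp_all add: ring_of_type_algebra_def)

lemma laurent_cring: "cring laurent_ring" by (rule cring_from_type_algebra)

lemma laurent_idealD:
  assumes "ideal I laurent_ring"
  shows "0 \<in> I" "x \<in> I \<Longrightarrow> y \<in> I \<Longrightarrow> x + y \<in> I" "x \<in> I \<Longrightarrow> r * x \<in> I" "x \<in> I \<Longrightarrow> y \<in> I \<Longrightarrow> x - y \<in> I"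
proof -
  show "0 \<in> I" using additive_subgroup.zero_closed[OF ideal.axioms(1)[OF assms]] by simp
  show a: "x + y \<in> I" if "x \<in> I" "y \<in> I" for x y using additive_subgroup.a_closed[OF ideal.axioms(1)[OF assms] that] by simp
  show m: "r * x \<in> I" if "x \<in> I" for r x using ideal.I_l_closed[OF assms that, of r] by simp
  show "x - y \<in> I" if "x \<in> I" "y \<in> I" using a[OF that(1) m[OF that(2), of "-1"]] by simp
qed

lemma laurent_ideal_sum: "ideal I laurent_ring \<Longrightarrow> (\<And>i. i \<in> A \<Longrightarrow> g i \<in> I) \<Longrightarrow> sum g A \<in> I"
  by (induction A rule: infinite_finite_induct) (auto intro: laurent_idealD)

lemma laurent_t_power: "laurent_t ^ n = Poly_Mapping.single (int n) 1"
  by (induction n) (simp_all add: laurent_t_def mult_single add.commute)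

text \<open>Each power of \<open>t ^ n\<close> is congruent to 1 modulo \<open>I\<close>, so
  \<open>Q(t ^ n)\<close> is congruent to the constant \<open>Q(1)\<close>.\<close>

lemma laurent_poly_mod:
  assumes I: "ideal I laurent_ring" and t: "laurent_t ^ n - 1 \<in> I"
  shows "laurent_poly n Q - Poly_Mapping.single 0 (of_int (poly Q 1)) \<in> I"
proof -
  define C where "C c = (Poly_Mapping.single 0 (of_int c) :: laurent)" for c :: int
  have "laurent_poly n Q = (\<Sum>i\<le>degree Q. C (coeff Q i) * (laurent_t ^ n) ^ i)"
    unfolding laurent_poly_def
    by (intro sum.cong refl) (simp only: C_def power_mult[symmetric], simp only: laurent_t_power mult_single add_0 mult_1_right)
  moreover have "Poly_Mapping.single 0 (of_int (poly Q 1)) = (\<Sum>i\<le>degree Q. C (coeff Q i))"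
  proof -
    have "(\<Sum>i\<in>A. C (coeff Q i)) = C (\<Sum>i\<in>A. coeff Q i)" for A :: "nat set"
      by (induction A rule: infinite_finite_induct) (simp_all add: C_def single_add)
    then show ?thesis by (simp add: C_def Polynomial.poly_altdef)
  qed
  ultimately have "laurent_poly n Q - Poly_Mapping.single 0 (of_int (poly Q 1)) =
      (\<Sum>i\<le>degree Q. C (coeff Q i) * ((laurent_t ^ n) ^ i - 1))"
    by (simp add: sum_subtractf right_diff_distrib)
  also have "\<dots> \<in> I"
  proof (rule laurent_ideal_sum[OF I], rule laurent_idealD(3)[OF I])
    fix i
    have "(laurent_t ^ n) ^ i - 1 = (\<Sum>l<i. (laurent_t ^ n) ^ l) * (laurent_t ^ n - 1)"
      by (subst power_diff_1_eq) (rule mult.commute)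
    also have "\<dots> \<in> I" by (rule laurent_idealD(3)[OF I t])
    finally show "(laurent_t ^ n) ^ i - 1 \<in> I" .
  qed
  finally show ?thesis .
qed

text \<open>Maximality is simplicity of the factor. If \<open>t ^ n\<close> acted as 1 on the
  factor, an element \<open>w\<close> outside the smaller submodule, killed by some
  \<open>Q(t ^ n)\<close>, would modulo that submodule be killed by the nonzero rational
  \<open>Q(1)\<close>, hence vanish there.\<close>

lemma composition_factor_ideal:
  fixes \<theta> :: "'x::topological_ab_group_add \<Rightarrow> 'x"
  assumes cpt: "compact (UNIV :: 'x set)" and dim: "has_dimension TYPE('x) d"
    and aut: "topological_automorphism \<theta>" and haar: "haar_measure \<mu>" and erg: "ergodic \<mu> \<theta>"
    and ccf: "cyclic_composition_factors laurent_ring (rational_dual_module \<theta>) k f" and j: "j \<in> {1..k}"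
  shows "maximalideal (PIdl\<^bsub>laurent_ring\<^esub> (f j)) laurent_ring"
    and "n \<ge> 1 \<Longrightarrow> laurent_t ^ n - 1 \<notin> PIdl\<^bsub>laurent_ring\<^esub> (f j)"
proof -
  let ?M = "rational_dual_module \<theta>" and ?I = "PIdl\<^bsub>laurent_ring\<^esub> (f j)"
  obtain W \<pi> where cs: "composition_series laurent_ring ?M k W" and \<pi>: "\<pi> permutes {1..k}"
    and iso: "\<forall>i\<in>{1..k}. module_isomorphic laurent_ring (quot_module (?M\<lparr>carrier := W i\<rparr>) (W (i - 1)))
           (quot_module (regular_module laurent_ring) (PIdl\<^bsub>laurent_ring\<^esub> (f (\<pi> i))))"
    using ccf unfolding cyclic_composition_factors_def by (elim conjE exE)
  have "j \<in> \<pi> ` {1..k}" using permutes_image[OF \<pi>] j by (simp only:)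
  then obtain i where i: "j = \<pi> i" "i \<in> {1..k}" by (elim imageE)
  have iso': "module_isomorphic laurent_ring (quot_module (?M\<lparr>carrier := W i\<rparr>) (W (i - 1)))
     (quot_module (regular_module laurent_ring) ?I)"
    using bspec[OF iso i(2)] by (simp only: i(1))
  have i': "Suc (i - 1) = i" "i - 1 < k" "i \<le> k" "i - 1 \<le> k" using i(2) by auto
  note cs' = cs[unfolded composition_series_def, THEN conjunct2, THEN conjunct2]
  have sub: "submodule (W l) laurent_ring ?M" if "l \<le> k" for l
    by (rule mp[OF spec[OF conjunct1[OF cs']] that])
  have st: "W l \<subset> W (Suc l) \<and> (\<forall>N. submodule N laurent_ring ?M \<and> W l \<subseteq> N \<and> N \<subseteq> W (Suc l) \<longrightarrow> N = W l \<or> N = W (Suc l))"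
    if "l < k" for l
    by (rule mp[OF spec[OF conjunct2[OF cs']] that])
  have HV: "W (i - 1) \<subset> W i" using st[OF i'(2)] by (simp only: i'(1))
  have simple: "N = W (i - 1) \<or> N = W i" if "submodule N laurent_ring ?M" "W (i - 1) \<subseteq> N" "N \<subseteq> W i" for N
    by (rule mp[OF spec[OF conjunct2[OF st[OF i'(2)], unfolded i'(1)]]]) (intro conjI that)
  note H = sub[OF i'(4)] and V = sub[OF i'(3)]
  note M = rational_dual_module_abelian_group[OF aut]
  have add: "\<forall>p\<in>carrier laurent_ring. \<forall>x\<in>carrier ?M. \<forall>y\<in>carrier ?M. p \<odot>\<^bsub>?M\<^esub> (x \<oplus>\<^bsub>?M\<^esub> y) = p \<odot>\<^bsub>?M\<^esub> x \<oplus>\<^bsub>?M\<^esub> p \<odot>\<^bsub>?M\<^esub> y"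
    by (intro ballI rational_dual_module_smult_add[OF aut])
  have I: "ideal ?I laurent_ring" by (rule cring.cgenideal_ideal[OF laurent_cring]) simp
  show "maximalideal ?I laurent_ring"
    by (rule simple_quotient_maximal[OF M H V HV add laurent_cring I iso' simple])
  show "laurent_t ^ n - 1 \<notin> ?I" if n: "n \<ge> 1"
  proof
    assume t: "laurent_t ^ n - 1 \<in> ?I"
    obtain w where "w \<in> W i - W (i - 1)" using psubset_imp_ex_mem[OF HV] by (elim exE)
    then have w: "w \<in> W i" "w \<notin> W (i - 1)" by simp_all
    obtain rel where r: "\<And>x. x \<in> W i \<Longrightarrow> \<exists>r. rel x r"
      "\<And>x r p. rel x r \<Longrightarrow> p \<in> carrier laurent_ring \<Longrightarrow> rel (p \<odot>\<^bsub>?M\<^esub> x) (p \<otimes>\<^bsub>laurent_ring\<^esub> r)"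
      "\<And>x r. rel x r \<Longrightarrow> x \<in> W (i - 1) \<longleftrightarrow> r \<in> ?I"
      by (rule quotient_correspondence[OF M H V psubset_imp_subset[OF HV] add laurent_cring I iso'], rule that)
    obtain r where wr: "rel w r" using r(1)[OF w(1)] by (elim exE)
    have "w \<in> carrier ?M"
      using subsetD[OF subgroup.subset[OF V[unfolded submodule_def, THEN conjunct1]] w(1)] by simp
    then obtain Q where Q: "poly Q 1 \<noteq> 0" "laurent_poly n Q \<odot>\<^bsub>?M\<^esub> w = \<zero>\<^bsub>?M\<^esub>"
      by (rule rational_dual_module_annihilator[OF cpt dim aut haar erg _ n])
    have "\<zero>\<^bsub>?M\<^esub> \<in> W (i - 1)" using subgroup.one_closed[OF H[unfolded submodule_def, THEN conjunct1]] by simp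
    moreover have "rel \<zero>\<^bsub>?M\<^esub> (laurent_poly n Q * r)" using r(2)[OF wr, of "laurent_poly n Q"] by (simp add: Q(2))
    ultimately have P: "laurent_poly n Q * r \<in> ?I" using r(3) by simp
    define q :: rat where "q = of_int (poly Q 1)"
    have "r * (laurent_poly n Q - Poly_Mapping.single 0 q) \<in> ?I"
      unfolding q_def by (rule laurent_idealD(3)[OF I laurent_poly_mod[OF I t]])
    from laurent_idealD(4)[OF I P this] have "Poly_Mapping.single 0 q * r \<in> ?I"
      by (simp add: algebra_simps)
    from laurent_idealD(3)[OF I this, of "Poly_Mapping.single 0 (1 / q)"] 
    have "(Poly_Mapping.single 0 (1 / q) * Poly_Mapping.single 0 q) * r \<in> ?I" by (simp only: mult.assoc)
    moreover have "1 / q * q = 1" using Q(1) by (simp add: q_def)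
    then have "Poly_Mapping.single 0 (1 / q) * Poly_Mapping.single 0 q = (1 :: laurent)"
      by (simp only: mult_single add_0 single_one)
    ultimately have "r \<in> ?I" by (simp only: mult_1_left)
    then show False using r(3)[OF wr] w(2) by simp
  qed
qed

section \<open>The composition factors as number fields\<close>

definition laurent_eval :: "complex \<Rightarrow> laurent \<Rightarrow> complex" where
  "laurent_eval \<xi> p = (\<Sum>m\<in>Poly_Mapping.keys p. of_rat (Poly_Mapping.lookup p m) * \<xi> powi m)"

lemma laurent_eval_superset:
  assumes "finite A" "Poly_Mapping.keys p \<subseteq> A"
  shows "laurent_eval \<xi> p = (\<Sum>m\<in>A. of_rat (Poly_Mapping.lookup p m) * \<xi> powi m)"
  unfolding laurent_eval_def by (rule sum.mono_neutral_left) (use assms in \<open>auto simp: in_keys_iff\<close>)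

lemma laurent_eval_add: "laurent_eval \<xi> (p + q) = laurent_eval \<xi> p + laurent_eval \<xi> q"
proof -
  let ?A = "Poly_Mapping.keys p \<union> Poly_Mapping.keys q"
  have "laurent_eval \<xi> (p + q) = (\<Sum>m\<in>?A. of_rat (Poly_Mapping.lookup (p + q) m) * \<xi> powi m)"
    by (rule laurent_eval_superset) (use keys_add[of p q] in auto)
  then show ?thesis
    by (simp add: laurent_eval_superset[of ?A p] laurent_eval_superset[of ?A q] lookup_add of_rat_add distrib_right sum.distrib)
qed

lemma laurent_eval_single [simp]: "laurent_eval \<xi> (Poly_Mapping.single m c) = of_rat c * \<xi> powi m"
  by (cases "c = 0") (simp_all add: laurent_eval_def)

lemma laurent_eval_0 [simp]: "laurent_eval \<xi> 0 = 0" by (simp add: laurent_eval_def)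

lemma laurent_eval_1 [simp]: "laurent_eval \<xi> 1 = 1"
  using laurent_eval_single[of \<xi> 0 1] by simp

lemma laurent_eval_sum: "laurent_eval \<xi> (sum g A) = (\<Sum>a\<in>A. laurent_eval \<xi> (g a))"
  by (induction A rule: infinite_finite_induct) (simp_all add: laurent_eval_add)

lemma laurent_sum_single: "(p :: laurent) = (\<Sum>m\<in>Poly_Mapping.keys p. Poly_Mapping.single m (Poly_Mapping.lookup p m))"
  by (rule poly_mapping_eqI) (auto simp: lookup_sum lookup_single when_def in_keys_iff sum.delta)

lemma laurent_eval_mult:
  assumes "\<xi> \<noteq> 0"
  shows "laurent_eval \<xi> (p * q) = laurent_eval \<xi> p * laurent_eval \<xi> q"
proof -
  have "p * q = (\<Sum>m\<in>Poly_Mapping.keys p. \<Sum>n\<in>Poly_Mapping.keys q.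
      Poly_Mapping.single (m + n) (Poly_Mapping.lookup p m * Poly_Mapping.lookup q n))"
    by (rule trans[OF arg_cong2[where f = "(*)", OF laurent_sum_single[of p] laurent_sum_single[of q]]])
      (simp only: sum_product mult_single)
  then show ?thesis
    unfolding laurent_eval_def[of \<xi> p] laurent_eval_def[of \<xi> q] sum_product
    using assms by (simp add: laurent_eval_sum of_rat_mult power_int_add mult_ac)
qed

lemma laurent_eval_t: "laurent_eval \<xi> laurent_t = \<xi>"
  by (simp add: laurent_t_def)

lemma laurent_eval_diff: "laurent_eval \<xi> (p - q) = laurent_eval \<xi> p - laurent_eval \<xi> q"
  using laurent_eval_add[of \<xi> "p - q" q] by simp

lemma rpoly_bound:
  assumes "degree p \<le> N"
  shows "rpoly p x = (\<Sum>i\<le>N. of_rat (coeff p i) * x ^ i)"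
proof -
  have "degree (map_poly of_rat p :: complex poly) \<le> N" by (rule order.trans[OF map_poly_degree_leq assms])
  then have "rpoly p x = (\<Sum>i\<le>N. coeff (map_poly of_rat p) i * x ^ i)"
    by (subst Polynomial.poly_altdef) (rule sum.mono_neutral_left, auto simp: coeff_eq_0)
  then show ?thesis by (simp add: coeff_map_poly)
qed

text \<open>Dividing by the lowest power of \<open>t\<close> gives an ordinary polynomial with
  nonzero constant term, so its roots are nonzero. It is not constant, for then \<open>f\<close>
  would be a monomial and therefore a unit.\<close>

lemma laurent_root:
  assumes f: "f = 0 \<or> (\<forall>g. g * f \<noteq> 1)"
  obtains \<xi> p where "\<xi> \<noteq> 0" "laurent_eval \<xi> f = 0" "p \<noteq> 0" "rpoly p \<xi> = 0"
proof (cases "f = 0")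
  case True
  have "rpoly [:-1, 1:] 1 = 0" by (subst rpoly_bound[of _ 1]) auto
  then show ?thesis using True by (intro that[of 1 "[:-1, 1:]"]) simp_all
next
  case False
  let ?K = "Poly_Mapping.keys f"
  have K: "finite ?K" "?K \<noteq> {}" using False by auto
  define a where "a = Min ?K"
  have a: "a \<in> ?K" "m \<in> ?K \<Longrightarrow> a \<le> m" for m using K by (auto simp: a_def)
  define N where "N = nat (Max ?K - a)"
  have N: "nat (m - a) \<le> N" if "m \<in> ?K" for m using Max_ge[OF K(1) that] by (simp add: N_def)
  define p where "p = (\<Sum>i\<le>N. Polynomial.monom (Poly_Mapping.lookup f (a + int i)) i)"
  have co: "coeff p i = (if i \<le> N then Poly_Mapping.lookup f (a + int i) else 0)" for i
    unfolding p_def by (simp add: coeff_sum sum.delta' cong: if_cong)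
  have c0: "coeff p 0 \<noteq> 0" using a(1) by (simp add: co in_keys_iff)
  then have p0: "p \<noteq> 0" by auto
  have dp: "degree p \<le> N" by (rule degree_le) (simp add: co)
  have ev: "laurent_eval \<xi> f = \<xi> powi a * rpoly p \<xi>" if "\<xi> \<noteq> 0" for \<xi>
  proof -
    have sub: "?K \<subseteq> (\<lambda>i. a + int i) ` {..N}"
    proof
      fix m assume m: "m \<in> ?K"
      then have "m = a + int (nat (m - a))" using a(2)[OF m] by simp
      then show "m \<in> (\<lambda>i. a + int i) ` {..N}" using N[OF m] by (intro image_eqI[of _ _ "nat (m - a)"]) auto
    qed
    have "laurent_eval \<xi> f = (\<Sum>i\<le>N. of_rat (Poly_Mapping.lookup f (a + int i)) * \<xi> powi (a + int i))"
      by (subst laurent_eval_superset[OF _ sub]) (simp_all add: sum.reindex inj_on_def)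
    also have "\<dots> = \<xi> powi a * rpoly p \<xi>"
      unfolding rpoly_bound[OF dp] sum_distrib_left using that by (intro sum.cong) (auto simp: co power_int_add)
    finally show ?thesis .
  qed
  have "degree p \<noteq> 0"
  proof
    assume d0: "degree p = 0"
    have "?K = {a}"
    proof -
      have "m = a" if m: "m \<in> ?K" for m
      proof (rule ccontr)
        assume "m \<noteq> a"
        then have "nat (m - a) > 0" using a(2)[OF m] by simp
        then have "coeff p (nat (m - a)) = 0" using d0 by (intro coeff_eq_0) simp
        then show False using N[OF m] m a(2)[OF m] by (simp add: co in_keys_iff)
      qed
      then have "?K \<subseteq> {a}" by (intro Set.subsetI) (simp only: singleton_iff)
      then show ?thesis using a(1) by (metis subset_singletonD empty_iff)
    qed
    note Ka = this
    have "(\<Sum>m\<in>?K. Poly_Mapping.single m (Poly_Mapping.lookup f m)) = Poly_Mapping.single a (Poly_Mapping.lookup f a)"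
      unfolding Ka by simp
    with laurent_sum_single[of f] have "f = Poly_Mapping.single a (Poly_Mapping.lookup f a)" by (rule trans)
    then have "Poly_Mapping.single (- a) (1 / Poly_Mapping.lookup f a) * f =
        Poly_Mapping.single (- a) (1 / Poly_Mapping.lookup f a) * Poly_Mapping.single a (Poly_Mapping.lookup f a)"
      by (rule arg_cong[where f = "\<lambda>g. Poly_Mapping.single (- a) (1 / Poly_Mapping.lookup f a) * g"])
    also have "\<dots> = 1" using a(1) by (simp add: mult_single in_keys_iff)
    finally show False using f False by blast
  qed
  then have "degree (map_poly of_rat p :: complex poly) \<noteq> 0" by (subst degree_map_poly) auto
  then have "\<not> constant (poly (map_poly of_rat p :: complex poly))" by (simp add: constant_degree)
  then obtain \<xi> where \<xi>: "rpoly p \<xi> = 0" using fundamental_theorem_of_algebra by blast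
  have "\<xi> \<noteq> 0"
  proof
    assume "\<xi> = 0"
    then have "coeff (map_poly of_rat p :: complex poly) 0 = 0" using \<xi> by (simp add: poly_0_coeff_0)
    then show False using c0 by (simp add: coeff_map_poly)
  qed
  then show ?thesis using that ev \<xi> p0 by simp
qed

lemma common_denominator:
  fixes q :: "nat \<Rightarrow> rat"
  obtains D :: int where "D > 0" "\<And>i. i \<le> N \<Longrightarrow> \<exists>a. of_int D * q i = of_int a"
proof -
  have "\<exists>D::int. D > 0 \<and> (\<forall>i\<le>N. \<exists>a. of_int D * q i = of_int a)"
  proof (induction N)
    case 0
    obtain a d where "quotient_of (q 0) = (a, d)" by (cases "quotient_of (q 0)")
    from quotient_of_denom_pos[OF this] quotient_of_div[OF this] show ?case
      by (intro exI[of _ d]) (auto intro!: exI[of _ a])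
  next
    case (Suc N)
    obtain D :: int where D: "D > 0" "\<forall>i\<le>N. \<exists>a. of_int D * q i = of_int a" using Suc by blast
    obtain a d where "quotient_of (q (Suc N)) = (a, d)" by (cases "quotient_of (q (Suc N))")
    from quotient_of_denom_pos[OF this] quotient_of_div[OF this]
    have d: "d > 0" "of_int d * q (Suc N) = of_int a" by auto
    have "\<exists>b. of_int (D * d) * q i = of_int b" if "i \<le> Suc N" for i
    proof (cases "i = Suc N")
      case True
      have "of_int (D * d) * q i = of_int (D * a)" using d(2) by (simp add: True)
      then show ?thesis by blast
    next
      case False
      then have "i \<le> N" using that by simp
      then obtain b where b: "of_int D * q i = of_int b" using D(2) by blast
      have "of_int (D * d) * q i = of_int d * (of_int D * q i)" by simp
      also have "\<dots> = of_int (d * b)" by (simp only: b of_int_mult)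
      finally show ?thesis by blast
    qed
    then show ?case using D(1) d(1) by (intro exI[of _ "D * d"]) simp
  qed
  then show ?thesis using that by blast
qed

text \<open>If the coefficients of the monic minimal polynomial of \<open>\<xi>\<close> have the common denominator
  \<open>D\<close>, then the minimal polynomial of \<open>D \<xi>\<close> has integer coefficients, without recourse to
  Gauss's lemma.\<close>

lemma integral_multiple:
  assumes p0: "p \<noteq> 0" "rpoly p \<xi> = 0"
  obtains F D where "number_field F (of_int D * \<xi>)" "(D::int) > 0"
proof -
  define Pr where "Pr p \<longleftrightarrow> p \<noteq> 0 \<and> rpoly p \<xi> = 0" for p
  have "Pr p" using p0 by (simp add: Pr_def)
  from ex_has_least_nat[of Pr, OF this, of degree]
  obtain m where m: "Pr m" and least: "\<forall>p. Pr p \<longrightarrow> degree m \<le> degree p" by (elim exE conjE)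
  have m0: "m \<noteq> 0" "rpoly m \<xi> = 0" using m by (simp_all add: Pr_def)
  define e where "e = degree m"
  define q where "q i = coeff m i / lead_coeff m" for i
  obtain D :: int where D: "D > 0" "\<And>i. i \<le> e \<Longrightarrow> \<exists>a. of_int D * q i = of_int a" 
    by (rule common_denominator[of e q], rule that)
  \<comment> \<open>These are the coefficients of the monic polynomial of \<open>D * \<xi>\<close>.
    The exponent \<open>e - i\<close> is at least 1 except at the leading coefficient, which is
    1.\<close>
  have "\<exists>a. of_int D ^ (e - i) * q i = of_int a" if i: "i \<le> e" for i
  proof (cases "i = e")
    case True
    then show ?thesis using m0(1) by (intro exI[of _ 1]) (simp add: q_def e_def)
  next
    case False
    then obtain l where l: "e - i = Suc l" using i by (cases "e - i") auto
    obtain a where "of_int D * q i = of_int a" using D(2)[OF i] by blast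
    then have "of_int D ^ (e - i) * q i = of_int (D ^ l * a)" by (simp add: l mult.assoc mult.left_commute)
    then show ?thesis by blast
  qed
  then obtain a where a: "\<And>i. i \<le> e \<Longrightarrow> of_int D ^ (e - i) * q i = of_int (a i)" by metis
  define F where "F = (\<Sum>i\<le>e. Polynomial.monom (a i) i)"
  have co: "coeff F i = (if i \<le> e then a i else 0)" for i
    unfolding F_def by (simp add: coeff_sum sum.delta' cong: if_cong)
  have ae: "a e = 1" using a[of e] m0(1) by (simp add: q_def e_def)
  have dF: "degree F = e"
    by (rule antisym[OF degree_le le_degree]) (simp_all add: co ae)
  have "number_field F (of_int D * \<xi>)"
  proof
    show "lead_coeff F = 1" by (simp add: dF co ae)
    have "ipoly F (of_int D * \<xi>) = rpoly (map_poly of_int F) (of_int D * \<xi>)" by simp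
    also have "\<dots> = (\<Sum>i\<le>e. of_rat (of_int D ^ (e - i) * q i) * (of_int D * \<xi>) ^ i)"
    proof (subst rpoly_bound[of _ e])
      show "degree (map_poly of_int F :: rat poly) \<le> e" using map_poly_degree_leq[of of_int F] dF by simp
      show "(\<Sum>i\<le>e. of_rat (coeff (map_poly of_int F) i) * (complex_of_int D * \<xi>) ^ i) =
        (\<Sum>i\<le>e. of_rat (of_int D ^ (e - i) * q i) * (of_int D * \<xi>) ^ i)"
        by (rule sum.cong[OF refl]) (simp only: coeff_map_poly of_int_0 co a atMost_iff if_True)
    qed
    also have "\<dots> = (\<Sum>i\<le>e. of_int D ^ e / of_rat (lead_coeff m) * (of_rat (coeff m i) * \<xi> ^ i))"
    proof (rule sum.cong[OF refl])
      fix i assume "i \<in> {..e}"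
      then have "complex_of_int D ^ e = of_int D ^ (e - i) * of_int D ^ i" by (simp add: power_add[symmetric])
      then show "of_rat (of_int D ^ (e - i) * q i) * (of_int D * \<xi>) ^ i =
          of_int D ^ e / of_rat (lead_coeff m) * (of_rat (coeff m i) * \<xi> ^ i)"
        by (simp add: q_def of_rat_mult of_rat_divide of_rat_power power_mult_distrib)
    qed
    also have "\<dots> = of_int D ^ e / of_rat (lead_coeff m) * rpoly m \<xi>"
      by (subst rpoly_bound[of m e]) (simp_all add: e_def sum_distrib_left)
    finally show "ipoly F (of_int D * \<xi>) = 0" using m0(2) by simp
  next
    fix r :: "rat poly" assume r: "rpoly r (of_int D * \<xi>) = 0" "r \<noteq> 0"
    \<comment> \<open>This is \<open>r\<close> with its variable scaled by \<open>D\<close>: a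
      polynomial vanishing at \<open>D * \<xi>\<close> becomes one vanishing at \<xi>, to which
      minimality of \<open>m\<close> applies.\<close>
    define s where "s = (\<Sum>i\<le>degree r. Polynomial.monom (coeff r i * of_int D ^ i) i)"
    have cs: "coeff s i = (if i \<le> degree r then coeff r i * of_int D ^ i else 0)" for i
      unfolding s_def by (simp add: coeff_sum sum.delta' cong: if_cong)
    have ds: "degree s \<le> degree r" by (rule degree_le) (simp add: cs)
    have "coeff s (degree r) \<noteq> 0" using r(2) D(1) by (simp add: cs)
    then have s0: "s \<noteq> 0" by auto
    have "rpoly s \<xi> = (\<Sum>i\<le>degree r. of_rat (coeff r i) * (of_int D * \<xi>) ^ i)"
      unfolding rpoly_bound[OF ds] by (rule sum.cong) (simp_all add: cs of_rat_mult of_rat_power power_mult_distrib mult_ac)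
    also have "\<dots> = 0" using r(1) by (simp add: rpoly_bound[OF order.refl])
    finally have "Pr s" using s0 by (simp add: Pr_def)
    then show "degree F \<le> degree r" using least ds by (simp add: dF e_def) (meson order.trans)
  qed
  then show ?thesis using that D(1) by blast
qed

text \<open>Evaluation at a nonzero complex root of \<open>f\<close> has as kernel a proper ideal
  containing \<open>f\<close>, which maximality makes equal to the ideal of \<open>f\<close>. The
  quotient is thus the field generated by \<xi>, and its multiple \<open>D * \<xi>\<close> is an
  integral generator as the locale requires.\<close>

lemma factor_field_number_field:
  assumes max: "maximalideal (PIdl\<^bsub>laurent_ring\<^esub> f) laurent_ring"
    and t: "\<And>n. n \<ge> 1 \<Longrightarrow> laurent_t ^ n - 1 \<notin> PIdl\<^bsub>laurent_ring\<^esub> f"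
  obtains F \<alpha> \<phi> \<xi> where "number_field_iso F \<alpha> (factor_field f) \<phi>" "\<xi> \<in> number_field.K \<alpha>" "\<xi> \<noteq> 0"
    "\<And>n. n \<ge> 1 \<Longrightarrow> \<xi> ^ n \<noteq> 1" "\<And>n. factor_elt_pow_minus_1 f n \<in> carrier (factor_field f)"
    "\<And>n. \<phi> (factor_elt_pow_minus_1 f n) = \<xi> ^ n - 1"
proof -
  let ?R = laurent_ring and ?I = "PIdl\<^bsub>laurent_ring\<^esub> f"
  interpret R: cring ?R by (rule laurent_cring)
  interpret I: maximalideal ?I ?R by (rule max)
  have I: "ideal ?I ?R" by (rule I.is_ideal)
  have Imem: "x \<in> ?I \<longleftrightarrow> (\<exists>g. x = g * f)" for x by (simp add: cgenideal_def)
  have nu: "\<forall>g. g * f \<noteq> 1"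
  proof (intro allI notI)
    fix g assume "g * f = 1"
    then have "1 \<in> ?I" unfolding Imem by (intro exI[of _ g]) (rule sym)
    then have "\<one>\<^bsub>?R\<^esub> \<in> ?I" by (simp only: laurent_ring_simps)
    from I.one_imp_carrier[OF this] I.I_notcarr show False by (metis)
  qed
  obtain \<xi> p where \<xi>: "\<xi> \<noteq> 0" "laurent_eval \<xi> f = 0" and p: "p \<noteq> 0" "rpoly p \<xi> = 0"
    by (rule laurent_root[OF disjI2[OF nu]], rule that)
  let ?e = "laurent_eval \<xi>"
  note em = laurent_eval_mult[OF \<xi>(1)]
  have ker: "?I = {x. ?e x = 0}"
  proof -
    have neg: "inv\<^bsub>add_monoid ?R\<^esub> x = - x" for x
      unfolding a_inv_def[symmetric] by (rule R.minus_equality) simp_all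
    have sg: "subgroup {x. ?e x = 0} (add_monoid ?R)"
    proof (rule group.subgroupI[OF R.a_group])
      show "{x. ?e x = 0} \<subseteq> carrier (add_monoid ?R)" by simp
      have "0 \<in> {x. ?e x = 0}" by simp
      then show "{x. ?e x = 0} \<noteq> {}" by (metis empty_iff)
      show "inv\<^bsub>add_monoid ?R\<^esub> x \<in> {x. ?e x = 0}" if "x \<in> {x. ?e x = 0}" for x
        unfolding neg using that laurent_eval_diff[of \<xi> 0 x] by simp
      show "x \<otimes>\<^bsub>add_monoid ?R\<^esub> y \<in> {x. ?e x = 0}" if "x \<in> {x. ?e x = 0}" "y \<in> {x. ?e x = 0}" for x y
        using that by (simp add: laurent_eval_add)
    qed
    have id: "ideal {x. ?e x = 0} ?R" by (rule idealI[OF R.ring_axioms sg]) (simp_all add: em)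
    have sub: "?I \<subseteq> {x. ?e x = 0}"
    proof
      fix x assume "x \<in> ?I"
      then obtain g where "x = g * f" unfolding Imem by (elim exE)
      then show "x \<in> {x. ?e x = 0}" by (simp add: em \<xi>(2))
    qed
    have ne: "{x. ?e x = 0} \<noteq> UNIV"
    proof
      assume u: "{x. ?e x = 0} = UNIV"
      have "1 \<in> {x. ?e x = 0}" unfolding u by (rule UNIV_I)
      then show False by simp
    qed
    have "{x. ?e x = 0} = ?I \<or> {x. ?e x = 0} = carrier ?R" by (rule I.I_maximal[OF id sub]) simp
    then show ?thesis
    proof
      assume "{x. ?e x = 0} = ?I" then show ?thesis by (rule sym)
    next
      assume "{x. ?e x = 0} = carrier ?R" then show ?thesis using ne by (simp only: laurent_ring_simps simp_thms)
    qed
  qed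
  have \<xi>n: "\<xi> ^ n \<noteq> 1" if "n \<ge> 1" for n
    using t[OF that] unfolding ker by (simp add: laurent_t_power laurent_eval_diff)
  define c where "c r = ?I +>\<^bsub>?R\<^esub> r" for r
  \<comment> \<open>Evaluation is constant on a coset, so its image is a singleton.\<close>
  define \<phi> where "\<phi> C = the_elem (?e ` C)" for C
  have c_in: "x \<in> c r \<longleftrightarrow> ?e x = ?e r" for x r
  proof -
    have "x \<in> c r \<longleftrightarrow> (\<exists>i\<in>?I. x = i + r)" unfolding c_def a_r_coset_def r_coset_def by simp
    also have "\<dots> \<longleftrightarrow> ?e x = ?e r"
    proof
      assume "\<exists>i\<in>?I. x = i + r"
      then show "?e x = ?e r" unfolding ker by (auto simp: laurent_eval_add)
    next
      assume "?e x = ?e r"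
      then show "\<exists>i\<in>?I. x = i + r" unfolding ker by (intro bexI[of _ "x - r"]) (simp_all add: laurent_eval_diff)
    qed
    finally show ?thesis .
  qed
  have \<phi>c: "\<phi> (c r) = ?e r" for r
  proof -
    have "?e ` c r = {?e r}"
    proof (intro Set.equalityI Set.subsetI)
      fix y assume "y \<in> ?e ` c r"
      then obtain x where "y = ?e x" "x \<in> c r" by (elim imageE)
      then show "y \<in> {?e r}" by (simp add: c_in)
    next
      fix y assume "y \<in> {?e r}"
      moreover have "r \<in> c r" by (simp only: c_in)
      ultimately show "y \<in> ?e ` c r" by (simp only: singleton_iff) (rule imageI)
    qed
    then show ?thesis by (simp add: \<phi>_def)
  qed
  have F1: "carrier (factor_field f) = range c"
    by (auto simp: factor_field_def FactRing_def A_RCOSETS_def RCOSETS_def c_def a_r_coset_def)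
  have F2: "c r \<oplus>\<^bsub>factor_field f\<^esub> c s = c (r + s)" for r s
    using I.a_rcos_sum[of r s] by (simp add: factor_field_def FactRing_def c_def)
  have F3: "c r \<otimes>\<^bsub>factor_field f\<^esub> c s = c (r * s)" for r s
    using I.rcoset_mult_add[of r s] by (simp add: factor_field_def FactRing_def c_def)
  have F4: "\<one>\<^bsub>factor_field f\<^esub> = c 1"
    by (simp add: factor_field_def FactRing_def c_def)
  note F = F1 F2 F3 F4
  obtain P D where P: "number_field P (of_int D * \<xi>)" "(D::int) > 0" by (rule integral_multiple[OF p])
  interpret nf: number_field P "of_int D * \<xi>" by (rule P(1))
  have \<xi>K: "\<xi> \<in> nf.K"
  proof -
    have "of_int D * \<xi> \<in> nf.K" using nf.K_rpoly[of "[:0, 1:]"] by (simp add: rpoly_bound[of _ 1])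
    then have "(of_int D * \<xi>) / of_int D \<in> nf.K" by (intro nf.K_divide nf.K_of_int)
    then show ?thesis using P(2) by simp
  qed
  have eK: "?e r \<in> nf.K" for r
    unfolding laurent_eval_def by (intro nf.K_sum nf.K_mult nf.K_of_rat nf.K_powi \<xi>K)
  have iso: "number_field_iso P (of_int D * \<xi>) (factor_field f) \<phi>"
  proof (rule number_field_iso.intro[OF P(1)], rule number_field_iso_axioms.intro)
    show "Ring.field (factor_field f)" unfolding factor_field_def by (rule I.quotient_is_field[OF R.is_cring])
    show "inj_on \<phi> (carrier (factor_field f))"
    proof (rule inj_onI)
      fix x y assume xy: "x \<in> carrier (factor_field f)" "y \<in> carrier (factor_field f)" "\<phi> x = \<phi> y"
      obtain r where r: "x = c r" using xy(1) unfolding F(1) by (elim rangeE)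
      obtain s where s: "y = c s" using xy(2) unfolding F(1) by (elim rangeE)
      note rs = r s
      have "?e r = ?e s" using xy(3) unfolding rs by (simp only: \<phi>c)
      then show "x = y" unfolding rs by (intro Set.set_eqI) (simp only: c_in)
    qed
    show "\<phi> ` carrier (factor_field f) = nf.K"
    proof
      show "\<phi> ` carrier (factor_field f) \<subseteq> nf.K" unfolding F(1) using eK by (auto simp: \<phi>c)
      show "nf.K \<subseteq> \<phi> ` carrier (factor_field f)"
      proof
        fix x assume "x \<in> nf.K"
        then obtain r where r: "x = rpoly r (of_int D * \<xi>)" by (rule nf.K_E)
        have "x = ?e (\<Sum>i\<le>degree r. Poly_Mapping.single (int i) (coeff r i * of_int D ^ i))"
          unfolding r rpoly_bound[OF order.refl] laurent_eval_sum
          by (rule sum.cong) (simp_all add: of_rat_mult of_rat_power power_mult_distrib)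
        then have "x = \<phi> (c (\<Sum>i\<le>degree r. Poly_Mapping.single (int i) (coeff r i * of_int D ^ i)))" by (simp only: \<phi>c)
        then show "x \<in> \<phi> ` carrier (factor_field f)" unfolding F(1) by blast
      qed
    qed
    show "\<phi> (x \<oplus>\<^bsub>factor_field f\<^esub> y) = \<phi> x + \<phi> y" if "x \<in> carrier (factor_field f)" "y \<in> carrier (factor_field f)" for x y
      using that unfolding F(1) by (auto simp: F(2) \<phi>c laurent_eval_add)
    show "\<phi> (x \<otimes>\<^bsub>factor_field f\<^esub> y) = \<phi> x * \<phi> y" if "x \<in> carrier (factor_field f)" "y \<in> carrier (factor_field f)" for x y
      using that unfolding F(1) by (auto simp: F(3) \<phi>c em)
    show "\<phi> \<one>\<^bsub>factor_field f\<^esub> = 1" by (simp add: F(4) \<phi>c)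
  qed
  interpret it: number_field_iso P "of_int D * \<xi>" "factor_field f" \<phi> by (rule iso)
  have t: "factor_elt f = c laurent_t" by (simp add: factor_elt_def c_def)
  then have tF: "factor_elt f \<in> carrier (factor_field f)" by (simp add: F(1))
  have oneF: "\<one>\<^bsub>factor_field f\<^esub> \<in> carrier (factor_field f)" by (simp add: F(1,4))
  have "\<phi> (factor_elt f) = \<xi>" by (simp add: t \<phi>c laurent_eval_t)
  then have pw: "\<phi> (factor_elt f [^]\<^bsub>factor_field f\<^esub> n) = \<xi> ^ n" "factor_elt f [^]\<^bsub>factor_field f\<^esub> n \<in> carrier (factor_field f)" for n :: nat
    using it.\<phi>_pow[OF tF, of n] by auto
  have m1: "factor_elt_pow_minus_1 f n \<in> carrier (factor_field f)" for n
    unfolding factor_elt_pow_minus_1_def by (rule it.\<phi>_minus(1)[OF pw(2) oneF])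
  have m2: "\<phi> (factor_elt_pow_minus_1 f n) = \<xi> ^ n - 1" for n
    unfolding factor_elt_pow_minus_1_def by (simp only: it.\<phi>_minus(2)[OF pw(2) oneF] pw(1) it.\<phi>_one)
  show ?thesis by (rule that[OF iso \<xi>K \<xi>(1)]) (fact \<xi>n m1 m2)+
qed

section \<open>Asymptotics of the orbit counts\<close>

definition local_prod :: "(nat \<times> nat \<times> (nat \<Rightarrow> real)) list \<Rightarrow> nat \<Rightarrow> real" where
  "local_prod xs n = prod_list (map (\<lambda>x. local_factor (fst x) (fst (snd x)) (snd (snd x)) n) xs)"

text \<open>The list \<open>xs\<close> records the finite places at which the element is a unit; without them the
  sequence is an integral combination of exponentials.\<close>

definition asymptotic :: "(nat \<Rightarrow> real) \<Rightarrow> bool" where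
  "asymptotic G \<longleftrightarrow> (\<exists>L D E xs. L > 0 \<and> (\<lambda>n. complex_of_real (D n)) \<in> trig \<and> (\<forall>n. 0 \<le> D n) \<and>
     (\<forall>n\<ge>1. D n \<noteq> 0) \<and> E \<longlonglongrightarrow> (1::real) \<and>
     (\<forall>x\<in>set xs. local_data (fst x) (fst (snd x)) (snd (snd x))) \<and>
     (\<forall>n\<ge>1. G n = L ^ n * D n * local_prod xs n * E n) \<and>
     (xs = [] \<longrightarrow> (\<exists>u\<in>intexp. \<forall>n\<ge>1. complex_of_real (G n) = u n)))"

lemma asymptoticI:
  assumes "L > 0" "(\<lambda>n. complex_of_real (D n)) \<in> trig" "\<And>n. 0 \<le> D n" "\<And>n. n \<ge> 1 \<Longrightarrow> D n \<noteq> 0"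
    "E \<longlonglongrightarrow> (1::real)" "\<And>x. x \<in> set xs \<Longrightarrow> local_data (fst x) (fst (snd x)) (snd (snd x))"
    "\<And>n. n \<ge> 1 \<Longrightarrow> G n = L ^ n * D n * local_prod xs n * E n"
    "xs = [] \<Longrightarrow> \<exists>u\<in>intexp. \<forall>n\<ge>1. complex_of_real (G n) = u n"
  shows "asymptotic G"
  unfolding asymptotic_def
  by (rule exI[of _ L], rule exI[of _ D], rule exI[of _ E], rule exI[of _ xs]) (intro conjI allI impI ballI assms; assumption)

lemma asymptoticE:
  assumes "asymptotic G"
  obtains L D E xs where "L > 0" "(\<lambda>n. complex_of_real (D n)) \<in> trig" "\<And>n. 0 \<le> D n" "\<And>n. n \<ge> 1 \<Longrightarrow> D n \<noteq> 0"
    "E \<longlonglongrightarrow> (1::real)" "\<And>x. x \<in> set xs \<Longrightarrow> local_data (fst x) (fst (snd x)) (snd (snd x))"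
    "\<And>n. n \<ge> 1 \<Longrightarrow> G n = L ^ n * D n * local_prod xs n * E n"
    "xs = [] \<Longrightarrow> \<exists>u\<in>intexp. \<forall>n\<ge>1. complex_of_real (G n) = u n"
proof -
  obtain L D E xs where *: "L > 0" "(\<lambda>n. complex_of_real (D n)) \<in> trig" "\<forall>n. 0 \<le> D n" "\<forall>n\<ge>1. D n \<noteq> 0"
    "E \<longlonglongrightarrow> (1::real)" "\<forall>x\<in>set xs. local_data (fst x) (fst (snd x)) (snd (snd x))"
    "\<forall>n\<ge>1. G n = L ^ n * D n * local_prod xs n * E n"
    "xs = [] \<longrightarrow> (\<exists>u\<in>intexp. \<forall>n\<ge>1. complex_of_real (G n) = u n)"
    using assms unfolding asymptotic_def by (elim exE conjE)
  show ?thesis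
    by (rule that[OF *(1,2) *(3)[rule_format] *(4)[rule_format] *(5) *(6)[rule_format] *(7)[rule_format] *(8)[THEN mp]])
qed

lemma asymptotic_cong:
  assumes "asymptotic G" "\<And>n. n \<ge> 1 \<Longrightarrow> H n = G n"
  shows "asymptotic H"
proof -
  obtain L D E xs where *: "L > 0" "(\<lambda>n. complex_of_real (D n)) \<in> trig" "\<And>n. 0 \<le> D n" "\<And>n. n \<ge> 1 \<Longrightarrow> D n \<noteq> 0"
    "E \<longlonglongrightarrow> (1::real)" "\<And>x. x \<in> set xs \<Longrightarrow> local_data (fst x) (fst (snd x)) (snd (snd x))"
    "\<And>n. n \<ge> 1 \<Longrightarrow> G n = L ^ n * D n * local_prod xs n * E n"
    "xs = [] \<Longrightarrow> \<exists>u\<in>intexp. \<forall>n\<ge>1. complex_of_real (G n) = u n"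
    by (rule asymptoticE[OF assms(1)], rule that)
  show ?thesis
  proof (rule asymptoticI[OF *(1,2,3,4,5,6)])
    show "H n = L ^ n * D n * local_prod xs n * E n" if "n \<ge> 1" for n
      by (rule trans[OF assms(2)[OF that] *(7)[OF that]])
    assume "xs = []"
    from *(8)[OF this] show "\<exists>u\<in>intexp. \<forall>n\<ge>1. complex_of_real (H n) = u n" by (simp add: assms(2))
  qed
qed

lemma asymptotic_mult:
  assumes "asymptotic G" "asymptotic H"
  shows "asymptotic (\<lambda>n. G n * H n)"
proof -
  obtain L D E xs where g: "L > 0" "(\<lambda>n. complex_of_real (D n)) \<in> trig" "\<And>n. 0 \<le> D n" "\<And>n. n \<ge> 1 \<Longrightarrow> D n \<noteq> 0"
    "E \<longlonglongrightarrow> (1::real)" "\<And>x. x \<in> set xs \<Longrightarrow> local_data (fst x) (fst (snd x)) (snd (snd x))"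
    "\<And>n. n \<ge> 1 \<Longrightarrow> G n = L ^ n * D n * local_prod xs n * E n"
    "xs = [] \<Longrightarrow> \<exists>u\<in>intexp. \<forall>n\<ge>1. complex_of_real (G n) = u n"
    by (rule asymptoticE[OF assms(1)], rule that)
  obtain L' D' E' ys where h: "L' > 0" "(\<lambda>n. complex_of_real (D' n)) \<in> trig" "\<And>n. 0 \<le> D' n" "\<And>n. n \<ge> 1 \<Longrightarrow> D' n \<noteq> 0"
    "E' \<longlonglongrightarrow> (1::real)" "\<And>x. x \<in> set ys \<Longrightarrow> local_data (fst x) (fst (snd x)) (snd (snd x))"
    "\<And>n. n \<ge> 1 \<Longrightarrow> H n = L' ^ n * D' n * local_prod ys n * E' n"
    "ys = [] \<Longrightarrow> \<exists>u\<in>intexp. \<forall>n\<ge>1. complex_of_real (H n) = u n"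
    by (rule asymptoticE[OF assms(2)], rule that)
  show ?thesis
  proof (rule asymptoticI[where L = "L * L'" and D = "\<lambda>n. D n * D' n" and E = "\<lambda>n. E n * E' n" and xs = "xs @ ys"])
    show "0 < L * L'" using g(1) h(1) by simp
    show "(\<lambda>n. complex_of_real (D n * D' n)) \<in> trig" using trig_mult[OF g(2) h(2)] by simp
    show "0 \<le> D n * D' n" for n using g(3) h(3) by simp
    show "D n * D' n \<noteq> 0" if "n \<ge> 1" for n using g(4)[OF that] h(4)[OF that] by simp
    show "(\<lambda>n. E n * E' n) \<longlonglongrightarrow> 1" using tendsto_mult[OF g(5) h(5)] by simp
    show "local_data (fst x) (fst (snd x)) (snd (snd x))" if "x \<in> set (xs @ ys)" for x
      using that g(6)[of x] h(6)[of x] by auto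
    show "G n * H n = (L * L') ^ n * (D n * D' n) * local_prod (xs @ ys) n * (E n * E' n)" if "n \<ge> 1" for n
      by (simp add: g(7)[OF that] h(7)[OF that] local_prod_def power_mult_distrib mult_ac)
    assume "xs @ ys = []"
    then have "xs = []" "ys = []" by simp_all
    obtain u where u: "u \<in> intexp" "\<forall>n\<ge>1. complex_of_real (G n) = u n" using g(8)[OF \<open>xs = []\<close>] by blast
    obtain v where v: "v \<in> intexp" "\<forall>n\<ge>1. complex_of_real (H n) = v n" using h(8)[OF \<open>ys = []\<close>] by blast
    show "\<exists>u\<in>intexp. \<forall>n\<ge>1. complex_of_real (G n * H n) = u n"
      by (rule bexI[OF _ intexp_mult[OF u(1) v(1)]]) (simp add: u(2) v(2))
  qed
qed

lemma asymptotic_intexp: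
  assumes "L > 0" "E \<longlonglongrightarrow> (1::real)" "\<And>n. n \<ge> 1 \<Longrightarrow> G n = L ^ n * E n"
    and "u \<in> intexp" "\<And>n. n \<ge> 1 \<Longrightarrow> complex_of_real (G n) = u n"
  shows "asymptotic G"
proof (rule asymptoticI[where D = "\<lambda>_. 1" and xs = "[]", OF assms(1) _ _ _ assms(2)])
  show "(\<lambda>n. complex_of_real 1) \<in> trig" by (rule trig_const)
  show "G n = L ^ n * 1 * local_prod [] n * E n" if "n \<ge> 1" for n using assms(3)[OF that] by (simp add: local_prod_def)
  show "\<exists>u\<in>intexp. \<forall>n\<ge>1. complex_of_real (G n) = u n" by (rule bexI[OF _ assms(4)]) (simp add: assms(5))
qed simp_all

lemma asymptotic_power: assumes "c > 0" shows "asymptotic (\<lambda>n. c ^ n)"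
  by (rule asymptotic_intexp[OF assms, of "\<lambda>_. 1" _ "\<lambda>n. complex_of_real c ^ n"])
    (simp_all add: intexp.intexp_power)

lemma asymptotic_1: "asymptotic (\<lambda>_. 1)"
  using asymptotic_power[of 1] by simp

lemma asymptotic_prod: "finite I \<Longrightarrow> (\<And>i. i \<in> I \<Longrightarrow> asymptotic (G i)) \<Longrightarrow> asymptotic (\<lambda>n. \<Prod>i\<in>I. G i n)"
  by (induction I rule: finite_induct) (simp_all add: asymptotic_1 asymptotic_mult)

lemma asymptotic_local_factor: assumes "local_data a p h" shows "asymptotic (local_factor a p h)"
proof (rule asymptoticI[where L = 1 and D = "\<lambda>_. 1" and E = "\<lambda>_. 1" and xs = "[(a, p, h)]"])
  show "(\<lambda>n. complex_of_real 1) \<in> trig" by (rule trig_const)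
qed (use assms in \<open>auto simp: local_prod_def\<close>)

text \<open>To be an integral combination of exponentials, the absolute value needs a sign that is
  itself exponential in \<open>n\<close>. Below modulus 1 the sign of \<open>b ^ n - 1\<close> is
  constant; above, it is that of \<open>b ^ n\<close>, which gives the exact form with
  \<open>s ^ n\<close>.\<close>

lemma asymptotic_real:
  fixes b :: real
  assumes nr: "\<And>n. n \<ge> 1 \<Longrightarrow> b ^ n \<noteq> 1"
  shows "asymptotic (\<lambda>n. \<bar>b ^ n - 1\<bar>)"
proof -
  \<comment> \<open>The exponent 1 excludes \<open>b = 1\<close>, and the exponent 2 excludes
    \<open>b = -1\<close>.\<close>
  have "\<bar>b\<bar> \<noteq> 1" using nr[of 1] nr[of 2] by (auto simp: abs_if split: if_splits)
  then consider "\<bar>b\<bar> < 1" | "\<bar>b\<bar> > 1" by linarith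
  then show ?thesis
  proof cases
    case 1
    have l: "(\<lambda>n. \<bar>b ^ n - 1\<bar>) \<longlonglongrightarrow> \<bar>0 - 1\<bar>" by (intro tendsto_intros LIMSEQ_abs_realpow_zero2 1)
    show ?thesis
    proof (rule asymptotic_intexp[of 1 "\<lambda>n. \<bar>b ^ n - 1\<bar>" _ "\<lambda>n. 1 - complex_of_real b ^ n"])
      show "(\<lambda>n. 1 - complex_of_real b ^ n) \<in> intexp" by (rule intexp_diff[OF intexp_1 intexp.intexp_power])
      fix n :: nat assume n: "n \<ge> 1"
      have "\<bar>b\<bar> ^ n \<le> 1" using 1 by (intro power_le_one) auto
      then have "b ^ n \<le> 1" using abs_le_D1[of "b ^ n" 1] by (simp add: power_abs)
      then have "\<bar>b ^ n - 1\<bar> = 1 - b ^ n" by simp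
      then show "complex_of_real \<bar>b ^ n - 1\<bar> = 1 - complex_of_real b ^ n" by simp
    qed (use l in simp_all)
  next
    case 2
    define s where "s = sgn b"
    have b: "b = \<bar>b\<bar> * s" by (simp add: s_def abs_mult_sgn)
    have s: "s = 1 \<or> s = -1" using 2 by (auto simp: s_def sgn_if)
    have b0: "b \<noteq> 0" using 2 by auto
    have "\<bar>1 / b\<bar> < 1" using 2 by (simp add: field_simps)
    then have l: "(\<lambda>n. \<bar>1 - (1 / b) ^ n\<bar>) \<longlonglongrightarrow> \<bar>1 - 0\<bar>" by (intro tendsto_intros LIMSEQ_abs_realpow_zero2)
    show ?thesis
    proof (rule asymptotic_intexp[of "\<bar>b\<bar>" "\<lambda>n. \<bar>1 - (1 / b) ^ n\<bar>" _ "\<lambda>n. complex_of_real \<bar>b\<bar> ^ n - complex_of_real s ^ n"])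
      show "(\<lambda>n. complex_of_real \<bar>b\<bar> ^ n - complex_of_real s ^ n) \<in> intexp"
        by (rule intexp_diff[OF intexp.intexp_power intexp.intexp_power])
      fix n :: nat assume n: "n \<ge> 1"
      have "b ^ n - 1 = b ^ n * (1 - (1 / b) ^ n)" using b0 by (simp add: right_diff_distrib power_divide)
      then show "\<bar>b ^ n - 1\<bar> = \<bar>b\<bar> ^ n * \<bar>1 - (1 / b) ^ n\<bar>" by (simp only: abs_mult power_abs)
      have "b ^ n = \<bar>b\<bar> ^ n * s ^ n" by (subst b) (rule power_mult_distrib)
      moreover have "s ^ n = 1 \<or> s ^ n = -1" using s by (cases "even n") auto
      moreover have "1 \<le> \<bar>b\<bar> ^ n" using 2 by (intro one_le_power) simp
      ultimately have "\<bar>b ^ n - 1\<bar> = \<bar>b\<bar> ^ n - s ^ n" by (elim disjE) simp_all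
      then show "complex_of_real \<bar>b ^ n - 1\<bar> = complex_of_real \<bar>b\<bar> ^ n - complex_of_real s ^ n"
        by (simp only: of_real_diff of_real_power)
    qed (use l b0 in simp_all)
  qed
qed

text \<open>The square equals \<open>(b ^ n - 1) * (cnj b ^ n - 1)\<close>, an integral combination
  of exponentials for every modulus. Only modulus 1 leaves a persistent oscillation, and the square
  itself then serves as \<open>D\<close>.\<close>

lemma asymptotic_complex:
  fixes b :: complex
  assumes nr: "\<And>n. n \<ge> 1 \<Longrightarrow> b ^ n \<noteq> 1"
  shows "asymptotic (\<lambda>n. (cmod (b ^ n - 1))\<^sup>2)"
proof -
  have sq: "complex_of_real ((cmod (b ^ n - 1))\<^sup>2) = (b ^ n - 1) * (cnj b ^ n - 1)" for n
    by (simp only: complex_norm_square complex_cnj_diff complex_cnj_power complex_cnj_one)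
  have ie: "(\<lambda>n. (b ^ n - 1) * (cnj b ^ n - 1)) \<in> intexp"
    by (intro intexp_mult intexp_diff intexp_1 intexp.intexp_power)
  consider "cmod b < 1" | "cmod b = 1" | "cmod b > 1" by linarith
  then show ?thesis
  proof cases
    case 1
    have "(\<lambda>n. (cmod (b ^ n - 1))\<^sup>2) \<longlonglongrightarrow> (cmod (0 - 1))\<^sup>2" by (intro tendsto_intros LIMSEQ_power_zero 1)
    then show ?thesis
      by (intro asymptotic_intexp[of 1 "\<lambda>n. (cmod (b ^ n - 1))\<^sup>2", OF _ _ _ ie sq]) simp_all
  next
    case 2
    show ?thesis
    proof (rule asymptoticI[where L = 1 and D = "\<lambda>n. (cmod (b ^ n - 1))\<^sup>2" and E = "\<lambda>_. 1" and xs = "[]"])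
      have "(\<lambda>n. (b ^ n + (- 1)) * (cnj b ^ n + (- 1))) \<in> trig"
        using 2 by (intro trig_mult trig.trig_add trig_power trig_const) simp_all
      then show "(\<lambda>n. complex_of_real ((cmod (b ^ n - 1))\<^sup>2)) \<in> trig" unfolding sq by simp
      show "\<exists>u\<in>intexp. \<forall>n\<ge>1. complex_of_real ((cmod (b ^ n - 1))\<^sup>2) = u n"
        by (rule bexI[OF _ ie]) (intro allI impI sq)
    qed (use nr in \<open>simp_all add: local_prod_def\<close>)
  next
    case 3
    then have b0: "b \<noteq> 0" by auto
    have "cmod (1 / b) < 1" using 3 b0 by (simp add: norm_divide pos_divide_less_eq)
    then have "(\<lambda>n. (cmod (1 - (1 / b) ^ n))\<^sup>2) \<longlonglongrightarrow> (cmod (1 - 0))\<^sup>2" by (intro tendsto_intros LIMSEQ_power_zero)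
    then have l: "(\<lambda>n. (cmod (1 - (1 / b) ^ n))\<^sup>2) \<longlonglongrightarrow> 1" by simp
    have L: "(cmod b)\<^sup>2 > 0" using b0 by simp
    show ?thesis
    proof (rule asymptotic_intexp[OF L l _ ie sq])
      fix n :: nat
      have "b ^ n - 1 = b ^ n * (1 - (1 / b) ^ n)" using b0 by (simp add: right_diff_distrib power_divide)
      then show "(cmod (b ^ n - 1))\<^sup>2 = ((cmod b)\<^sup>2) ^ n * (cmod (1 - (1 / b) ^ n))\<^sup>2"
        by (simp only: norm_mult norm_power power_mult_distrib power_mult[symmetric] mult.commute[of n 2])
    qed
  qed
qed

theorem asymptotic_zeta:
  assumes "asymptotic G"
  shows "rational_fps (zfps (\<lambda>n. of_real (G n))) \<or> has_natural_boundary (zfps (\<lambda>n. of_real (G n)))"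
proof -
  obtain L D E xs where g: "L > 0" "(\<lambda>n. complex_of_real (D n)) \<in> trig" "\<And>n. 0 \<le> D n" "\<And>n. n \<ge> 1 \<Longrightarrow> D n \<noteq> 0"
    "E \<longlonglongrightarrow> (1::real)" "\<And>x. x \<in> set xs \<Longrightarrow> local_data (fst x) (fst (snd x)) (snd (snd x))"
    "\<And>n. n \<ge> 1 \<Longrightarrow> G n = L ^ n * D n * local_prod xs n * E n"
    "xs = [] \<Longrightarrow> \<exists>u\<in>intexp. \<forall>n\<ge>1. complex_of_real (G n) = u n"
    by (rule asymptoticE[OF assms], rule that)
  show ?thesis
  proof (cases "xs = []")
    case True
    obtain u where u: "u \<in> intexp" "\<forall>n\<ge>1. complex_of_real (G n) = u n" using g(8)[OF True] by blast
    have "zfps (\<lambda>n. of_real (G n)) = zfps u" by (rule zfps_cong) (use u(2) in simp)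
    then show ?thesis using rational_zfps[OF u(1)] by simp
  next
    case False
    let ?V = "{0..<length xs}"
    define P where "P n = (\<Prod>v\<in>?V. local_factor (fst (xs ! v)) (fst (snd (xs ! v))) (snd (snd (xs ! v))) n)" for n
    have P: "local_prod xs n = P n" for n
      unfolding local_prod_def P_def prod.list_conv_set_nth by (rule prod.cong) simp_all
    have V: "finite ?V" "?V \<noteq> {}" using False by simp_all
    have ld: "local_data (fst (xs ! v)) (fst (snd (xs ! v))) (snd (snd (xs ! v)))" if "v \<in> ?V" for v
      by (rule g(6)) (use that in simp)
    have "\<exists>q i0. prime q \<and> (\<forall>i \<omega>. i0 \<le> i \<longrightarrow> i \<ge> 1 \<longrightarrow> \<omega> ^ (q ^ i) = 1 \<longrightarrow> \<omega> ^ (q ^ (i - 1)) \<noteq> 1 \<longrightarrow>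
        \<not> negl (\<lambda>n. of_real (D n * P n) * \<omega> ^ n))"
      unfolding P_def
      by (rule not_negl[where V = ?V and a = "\<lambda>v. fst (xs ! v)" and p = "\<lambda>v. fst (snd (xs ! v))"
          and h = "\<lambda>v. snd (snd (xs ! v))" and x = D, OF V _ g(2) g(3)]) (rule ld, assumption, rule g(4), assumption)
    then obtain q i0 where q: "prime q" and nn: "\<forall>i \<omega>. i0 \<le> i \<longrightarrow> i \<ge> 1 \<longrightarrow> \<omega> ^ (q ^ i) = 1 \<longrightarrow> \<omega> ^ (q ^ (i - 1)) \<noteq> 1 \<longrightarrow>
        \<not> negl (\<lambda>n. of_real (D n * P n) * \<omega> ^ n)"
      by (elim exE conjE)
    define u where "u n = complex_of_real (L ^ n * D n * P n * E n)" for n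
    have Z: "zfps (\<lambda>n. of_real (G n)) = zfps u" by (rule zfps_cong) (simp add: g(7) u_def P)
    have uL: "u n / of_real L ^ n = of_real (D n * P n) * of_real (E n)" for n
      using g(1) by (simp add: u_def)
    have bP: "bdd_seq (\<lambda>n. complex_of_real (P n))"
      unfolding P_def of_real_prod by (rule bdd_seq_prod) (rule bdd_local_factor[OF ld])
    have bDP: "bdd_seq (\<lambda>n. complex_of_real (D n * P n))"
      using bdd_seq_mult[OF bdd_seq_trig[OF g(2)] bP] by simp
    have "Bseq E" using g(5) by (intro convergent_imp_Bseq convergentI)
    then have bE: "bdd_seq (\<lambda>n. complex_of_real (E n))"
      unfolding Bseq_def bdd_seq_def by (elim exE conjE) (simp, blast)
    have bu: "bdd_seq (\<lambda>n. u n / of_real L ^ n)" unfolding uL by (rule bdd_seq_mult[OF bDP bE])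
    have "has_natural_boundary (zfps u)"
    proof (rule natural_boundary_zfps[where L = L and q = q and ?i0.0 = i0, OF g(1) bu q])
      fix i \<omega> assume w: "i0 \<le> i" "1 \<le> i" "\<omega> ^ (q ^ i) = 1" "\<omega> ^ (q ^ (i - 1)) \<noteq> (1::complex)"
      have "cmod \<omega> ^ (q ^ i) = 1 ^ (q ^ i)" using w(3) by (metis norm_one norm_power power_one)
      then have w1: "cmod \<omega> = 1" using prime_gt_0_nat[OF q] by (subst (asm) power_eq_iff_eq_base) auto
      show "\<not> negl (\<lambda>n. u n / of_real L ^ n * \<omega> ^ n)"
      proof
        assume ng: "negl (\<lambda>n. u n / of_real L ^ n * \<omega> ^ n)"
        \<comment> \<open>The error caused by \<open>E\<close> tends to 0, hence has mean 0.
          Subtracting it leaves the exact product treated by \<open>not_negl\<close>.\<close>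
        define z where "z n = of_real (D n * P n) * \<omega> ^ n * of_real (E n - 1)" for n
        have b1: "bdd_seq (\<lambda>n. of_real (D n * P n) * \<omega> ^ n)" by (rule bdd_seq_mult[OF bDP bdd_seq_unit[OF w1]])
        obtain C where C: "C \<ge> 0" "\<And>n. cmod (of_real (D n * P n) * \<omega> ^ n) \<le> C" by (rule bdd_seqE[OF b1], rule that)
        have "(\<lambda>n. C * \<bar>E n - 1\<bar>) \<longlonglongrightarrow> C * \<bar>1 - 1\<bar>" by (intro tendsto_intros g(5))
        then have l0: "(\<lambda>n. C * \<bar>E n - 1\<bar>) \<longlonglongrightarrow> 0" by simp
        have "cmod (z n) \<le> C * \<bar>E n - 1\<bar>" for n
          unfolding z_def norm_mult[of _ "of_real (E n - 1)"] norm_of_real by (rule mult_right_mono[OF C(2)]) simp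
        then have zl: "z \<longlonglongrightarrow> 0" by (intro Lim_null_comparison[OF _ l0] always_eventually allI)
        have bz: "bdd_seq z"
          unfolding z_def of_real_diff by (intro bdd_seq_mult[OF b1] bdd_seq_diff bE bdd_seq_const)
        have b2: "bdd_seq (\<lambda>n. u n / of_real L ^ n * \<omega> ^ n)" by (rule bdd_seq_mult[OF bu bdd_seq_unit[OF w1]])
        have "negl (\<lambda>n. u n / of_real L ^ n * \<omega> ^ n - z n)" by (rule negl_diff[OF b2 bz ng negl_tendsto_0[OF zl]])
        moreover have "u n / of_real L ^ n * \<omega> ^ n - z n = of_real (D n * P n) * \<omega> ^ n" for n
          unfolding uL z_def by (simp add: algebra_simps)
        ultimately have "negl (\<lambda>n. of_real (D n * P n) * \<omega> ^ n)" by (simp only:)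
        then show False using nn w by blast
      qed
    qed
    then show ?thesis using Z by simp
  qed
qed

section \<open>The contribution of one composition factor\<close>

context number_field_iso
begin

lemma dval_dominant:
  assumes w: "dval w" and x: "x \<in> K" "x \<noteq> 0" "y \<in> K" "y \<noteq> 0" "x + y \<noteq> 0" "w x < w y"
  shows "w (x + y) = w x"
proof -
  have "w x \<le> w (x + y)" using dval_add[OF w x(1-5)] x(6) by simp
  moreover have "min (w (x + y)) (w y) \<le> w x"
    using dval_add[OF w, of "x + y" "- y"] dval_uminus[OF w x(3,4)] x by simp
  ultimately show ?thesis using x(6) by linarith
qed

context
  fixes \<xi> :: complex and x :: "nat \<Rightarrow> 'a"
  assumes \<xi>: "\<xi> \<in> K" "\<xi> \<noteq> 0" and nr: "\<And>n. n \<ge> 1 \<Longrightarrow> \<xi> ^ n \<noteq> 1"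
    and x: "\<And>n. x n \<in> carrier F" "\<And>n. \<phi> (x n) = \<xi> ^ n - 1"
begin

lemma x_nonzero: "n \<ge> 1 \<Longrightarrow> x n \<noteq> \<zero>\<^bsub>F\<^esub>"
  using \<phi>_eq_0_iff[OF x(1), of n] nr[of n] x(2)[of n] by auto

text \<open>By the ultrametric inequality the dominant term of \<open>\<xi> ^ n - 1\<close> decides
  when \<xi> is not a unit: positive valuation gives the constant 1, negative valuation an exact
  exponential with integral base. Only the unit case yields a local factor.\<close>

lemma asymptotic_place:
  assumes P: "prim P"
  shows "asymptotic (\<lambda>n. place P (x n))"
proof -
  let ?w = "vv P" and ?N = "real (NP P)"
  have w: "dval ?w" by (rule vv(1)[OF P])
  have N: "?N > 1" using NP_ge_2[OF P] by simp
  have pl: "place P (x n) = ?N powi (- ?w (\<xi> ^ n - 1))" if "n \<ge> 1" for n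
    using x(1)[of n] x_nonzero[OF that] by (simp add: place_def x(2))
  have K: "\<xi> ^ n \<in> K" "\<xi> ^ n \<noteq> 0" "- 1 \<in> K" "(- 1 :: complex) \<noteq> 0" for n using \<xi> by simp_all
  have w1: "?w (- 1) = 0" using dval_uminus[OF w, of 1] dval_1[OF w] by simp
  have wp: "?w (\<xi> ^ n) = int n * ?w \<xi>" for n by (rule dval_power[OF w \<xi>])
  consider "?w \<xi> = 0" | "?w \<xi> > 0" | "?w \<xi> < 0" by linarith
  then show ?thesis
  proof cases
    case 1
    have "\<exists>a p h. a \<ge> 1 \<and> prime p \<and> (\<forall>t. 0 < h t) \<and> (\<forall>t. h (Suc t) < h t) \<and>
        (\<forall>n\<ge>1. ?N powi (- ?w (\<xi> ^ n - 1)) = (if a dvd n then h (multiplicity p n) else 1))"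
      by (rule unit_place_structure[OF w \<xi> 1 _ N]) (rule nr)
    then obtain a p h where h: "local_data a p h"
      "\<forall>n\<ge>1. ?N powi (- ?w (\<xi> ^ n - 1)) = (if a dvd n then h (multiplicity p n) else 1)"
      unfolding local_data_def by blast
    show ?thesis
      by (rule asymptotic_cong[OF asymptotic_local_factor[OF h(1)]]) (simp add: pl h(2) local_factor_def)
  next
    case 2
    have "place P (x n) = 1" if n: "n \<ge> 1" for n
    proof -
      have "?w (- 1 + \<xi> ^ n) = ?w (- 1)"
        by (rule dval_dominant[OF w K(3,4) K(1,2)]) (use nr[OF n] 2 n w1 wp[of n] in \<open>auto simp: add_eq_0_iff\<close>)
      then show ?thesis by (simp add: pl[OF n] w1)
    qed
    then show ?thesis by (intro asymptotic_cong[OF asymptotic_1]) simp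
  next
    case 3
    have "place P (x n) = (?N ^ nat (- ?w \<xi>)) ^ n" if n: "n \<ge> 1" for n
    proof -
      have "int n * ?w \<xi> < 0" using 3 n by (intro mult_pos_neg) simp_all
      then have "?w (\<xi> ^ n + - 1) = ?w (\<xi> ^ n)"
        by (intro dval_dominant[OF w K(1,2) K(3,4)]) (use nr[OF n] w1 wp[of n] in \<open>auto simp: add_eq_0_iff\<close>)
      then have "?w (\<xi> ^ n - 1) = int n * ?w \<xi>" by (simp add: wp)
      moreover have "- (int n * ?w \<xi>) = int (nat (- ?w \<xi>) * n)" using 3 by simp
      ultimately have "place P (x n) = ?N powi int (nat (- ?w \<xi>) * n)" by (simp only: pl[OF n])
      then show ?thesis by (simp only: power_int_of_nat power_mult)
    qed
    moreover have "?N ^ nat (- ?w \<xi>) > 0" using N by simp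
    ultimately show ?thesis by (intro asymptotic_cong[OF asymptotic_power]) simp_all
  qed
qed

text \<open>Non-real conjugates are taken in pairs, because the square of the modulus of
  \<open>b ^ n - 1\<close> is an exponential sum, while the modulus itself need not be one.
  Injectivity of the embeddings keeps every conjugate of \<xi> from being a root of unity.\<close>

lemma asymptotic_norm: "asymptotic (\<lambda>n. cmod (nrm (\<xi> ^ n - 1)))"
proof -
  have s: "\<sigma> b (\<xi> ^ n - 1) = \<sigma> b \<xi> ^ n - 1" if "b \<in> conj" for b n
    using that \<xi>(1) by (simp add: \<sigma>_diff \<sigma>_power \<sigma>_1)
  have nr': "\<sigma> b \<xi> ^ n \<noteq> 1" if "b \<in> conj" "n \<ge> 1" for b n
    using \<sigma>_nonzero[OF that(1), of "\<xi> ^ n - 1"] nr[OF that(2)] s[OF that(1), of n] \<xi>(1) by auto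
  have "cmod (nrm (\<xi> ^ n - 1)) = (\<Prod>b\<in>{b\<in>conj. Im b \<ge> 0}. if b \<in> \<real> then cmod (\<sigma> b \<xi> ^ n - 1) else (cmod (\<sigma> b \<xi> ^ n - 1))\<^sup>2)" for n
  proof -
    have "cmod (nrm (\<xi> ^ n - 1)) = (\<Prod>b\<in>conj. cmod (\<sigma> b \<xi> ^ n - 1))"
      unfolding nrm_def prod_norm[symmetric] by (intro prod.cong) (simp_all add: s)
    also have "\<dots> = (\<Prod>b\<in>{b\<in>conj. Im b \<ge> 0}. if b \<in> \<real> then cmod (\<sigma> b \<xi> ^ n - 1) else (cmod (\<sigma> b \<xi> ^ n - 1))\<^sup>2)"
    proof (rule prod_pairs_cnj[OF finite_conj conj_cnj])
      fix b assume b: "b \<in> conj"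
      have "\<sigma> (cnj b) \<xi> ^ n - 1 = cnj (\<sigma> b \<xi> ^ n - 1)" using \<sigma>_cnj[OF b \<xi>(1)] by simp
      then show "cmod (\<sigma> (cnj b) \<xi> ^ n - 1) = cmod (\<sigma> b \<xi> ^ n - 1)" by (simp only: complex_mod_cnj)
    qed
    finally show ?thesis .
  qed
  moreover have "asymptotic (\<lambda>n. \<Prod>b\<in>{b\<in>conj. Im b \<ge> 0}. if b \<in> \<real> then cmod (\<sigma> b \<xi> ^ n - 1) else (cmod (\<sigma> b \<xi> ^ n - 1))\<^sup>2)"
  proof (rule asymptotic_prod)
    show "finite {b\<in>conj. Im b \<ge> 0}" using finite_conj by simp
    fix b assume "b \<in> {b\<in>conj. Im b \<ge> 0}"
    then have b: "b \<in> conj" by simp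
    show "asymptotic (\<lambda>n. if b \<in> \<real> then cmod (\<sigma> b \<xi> ^ n - 1) else (cmod (\<sigma> b \<xi> ^ n - 1))\<^sup>2)"
    proof (cases "b \<in> \<real>")
      case True
      then have "cnj b = b" by (simp add: Reals_cnj_iff)
      then have "cnj (\<sigma> b \<xi>) = \<sigma> b \<xi>" using \<sigma>_cnj[OF b \<xi>(1)] by simp
      then have "\<sigma> b \<xi> \<in> \<real>" by (simp add: Reals_cnj_iff)
      then obtain r where r: "\<sigma> b \<xi> = complex_of_real r" by (elim Reals_cases)
      have rn: "r ^ n \<noteq> 1" if "n \<ge> 1" for n
      proof
        assume "r ^ n = 1"
        then have "\<sigma> b \<xi> ^ n = 1" unfolding r of_real_power[symmetric] by simp
        then show False using nr'[OF b that] by simp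
      qed
      have "cmod (\<sigma> b \<xi> ^ n - 1) = \<bar>r ^ n - 1\<bar>" for n
      proof -
        have "\<sigma> b \<xi> ^ n - 1 = complex_of_real (r ^ n - 1)" by (simp add: r)
        then show ?thesis by (simp only: norm_of_real)
      qed
      then show ?thesis using asymptotic_real[of r, OF rn] True by simp
    next
      case False
      then show ?thesis using asymptotic_complex[of "\<sigma> b \<xi>", OF nr'[OF b]] by simp
    qed
  qed
  ultimately show ?thesis by (simp only:)
qed

lemma asymptotic_abs_prod:
  assumes T: "T \<subseteq> finite_places F" "S = finite_places F - T" and S: "finite S"
  shows "asymptotic (\<lambda>n. abs_prod (infinite_places F \<union> S) (x n))"
proof -
  have "asymptotic (\<lambda>n. \<Prod>v\<in>S. v (x n))"
  proof (rule asymptotic_prod[OF S])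
    fix v assume "v \<in> S"
    then have "v \<in> place ` {P. prim P}" using T(2) by (simp add: finite_places_eq)
    then obtain P where "v = place P" "prim P" by (elim imageE) simp
    then show "asymptotic (\<lambda>n. v (x n))" using asymptotic_place by simp
  qed
  then have "asymptotic (\<lambda>n. cmod (nrm (\<xi> ^ n - 1)) * (\<Prod>v\<in>S. v (x n)))"
    by (rule asymptotic_mult[OF asymptotic_norm])
  then show ?thesis
    by (rule asymptotic_cong) (simp add: abs_prod_complement(2)[OF x(1) x_nonzero T S] x(2))
qed

end

end

theorem corollary16:
  fixes \<theta> :: "'x::{topological_ab_group_add, t2_space} \<Rightarrow> 'x"
    and \<mu> :: "'x measure"
    and d k :: nat
    and f :: "nat \<Rightarrow> laurent"
    and T S :: "nat \<Rightarrow> (laurent set \<Rightarrow> real) set"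
  assumes "compact (UNIV :: 'x set)" and "connected (UNIV :: 'x set)"
    and "has_dimension TYPE('x) d" and "1 \<le> d"
    and "topological_automorphism \<theta>"
    and "haar_measure \<mu>" and "ergodic \<mu> \<theta>"
    and "cyclic_composition_factors laurent_ring (rational_dual_module \<theta>) k f"
    and "\<And>j. j \<in> {1..k} \<Longrightarrow> T j \<subseteq> finite_places (factor_field (f j))"
    and "\<And>j v. j \<in> {1..k} \<Longrightarrow> v \<in> T j \<Longrightarrow> v (factor_elt (f j)) = 1"
    and "\<And>n. 1 \<le> n \<Longrightarrow> finite (periodic_points \<theta> n)"
    and "\<And>n. 1 \<le> n \<Longrightarrow> real (num_periodic \<theta> n) =
           (\<Prod>j=1..k. inverse (abs_prod (T j) (factor_elt_pow_minus_1 (f j) n)))"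
    and "\<And>j. j \<in> {1..k} \<Longrightarrow> S j = finite_places (factor_field (f j)) - T j"
  shows "(\<forall>n\<ge>1. real (num_periodic \<theta> n) =
            (\<Prod>j=1..k. abs_prod (infinite_places (factor_field (f j)) \<union> S j)
                                 (factor_elt_pow_minus_1 (f j) n))) \<and>
         (d \<le> 3 \<and> (\<forall>j\<in>{1..k}. finite (S j)) \<longrightarrow>
            rational_fps (dynamical_zeta \<theta>) \<or> has_natural_boundary (dynamical_zeta \<theta>))"
proof -
  note cpt = assms(1) and dim = assms(3) and aut = assms(5) and haar = assms(6) and erg = assms(7) and ccf = assms(8)
  let ?y = "\<lambda>j n. factor_elt_pow_minus_1 (f j) n"
  let ?P = "\<lambda>j. infinite_places (factor_field (f j)) \<union> S j"
  \<comment> \<open>Both conclusions reduce to a single factor: the inverse of the part at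
    \<open>T j\<close> is the product over the complementary places, and for finite
    \<open>S j\<close> that product has the asymptotic shape, which finite products
    preserve.\<close>
  have factor: "(\<forall>n\<ge>1. inverse (abs_prod (T j) (?y j n)) = abs_prod (?P j) (?y j n)) \<and>
      (finite (S j) \<longrightarrow> asymptotic (\<lambda>n. abs_prod (?P j) (?y j n)))" if j: "j \<in> {1..k}" for j
  proof -
    have max: "maximalideal (PIdl\<^bsub>laurent_ring\<^esub> (f j)) laurent_ring"
      by (rule composition_factor_ideal(1)[OF cpt dim aut haar erg ccf j])
    have t: "laurent_t ^ n - 1 \<notin> PIdl\<^bsub>laurent_ring\<^esub> (f j)" if "n \<ge> 1" for n
      by (rule composition_factor_ideal(2)[OF cpt dim aut haar erg ccf j that])
    obtain F \<alpha> \<phi> \<xi> where iso: "number_field_iso F \<alpha> (factor_field (f j)) \<phi>"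
      and xi: "\<xi> \<in> number_field.K \<alpha>" "\<xi> \<noteq> 0" and nr: "\<And>n. n \<ge> 1 \<Longrightarrow> \<xi> ^ n \<noteq> 1"
      and car: "\<And>n. ?y j n \<in> carrier (factor_field (f j))" and val: "\<And>n. \<phi> (?y j n) = \<xi> ^ n - 1"
      by (rule factor_field_number_field[OF max]) (rule t, assumption, rule that, assumption+)
    interpret it: number_field_iso F \<alpha> "factor_field (f j)" \<phi> by (rule iso)
    have Tj: "T j \<subseteq> finite_places (factor_field (f j))" "S j = finite_places (factor_field (f j)) - T j"
      using assms(9)[OF j] assms(13)[OF j] by blast+
    have nz: "?y j n \<noteq> \<zero>\<^bsub>factor_field (f j)\<^esub>" if "n \<ge> 1" for n
      by (rule it.x_nonzero[OF xi _ car val that]) (rule nr)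
    have "inverse (abs_prod (T j) (?y j n)) = abs_prod (?P j) (?y j n)" if "n \<ge> 1" for n
      by (rule it.abs_prod_complement(1)[OF car nz[OF that] Tj])
    moreover have "asymptotic (\<lambda>n. abs_prod (?P j) (?y j n))" if "finite (S j)"
      by (rule it.asymptotic_abs_prod[OF xi _ car val Tj that]) (rule nr)
    ultimately show ?thesis by blast
  qed
  have A: "real (num_periodic \<theta> n) = (\<Prod>j=1..k. abs_prod (?P j) (?y j n))" if n: "1 \<le> n" for n
    unfolding assms(12)[OF n] by (rule prod.cong[OF refl]) (use factor n in blast)
  have B: "rational_fps (dynamical_zeta \<theta>) \<or> has_natural_boundary (dynamical_zeta \<theta>)"
    if fin: "\<forall>j\<in>{1..k}. finite (S j)"
  proof -
    have "asymptotic (\<lambda>n. \<Prod>j=1..k. abs_prod (?P j) (?y j n))"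
      by (rule asymptotic_prod) (use factor fin in auto)
    then have "asymptotic (\<lambda>n. real (num_periodic \<theta> n))" by (rule asymptotic_cong) (rule A)
    from asymptotic_zeta[OF this] show ?thesis
      by (simp add: dynamical_zeta_def zfps_def zlog_def)
  qed
  show ?thesis using A B by blast
qed

end
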